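(* Assume $\psi \in L^1(\mathbb{R}^d)$ with $\int_{\mathbb{R}^d} \psi \, dx = 1$ and $$\| \psi - \psi(\cdot- y) \|_{H^1} \to 0 \qquad \text{as } y \to 0.$$ Then $S : \ell^1(h^1) \to H^1(\mathbb{R}^d)$ is open, and surjective. Indeed if $f \in H^1$ and $\varepsilon>0$ then a sequence $c \in \ell^1(h^1)$ exists such that $Sc=f$, where the series $Sc=\sum_{j>0}\sum_{k\in\mathbb{Z}^d}c_{j,k}\psi_{j,k}$ converges in the sense that the sum over $k$ converges absolutely in $L^1$ to a function belonging to $H^1$ and the sum over $j$ converges absolutely in $H^1$, and such that $$\| c \|_{\ell^1(h^1)} \leq C \| f \|_{H^1} + \varepsilon ,$$ for some constant $C=C(b)$.
   Context: Fix $d\in\mathbb{N}$. The dilation matrices are isotropic and expanding: $a_j=\alpha_j I$ ($j=1,2,3,\ldots$), where $\alpha_j$ are nonzero real numbers with $|\alpha_j|\to\infty$ as $j\to\infty$. The translation matrix $b$ is an invertible $d\times d$ real matrix. Functions are complex-valued; sums over $j>0$ are over $j=1,2,3,\ldots$. Here $\psi_{j,k}(x) = |\det a_j|\,\psi(a_jx-bk)$ for $k\in\mathbb{Z}^d$, and the synthesis operator is $Sc=\sum_{j>0}\sum_{k\in\mathbb{Z}^d}c_{j,k}\psi_{j,k}$. Hardy space: let $C_d=\Gamma((d+1)/2)\pi^{-(d+1)/2}$, $Z(x)=C_d\,x/|x|^{d+1}$ for $x\ne0$ and $Z(0)=0$. The (vector-valued) Riesz transform of $f\in L^1(\mathbb{R}^d)$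 is $Rf(x)=(f*Z)(x)=\text{p.v.}\int f(x-y)Z(y)\,dy$. $H^1=H^1(\mathbb{R}^d)=\{f\in L^1: Rf\in L^1\}$ with $\|f\|_{H^1}=\|f\|_1+\|Rf\|_1$ (with $\|f\|_{H^1}=\infty$ if $f\notin H^1$). Discrete Hardy space: let $\mathcal{C}_0=(-1/2,1/2)^d$ (row vectors). Fix a smooth, compactly supported cut-off function $\nu$ supported in $\mathcal{C}_0$ with $\nu\equiv1$ near the origin. The discrete Riesz kernel $z=\{z_k\}_{k\in\mathbb{Z}^d}\in\ell^2$, $z_k\in\mathbb{C}^d$, is defined by its Fourier series $$\zeta(\xi)=\sum_{k\in\mathbb{Z}^d} z_k e^{-2\pi i\xi k}:=-i\frac{\xi b^{-1}}{|\xi b^{-1}|}\nu(\xi),\qquad \xi\in\mathcal{C}_0,$$ with $\xi$ a row vector and $k$ a column vector. Then $h^1=\{s\in\ell^1(\mathbb{Z}^d): s*z\in\ell^1\}$ with norm $\|s\|_{h^1}=\|s\|_{\ell^1}+\|s*z\|_{\ell^1}$. For sequences $c=\{c_{j,k}\}_{j>0,k\in\mathbb{Z}^d}$ of complex numbers, with $c_j=\{c_{j,k}\}_{k\in\mathbb{Z}^d}$, put $\|c\|_{\ell^1(h^1)}=\sum_{j>0}\|c_j\|_{h^1}$; $\ell^1(h^1)$ is the Banach space of sequences for which this is finite. ($d$ and $\nu$ are fixed, so the dependence of constants on them is not displayed.) *)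

theory Defs
  imports "HOL-Analysis.Analysis"
begin

section \<open>The Hardy space on Euclidean space\<close>

definition L1_norm :: "(real^'n \<Rightarrow> 'b::real_normed_vector) \<Rightarrow> ennreal" where
  "L1_norm f = (\<integral>\<^sup>+ x. ennreal (norm (f x)) \<partial>lebesgue)"

definition riesz_kernel :: "real^'n \<Rightarrow> real^'n" where
  "riesz_kernel x = (if x = 0 then 0 else
     (Gamma ((real CARD('n) + 1) / 2) * pi powr (- (real CARD('n) + 1) / 2)
        / norm x ^ (CARD('n) + 1)) *\<^sub>R x)"

definition truncated_riesz :: "(real^'n \<Rightarrow> complex) \<Rightarrow> real \<Rightarrow> real^'n \<Rightarrow> complex^'n" where
  "truncated_riesz f \<epsilon> x = set_lebesgue_integral lebesgue {y. \<epsilon> < norm y}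
     (\<lambda>y. \<chi> i. f (x - y) * complex_of_real (riesz_kernel y $ i))"

text \<open>The principal value. Where it does not exist, \<open>Lim\<close> is an unspecified constant;
  the space below requires existence almost everywhere.\<close>

definition riesz :: "(real^'n \<Rightarrow> complex) \<Rightarrow> real^'n \<Rightarrow> complex^'n" where
  "riesz f x = Lim (at_right 0) (\<lambda>\<epsilon>. truncated_riesz f \<epsilon> x)"

definition H1 :: "(real^'n \<Rightarrow> complex) set" where
  "H1 = {f. integrable lebesgue f
          \<and> (AE x in lebesgue. \<exists>l. ((\<lambda>\<epsilon>. truncated_riesz f \<epsilon> x) \<longlongrightarrow> l) (at_right 0))
          \<and> integrable lebesgue (riesz f)}"

definition H1_norm :: "(real^'n \<Rightarrow> complex) \<Rightarrow> ennreal" where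
  "H1_norm f = (if f \<in> H1 then L1_norm f + L1_norm (riesz f) else \<infinity>)"

text \<open>The Banach space itself consists of classes modulo equality almost everywhere.
  The distance does not depend on the representatives.\<close>

definition ae_class :: "(real^'n \<Rightarrow> complex) \<Rightarrow> (real^'n \<Rightarrow> complex) set" where
  "ae_class f = {g. AE x in lebesgue. g x = f x}"

definition H1_space :: "(real^'n \<Rightarrow> complex) set set" where
  "H1_space = ae_class ` H1"

definition H1_dist :: "(real^'n \<Rightarrow> complex) set \<Rightarrow> (real^'n \<Rightarrow> complex) set \<Rightarrow> real" where
  "H1_dist F G =
     enn2real (H1_norm (\<lambda>x. (SOME f. f \<in> F) x - (SOME g. g \<in> G) x))"

definition H1_topology :: "(real^'n \<Rightarrow> complex) set topology" where
  "H1_topology = Metric_space.mtopology H1_space H1_dist"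


section \<open>The discrete Hardy space\<close>

text \<open>Frequencies \<open>\<xi>\<close> are row vectors and lattice points are column vectors; both have the
  same type, so \<open>\<xi> b\<^sup>-\<^sup>1\<close> is \<open>\<xi> v* matrix_inv b\<close> and \<open>\<xi> k\<close> is an inner product.\<close>

definition lattice_point :: "int^'n \<Rightarrow> real^'n" where
  "lattice_point k = (\<chi> i. real_of_int (k $ i))"

definition frequency_cube :: "(real^'n) set" where
  "frequency_cube = {\<xi>. \<forall>i. - 1/2 < \<xi> $ i \<and> \<xi> $ i < 1/2}"

primrec times_cont_diff :: "nat \<Rightarrow> (real^'n \<Rightarrow> complex) \<Rightarrow> bool" where
  "times_cont_diff 0 f \<longleftrightarrow> continuous_on UNIV f"
| "times_cont_diff (Suc m) f \<longleftrightarrow>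
     (\<forall>x. f differentiable (at x))
     \<and> (\<forall>v. times_cont_diff m (\<lambda>x. frechet_derivative f (at x) v))"

definition cutoff :: "(real^'n \<Rightarrow> complex) \<Rightarrow> bool" where
  "cutoff \<nu> \<longleftrightarrow> (\<forall>m. times_cont_diff m \<nu>)
     \<and> compact (closure {\<xi>. \<nu> \<xi> \<noteq> 0})
     \<and> closure {\<xi>. \<nu> \<xi> \<noteq> 0} \<subseteq> frequency_cube
     \<and> (\<forall>\<^sub>F \<xi> in nhds 0. \<nu> \<xi> = 1)"

definition riesz_symbol :: "real^'n^'n \<Rightarrow> (real^'n \<Rightarrow> complex) \<Rightarrow> real^'n \<Rightarrow> complex^'n" where
  "riesz_symbol b \<nu> \<xi> = (\<chi> i. - \<i> * complex_of_real
     ((\<xi> v* matrix_inv b) $ i / norm (\<xi> v* matrix_inv b)) * \<nu> \<xi>)"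

text \<open>The sequence with Fourier series \<open>\<Sum>\<^sub>k z\<^sub>k exp (-2\<pi>i\<xi>k) = riesz_symbol b \<nu> \<xi>\<close> on the cube,
  given by the Fourier coefficients.\<close>

definition discrete_riesz :: "real^'n^'n \<Rightarrow> (real^'n \<Rightarrow> complex) \<Rightarrow> int^'n \<Rightarrow> complex^'n" where
  "discrete_riesz b \<nu> k = set_lebesgue_integral lebesgue frequency_cube
     (\<lambda>\<xi>. cis (2 * pi * (\<xi> \<bullet> lattice_point k)) *s riesz_symbol b \<nu> \<xi>)"

definition seq_conv ::
    "(int^'n \<Rightarrow> complex) \<Rightarrow> (int^'n \<Rightarrow> complex^'n) \<Rightarrow> int^'n \<Rightarrow> complex^'n" where
  "seq_conv s z k = (\<Sum>\<^sub>\<infinity>l. s l *s z (k - l))"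

definition l1_norm :: "(int^'n \<Rightarrow> 'b::real_normed_vector) \<Rightarrow> ennreal" where
  "l1_norm s = (\<Sum>\<^sub>\<infinity>k. ennreal (norm (s k)))"

text \<open>If \<open>s\<close> is not in \<open>\<ell>\<^sup>1\<close>, the first summand is already infinite, so this norm is finite
  exactly on the discrete Hardy space.\<close>

definition h1_norm :: "real^'n^'n \<Rightarrow> (real^'n \<Rightarrow> complex) \<Rightarrow> (int^'n \<Rightarrow> complex) \<Rightarrow> ennreal" where
  "h1_norm b \<nu> s = l1_norm s + l1_norm (seq_conv s (discrete_riesz b \<nu>))"

text \<open>The scale index \<open>j\<close> runs over \<open>1, 2, 3, \<dots>\<close>; the unused entries at \<open>j = 0\<close> are pinned
  to zero so that a sequence is determined by its genuine entries.\<close>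

definition l1h1_norm ::
    "real^'n^'n \<Rightarrow> (real^'n \<Rightarrow> complex) \<Rightarrow> (nat \<Rightarrow> int^'n \<Rightarrow> complex) \<Rightarrow> ennreal" where
  "l1h1_norm b \<nu> c = (\<Sum>\<^sub>\<infinity>j\<in>{1..}. h1_norm b \<nu> (c j))"

definition l1h1 ::
    "real^'n^'n \<Rightarrow> (real^'n \<Rightarrow> complex) \<Rightarrow> (nat \<Rightarrow> int^'n \<Rightarrow> complex) set" where
  "l1h1 b \<nu> = {c. c 0 = (\<lambda>k. 0) \<and> l1h1_norm b \<nu> c < \<infinity>}"

definition l1h1_dist ::
    "real^'n^'n \<Rightarrow> (real^'n \<Rightarrow> complex) \<Rightarrow>
     (nat \<Rightarrow> int^'n \<Rightarrow> complex) \<Rightarrow> (nat \<Rightarrow> int^'n \<Rightarrow> complex) \<Rightarrow> real" where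
  "l1h1_dist b \<nu> c c' = enn2real (l1h1_norm b \<nu> (\<lambda>j k. c j k - c' j k))"

definition l1h1_topology ::
    "real^'n^'n \<Rightarrow> (real^'n \<Rightarrow> complex) \<Rightarrow> (nat \<Rightarrow> int^'n \<Rightarrow> complex) topology" where
  "l1h1_topology b \<nu> = Metric_space.mtopology (l1h1 b \<nu>) (l1h1_dist b \<nu>)"


section \<open>Affine synthesis\<close>

definition affine_atom ::
    "(nat \<Rightarrow> real^'n^'n) \<Rightarrow> real^'n^'n \<Rightarrow> (real^'n \<Rightarrow> complex) \<Rightarrow>
     nat \<Rightarrow> int^'n \<Rightarrow> real^'n \<Rightarrow> complex" where
  "affine_atom a b \<psi> j k x =
     complex_of_real \<bar>det (a j)\<bar> * \<psi> (a j *v x - b *v lattice_point k)"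

text \<open>\<open>synthesis_converges a b \<psi> c f\<close>: the double series with coefficients \<open>c\<close> has sum \<open>f\<close>, where
  for each \<open>j\<close> the sum over \<open>k\<close> converges absolutely in \<open>L\<^sup>1\<close> to an element \<open>F j\<close> of \<open>H\<^sup>1\<close>, and the sum
  of the \<open>F j\<close> converges absolutely in \<open>H\<^sup>1\<close> to \<open>f\<close>.\<close>

definition synthesis_converges ::
    "(nat \<Rightarrow> real^'n^'n) \<Rightarrow> real^'n^'n \<Rightarrow> (real^'n \<Rightarrow> complex) \<Rightarrow>
     (nat \<Rightarrow> int^'n \<Rightarrow> complex) \<Rightarrow> (real^'n \<Rightarrow> complex) \<Rightarrow> bool" where
  "synthesis_converges a b \<psi> c f \<longleftrightarrow> f \<in> H1 \<and>
     (\<exists>F. (\<forall>j\<ge>1. F j \<in> H1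
             \<and> (\<Sum>\<^sub>\<infinity>k. L1_norm (\<lambda>x. c j k * affine_atom a b \<psi> j k x)) < \<infinity>
             \<and> ((\<lambda>K. L1_norm (\<lambda>x. F j x - (\<Sum>k\<in>K. c j k * affine_atom a b \<psi> j k x))) \<longlongrightarrow> 0)
                 (finite_subsets_at_top UNIV))
        \<and> (\<Sum>\<^sub>\<infinity>j\<in>{1..}. H1_norm (F j)) < \<infinity>
        \<and> (\<lambda>J. H1_norm (\<lambda>x. f x - (\<Sum>j=1..J. F j x))) \<longlonglongrightarrow> 0)"

text \<open>The sum is determined up to equality almost everywhere, so the set of all sums is a single
  element of \<open>H1_space\<close> when the series converges (and is empty otherwise).\<close>

definition synthesis ::
    "(nat \<Rightarrow> real^'n^'n) \<Rightarrow> real^'n^'n \<Rightarrow> (real^'n \<Rightarrow> complex) \<Rightarrow>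
     (nat \<Rightarrow> int^'n \<Rightarrow> complex) \<Rightarrow> (real^'n \<Rightarrow> complex) set" where
  "synthesis a b \<psi> c = {f. synthesis_converges a b \<psi> c f}"

end

theory Submission
 imports Defs "HOL-Probability.Probability"
begin

text \<open>
 An integrable function \<open>f\<close> lies in \<open>H\<^sup>1\<close> with Riesz transform \<open>g\<close> iff \<open>g\<close> is integrable and its Fourier
 transform is \<open>-i\<xi>/|\<xi>|\<close> times that of \<open>f\<close>. Truncated kernels are compared with conjugate Poisson kernels,
 and the Fourier identity for a pointwise principal value follows from Calderon-Zygmund decompositions
 at heights tending to infinity.

 Let \<open>\<theta>\<close> be band limited with integral 1. Sampling \<open>f * \<theta>\<close> on the lattice turns the Riesz transform of \<open>f\<close>
 into the discrete one, so the coefficients \<open>c\<^sub>j\<close> that sample \<open>f\<close> at scale \<open>j\<close> have \<open>h\<^sup>1\<close> norm at most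
 \<open>C \<parallel>f\<parallel>\<close>. Let \<open>T\<^sub>j f \<psi>\<close> be their synthesis. By periodicity of the Fourier series of \<open>c\<^sub>j\<close>, it is
 close in \<open>L\<^sup>1\<close> to \<open>f\<close> plus finitely many modulations of \<open>f\<close> with frequencies proportional to \<open>\<alpha>\<^sub>j\<close>;
 averaging over a sparse set of scales removes these. The Riesz transform of \<open>T\<^sub>j f \<psi>\<close> has the same form,
 since the hypothesis on \<open>\<psi>\<close> makes the Riesz transform of \<open>\<psi> - \<psi> * \<theta>\<close> integrable. Hence finitely many
 scales approximate \<open>f\<close> in \<open>H\<^sup>1\<close>, and one iterates on the remainder with new scales.
\<close>

text \<open>The Riesz transform is unbounded on L1, and membership in \<open>H1\<close> asks only
  for a pointwise limit that happens to be integrable. Nothing dominates the truncations, so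
  dominated convergence cannot give the Fourier identity. At height lam the bad part has at most
  twice the mass of f on a set of measure O(1/lam), which tends to 0, while the good part is in L2
  for each fixed height; this is why large heights help.

  The Fourier transform of \<psi> need not vanish on the dual lattice, so a single scale leaves
  modulated copies of f. Their frequencies separate as \<open>\<alpha> j\<close> grows, hence by
  Riemann-Lebesgue for |f| they are nearly orthogonal in L2(|f| dx), and averaging M of them leaves
  L1 norm O(M^(-1/2)) up to an arbitrarily small error. The average costs nothing in
  \<open>h1_norm\<close>: each of the M scales receives the coefficients divided by M.

  The coefficients come from \<open>th\<close>, which is built from b and \<nu> alone; \<psi> and
  the dilations decide only which scales are used and how many. This is why the constant depends on
  neither.\<close>

abbreviation (input) em :: "'a::euclidean_space set => ennreal" where "em == emeasure lborel"

abbreviation (input) lims :: "(nat => 'a::topological_space) => 'a => bool" (infixr "--->" 60)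
 where "X ---> L == (X \<longlongrightarrow> L) sequentially"

abbreviation (input) lint :: "('a::euclidean_space => 'b::{banach,second_countable_topology}) => 'b" (binder "LI " 10)
 where "lint f == lebesgue_integral lborel f"

abbreviation (input) nint :: "('a::euclidean_space => ennreal) => ennreal" (binder "NI " 10)
 where "nint f == nn_integral lborel f"

abbreviation (input) aelb :: "('a::euclidean_space => bool) => bool" (binder "AEL " 10)
 where "aelb P == almost_everywhere lborel P"

abbreviation (input) bm :: "('a::topological_space => 'b::topological_space) set"
 where "bm == borel_measurable borel"

abbreviation (input) cr :: "real => complex" where "cr == complex_of_real"

section \<open>Integrals, L1 norms and the Fourier transform of integrable functions\<close>

abbreviation L1 :: "('a::euclidean_space => 'b::{banach,second_countable_topology}) => bool" where
 "L1 f \<equiv> integrable lborel f"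

definition N :: "('a::euclidean_space => 'b::real_normed_vector) => ennreal" where
 "N f = (NI x. norm (f x))"

definition E :: "'a::euclidean_space => 'a => complex" where
 "E x y = cis (2 * pi * (x \<bullet> y))"

definition F :: "('a::euclidean_space => complex) => 'a => complex" where
 "F f y = (LI x. f x * E x (-y))"

lemma E_measurable[measurable]:
 "f \<in> borel_measurable M ==> g \<in> borel_measurable M ==> (%x. E (f x) (g x)) \<in> borel_measurable M"
 unfolding E_def cis_conv_exp by measurable

lemma E_simps[simp]: "norm (E x y) = 1" "E 0 y = 1" "E x 0 = 1"
 by (auto simp: E_def)

lemma E_add: "E (x + y) z = E x z * E y z" "E z (x + y) = E z x * E z y"
 and E_minus: "E (-x) y = cnj (E x y)" "E x (-y) = cnj (E x y)"
 and E_scale: "E (r *\<^sub>R x) y = E x (r *\<^sub>R y)"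
 and E_commute: "E x y = E y x"
 by (auto simp: E_def cis_mult algebra_simps cis_cnj inner_commute)

lemma E_diff: "E (x - y) z = E x z * cnj (E y z)" "E z (x - y) = E z x * cnj (E z y)"
 using E_add[of x "-y" z] E_add[of z x "-y"] by (auto simp: E_minus)

lemma E_cnj[simp]: "cnj (E x y) * E x y = 1" "E x y * cnj (E x y) = 1"
 by (auto simp: E_def cis_cnj cis_mult)

lemma continuous_E[continuous_intros]:
 "continuous_on S f ==> continuous_on S g ==> continuous_on S (%x. E (f x) (g x))"
 unfolding E_def cis_conv_exp by (intro continuous_intros)

lemma N_less_top: "L1 f ==> N f < \<infinity>"
 by (simp add: N_def integrable_iff_bounded)

lemma L1_iff: "L1 f \<longleftrightarrow> f \<in> bm & N f < \<infinity>"
 by (simp add: N_def integrable_iff_bounded)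

lemma L1_mult_bounded:
 fixes f g :: "'a::euclidean_space => complex"
 assumes "L1 f" "g \<in> bm" "!!x. norm (g x) <= B"
 shows "L1 (%x. f x * g x)" "L1 (%x. g x * f x)"
proof -
 have m: "norm (f x * g x) <= norm (B * norm (f x))" for x
  using mult_left_mono[OF assms(3)[of x], of "norm (f x)"] abs_ge_self[of "B * norm (f x)"]
  by (simp add: norm_mult mult.commute[of B])
 have "L1 (%x. B * norm (f x))" using assms(1) by auto
 then show "L1 (%x. f x * g x)"
  by (rule Bochner_Integration.integrable_bound) (use assms(1,2) m in auto)
 then show "L1 (%x. g x * f x)" by (simp add: mult.commute)
qed

lemma L1_E: "L1 f ==> L1 (%x. f x * E x y)"
 by (rule L1_mult_bounded(1)[where B=1]) auto

lemma N_eq: "L1 f ==> N f = ennreal (LI x. norm (f x))"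
 by (simp add: N_def nn_integral_eq_integral)

lemma norm_F_le: "L1 f ==> norm (F f y) <= (LI x. norm (f x))"
 unfolding F_def using integral_norm_bound[of lborel "%x. f x * E x (-y)"] by (simp add: norm_mult)

lemma continuous_F: "L1 f ==> continuous_on UNIV (F f)"
proof (unfold continuous_on_sequentially, intro allI impI ballI)
 fix s y assume f: "L1 f" and "(\<forall>n. s n \<in> UNIV) & s ---> (y::'a)"
 then have "(%n. f x * E x (- s n)) ---> f x * E x (-y)" for x
  by (intro tendsto_intros continuous_on_tendsto_compose[of UNIV "E x"] continuous_intros) auto
 then show "(F f \<circ> s) ---> F f y"
  unfolding F_def o_def using f
  by (intro integral_dominated_convergence[where w="%x. norm (f x)"]) (auto simp: norm_mult)
qed

lemma F_add: "L1 f ==> L1 g ==> F (%x. f x + g x) y = F f y + F g y"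
 and F_diff: "L1 f ==> L1 g ==> F (%x. f x - g x) y = F f y - F g y"
 and F_cmult: "F (%x. a * f x) y = a * F f y"
 and F_sum: "(!!i. i \<in> I ==> L1 (h i)) ==> F (%x. \<Sum>i\<in>I. h i x) y = (\<Sum>i\<in>I. F (h i) y)"
 unfolding F_def by (simp_all add: L1_E ring_distribs sum_distrib_right mult.assoc
   Bochner_Integration.integral_sum)

lemma F_cong_AE: "AEL x. f x = g x ==> f \<in> bm ==> g \<in> bm ==> F f y = F g y"
 unfolding F_def by (intro integral_cong_AE) auto

lemma lborel_translate:
 fixes f :: "'a::euclidean_space => 'b::{banach,second_countable_topology}"
 shows "f \<in> bm ==> (LI x. f (x - a)) = (LI x. f x)"
  "g \<in> bm ==> (NI x. g (x - a)) = (NI x. g x)"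
 by (subst (2) lborel_distr_plus[of "-a", symmetric],
   simp add: integral_distr nn_integral_distr)+

lemma lborel_uminus_euclidean: "distr lborel borel uminus = (lborel :: 'a::euclidean_space measure)"
 using lborel_affine[of "-1" "0::'a"] by (simp add: density_1)

lemma lborel_reflect:
 fixes f :: "'a::euclidean_space => 'b::{banach,second_countable_topology}"
 shows "f \<in> bm ==> (LI x. f (a - x)) = (LI x. f x)"
  "g \<in> bm ==> (NI x. g (a - x)) = (NI x. g x)"
proof -
 assume "f \<in> bm"
 then show "(LI x. f (a - x)) = (LI x. f x)"
  using lborel_translate(1)[of "%x. f (-x)" a]
  by (subst (2) lborel_uminus_euclidean[symmetric]) (simp add: integral_distr)
next
 assume "g \<in> bm"
 then show "(NI x. g (a - x)) = (NI x. g x)"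
  using lborel_translate(2)[of "%x. g (-x)" a]
  by (subst (2) lborel_uminus_euclidean[symmetric]) (simp add: nn_integral_distr)
qed

lemma nn_dilate:
 fixes g :: "'a::euclidean_space => ennreal"
 assumes "g \<in> bm" "a ~= 0"
 shows "(NI x. ennreal (\<bar>a\<bar>^DIM('a)) * g (a *\<^sub>R x)) = (NI x. g x)"
 using assms by (subst (2) lborel_affine[of a 0])
  (auto simp: nn_integral_density nn_integral_distr power_abs)

lemma lborel_dilate:
 fixes f :: "'a::euclidean_space => 'b::{banach,second_countable_topology}"
 assumes "f \<in> bm" "a ~= 0"
 shows "(LI x. \<bar>a\<bar>^DIM('a) *\<^sub>R f (a *\<^sub>R x)) = (LI x. f x)"
 using assms by (subst (2) lborel_affine[of a 0])
  (auto simp: integral_density integral_distr power_abs)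

lemma N_translate: "f \<in> bm ==> N (%x. f (x - a)) = N f"
 unfolding N_def by (rule lborel_translate) auto

lemma L1_translate: assumes [measurable]: "L1 f" shows "L1 (%x. f (x - a))"
 unfolding L1_iff using assms by (subst N_translate) (auto simp: L1_iff)

lemma F_translate: "L1 f ==> F (%x. f (x - a)) y = E a (-y) * F f y"
proof -
 assume f: "L1 f"
 have "F (%x. f (x - a)) y = (LI x. (%x. f x * E (x + a) (-y)) (x - a))"
  by (simp add: F_def)
 also have "... = (LI x. E a (-y) * (f x * E x (-y)))"
  using f by (subst lborel_translate(1)) (auto simp: E_add mult_ac)
 finally show ?thesis by (simp add: F_def)
qed

text \<open>The factor makes dilation an L1 isometry for either sign of \<open>a\<close>, and it is
  the determinant factor of \<open>affine_atom\<close> for the matrix \<open>mat a\<close>.\<close>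

definition dil :: "real => ('a::euclidean_space => complex) => 'a => complex" where
 "dil a f x = \<bar>a\<bar>^DIM('a) *\<^sub>R f (a *\<^sub>R x)"

lemma N_dil: "f \<in> bm ==> a ~= 0 ==> N (dil a f) = N f"
 using nn_dilate[of "%x. ennreal (norm (f x))" a]
 by (simp add: N_def dil_def ennreal_mult power_abs)

lemma dil_measurable[measurable]:
 assumes [measurable]: "f \<in> bm" shows "dil a f \<in> bm"
 unfolding dil_def by measurable

lemma L1_dil: "L1 f ==> a ~= 0 ==> L1 (dil a f)"
 by (auto simp: L1_iff N_dil dil_measurable)

lemma F_dil:
 assumes "L1 f" "a ~= 0" shows "F (dil a f) y = F f (y /\<^sub>R a)"
proof -
 have "F (dil a f) y = (LI x. \<bar>a\<bar>^DIM('a) *\<^sub>R (%x. f x * E x (- (y /\<^sub>R a))) (a *\<^sub>R x))"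
  using assms by (simp add: F_def dil_def E_scale)
 also have "... = F f (y /\<^sub>R a)"
  unfolding F_def using assms by (intro lborel_dilate) auto
 finally show ?thesis .
qed

lemma sigma_finite_count: "sigma_finite_measure (count_space (UNIV::'c::countable set))"
 by (rule sigma_finite_measure_count_space_countable) auto

text \<open>Fubini, packaged once for every superposition that occurs: the parameter runs over
  Lebesgue measure for convolution and subordination, over the lattice for synthesis, and over the
  naturals for sums of atoms and of scales.\<close>

lemma mix:
 fixes h :: "'u => 'a::euclidean_space => complex"
 assumes "sigma_finite_measure M" and m[measurable]: "(%(u,x). h u x) \<in> borel_measurable (M \<Otimes>\<^sub>M lborel)"
  and fin: "(\<integral>\<^sup>+u. N (h u) \<partial>M) < \<infinity>"
 shows "L1 (%x. \<integral>u. h u x \<partial>M)" "N (%x. \<integral>u. h u x \<partial>M) <= (\<integral>\<^sup>+u. N (h u) \<partial>M)"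
  "F (%x. \<integral>u. h u x \<partial>M) y = (\<integral>u. F (h u) y \<partial>M)"
  "AE u in M. L1 (h u)" "AEL x. integrable M (%u. h u x)"
  "integrable M (%u. F (h u) y)"
proof -
 interpret M: sigma_finite_measure M by fact
 interpret pair_sigma_finite M "lborel::'a measure" ..
 have h: "integrable (M \<Otimes>\<^sub>M lborel) (%(u,x). h u x)"
  using fin by (simp add: integrable_iff_bounded N_def lborel.nn_integral_fst[symmetric] split_beta')
 have h': "integrable (lborel \<Otimes>\<^sub>M M) (%(x,u). h u x)"
  using integrable_product_swap[OF h] by simp
 show "L1 (%x. \<integral>u. h u x \<partial>M)" using integrable_snd[OF h] .
 show "AE u in M. L1 (h u)" using AE_integrable_fst[OF h] .
 show "AEL x. integrable M (%u. h u x)" using AE_integrable_snd[OF h] .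
 have "N (%x. \<integral>u. h u x \<partial>M) <= (NI x. \<integral>\<^sup>+u. norm (h u x) \<partial>M)"
  unfolding N_def using AE_integrable_snd[OF h]
  by (intro nn_integral_mono_AE) (auto elim!: eventually_mono intro!: integral_norm_bound_ennreal)
 also have "... = (\<integral>\<^sup>+u. N (h u) \<partial>M)"
  unfolding N_def by (rule Fubini') simp
 finally show "N (%x. \<integral>u. h u x \<partial>M) <= (\<integral>\<^sup>+u. N (h u) \<partial>M)" .
 have hE: "integrable (M \<Otimes>\<^sub>M lborel) (%(u,x). h u x * E x (-y))"
  using fin by (simp add: integrable_iff_bounded N_def lborel.nn_integral_fst[symmetric] split_beta' norm_mult)
 show "integrable M (%u. F (h u) y)" using integrable_fst[OF hE] by (simp add: F_def)
 show "F (%x. \<integral>u. h u x \<partial>M) y = (\<integral>u. F (h u) y \<partial>M)"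
  unfolding F_def using Fubini_integral[OF hE] by simp
qed

lemma lborel_prod_integral:
 fixes h :: "'a::euclidean_space => real => complex"
 assumes "!!b. b \<in> Basis ==> integrable lborel (h b)"
 shows "(LI x. (\<Prod>b\<in>Basis. h b (x \<bullet> b))) = (\<Prod>b\<in>Basis. (LI t. h b t))"
  "integrable lborel (%x. \<Prod>b\<in>Basis. h b (x \<bullet> b))"
proof -
 interpret product_sigma_finite "%_::'a. lborel :: real measure" ..
 have [measurable]: "b \<in> Basis ==> h b \<in> bm" for b using assms by auto
 have *: "(\<Prod>b\<in>Basis. h b ((\<Sum>c\<in>Basis. f c *\<^sub>R c) \<bullet> b)) = (\<Prod>b\<in>Basis. h b (f b))" for f :: "'a => real"
  by (intro prod.cong) auto
 show "(LI x. (\<Prod>b\<in>Basis. h b (x \<bullet> b))) = (\<Prod>b\<in>Basis. (LI t. h b t))"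
  by (subst lborel_eq, subst integral_distr) (use assms in \<open>auto simp: * intro!: product_integral_prod\<close>)
 show "integrable lborel (%x. \<Prod>b\<in>Basis. h b (x \<bullet> b))"
  by (subst lborel_eq, subst integrable_distr_eq) (use assms in \<open>auto simp: * intro!: product_integrable_prod\<close>)
qed

lemma N_triangle:
 fixes f :: "'a::euclidean_space => complex"
 shows "f \<in> bm ==> g \<in> bm ==> N (%x. f x + g x) <= N f + N g"
 unfolding N_def by (subst nn_integral_add[symmetric])
  (auto intro!: nn_integral_mono simp: ennreal_plus[symmetric] norm_triangle_ineq simp del: ennreal_plus)

lemma N_uminus[simp]: "N (%x. - f x) = N f" by (simp add: N_def)

lemma N_triangle_diff:
 fixes f :: "'a::euclidean_space => complex"
 shows "f \<in> bm ==> g \<in> bm ==> N (%x. f x - g x) <= N f + N g"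
 using N_triangle[of f "%x. - g x"] by simp

lemma N_diff_commute: "N (%x. f x - g x) = N (%x. g x - f x)"
 by (simp add: N_def norm_minus_commute)

lemma N_triangle3:
 fixes f :: "'a::euclidean_space => complex"
 shows "f \<in> bm ==> g \<in> bm ==> h \<in> bm ==>
  N (%x. f x - h x) <= N (%x. f x - g x) + N (%x. g x - h x)"
 using N_triangle[of "%x. f x - g x" "%x. g x - h x"] by simp

lemma N_cmult:
 fixes a :: complex
 shows "f \<in> bm ==> N (%x. a * f x) = ennreal (norm a) * N f"
 unfolding N_def by (subst nn_integral_cmult[symmetric]) (auto simp: norm_mult ennreal_mult)

text \<open>For an indicator, outer regularity of A and of its complement gives open U and V with
  small overlap; a Urysohn function for the complements of V and U differs from the indicator only
  on the overlap. Boundedness is recorded because \<open>osc_tendsto_bounded\<close> needs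
  it.\<close>

lemma L1_dense:
 fixes f :: "'a::euclidean_space => complex"
 assumes "L1 f" "e > 0"
 shows "\<exists>g. continuous_on UNIV g & L1 g & (\<exists>B. \<forall>x. norm (g x) <= B) & N (%x. f x - g x) < ennreal e"
 using assms
proof (induction arbitrary: e rule: integrable_induct)
 case (base A c)
 define d where "d = e / (2 * (norm c + 1))"
 have d: "d > 0" "norm c * (2 * d) < e" using base
  by (auto simp: d_def field_simps add_pos_nonneg)
 have A: "A \<in> sets borel" using base by simp
 obtain U where U: "open U" "A \<subseteq> U" "em (U - A) < ennreal d"
  using outer_regular_lborel[OF A d(1)] .
 obtain V where V: "open V" "-A \<subseteq> V" "em (V - (-A)) < ennreal d"
  using outer_regular_lborel[of "-A" d] A d(1) by auto
 obtain g where g: "continuous_on UNIV g" "!!x. g x \<in> closed_segment c 0"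
   "!!x. x \<in> -V ==> g x = c" "!!x. x \<in> -U ==> g x = (0::complex)"
  using Urysohn[of "-V" "-U" c 0] U V by auto
 have gc: "norm (g x) <= norm c" for x
  using segment_bound1[OF g(2)[of x]] segment_bound[of "g x" 0 c] g(2)[of x] by (auto simp: closed_segment_commute)
 have gm[measurable]: "g \<in> bm" using g(1) by (rule borel_measurable_continuous_onI)
 have le: "norm (indicator A x *\<^sub>R c - g x) <= norm c * indicat_real (U \<inter> V) x" for x
 proof -
  have "g x = c" if "x \<notin> V" using g(3) that by simp
  moreover have "g x = 0" if "x \<notin> U" using g(4) that by simp
  moreover have "norm (c - g x) <= norm c"
   using segment_bound[of "g x" 0 c] segment_bound(2)[of "g x" c 0] g(2)[of x] by (auto simp: closed_segment_commute norm_minus_commute)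
  ultimately show ?thesis using U V gc[of x] by (auto split: split_indicator)
 qed
 have "N (%x. indicator A x *\<^sub>R c - g x) <= (NI x. ennreal (norm c) * indicator (U \<inter> V) x)"
  unfolding N_def by (intro nn_integral_mono)
   (use ennreal_leI[OF le] in \<open>simp add: ennreal_mult ennreal_indicator\<close>)
 also have "... = ennreal (norm c) * em (U \<inter> V)"
  using U V by (subst nn_integral_cmult_indicator) auto
 also have "... <= ennreal (norm c) * (ennreal d + ennreal d)"
 proof (intro mult_left_mono)
  have "em (U \<inter> V) <= em ((U - A) \<union> (V - (-A)))"
   using U V A by (intro emeasure_mono) auto
  also have "... <= em (U - A) + em (V - (-A))"
   using U V A by (intro emeasure_subadditive) auto
  finally show "em (U \<inter> V) <= ennreal d + ennreal d"
   using U V by (meson add_mono less_imp_le order_trans)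
 qed auto
 also have "... < ennreal e" using d by (auto simp: ennreal_plus[symmetric] ennreal_mult[symmetric] ennreal_less_iff simp del: ennreal_plus)
 finally have n: "N (%x. indicator A x *\<^sub>R c - g x) < ennreal e" .
 have "L1 (%x. indicator A x *\<^sub>R c - g x)"
  unfolding L1_iff using A n by (auto intro: order_less_trans)
 moreover have "L1 (%x. indicator A x *\<^sub>R c)" using base by auto
 ultimately have "L1 (%x. indicator A x *\<^sub>R c - (indicator A x *\<^sub>R c - g x))" by (rule Bochner_Integration.integrable_diff[rotated])
 then show ?case using g(1) gc n by (intro exI[of _ g]) auto
next
 case (add f1 f2)
 from add.IH(1)[of "e/2"] add.IH(2)[of "e/2"] add.prems obtain g1 g2 B1 B2 where
  g: "continuous_on UNIV g1" "L1 g1" "\<forall>x. norm (g1 x) <= B1" "N (%x. f1 x - g1 x) < ennreal (e/2)"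
    "continuous_on UNIV g2" "L1 g2" "\<forall>x. norm (g2 x) <= B2" "N (%x. f2 x - g2 x) < ennreal (e/2)" by auto
 have "N (%x. (f1 x - g1 x) + (f2 x - g2 x)) <= N (%x. f1 x - g1 x) + N (%x. f2 x - g2 x)"
  using add g by (intro N_triangle) auto
 also have "... < ennreal (e/2) + ennreal (e/2)" using g by (intro add_strict_mono)
 finally have "N (%x. (f1 x + f2 x) - (g1 x + g2 x)) < ennreal e"
  using add.prems by (simp add: ennreal_plus[symmetric] algebra_simps del: ennreal_plus)
 moreover have "norm (g1 x + g2 x) <= B1 + B2" for x using g by (meson norm_triangle_mono)
 ultimately show ?case using g by (intro exI[of _ "%x. g1 x + g2 x"]) (auto intro!: continuous_intros)
next
 case (lim f s)
 have "(%i. (NI x. norm (f x - s i x))) ---> 0"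
 proof (rule nn_integral_dominated_convergence_norm[where w="%x. 2 * norm (f x)"])
  show "(NI x. ennreal (2 * norm (f x))) < \<infinity>"
   using \<open>L1 f\<close> integrable_iff_bounded[of lborel "%x. 2 * norm (f x)"] by auto
 qed (use lim in auto)
 then have "\<forall>\<^sub>F i in sequentially. N (%x. f x - s i x) < ennreal (e/2)"
  unfolding N_def using lim.prems by (intro order_tendstoD) auto
 then obtain i where i: "N (%x. f x - s i x) < ennreal (e/2)" by (auto simp: eventually_sequentially)
 from lim.IH[of "e/2" i] lim.prems obtain g B where
  g: "continuous_on UNIV g" "L1 g" "\<forall>x. norm (g x) <= B" "N (%x. s i x - g x) < ennreal (e/2)" by auto
 have "N (%x. f x - g x) <= N (%x. f x - s i x) + N (%x. s i x - g x)"
  using lim g by (intro N_triangle3) auto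
 also have "... < ennreal (e/2) + ennreal (e/2)" using g i by (intro add_strict_mono)
 finally show ?case using g lim.prems by (intro exI[of _ g]) (auto simp: ennreal_plus[symmetric] simp del: ennreal_plus)
qed

text \<open>With Lebesgue measure and the identity for \<open>t\<close> this is convolution; with
  counting measure on the lattice and \<open>t k = b *v lp k\<close> it is synthesis at scale one.
  One set of estimates serves both.\<close>

definition sm :: "'u measure => ('u => 'a::euclidean_space) => ('u => complex) => ('a => complex) => 'a => complex" where
 "sm M t s f x = (\<integral>u. s u * f (x - t u) \<partial>M)"

lemma sm:
 assumes M: "sigma_finite_measure M" and [measurable]: "t \<in> M \<rightarrow>\<^sub>M borel" and s: "integrable M s" and f: "L1 f"
 shows "L1 (sm M t s f)" "N (sm M t s f) <= (\<integral>\<^sup>+u. norm (s u) \<partial>M) * N f"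
  "F (sm M t s f) y = (\<integral>u. s u * E (t u) (-y) \<partial>M) * F f y"
  "AEL x. integrable M (%u. s u * f (x - t u))"
proof -
 have [measurable]: "s \<in> borel_measurable M" "f \<in> bm" using s f by auto
 have eq: "N (%x. s u * f (x - t u)) = ennreal (norm (s u)) * N f" for u
  by (subst N_cmult) (auto simp: N_translate)
 have nn: "(\<integral>\<^sup>+u. N (%x. s u * f (x - t u)) \<partial>M) = (\<integral>\<^sup>+u. norm (s u) \<partial>M) * N f"
  unfolding eq by (rule nn_integral_multc) auto
 also have "... < \<infinity>" using s N_less_top[OF f] by (auto simp: integrable_iff_bounded ennreal_mult_less_top)
 finally have fin: "(\<integral>\<^sup>+u. N (%x. s u * f (x - t u)) \<partial>M) < \<infinity>" .
 note mix = mix[OF M _ fin]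
 show "L1 (sm M t s f)" "N (sm M t s f) <= (\<integral>\<^sup>+u. norm (s u) \<partial>M) * N f"
  "AEL x. integrable M (%u. s u * f (x - t u))"
  using mix(1,2,5) by (auto simp: sm_def[abs_def] nn)
 have "F (sm M t s f) y = (\<integral>u. F (%x. s u * f (x - t u)) y \<partial>M)"
  using mix(3) by (simp add: sm_def[abs_def])
 then show "F (sm M t s f) y = (\<integral>u. s u * E (t u) (-y) \<partial>M) * F f y"
  using f by (simp add: F_cmult F_translate mult.assoc flip: integral_mult_left_zero)
qed

definition conv :: "('a::euclidean_space => complex) => ('a => complex) => 'a => complex" where
 "conv s f = sm lborel (%u. u) s f"

lemma conv_eq: "conv s f x = (LI u. s u * f (x - u))"
 by (simp add: conv_def sm_def)

lemma conv:
 assumes "L1 s" "L1 f"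
 shows "L1 (conv s f)" "N (conv s f) <= N s * N f" "F (conv s f) y = F s y * F f y"
 using sm[of lborel "%u. u" s f] assms by (auto simp: conv_def F_def[of s] N_def[of s] lborel.sigma_finite_measure_axioms)

section \<open>The Riesz transform as a Fourier multiplier\<close>

definition m :: "'n => real^'n => complex" where
 "m i y = - \<i> * of_real (y $ i / norm y)"

text \<open>The Fourier-side form of "g is the i-th Riesz transform of f". It is visibly linear and
  invariant under translation, and free of principal values; \<open>H1_I\<close> and
  \<open>H1_D\<close> tie it to the pointwise definition. Since \<open>m i 0 = 0\<close>, it
  includes the condition that g has integral 0.\<close>

definition RR :: "'n => (real^'n => complex) => (real^'n => complex) => bool" where
 "RR i f g \<longleftrightarrow> L1 f & L1 g & (\<forall>y. F g y = m i y * F f y)"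

lemma RR_add: "RR i f g ==> RR i f' g' ==> RR i (%x. f x + f' x) (%x. g x + g' x)"
 and RR_diff: "RR i f g ==> RR i f' g' ==> RR i (%x. f x - f' x) (%x. g x - g' x)"
 and RR_cmult: "RR i f g ==> RR i (%x. a * f x) (%x. a * g x)"
 and RR_sum: "(!!j. j \<in> J ==> RR i (h j) (k j)) ==> RR i (%x. \<Sum>j\<in>J. h j x) (%x. \<Sum>j\<in>J. k j x)"
 and RR_translate: "RR i f g ==> RR i (%x. f (x - v)) (%x. g (x - v))"
 by (auto simp: RR_def F_add F_diff F_cmult F_translate L1_translate F_sum sum_distrib_left algebra_simps)

text \<open>The multiplier is homogeneous of degree 0 but odd, so a negative dilation factor
  reverses its sign.\<close>

lemma RR_dil:
 assumes "RR i f g" "a ~= 0" shows "RR i (dil a f) (%x. sgn (of_real a) * dil a g x)"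
proof -
 have "sgn (of_real a) * m i (y /\<^sub>R a) = m i y" for y
  using assms(2) by (auto simp: m_def sgn_of_real sgn_if field_simps abs_if)
 then show ?thesis using assms by (auto simp: RR_def F_cmult F_dil L1_dil mult.assoc[symmetric])
qed

lemma RR_mix:
 assumes M: "sigma_finite_measure M" and "(%(u,x). h u x) \<in> borel_measurable (M \<Otimes>\<^sub>M lborel)"
  "(%(u,x). k u x) \<in> borel_measurable (M \<Otimes>\<^sub>M lborel)"
  and "(\<integral>\<^sup>+u. N (h u) \<partial>M) < \<infinity>" "(\<integral>\<^sup>+u. N (k u) \<partial>M) < \<infinity>" and R: "AE u in M. RR i (h u) (k u)"
 shows "RR i (%x. \<integral>u. h u x \<partial>M) (%x. \<integral>u. k u x \<partial>M)"
proof -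
 note h = mix[OF M assms(2,4)] and k = mix[OF M assms(3,5)]
 have "(\<integral>u. F (k u) y \<partial>M) = (\<integral>u. m i y * F (h u) y \<partial>M)" for y
  using R h(6) k(6) by (intro integral_cong_AE) (auto simp: RR_def)
 then show ?thesis using h(1,3) k(1,3) by (auto simp: RR_def)
qed

section \<open>Gaussians, and the Poisson kernels by subordination\<close>

lemma gamma_scaled:
 assumes "a > 0" "c > (0::real)"
 shows "has_bochner_integral lborel (%s. indicator {0<..} s * s powr (a - 1) * exp (- (c * s))) (Gamma a * c powr (-a))"
proof (rule has_bochner_integral_nn_integral)
 have *: "indicat_real {0..} (c * s) * (c * s) powr (a - 1) / exp (c * s) =
   c powr (a - 1) * (indicat_real {0<..} s * s powr (a - 1) * exp (- (c * s)))" for s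
  using assms by (auto simp: powr_mult exp_minus field_simps zero_le_mult_iff split: split_indicator)
 have c: "c * c powr (a - 1) = c powr a" using assms by (simp add: powr_mult_base)
 define X where "X s = indicat_real {0<..} s * s powr (a - 1) * exp (- (c * s))" for s
 have X: "X \<in> bm" "!!s. X s >= 0" by (auto simp: X_def[abs_def])
 have "ennreal (Gamma a) = ennreal c * (NI s. ennreal (c powr (a - 1) * X s))"
  using assms unfolding Gamma_conv_nn_integral_real[OF assms(1)] X_def
  by (subst nn_integral_real_affine[of _ c 0]) (auto simp: *)
 also have "... = ennreal (c * c powr (a - 1)) * (NI s. ennreal (X s))"
  using assms X by (simp add: ennreal_mult' nn_integral_cmult mult.assoc)
 also have "... = ennreal (c powr a) * (NI s. ennreal (indicat_real {0<..} s * s powr (a - 1) * exp (- (c * s))))"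
  unfolding c X_def ..
 finally have "ennreal (c powr (-a)) * ennreal (Gamma a) = ennreal (c powr (-a) * c powr a) *
   (NI s. ennreal (indicat_real {0<..} s * s powr (a - 1) * exp (- (c * s))))"
  by (simp add: ennreal_mult' mult.assoc)
 then show "(NI s. ennreal (indicat_real {0<..} s * s powr (a - 1) * exp (- (c * s)))) = ennreal (Gamma a * c powr (-a))"
  using assms by (simp add: powr_minus mult.commute flip: ennreal_mult')
qed (use assms in \<open>auto intro!: mult_nonneg_nonneg Gamma_real_nonneg\<close>)

lemma gauss_line:
 assumes "s > 0"
 shows "integrable lborel (%t. t^k * exp (- pi * t\<^sup>2 / s))"
  "(LI t. cr (exp (- pi * t\<^sup>2 / s)) * cis (2 * pi * (t * x))) = cr (sqrt s * exp (- pi * s * x\<^sup>2))"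
proof -
 \<comment> \<open>With this \<open>c\<close>, \<open>std_normal_density (c * t)\<close> is a
   constant times the Gaussian, so the transform is read off from the characteristic function of the
   normal law.\<close>
 define c where "c = sqrt (2 * pi / s)"
 have c: "c > 0" "c\<^sup>2 = 2 * pi / s" "c / sqrt (2 * pi) = 1 / sqrt s"
  using assms by (auto simp: c_def real_sqrt_divide power_divide)
 have n: "std_normal_density (c * t) = 1 / sqrt (2 * pi) * exp (- pi * t\<^sup>2 / s)" for t
  by (simp add: std_normal_density_def power_mult_distrib c(2))
 have "integrable lborel (%t. std_normal_density (0 + c * t) * (c * t)^k)"
  using integrable_normal_moment[where \<mu>=0 and \<sigma>=1 and k=k] c(1)
   lborel_integrable_real_affine_iff[of c "%t. std_normal_density t * t^k" 0] by simp
 then have "integrable lborel (%t. sqrt (2 * pi) / c ^ k * (std_normal_density (c * t) * (c * t)^k))" by simp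
 moreover have "(%t. sqrt (2 * pi) / c ^ k * (std_normal_density (c * t) * (c * t)^k)) = (%t. t^k * exp (- pi * t\<^sup>2 / s))"
  using c(1) by (simp add: n power_mult_distrib fun_eq_iff)
 ultimately show "integrable lborel (%t. t^k * exp (- pi * t\<^sup>2 / s))" by simp
 define y where "y = 2 * pi * x / c"
 have y: "y\<^sup>2 / 2 = pi * s * x\<^sup>2" "y * (c * t) = 2 * pi * (t * x)" for t
 proof -
  have "c * (c * s) = pi * 2" using c(2) assms by (simp add: power2_eq_square field_simps)
  then show "y\<^sup>2 / 2 = pi * s * x\<^sup>2" "y * (c * t) = 2 * pi * (t * x)"
   using c(1) by (simp_all add: y_def field_simps power2_eq_square)
 qed
 have "cr (exp (- y\<^sup>2 / 2)) = (LI t. std_normal_density t *\<^sub>R iexp (y * t))"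
  using char_std_normal_distribution[THEN fun_cong, of y] unfolding char_def
  by (subst (asm) integral_density) auto
 also have "... = c *\<^sub>R (LI t. std_normal_density (c * t) *\<^sub>R iexp (y * (c * t)))"
  using c by (subst lborel_integral_real_affine[of c _ 0]) auto
 also have "... = (c / sqrt (2 * pi)) *\<^sub>R (LI t. cr (exp (- pi * t\<^sup>2 / s)) * cis (2 * pi * (t * x)))"
  unfolding n y(2) by (simp add: scaleR_conv_of_real cis_conv_exp mult.assoc)
 finally show "(LI t. cr (exp (- pi * t\<^sup>2 / s)) * cis (2 * pi * (t * x))) = cr (sqrt s * exp (- pi * s * x\<^sup>2))"
  using assms y(1) unfolding c(3) by (simp add: scaleR_conv_of_real field_simps)
qed

text \<open>The function t |-> exp(-pi t^2/s) cis(2 pi t x) vanishes at both ends, so its derivative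
  integrates to 0; this expresses the first moment through the integral in
  \<open>gauss_line\<close>.\<close>

lemma gauss_line':
 assumes "s > 0"
 shows "(LI t. cr (t * exp (- pi * t\<^sup>2 / s)) * cis (2 * pi * (t * x))) = \<i> * of_real (s * x * (sqrt s * exp (- pi * s * x\<^sup>2)))"
proof -
 define f where "f t = cr (exp (- pi * t\<^sup>2 / s)) * cis (2 * pi * (t * x))" for t
 define g where "g t = cr (t * exp (- pi * t\<^sup>2 / s)) * cis (2 * pi * (t * x))" for t
 have d: "(f has_vector_derivative (cr (- 2 * pi / s) * g t + 2 * pi * \<i> * x * f t)) (at t)" for t
 proof -
  define h where "h z = exp (cr (- pi / s) * z\<^sup>2 + 2 * pi * \<i> * x * z)" for z
  have fh: "f = (%t. h (of_real t))"
   by (auto simp: fun_eq_iff f_def h_def cis_conv_exp exp_add exp_of_real[symmetric] mult_ac) (simp add: exp_diff exp_minus field_simps)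
  have "(h has_field_derivative (cr (- pi / s) * (2 * z) + 2 * pi * \<i> * x) * h z) (at z)" for z
   unfolding h_def using assms by (auto intro!: derivative_eq_intros)
  from has_vector_derivative_real_field[OF this, of t] show ?thesis
   unfolding fh[symmetric] by (simp add: fh[THEN fun_cong, symmetric] g_def f_def algebra_simps)
 qed
 have f: "integrable lborel f"
  unfolding f_def using gauss_line(1)[OF assms, of 0] by (intro Bochner_Integration.integrable_bound[OF gauss_line(1)[OF assms, of 0]]) (auto simp: norm_mult cis_conv_exp)
 have g: "integrable lborel g"
  unfolding g_def by (intro Bochner_Integration.integrable_bound[OF gauss_line(1)[OF assms, of 1]]) (auto simp: norm_mult cis_conv_exp)
 have lim: "((%t. norm (f t)) \<longlongrightarrow> 0) at_top" "((%t. norm (f t)) \<longlongrightarrow> 0) at_bot"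
 proof -
  have "LIM t at_top. (pi / s) * t^2 :> at_top" "LIM t at_bot. (pi / s) * t^2 :> at_top"
   by (rule filterlim_tendsto_pos_mult_at_top[OF tendsto_const];
    use assms in \<open>auto intro: filterlim_pow_at_top[OF _ filterlim_ident] filterlim_pow_at_bot_even[OF _ filterlim_ident]\<close>)+
  then show "((%t. norm (f t)) \<longlongrightarrow> 0) at_top" "((%t. norm (f t)) \<longlongrightarrow> 0) at_bot"
   by (auto simp: f_def norm_mult filterlim_uminus_at_top intro!: filterlim_compose[OF exp_at_bot])
 qed
 have "(LBINT t=-\<infinity>..\<infinity>. cr (- 2 * pi / s) * g t + 2 * pi * \<i> * x * f t) = 0 - 0"
 proof (rule interval_integral_FTC_integrable[where F=f])
  show "set_integrable lborel (einterval (- \<infinity>) \<infinity>) (%t. cr (- 2 * pi / s) * g t + 2 * pi * \<i> * x * f t)"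
   using f g by (auto simp: set_integrable_def)
  show "((f \<circ> real_of_ereal) \<longlongrightarrow> 0) (at_right (- \<infinity>))" "((f \<circ> real_of_ereal) \<longlongrightarrow> 0) (at_left \<infinity>)"
   using lim[THEN tendsto_norm_zero_cancel] by (simp_all add: ereal_tendsto_simps)
 qed (use d assms in \<open>auto simp: f_def g_def cis_conv_exp intro!: continuous_intros\<close>)
 then have "cr (- 2 * pi / s) * (LI t. g t) + 2 * pi * \<i> * x * (LI t. f t) = 0"
  using f g by (simp add: interval_lebesgue_integral_def set_lebesgue_integral_def)
 then have "(LI t. g t) = \<i> * s * x * (LI t. f t)"
  using assms by (simp add: field_simps)
 then show ?thesis unfolding f_def g_def gauss_line(2)[OF assms] by simp
qed

lemma gauss_factor:
 "cr (exp (- pi * (norm x)\<^sup>2 / s)) * E x y =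
  (\<Prod>b\<in>Basis. cr (exp (- pi * (x \<bullet> b)\<^sup>2 / s)) * cis (2 * pi * ((x \<bullet> b) * (y \<bullet> b))))"
proof -
 have "x \<bullet> x = (\<Sum>b\<in>Basis. (x \<bullet> b)\<^sup>2)" "x \<bullet> y = (\<Sum>b\<in>Basis. (x \<bullet> b) * (y \<bullet> b))"
  by (subst euclidean_inner, simp add: power2_eq_square)+
 then show ?thesis
  by (simp add: prod.distrib cis_conv_exp E_def power2_norm_eq_inner exp_sum[symmetric] sum_distrib_left sum_divide_distrib exp_of_real[symmetric])
qed

lemma gauss:
 fixes y :: "'a::euclidean_space"
 assumes "s > 0"
 shows "L1 (%x::'a. cr (exp (- pi * (norm x)\<^sup>2 / s)))"
  "(LI x. cr (exp (- pi * (norm x)\<^sup>2 / s)) * E x y) = cr (sqrt s ^ DIM('a) * exp (- pi * s * (norm y)\<^sup>2))"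
  "b \<in> Basis ==> (LI x. cr (x \<bullet> b) * (cr (exp (- pi * (norm x)\<^sup>2 / s)) * E x y)) =
   \<i> * of_real (s * (y \<bullet> b) * (sqrt s ^ DIM('a) * exp (- pi * s * (norm y)\<^sup>2)))"
proof -
 define h where "h b t = cr (exp (- pi * t\<^sup>2 / s)) * cis (2 * pi * (t * (y \<bullet> b)))" for b t
 have ih: "integrable lborel (h b)" for b
  unfolding h_def by (intro Bochner_Integration.integrable_bound[OF gauss_line(1)[OF assms, of 0]]) (auto simp: norm_mult cis_conv_exp)
 have ih': "integrable lborel (%t. of_real t * h b t)" for b
  unfolding h_def by (intro Bochner_Integration.integrable_bound[OF gauss_line(1)[OF assms, of 1]]) (auto simp: norm_mult cis_conv_exp)
 have pr: "(\<Prod>b\<in>Basis. cr (sqrt s * exp (- pi * s * (y \<bullet> b)\<^sup>2))) = cr (sqrt s ^ DIM('a) * exp (- pi * s * (norm y)\<^sup>2))"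
 proof -
  have "y \<bullet> y = (\<Sum>b\<in>Basis. (y \<bullet> b)\<^sup>2)"
   by (subst euclidean_inner, simp add: power2_eq_square)
  then show ?thesis
   by (simp add: prod.distrib power2_norm_eq_inner exp_sum[symmetric] sum_distrib_left exp_of_real[symmetric] sum_negf)
 qed
 show "L1 (%x::'a. cr (exp (- pi * (norm x)\<^sup>2 / s)))"
 proof (rule Bochner_Integration.integrable_bound)
  show "L1 (%x. \<Prod>b\<in>Basis. h b (x \<bullet> b))" by (rule lborel_prod_integral) (rule ih)
  show "AEL x. norm (cr (exp (- pi * (norm x)\<^sup>2 / s))) <= norm (\<Prod>b\<in>Basis. h b (x \<bullet> b))"
   unfolding h_def by (subst gauss_factor[symmetric]) (simp add: norm_mult)
 qed auto
 show "(LI x. cr (exp (- pi * (norm x)\<^sup>2 / s)) * E x y) = cr (sqrt s ^ DIM('a) * exp (- pi * s * (norm y)\<^sup>2))"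
  unfolding gauss_factor pr[symmetric] gauss_line(2)[OF assms, symmetric]
  by (rule lborel_prod_integral) (use ih in \<open>auto simp: h_def[abs_def]\<close>)
 assume b: "b \<in> Basis"
 have "(LI x. cr (x \<bullet> b) * (cr (exp (- pi * (norm x)\<^sup>2 / s)) * E x y)) =
  (LI x. (\<Prod>c\<in>Basis. (if c = b then of_real (x \<bullet> c) * h c (x \<bullet> c) else h c (x \<bullet> c))))"
  unfolding gauss_factor using b by (intro Bochner_Integration.integral_cong refl)
   (simp add: prod.remove[of Basis b] h_def mult.assoc)
 also have "... = (\<Prod>c\<in>Basis. (LI t. (if c = b then of_real t * h c t else h c t)))"
 proof (rule lborel_prod_integral(1))
  show "integrable lborel (%t. if c = b then cr t * h c t else h c t)" for c
   using ih[of c] ih'[of c] by (cases "c = b") auto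
 qed
 also have "... = (LI t. of_real t * h b t) * (\<Prod>c\<in>Basis - {b}. (LI t. h c t))"
  using b by (simp add: prod.remove[of Basis b])
 also have "(LI t. of_real t * h b t) = (\<i> * of_real (s * (y \<bullet> b))) * (LI t. h b t)"
  using gauss_line'[OF assms, of "y \<bullet> b"] gauss_line(2)[OF assms, of "y \<bullet> b"] by (simp add: h_def mult.assoc)
 also have "... * (\<Prod>c\<in>Basis - {b}. (LI t. h c t)) = (\<i> * of_real (s * (y \<bullet> b))) * (\<Prod>c\<in>Basis. (LI t. h c t))"
  using b by (simp add: prod.remove[of Basis b] mult.assoc)
 also have "(\<Prod>c\<in>Basis. (LI t. h c t)) = cr (sqrt s ^ DIM('a) * exp (- pi * s * (norm y)\<^sup>2))"
  unfolding h_def gauss_line(2)[OF assms] by (rule pr)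
 finally show "(LI x. cr (x \<bullet> b) * (cr (exp (- pi * (norm x)\<^sup>2 / s)) * E x y)) =
   \<i> * of_real (s * (y \<bullet> b) * (sqrt s ^ DIM('a) * exp (- pi * s * (norm y)\<^sup>2)))" by (simp add: mult.assoc)
qed

lemma sqrt_power: "s > 0 ==> sqrt s ^ n = s powr (real n / 2)"
 using powr_power[of s "1/2" n] by (simp add: powr_half_sqrt)

text \<open>The subordination density: the Gamma law with shape 1/2 and rate pi.\<close>

definition w :: "real => real" where
 "w s = indicator {0<..} s * s powr (1 / 2 - 1) * exp (- (pi * s))"

text \<open>In closed form this is exp(-2 pi |r|), the Fourier transform of the Poisson kernel. The
  integral form is kept because Fourier transforms then reduce to Gaussians by Fubini; bounds,
  continuity and the value at 0 are all that is used of \<open>p\<close> itself.\<close>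

definition p :: "real => real" where
 "p r = (LI s. w s * exp (- pi * r\<^sup>2 / s))"

lemma w: "w \<in> bm" "w s >= 0" "integrable lborel w" "(LI s. w s) = 1" "s <= 0 ==> w s = 0"
proof -
 have "has_bochner_integral lborel w 1"
  using gamma_scaled[of "1/2" pi] by (simp add: w_def[abs_def] Gamma_one_half_real powr_half_sqrt powr_minus)
 then show "integrable lborel w" "(LI s. w s) = 1" by (auto simp: has_bochner_integral_iff)
qed (auto simp: w_def[abs_def])

lemma w_exp: "integrable lborel (%s. w s * exp (- pi * r\<^sup>2 / s))" "0 <= w s * exp (- pi * r\<^sup>2 / s)"
  "w s * exp (- pi * r\<^sup>2 / s) <= w s"
proof -
 show *: "w s * exp (- pi * r\<^sup>2 / s) <= w s" for s
  using w(2,5)[of s] by (cases "s > 0") (auto intro!: mult_left_le)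
 show "integrable lborel (%s. w s * exp (- pi * r\<^sup>2 / s))"
  by (rule Bochner_Integration.integrable_bound[OF w(3)]) (use w(1,2) * in auto)
qed (use w(2) in auto)

lemma p: "0 <= p r" "p r <= 1" "p 0 = 1" "continuous_on UNIV p"
proof -
 show "0 <= p r" unfolding p_def by (intro Bochner_Integration.integral_nonneg w_exp)
 have "p r <= (LI s. w s)" unfolding p_def by (intro integral_mono w_exp w)
 then show "p r <= 1" by (simp add: w)
 show "p 0 = 1" by (simp add: p_def w)
 show "continuous_on UNIV p"
 proof (unfold continuous_on_sequentially, intro allI impI ballI)
  fix t r assume tr: "(\<forall>n. t n \<in> UNIV) & t ---> (r::real)"
  show "(p \<circ> t) ---> p r"
   unfolding p_def o_def
  proof (intro integral_dominated_convergence[where w=w] w(3) AE_I2)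
   show "(%n. w s * exp (- pi * (t n)\<^sup>2 / s)) ---> w s * exp (- pi * r\<^sup>2 / s)" for s
    using tr by (cases "s = 0") (auto simp: w(5) simp del: mult_minus_left intro!: tendsto_intros)
  qed (use w(1,2) w_exp(2,3) in auto)
 qed
qed

text \<open>The substitution s -> r^2/s interchanges the two exponentials. The gain is a factor r
  outside and 1/s inside, which cancels the 1/|y| of the Riesz multiplier in
  \<open>F_mp\<close>.\<close>

lemma p_alt:
 assumes "r > 0"
 shows "integrable lborel (%s. w s * exp (- pi * r\<^sup>2 / s) / s)" "p r = r * (LI s. w s * exp (- pi * r\<^sup>2 / s) / s)"
proof -
 define f where "f s = w s * exp (- pi * r\<^sup>2 / s)" for s
 have f: "integrable lborel f" unfolding f_def by (rule w_exp)
 have fS: "indicator {0<..} s * f s = f s" for s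
  using w(5)[of s] by (auto simp: f_def split: split_indicator)
 have "set_integrable lebesgue {0<..} f" "integral {0<..} f = p r"
 proof -
  have *: "set_integrable lborel {0<..} f" using f by (simp add: set_integrable_def fS)
  then show "set_integrable lebesgue {0<..} f" unfolding set_integrable_def by (rule integrable_completion[THEN iffD2, rotated]) (use w(1) in \<open>auto simp: f_def[abs_def]\<close>)
  show "integral {0<..} f = p r"
   using set_borel_integral_eq_integral(2)[OF *] by (simp add: set_lebesgue_integral_def fS) (simp add: f_def p_def)
 qed
 moreover have im: "(%s. r\<^sup>2 / s) ` {0<..} = {0<..}"
  using assms by (auto simp: image_iff intro!: bexI[of _ "r\<^sup>2 / x" for x])
 moreover have "inj_on (%s. r\<^sup>2 / s) {0<..}" using assms by (auto simp: inj_on_def field_simps)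
 moreover have "((%s. r\<^sup>2 / s) has_field_derivative - (r\<^sup>2) / s\<^sup>2) (at s within {0<..})" if "s \<in> {0<..}" for s
  using that by (auto intro!: derivative_eq_intros simp: power2_eq_square)
 ultimately have "(%s. \<bar>- (r\<^sup>2) / s\<^sup>2\<bar> * f (r\<^sup>2 / s)) absolutely_integrable_on {0<..} &
   integral {0<..} (%s. \<bar>- (r\<^sup>2) / s\<^sup>2\<bar> * f (r\<^sup>2 / s)) = p r"
  by (subst has_absolute_integral_change_of_variables_1') auto
 moreover have eq: "\<bar>- (r\<^sup>2) / s\<^sup>2\<bar> * f (r\<^sup>2 / s) = r * (f s / s)" if "s > 0" for s
 proof -
  have h: "x powr (- (1 / 2)) = 1 / sqrt x" if "x > 0" for x :: real
   using that powr_minus[of x "1/2"] by (simp add: powr_half_sqrt field_simps)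
  have "exp (- (pi * (r\<^sup>2 / s))) * exp (- pi * r\<^sup>2 / (r\<^sup>2 / s)) = exp (- (pi * s)) * exp (- pi * r\<^sup>2 / s)"
   using that assms by (simp add: mult_exp_exp field_simps)
  moreover have "\<bar>- (r\<^sup>2) / s\<^sup>2\<bar> * (1 / sqrt (r\<^sup>2 / s)) = r * (1 / sqrt s / s)"
   using that assms by (simp add: real_sqrt_divide power2_eq_square field_simps)
  moreover have "\<bar>- (r\<^sup>2) / s\<^sup>2\<bar> * f (r\<^sup>2 / s) = (\<bar>- (r\<^sup>2) / s\<^sup>2\<bar> * (1 / sqrt (r\<^sup>2 / s))) *
   (exp (- (pi * (r\<^sup>2 / s))) * exp (- pi * r\<^sup>2 / (r\<^sup>2 / s)))"
   using that assms by (simp add: f_def w_def h)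
  moreover have "r * (f s / s) = (r * (1 / sqrt s / s)) * (exp (- (pi * s)) * exp (- pi * r\<^sup>2 / s))"
   using that by (simp add: f_def w_def h)
  ultimately show ?thesis by (simp only:)
 qed
 ultimately have a: "(%s. r * (f s / s)) absolutely_integrable_on {0<..}" "integral {0<..} (%s. r * (f s / s)) = p r"
  using set_integrable_cong[of lebesgue lebesgue "{0<..}" "{0<..}" "%s. \<bar>- (r\<^sup>2) / s\<^sup>2\<bar> * f (r\<^sup>2 / s)" "%s. r * (f s / s)"]
   Henstock_Kurzweil_Integration.integral_cong[of "{0<..}" "%s. \<bar>- (r\<^sup>2) / s\<^sup>2\<bar> * f (r\<^sup>2 / s)" "%s. r * (f s / s)"] by auto
 have m[measurable]: "f \<in> bm" using w(1) by (simp add: f_def[abs_def])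
 have fS': "(%s. indicator {0<..} s *\<^sub>R (r * (f s / s))) = (%s. r * (f s / s))"
 proof
  fix s show "indicator {0<..} s *\<^sub>R (r * (f s / s)) = r * (f s / s)"
   using fS[of s] by (auto split: split_indicator)
 qed
 have "integrable lebesgue (%s. r * (f s / s))" using a(1) by (simp only: set_integrable_def fS')
 then have b: "integrable lborel (%s. r * (f s / s))" by (subst (asm) integrable_completion) auto
 then have "integrable lborel (%s. (1 / r) * (r * (f s / s)))" by (rule integrable_mult_right)
 then show "integrable lborel (%s. w s * exp (- pi * r\<^sup>2 / s) / s)" using assms by (simp add: f_def)
 have "set_integrable lborel {0<..} (%s. r * (f s / s))" using b by (simp only: set_integrable_def fS')
 from set_borel_integral_eq_integral(2)[OF this] a(2)
 show "p r = r * (LI s. w s * exp (- pi * r\<^sup>2 / s) / s)"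
  by (simp only: set_lebesgue_integral_def fS' integral_mult_right_zero) (simp add: f_def)
qed

definition Pc :: "'n itself => real" where
 "Pc _ = Gamma ((real CARD('n) + 1) / 2) * pi powr (- (real CARD('n) + 1) / 2)"

text \<open>\<open>P e\<close> and \<open>Q e i\<close> are the Poisson and the conjugate Poisson kernel at height \<open>e\<close>.\<close>

definition P :: "real => real^'n => real" where
 "P e x = Pc TYPE('n) * e / sqrt (e\<^sup>2 + (norm x)\<^sup>2) ^ (CARD('n) + 1)"

definition Q :: "real => 'n => real^'n => real" where
 "Q e i x = Pc TYPE('n) * x $ i / sqrt (e\<^sup>2 + (norm x)\<^sup>2) ^ (CARD('n) + 1)"

lemma Pc_pos: "Pc TYPE('n::finite) > 0"
 by (auto simp: Pc_def intro!: mult_pos_pos Gamma_real_pos)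

text \<open>A Gamma integral with shape (n+1)/2 and rate pi(1+|x|^2/e^2). Its value produces the
  constant \<open>Pc\<close>, which is also the constant of \<open>riesz_kernel\<close>.\<close>

lemma P_integral:
 assumes "e > 0"
 shows "has_bochner_integral lborel (%s. w s * (sqrt (s / e\<^sup>2) ^ CARD('n) * exp (- pi * (s / e\<^sup>2) * (norm (x::real^'n))\<^sup>2))) (P e x)"
proof -
 define c where "c = pi * (1 + (norm x)\<^sup>2 / e\<^sup>2)"
 have c: "c > 0" using assms by (auto simp: c_def intro!: mult_pos_pos add_pos_nonneg)
 let ?n = "real CARD('n)"
 have "has_bochner_integral lborel (%s. (1 / e ^ CARD('n)) * (indicator {0<..} s * s powr ((?n + 1) / 2 - 1) * exp (- (c * s))))
   ((1 / e ^ CARD('n)) * (Gamma ((?n + 1) / 2) * c powr (- ((?n + 1) / 2))))"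
  by (intro has_bochner_integral_mult_right gamma_scaled c) auto
 moreover have "(1 / e ^ CARD('n)) * (indicator {0<..} s * s powr ((?n + 1) / 2 - 1) * exp (- (c * s))) =
   w s * (sqrt (s / e\<^sup>2) ^ CARD('n) * exp (- pi * (s / e\<^sup>2) * (norm x)\<^sup>2))" for s
 proof (cases "s > 0")
  case True
  have "sqrt (s / e\<^sup>2) ^ CARD('n) = s powr (?n / 2) / e ^ CARD('n)"
   using True assms by (simp add: real_sqrt_divide power_divide sqrt_power)
  moreover have "s powr ((?n + 1) / 2 - 1) = s powr (1/2 - 1) * s powr (?n / 2)"
   by (simp add: powr_add[symmetric] field_simps)
  moreover have "exp (- (c * s)) = exp (- (pi * s)) * exp (- pi * (s / e\<^sup>2) * (norm x)\<^sup>2)"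
   by (simp add: mult_exp_exp c_def field_simps)
  ultimately show ?thesis using True by (simp add: w_def)
 qed (simp add: w_def)
 moreover have "(1 / e ^ CARD('n)) * (Gamma ((?n + 1) / 2) * c powr (- ((?n + 1) / 2))) = P e x"
 proof -
  define q where "q = e\<^sup>2 + (norm x)\<^sup>2"
  have q: "q > 0" using assms by (simp add: q_def add_pos_nonneg)
  have "c = pi * (q / e\<^sup>2)" using assms by (simp add: c_def q_def field_simps)
  then have "c powr (- ((?n + 1) / 2)) = pi powr (- ((?n + 1) / 2)) * ((q / e\<^sup>2) powr (- ((?n + 1) / 2)))"
   using powr_mult[of pi "q / e\<^sup>2" "- ((?n + 1) / 2)"] q assms by simp
  also have "(q / e\<^sup>2) powr (- ((?n + 1) / 2)) = 1 / sqrt (q / e\<^sup>2) ^ (CARD('n) + 1)"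
   using sqrt_power[of "q / e\<^sup>2" "CARD('n) + 1"] q assms
   by (simp only: powr_minus_divide of_nat_add of_nat_1) simp
  also have "sqrt (q / e\<^sup>2) = sqrt q / e" using assms by (simp add: real_sqrt_divide)
  finally show ?thesis using assms by (simp add: P_def Pc_def q_def[symmetric] power_divide minus_divide_left)
 qed
 ultimately show ?thesis by simp
qed

lemma P_pos: "e > 0 ==> P e x > 0"
 unfolding P_def using Pc_pos by (intro divide_pos_pos mult_pos_pos zero_less_power) (auto simp: add_pos_nonneg)

lemma P_measurable[measurable]: "P e \<in> bm" "Q e i \<in> bm"
 unfolding P_def[abs_def] Q_def[abs_def] by measurable

lemma Q_eq: "e > 0 ==> Q e i x = x $ i / e * P e x"
 by (simp add: P_def Q_def)

lemma vec_nth_measurable[measurable]: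
 fixes f :: "'x => real^'n"
 shows "f \<in> borel_measurable M ==> (%x. f x $ i) \<in> borel_measurable M"
 by (rule measurable_compose[OF _ borel_measurable_continuous_onI]) (auto intro!: continuous_intros)

lemma norm_m_le: "norm (m i y) <= 1"
 using component_le_norm_cart[of y i] by (auto simp: m_def norm_mult norm_divide divide_le_eq)

text \<open>Both transforms arise by integrating Gaussian transforms against \<open>w\<close>. For
  \<open>F_mp\<close>, \<open>p_alt\<close> turns y/|y| times \<open>p\<close> into a mixture of y
  times Gaussians, whose transform is the first moment in \<open>gauss\<close>. The minus sign
  appears because \<open>F\<close> is the forward transform and \<open>Q\<close> is odd.\<close>

lemma
 assumes e: "e > 0"
 shows p_L1: "L1 (%y::real^'n. cr (p (e * norm y)))"
  and F_p: "F (%y::real^'n. cr (p (e * norm y))) x = cr (P e x)"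
  and F_mp: "F (%y::real^'n. m i y * cr (p (e * norm y))) x = - cr (Q e i x)"
  and mp_L1: "L1 (%y::real^'n. m i y * cr (p (e * norm y)))"
proof -
 define g :: "real => real^'n => complex" where "g s y = cr (exp (- pi * (norm y)\<^sup>2 / (s / e\<^sup>2)))" for s y
 define h where "h s y = cr (w s) * g s y" for s y
 have gm[measurable]: "(%(s,y). g s y) \<in> borel_measurable (lborel \<Otimes>\<^sub>M lborel)" unfolding g_def by measurable
 have wm[measurable]: "w \<in> bm" by (rule w)
 have hm[measurable]: "(%(s,y). h s y) \<in> borel_measurable (lborel \<Otimes>\<^sub>M lborel)" unfolding h_def by measurable
 have gF: "F (g s) z = cr (sqrt (s / e\<^sup>2) ^ CARD('n) * exp (- pi * (s / e\<^sup>2) * (norm z)\<^sup>2))"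
   and gL: "L1 (g s)" if "s > 0" for s z
  using gauss(1)[of "s / e\<^sup>2"] gauss(2)[of "s / e\<^sup>2" "-z"] that e by (simp_all add: F_def g_def[abs_def])
 have hF: "F (h s) z = cr (w s * (sqrt (s / e\<^sup>2) ^ CARD('n) * exp (- pi * (s / e\<^sup>2) * (norm z)\<^sup>2)))"
   and hL: "L1 (h s)" for s z
  using gF[of s z] gL[of s] w(5)[of s] by (cases "s > 0"; auto simp: h_def[abs_def] F_cmult F_def[of "%_. 0"])+
 have Nh: "N (h s) = ennreal (w s * sqrt (s / e\<^sup>2) ^ CARD('n))" for s
 proof -
  have "(LI x. norm (h s x)) = Re (F (h s) 0)"
   unfolding F_def using hL[of s] w(2)[of s]
   by (subst integral_Re[symmetric]) (auto simp: norm_mult h_def[abs_def] g_def[abs_def] intro!: Bochner_Integration.integral_cong L1_E)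
  then show ?thesis using N_eq[OF hL[of s]] by (simp add: hF)
 qed
 have ab: "w s * \<bar>sqrt (s / e\<^sup>2) ^ CARD('n)\<bar> = w s * sqrt (s / e\<^sup>2) ^ CARD('n)" for s
  using w(5)[of s] e by (cases "s > 0") auto
 have fin: "(NI s. N (h s)) < \<infinity>"
  using P_integral[OF e, of "0::real^'n"] w(2) unfolding Nh has_bochner_integral_iff integrable_iff_bounded by (auto simp: abs_mult ab)
 have hp: "(LI s. h s y) = cr (p (e * norm y))" for y
  unfolding h_def g_def p_def by (subst of_real_mult[symmetric], subst integral_complex_of_real) (simp add: power_mult_distrib mult_ac)
 note mx = mix[OF lborel.sigma_finite_measure_axioms hm fin]
 show pL: "L1 (%y::real^'n. cr (p (e * norm y)))" using mx(1) by (simp add: hp)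
 show "F (%y::real^'n. cr (p (e * norm y))) x = cr (P e x)"
  using mx(3) P_integral[OF e, of x] by (simp only: hp hF integral_complex_of_real) (simp add: has_bochner_integral_iff)
 show mpL: "L1 (%y::real^'n. m i y * cr (p (e * norm y)))"
  by (rule L1_mult_bounded(2)[OF pL _ norm_m_le]) (simp add: m_def[abs_def])
 define k where "k s y = cr (- e * y $ i / s) * (\<i> * h s y)" for s y
 have km[measurable]: "(%(s,y). k s y) \<in> borel_measurable (lborel \<Otimes>\<^sub>M lborel)"
  using hm unfolding k_def split_beta' by measurable
 have kp: "(LI s. k s y) = m i y * cr (p (e * norm y))"
  and kn: "(NI s. norm (k s y)) <= ennreal (p (e * norm y))" for y
 proof -
  have kw: "k s y = cr (w s * exp (- pi * (e * norm y)\<^sup>2 / s) / s) * (- \<i> * of_real (e * y $ i))" for s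
   by (simp add: k_def h_def g_def power_mult_distrib mult_ac)
  show "(LI s. k s y) = m i y * cr (p (e * norm y))"
  proof (cases "y = 0")
   case False
   then have "e * norm y > 0" using e by simp
   from p_alt[OF this] False e show ?thesis
    unfolding kw integral_mult_left_zero integral_complex_of_real by (simp add: m_def)
  qed (simp add: k_def m_def)
  show "(NI s. norm (k s y)) <= ennreal (p (e * norm y))"
  proof (cases "y = 0")
   case False
   then have r: "e * norm y > 0" using e by simp
   have "norm (k s y) <= (e * norm y) * (w s * exp (- pi * (e * norm y)\<^sup>2 / s) / s)" for s
   proof (cases "s > 0")
    case True
    define W where "W = w s * exp (- pi * (e * norm y)\<^sup>2 / s) / s"
    have "W >= 0" using w(2)[of s] True by (simp add: W_def)
    then show ?thesis unfolding kw W_def[symmetric] using e component_le_norm_cart[of y i]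
     by (simp add: norm_mult abs_mult mult.commute[of W] mult_left_mono mult_right_mono)
   qed (simp add: kw w(5))
   then have "(NI s. norm (k s y)) <= (NI s. ennreal ((e * norm y) * (w s * exp (- pi * (e * norm y)\<^sup>2 / s) / s)))"
    by (intro nn_integral_mono ennreal_leI) auto
   also have "... = ennreal (p (e * norm y))"
   proof (subst nn_integral_eq_integral)
    show "AE s in lborel. 0 <= (e * norm y) * (w s * exp (- pi * (e * norm y)\<^sup>2 / s) / s)"
    proof (rule AE_I2)
     fix s show "0 <= (e * norm y) * (w s * exp (- pi * (e * norm y)\<^sup>2 / s) / s)"
      using r w(2,5)[of s] by (cases "s > 0") (auto simp del: mult_pos_pos)
    qed
   qed (rule integrable_mult_right, rule p_alt(1)[OF r], simp only: p_alt(2)[OF r] integral_mult_right_zero)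
   finally show ?thesis .
  qed (simp add: k_def)
 qed
 have fin': "(NI s. N (k s)) < \<infinity>"
 proof -
  have "(NI s. N (k s)) = (NI y. (NI s. norm (k s y)))"
   unfolding N_def by (rule lborel_pair.Fubini'[symmetric]) measurable
  also have "... <= (\<integral>\<^sup>+y. ennreal (p (e * norm y)) \<partial>(lborel::(real^'n) measure))" by (intro nn_integral_mono kn)
  also have "... < \<infinity>" using N_less_top[OF pL] p(1) by (simp add: N_def)
  finally show ?thesis .
 qed
 have kF: "F (k s) x = cr ((- x $ i / e) * (w s * (sqrt (s / e\<^sup>2) ^ CARD('n) * exp (- pi * (s / e\<^sup>2) * (norm x)\<^sup>2))))" for s
 proof (cases "s > 0")
  case True
  then have s: "s / e\<^sup>2 > 0" using e by simp
  have "F (k s) x = cr (- e * w s / s) * \<i> * (LI y. cr (y \<bullet> axis i 1) * (cr (exp (- pi * (norm y)\<^sup>2 / (s / e\<^sup>2))) * E y (- x)))"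
   unfolding F_def integral_mult_right_zero[symmetric]
   by (intro Bochner_Integration.integral_cong) (auto simp: k_def h_def g_def inner_axis mult_ac)
  also have "... = cr ((- x $ i / e) * (w s * (sqrt (s / e\<^sup>2) ^ CARD('n) * exp (- pi * (s / e\<^sup>2) * (norm x)\<^sup>2))))"
   using True e by (subst gauss(3)[OF s]) (auto simp: inner_axis axis_in_Basis_iff field_simps power2_eq_square)
  finally show ?thesis .
 qed (simp add: k_def h_def w(5) F_def)
 show "F (%y::real^'n. m i y * cr (p (e * norm y))) x = - cr (Q e i x)"
  using mix(3)[OF lborel.sigma_finite_measure_axioms km fin', of x] P_integral[OF e, of x]
  by (simp only: kp kF integral_complex_of_real integral_mult_right_zero) (simp add: has_bochner_integral_iff Q_eq[OF e])
qed

lemma P_one: "e > 0 ==> (NI x. P e (x::real^'n)) = 1"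
proof -
 assume e: "e > 0"
 define g where "g s x = w s * (sqrt (s / e\<^sup>2) ^ CARD('n) * exp (- pi * (s / e\<^sup>2) * (norm x)\<^sup>2))" for s and x :: "real^'n"
 have [measurable]: "w \<in> bm" by (rule w)
 have [measurable]: "(%(s,x). g s x) \<in> borel_measurable (lborel \<Otimes>\<^sub>M lborel)" unfolding g_def by measurable
 have g0: "g s x >= 0" for s x unfolding g_def using w(2)[of s] w(5)[of s] by (cases "s > 0") auto
 have "(NI x. P e (x::real^'n)) = (NI x. (NI s. ennreal (g s x)))"
 proof (intro nn_integral_cong)
  fix x :: "real^'n"
  show "ennreal (P e x) = (NI s. ennreal (g s x))"
   using P_integral[OF e, of x] g0 by (subst nn_integral_eq_integral) (auto simp: has_bochner_integral_iff g_def)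
 qed
 also have "... = (NI s. (NI x. ennreal (g s x)))" by (rule lborel_pair.Fubini') measurable
 also have "... = (NI s. ennreal (w s))"
 proof (intro nn_integral_cong)
  fix s :: real
  show "(NI x. ennreal (g s x)) = ennreal (w s)"
  proof (cases "s > 0")
   case True
   then have t: "e\<^sup>2 / s > 0" "s / e\<^sup>2 > 0" using e by auto
   have "sqrt (s / e\<^sup>2) * sqrt (e\<^sup>2 / s) = 1" using True e by (simp add: real_sqrt_mult[symmetric])
   then have sq: "sqrt (s / e\<^sup>2) ^ CARD('n) * sqrt (e\<^sup>2 / s) ^ CARD('n) = 1" by (simp flip: power_mult_distrib)
   have i: "L1 (%x::real^'n. exp (- pi * (s / e\<^sup>2) * (norm x)\<^sup>2))"
    using gauss(1)[OF t(1), THEN integrable_Re, where 'a1="real^'n"] by (simp add: field_simps)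
   have "cr (LI x. exp (- pi * (s / e\<^sup>2) * (norm (x::real^'n))\<^sup>2)) = sqrt (e\<^sup>2 / s) ^ CARD('n)"
    using gauss(2)[OF t(1), of "0::real^'n"] by (simp add: field_simps flip: integral_complex_of_real)
   then have v: "(LI x. exp (- pi * (s / e\<^sup>2) * (norm (x::real^'n))\<^sup>2)) = sqrt (e\<^sup>2 / s) ^ CARD('n)"
    using of_real_eq_iff by blast
   have "(NI x. ennreal (g s x)) = ennreal (LI x. g s x)"
    using i g0 by (intro nn_integral_eq_integral) (auto simp: g_def)
   also have "(LI x. g s x) = w s"
    unfolding g_def using sq v by (simp add: mult.assoc)
   finally show ?thesis .
  qed (simp add: g_def w(5))
 qed
 also have "... = 1" using w by (subst nn_integral_eq_integral) auto
 finally show ?thesis .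
qed

text \<open>The multiplication formula. Taking for k a damping factor with known transform, it
  rewrites a convolution as a damped inverse Fourier integral; inversion, uniqueness and the Poisson
  means all start here.\<close>

lemma F_mult:
 fixes f k :: "'a::euclidean_space => complex"
 assumes f: "L1 f" and k: "L1 k"
 shows "(LI y. f y * F k (y - x)) = (LI z. F f z * k z * E z x)"
proof -
 have [measurable]: "f \<in> bm" "k \<in> bm" using f k by auto
 have "integrable (lborel \<Otimes>\<^sub>M lborel) (%(y,z). f y * (k z * E z (x - y)))"
 proof -
  have "(NI y. (NI z. ennreal (norm (f y) * norm (k z)))) = N f * N k"
   by (simp add: ennreal_mult nn_integral_cmult nn_integral_multc N_def)
  also have "... < \<infinity>" using N_less_top[OF f] N_less_top[OF k] by (simp add: ennreal_mult_less_top)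
  finally show ?thesis
   by (simp add: integrable_iff_bounded lborel.nn_integral_fst[symmetric] split_beta' norm_mult)
 qed
 from lborel_pair.Fubini_integral[OF this]
 have "(LI y. (LI z. f y * (k z * E z (x - y)))) = (LI z. (LI y. f y * (k z * E z (x - y))))"
  by simp
 moreover have "(LI z. k z * E z (x - y)) = F k (y - x)" for y
  by (simp add: F_def)
 moreover have "(LI y. f y * (k z * E z (x - y))) = F f z * k z * E z x" for z
  by (simp add: F_def E_diff E_minus E_commute[of z] mult_ac flip: integral_mult_right_zero integral_mult_left_zero)
 ultimately show ?thesis by simp
qed

section \<open>Poisson means, Fourier inversion and an L2 bound\<close>

abbreviation CP :: "real => real^'n => complex" where "CP e x \<equiv> cr (P e x)"
abbreviation CQ :: "real => 'n => real^'n => complex" where "CQ e i x \<equiv> cr (Q e i x)"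

lemma P_even[simp]: "P e (- x) = P e x" "P e (x - y) = P e (y - x)" and Q_odd[simp]: "Q e i (- x) = - Q e i x"
 by (simp_all add: P_def Q_def norm_minus_commute)

lemma P_nonneg[simp]: "e > 0 ==> 0 <= P e x"
 using P_pos[of e x] by simp

lemma P_L1: "e > 0 ==> L1 (CP e :: real^'n => complex)" "e > 0 ==> L1 (P e :: real^'n => real)"
 and N_P: "e > 0 ==> N (CP e :: real^'n => complex) = 1"
 using P_one[of e, where 'n='n] by (auto simp: L1_iff N_def)

lemma P_integral_one: "e > 0 ==> (LI x. P e (x::real^'n)) = 1"
 using P_one[of e, where 'n='n] nn_integral_eq_integral[OF P_L1(2)[of e, where 'n='n]] by (auto simp: ennreal_eq_1)

lemma conv_P:
 assumes "L1 f" "e > 0"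
 shows "conv f (CP e) x = (LI z. F f z * cr (p (e * norm z)) * E z x)"
 unfolding F_mult[OF assms(1) p_L1[OF assms(2)], symmetric] F_p[OF assms(2)] conv_eq by simp

lemma conv_Q:
 assumes "L1 f" "e > 0"
 shows "conv f (CQ e i) x = (LI z. F f z * (m i z * cr (p (e * norm z))) * E z x)"
proof -
 have "CQ e i (x - y) = - CQ e i (y - x)" for y
  using Q_odd[of e i "y - x"] by (simp del: Q_odd)
 then show ?thesis
  unfolding F_mult[OF assms(1) mp_L1[OF assms(2)], symmetric] F_mp[OF assms(2)] conv_eq by simp
qed

lemma conv_commute: "f \<in> bm ==> g \<in> bm ==> conv f g x = conv g f x"
 using lborel_reflect(1)[of "%y. f y * g (x - y)" x] by (simp add: conv_eq mult.commute)

lemma P_scale: "e > 0 ==> P e x = P 1 (x /\<^sub>R e) / e ^ CARD('n)" for x :: "real^'n"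
proof -
 assume e: "e > 0"
 have "e\<^sup>2 + (norm x)\<^sup>2 = e\<^sup>2 * (1 + (norm (x /\<^sub>R e))\<^sup>2)" using e by (simp add: field_simps power_mult_distrib power_divide)
 then have "sqrt (e\<^sup>2 + (norm x)\<^sup>2) = e * sqrt (1 + (norm (x /\<^sub>R e))\<^sup>2)" using e by (simp add: real_sqrt_mult)
 then show ?thesis using e by (simp add: P_def power_mult_distrib)
qed

text \<open>The Poisson-averaged oscillation. Its convergence to 0 as e -> 0 is the notion of
  Lebesgue point used throughout: it controls Poisson means and, through \<open>conv_Q_tr\<close>,
  the truncated Riesz integrals.\<close>

definition osc :: "(real^'n => complex) => real => real^'n => ennreal" where
 "osc f e x = (NI y. norm (f (x - y) - f x) * P e y)"

lemma osc_scaled: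
 assumes [measurable]: "f \<in> bm" and e: "e > 0"
 shows "osc f e x = (NI y. norm (f (x - e *\<^sub>R y) - f x) * P 1 y)"
 unfolding osc_def using e
 by (subst nn_dilate[of _ "1/e", symmetric])
   (auto simp: P_scale[of e] ennreal_mult[symmetric] abs_of_pos P_pos less_imp_le power_divide field_simps  intro!: nn_integral_cong
    nn_dilate[of "%y. ennreal (norm (f (x - e *\<^sub>R y) - f x) * P 1 y)" "1/e", symmetric, THEN trans])

lemma osc_tendsto_bounded:
 fixes f :: "real^'n => complex"
 assumes [measurable]: "f \<in> bm" and B: "!!x. norm (f x) <= B" and c: "isCont f x"
 shows "((%e. osc f e x) \<longlongrightarrow> 0) (at_right 0)"
proof (unfold tendsto_at_iff_sequentially, intro allI impI)
 fix X :: "nat => real" assume X: "\<forall>i. X i \<in> {0<..} - {0}" and X0: "X ---> 0"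
 have B0: "B >= 0" using B[of 0] norm_ge_zero order_trans by blast
 have "(%i. (NI y. norm (f (x - X i *\<^sub>R y) - f x) * P 1 y)) ---> (\<integral>\<^sup>+y. 0 \<partial>(lborel::(real^'n) measure))"
 proof (rule nn_integral_dominated_convergence[where w="%y. ennreal (2 * B) * ennreal (P 1 y)"])
  show "AE y in lborel. ennreal (norm (f (x - X i *\<^sub>R y) - f x) * P 1 y) <= ennreal (2 * B) * ennreal (P 1 y)" for i
  proof (rule AE_I2)
   fix y show "ennreal (norm (f (x - X i *\<^sub>R y) - f x) * P 1 y) <= ennreal (2 * B) * ennreal (P 1 y)"
    using B[of "x - X i *\<^sub>R y"] B[of x] norm_triangle_ineq4[of "f (x - X i *\<^sub>R y)" "f x"] P_nonneg[of 1 y] B0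
    by (subst ennreal_mult[symmetric]) (auto intro!: ennreal_leI mult_right_mono)
  qed
  show "(NI y. ennreal (2 * B) * ennreal (P 1 (y::real^'n))) < \<infinity>"
   by (simp add: nn_integral_cmult P_one)
  show "AE y in lborel. (%i. ennreal (norm (f (x - X i *\<^sub>R y) - f x) * P 1 y)) ---> 0"
  proof (rule AE_I2)
   fix y
   have "(%i. x - X i *\<^sub>R y) ---> x - 0 *\<^sub>R y" by (intro tendsto_intros X0)
   then have "(%i. f (x - X i *\<^sub>R y)) ---> f x" using isCont_tendsto_compose[OF c] by simp
   then have "(%i. norm (f (x - X i *\<^sub>R y) - f x) * P 1 y) ---> norm (f x - f x) * P 1 y" by (intro tendsto_intros)
   then show "(%i. ennreal (norm (f (x - X i *\<^sub>R y) - f x) * P 1 y)) ---> 0"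
    using tendsto_ennrealI by fastforce
  qed
 qed auto
 moreover have "osc f (X i) x = (NI y. norm (f (x - X i *\<^sub>R y) - f x) * P 1 y)" for i
  using X by (intro osc_scaled) auto
 ultimately show "((%e. osc f e x) \<circ> X) ---> 0" by (simp add: o_def)
qed

lemma conv_P_osc:
 fixes f :: "real^'n => complex"
 assumes f: "L1 f" and e: "e > 0"
 shows "ennreal (norm (conv f (CP e) x - f x)) <= osc f e x"
proof -
 have [measurable]: "f \<in> bm" using f by auto
 have b: "P e y <= Pc TYPE('n) / e ^ CARD('n)" for y :: "real^'n"
 proof -
  have "e ^ (CARD('n) + 1) <= sqrt (e\<^sup>2 + (norm y)\<^sup>2) ^ (CARD('n) + 1)"
   using e by (intro power_mono real_le_rsqrt) auto
  then have "P e y <= Pc TYPE('n) * e / e ^ (CARD('n) + 1)"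
   unfolding P_def using e Pc_pos[where 'n='n] by (intro divide_left_mono mult_pos_pos zero_less_power) (auto simp: add_pos_nonneg)
  then show ?thesis using e by simp
 qed
 have "L1 (%y. f (x - y))" using f lborel_reflect(2)[of "%y. ennreal (norm (f y))" x] by (simp add: L1_iff N_def)
 then have i1: "L1 (%y. f (x - y) * CP e y)"
  using b e by (intro L1_mult_bounded(1)[where B="Pc TYPE('n) / e ^ CARD('n)"]) auto
 have i2: "L1 (%y::real^'n. f x * CP e y)" using P_L1(1)[OF e] by (rule integrable_mult_right)
 have "conv f (CP e) x - f x = (LI y. f (x - y) * CP e y) - (LI y. f x * CP e (y::real^'n))"
  by (simp add: conv_commute[of f "CP e"]) (simp add: conv_eq P_integral_one[OF e] mult.commute integral_complex_of_real)
 also have "... = (LI y. (f (x - y) - f x) * CP e y)"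
  using i1 i2 by (simp add: Bochner_Integration.integral_diff[symmetric] left_diff_distrib)
 also have "ennreal (norm ...) <= osc f e x"
  using integral_norm_bound_ennreal[OF Bochner_Integration.integrable_diff[OF i1 i2]] e
  by (simp add: osc_def norm_mult left_diff_distrib flip: norm_mult left_diff_distrib)
    (simp add: norm_mult)
 finally show ?thesis .
qed

lemma tendsto_of_ennreal_bound:
 assumes "\<forall>\<^sub>F e in Fl. ennreal (norm (g e - l)) <= h e" "(h \<longlongrightarrow> 0) Fl"
 shows "(g \<longlongrightarrow> (l::'b::real_normed_vector)) Fl"
proof -
 have "((%e. ennreal (norm (g e - l))) \<longlongrightarrow> 0) Fl"
  by (rule tendsto_sandwich[OF _ assms(1) tendsto_const assms(2)]) auto
 then have "((%e. norm (g e - l)) \<longlongrightarrow> 0) Fl"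
  using tendsto_ennrealD[of "%e. norm (g e - l)" 0 Fl] by simp
 then show ?thesis by (simp add: tendsto_norm_zero_iff LIM_zero_iff)
qed

lemma conv_P_tendsto:
 assumes "L1 f" "((%e. osc f e x) \<longlongrightarrow> 0) (at_right 0)"
 shows "((%e. conv f (CP e) x) \<longlongrightarrow> f x) (at_right 0)"
 by (rule tendsto_of_ennreal_bound[OF _ assms(2)])
   (auto intro!: conv_P_osc assms eventually_at_right_less[THEN eventually_mono])

lemma p_tendsto: "((%e. p (e * r)) \<longlongrightarrow> 1) (at_right 0)"
proof -
 have "((%e. p (e * r)) \<longlongrightarrow> p (0 * r)) (at 0)"
  using p(4) by (intro continuous_on_tendsto_compose[of UNIV p] tendsto_intros) auto
 then show ?thesis by (simp add: p filterlim_at_split)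
qed

text \<open>Poisson means converge to k at a point of continuity, and by \<open>conv_P\<close> they
  equal the inversion integral damped by \<open>p\<close>; integrability of the transform allows the
  damping to be removed.\<close>

lemma inversion:
 fixes k :: "real^'n => complex"
 assumes k: "L1 k" "!!x. norm (k x) <= B" "isCont k y" and Fk: "L1 (F k)"
 shows "(LI x. F k x * E x y) = k y"
proof (rule tendsto_unique[of "at_right (0::real)"])
 show "((%e. conv k (CP e) y) \<longlongrightarrow> k y) (at_right 0)"
  using k by (intro conv_P_tendsto osc_tendsto_bounded[of k B]) auto
 have [measurable]: "F k \<in> bm" using Fk by auto
 show "((%e. conv k (CP e) y) \<longlongrightarrow> (LI x. F k x * E x y)) (at_right 0)"
 proof (rule Lim_transform_eventually)
  show "\<forall>\<^sub>F e in at_right 0. (LI z. F k z * cr (p (e * norm z)) * E z y) = conv k (CP e) y"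
   using k by (auto intro!: conv_P[symmetric] eventually_at_right_less[THEN eventually_mono])
  show "((%e. (LI z. F k z * cr (p (e * norm z)) * E z y)) \<longlongrightarrow> (LI x. F k x * E x y)) (at_right 0)"
  proof (unfold tendsto_at_iff_sequentially, intro allI impI)
   fix X :: "nat => real" assume X: "\<forall>i. X i \<in> {0<..} - {0}" "X ---> 0"
   have [measurable]: "p \<in> bm" using p(4) by (rule borel_measurable_continuous_onI)
   have "(%i. p (X i * r)) ---> 1" for r
    using p_tendsto[of r, unfolded tendsto_at_iff_sequentially] X by (auto simp: o_def)
   then have "(%i. F k z * cr (p (X i * norm z)) * E z y) ---> F k z * cr 1 * E z y" for z
    by (intro tendsto_intros)
   then show "((%e. (LI z. F k z * cr (p (e * norm z)) * E z y)) \<circ> X) ---> (LI x. F k x * E x y)"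
    unfolding o_def using Fk p(1,2)
    by (intro integral_dominated_convergence[where w="%z. norm (F k z)"]) (auto simp: norm_mult intro!: mult_left_le)
  qed
 qed
qed auto

lemma F_eq_0_imp:
 fixes k :: "real^'n => complex"
 assumes "L1 k" "!!x. norm (k x) <= B" "isCont k y" "!!x. F k x = 0"
 shows "k y = 0"
proof -
 have "F k = (%_. 0)" using assms(4) by auto
 then show ?thesis using inversion[OF assms(1,2,3)] by simp
qed

definition N2 :: "(real^'n => complex) => ennreal" where
 "N2 f = (NI x. ennreal ((norm (f x))\<^sup>2))"

lemma cnj_measurable[measurable]: "f \<in> borel_measurable M ==> (%x. cnj (f x)) \<in> borel_measurable M"
 by (rule measurable_compose[OF _ borel_measurable_continuous_onI]) (auto intro!: continuous_intros)

text \<open>The damped square integral of the transform equals the pairing of h with its own Poisson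
  mean, and this pairing is at most the square norm since \<open>P e\<close> is symmetric with mass
  1. Fatou removes the damping. The one-sided inequality is enough for
  \<open>N2_conv_Q\<close>.\<close>

lemma bessel:
 fixes h :: "real^'n => complex"
 assumes h: "L1 h"
 shows "N2 (F h) <= N2 h"
proof -
 have [measurable]: "h \<in> bm" using h by auto
 have hc: "L1 (%x. cnj (h x))" using h by auto
 have [measurable]: "F h \<in> bm" using continuous_F[OF h] by (rule borel_measurable_continuous_onI)
 have [measurable]: "p \<in> bm" using p(4) by (rule borel_measurable_continuous_onI)
 have main: "(NI z. ennreal ((norm (F h z))\<^sup>2 * p (e * norm z))) <= N2 h" if e: "e > 0" for e
 proof -
  define k where "k z = F h (-z) * cr (p (e * norm z))" for z
  have "L1 (%z. F h z * cr (p (e * norm z)))"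
   using norm_F_le[OF h] by (intro L1_mult_bounded(2)[OF p_L1[OF e]]) auto
  from this have k: "L1 k"
   using lborel_reflect(2)[of "%z. ennreal (norm (F h z * cr (p (e * norm z))))" 0]
   by (simp add: L1_iff N_def k_def[abs_def])
  have Fk: "F k y = conv h (CP e) y" for y
   using lborel_reflect(1)[of "%z. F h z * cr (p (e * norm z)) * E z y" 0]
   by (simp add: conv_P[OF h e] F_def[of k] k_def E_minus)
  have Fc: "F (%x. cnj (h x)) z = cnj (F h (-z))" for z
   using Bochner_Integration.integral_cnj[of lborel "%x. h x * E x z"] by (simp add: F_def E_minus)
  have "(LI z. cr ((norm (F h (-z)))\<^sup>2 * p (e * norm z))) = (LI y. cnj (h y) * conv h (CP e) y)"
  proof -
   have "cr ((norm (F h (-z)))\<^sup>2 * p (e * norm z)) = cnj (F h (-z)) * k z" for z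
    by (simp only: of_real_mult complex_norm_square k_def mult_ac)
   then show ?thesis using F_mult[OF hc k, of 0] unfolding Fk Fc by simp
  qed
  then have eq: "cr (LI z. (norm (F h (-z)))\<^sup>2 * p (e * norm z)) = (LI y. cnj (h y) * conv h (CP e) y)"
   by (simp only: integral_complex_of_real)
  have i: "L1 (%z. (norm (F h (-z)))\<^sup>2 * p (e * norm z))"
  proof -
   have "L1 (%z. cnj (F h (-z)) * k z)"
    using norm_F_le[OF h] by (intro L1_mult_bounded(2)[OF k]) auto
   then have "L1 (%z. Re (cnj (F h (-z)) * k z))" by (rule integrable_Re)
   moreover have "Re (cnj (F h (-z)) * k z) = (norm (F h (-z)))\<^sup>2 * p (e * norm z)" for z
    by (simp add: k_def cmod_power2) (simp add: power2_eq_square algebra_simps)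
   ultimately show ?thesis by simp
  qed
  have "(NI z. ennreal ((norm (F h z))\<^sup>2 * p (e * norm z))) = (NI z. ennreal ((norm (F h (-z)))\<^sup>2 * p (e * norm z)))"
   using lborel_reflect(2)[of "%z. ennreal ((norm (F h z))\<^sup>2 * p (e * norm z))" 0] by simp
  also have "... = ennreal (LI z. (norm (F h (-z)))\<^sup>2 * p (e * norm z))"
   using i p(1) by (intro nn_integral_eq_integral) auto
  also have "... <= ennreal (norm (LI y. cnj (h y) * conv h (CP e) y))"
   unfolding eq[symmetric] by (auto intro!: ennreal_leI)
  also have "... <= (NI y. norm (cnj (h y) * conv h (CP e) y))"
  proof (cases "L1 (%y. cnj (h y) * conv h (CP e) y)")
   case True then show ?thesis by (rule integral_norm_bound_ennreal)
  qed (simp add: not_integrable_integral_eq)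
  also have "... <= (NI y. (NI u. ennreal (norm (h y) * (norm (h u) * P e (y - u)))))"
  proof (intro nn_integral_mono)
   fix y
   have "ennreal (norm (conv h (CP e) y)) <= (NI u. ennreal (norm (h u) * P e (y - u)))"
   proof (cases "L1 (%u. h u * CP e (y - u))")
    case True
    from integral_norm_bound_ennreal[OF this] e show ?thesis by (simp add: conv_eq norm_mult)
   qed (simp add: conv_eq not_integrable_integral_eq)
   then have "ennreal (norm (h y)) * ennreal (norm (conv h (CP e) y)) <= ennreal (norm (h y)) * (NI u. ennreal (norm (h u) * P e (y - u)))"
    by (intro mult_left_mono) auto
   then show "ennreal (norm (cnj (h y) * conv h (CP e) y)) <= (NI u. ennreal (norm (h y) * (norm (h u) * P e (y - u))))"
    using e by (simp add: norm_mult ennreal_mult nn_integral_cmult)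
  qed
  \<comment> \<open>The bound 2ab <= a^2 + b^2 splits the double integral into two equal halves,
    each with one variable carrying only the kernel.\<close>
  also have "... <= (NI y. (NI u. ennreal ((norm (h y))\<^sup>2 / 2 * P e (y - u)) + ennreal ((norm (h u))\<^sup>2 / 2 * P e (y - u))))"
  proof (intro nn_integral_mono)
   fix y u
   have "norm (h y) * norm (h u) <= (norm (h y))\<^sup>2 / 2 + (norm (h u))\<^sup>2 / 2"
    using sum_squares_bound[of "norm (h y)" "norm (h u)"] by simp
   then have "norm (h y) * norm (h u) * P e (y - u) <= ((norm (h y))\<^sup>2 / 2 + (norm (h u))\<^sup>2 / 2) * P e (y - u)"
    by (intro mult_right_mono P_nonneg e)
   then show "ennreal (norm (h y) * (norm (h u) * P e (y - u))) <= ennreal ((norm (h y))\<^sup>2 / 2 * P e (y - u)) + ennreal ((norm (h u))\<^sup>2 / 2 * P e (y - u))"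
    using e by (subst ennreal_plus[symmetric]) (auto intro!: ennreal_leI mult_nonneg_nonneg simp: algebra_simps simp del: ennreal_plus)
  qed
  also have "... = (NI y. (NI u. ennreal ((norm (h y))\<^sup>2 / 2 * P e (y - u)))) + (NI u. (NI y. ennreal ((norm (h u))\<^sup>2 / 2 * P e (y - u))))"
  proof -
   have "(NI y. (NI u. ennreal ((norm (h u))\<^sup>2 / 2 * P e (y - u)))) = (NI u. (NI y. ennreal ((norm (h u))\<^sup>2 / 2 * P e (y - u))))"
    by (rule lborel_pair.Fubini') measurable
   then show ?thesis by (simp add: nn_integral_add del: P_even)
  qed
  also have "... = ennreal (1/2) * N2 h + ennreal (1/2) * N2 h"
  proof -
   have 1: "(NI u. ennreal (P e (y - u))) = 1" for y :: "real^'n"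
    using lborel_reflect(2)[of "%u. ennreal (P e u)" y] P_one[OF e, where 'n='n] by (simp del: P_even)
   have eq: "ennreal (a / 2 * P e (y - u)) = ennreal (a / 2) * ennreal (P e (y - u))" for a and y u :: "real^'n"
    by (rule ennreal_mult''[OF P_nonneg[OF e]])
   have h2: "ennreal ((norm (h y))\<^sup>2 / 2) = ennreal (1/2) * ennreal ((norm (h y))\<^sup>2)" for y
    by (subst ennreal_mult[symmetric]) auto
   have 2: "(NI y. ennreal (P e (y - u))) = 1" for u :: "real^'n"
    using 1[of u] by (subst P_even(2))
   show ?thesis by (simp add: eq nn_integral_cmult 1 2 h2 N2_def del: P_even times_divide_eq_left)
  qed
  also have "... = N2 h"
  proof -
   have "ennreal (1/2) + ennreal (1/2) = 1" by (subst ennreal_plus[symmetric]) auto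
   then show ?thesis by (simp only: distrib_right[symmetric] mult_1)
  qed
  finally show ?thesis .
 qed
 have "N2 (F h) = (NI z. liminf (%i. ennreal ((norm (F h z))\<^sup>2 * p (1 / Suc i * norm z))))"
  unfolding N2_def
 proof (intro nn_integral_cong)
  fix z :: "real^'n"
  have "(%i. p (1 / Suc i * norm z)) ---> 1"
   using p_tendsto[of "norm z", unfolded tendsto_at_iff_sequentially, rule_format, of "%i. 1 / Suc i"] LIMSEQ_Suc[OF lim_1_over_n]
   by (auto simp: o_def)
  then have "(%i. ennreal ((norm (F h z))\<^sup>2 * p (1 / Suc i * norm z))) ---> ennreal ((norm (F h z))\<^sup>2 * 1)"
   by (intro tendsto_ennrealI tendsto_intros)
  then show "ennreal ((norm (F h z))\<^sup>2) = liminf (%i. ennreal ((norm (F h z))\<^sup>2 * p (1 / Suc i * norm z)))"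
   using lim_imp_Liminf[OF sequentially_bot] by fastforce
 qed
 also have "... <= liminf (%i. (NI z. ennreal ((norm (F h z))\<^sup>2 * p (1 / Suc i * norm z))))"
  by (rule nn_integral_liminf) auto
 also have "... <= N2 h"
  by (intro Liminf_le always_eventually allI main) auto
 finally show ?thesis .
qed

text \<open>\<open>conv f (CQ e i)\<close> is, up to reflection, the Fourier transform of k, and k
  is the transform of f times a factor of modulus at most 1. Bessel's inequality applied to k and
  then to f gives an L2 bound uniform in \<open>e\<close>.\<close>

lemma N2_conv_Q:
 fixes f :: "real^'n => complex"
 assumes f: "L1 f" and e: "e > 0"
 shows "N2 (conv f (CQ e i)) <= N2 f"
proof -
 define k where "k z = F f z * (m i z * cr (p (e * norm z)))" for z
 have [measurable]: "F f \<in> bm" using continuous_F[OF f] by (rule borel_measurable_continuous_onI)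
 have k: "L1 k" unfolding k_def using norm_F_le[OF f] by (intro L1_mult_bounded(2)[OF mp_L1[OF e]]) auto
 have [measurable]: "F k \<in> bm" using continuous_F[OF k] by (rule borel_measurable_continuous_onI)
 have "conv f (CQ e i) x = F k (0 - x)" for x
  by (simp add: conv_Q[OF f e] k_def F_def[of k])
 then have "N2 (conv f (CQ e i)) = N2 (F k)"
  using lborel_reflect(2)[of "%x. ennreal ((norm (F k x))\<^sup>2)" 0] by (simp add: N2_def)
 also have "... <= N2 k" by (rule bessel[OF k])
 also have "... <= N2 (F f)" unfolding N2_def
 proof (intro nn_integral_mono ennreal_leI power_mono)
  fix z show "norm (k z) <= norm (F f z)"
   using norm_m_le[of i z] p(1,2)[of "e * norm z"] unfolding k_def norm_mult
   by (intro mult_left_le mult_le_one) auto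
 qed auto
 also have "... <= N2 f" by (rule bessel[OF f])
 finally show ?thesis .
qed

section \<open>A Vitali covering, the Poisson maximal function and Lebesgue points\<close>

abbreviation mu :: "(real^'n => complex) => (real^'n) measure" where
 "mu f \<equiv> density lborel (%x. ennreal (norm (f x)))"

lemma mu_UNIV: "L1 f ==> emeasure (mu f) UNIV = N f"
 by (subst emeasure_density) (auto simp: N_def)

text \<open>A ball is bad if the average of |f| over it exceeds \<open>lam\<close>. Besides
  disjointness and covering, each selected ball must be nearly maximal: no concentric ball of at
  least twice its radius is bad. This later bounds the mean of f on the pieces from above.\<close>

lemma vitali:
 fixes f :: "real^'n => complex"
 assumes f: "L1 f" and lam: "lam > 0"
 obtains c :: "nat => real^'n" and r :: "nat => real" where "!!k. r k >= 0"
  "disjoint_family (%k. ball (c k) (r k))"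
  "!!k. ennreal lam * em (ball (c k) (r k)) <= emeasure (mu f) (ball (c k) (r k))"
  "!!k R. r k > 0 ==> R >= 2 * r k ==> emeasure (mu f) (ball (c k) R) <= ennreal lam * em (ball (c k) R)"
  "!!x R. x \<notin> (\<Union>k. ball (c k) (5 * r k)) ==> emeasure (mu f) (ball x R) <= ennreal lam * em (ball x R)"
proof -
 define bad where "bad x R \<longleftrightarrow> R > 0 & ennreal lam * em (ball x R) < emeasure (mu f) (ball x R)" for x R
 define V where "V = unit_ball_vol (real CARD('n))"
 define T where "T = enn2real (N f)"
 \<comment> \<open>Bad radii are bounded because a bad ball has volume below \<open>T / lam\<close>;
   for radii at least 1 the radius is bounded by its power.\<close>
 define B where "B = max 1 (T / (lam * V))"
 have V: "V > 0" by (simp add: V_def)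
 have T: "N f = ennreal T" using N_less_top[OF f] by (simp add: T_def less_top)
 have B: "R <= B" if "bad x R" for x R
 proof (cases "R >= 1")
  case True
  have "ennreal (lam * (V * R ^ CARD('n))) < emeasure (mu f) (ball x R)"
   using that lam V True by (simp add: bad_def emeasure_ball V_def ennreal_mult)
  also have "... <= emeasure (mu f) UNIV" by (intro emeasure_mono) auto
  also have "... = ennreal T" using mu_UNIV[OF f] T by simp
  finally have "lam * V * R ^ CARD('n) < T" using lam V True by (subst (asm) ennreal_less_iff) (auto simp: mult.assoc)
  moreover have "R <= R ^ CARD('n)" using True by (intro self_le_power) auto
  ultimately have "lam * V * R < T" using lam V by (meson mult_left_mono mult_pos_pos le_less_trans less_imp_le)
  then show ?thesis using lam V by (simp add: B_def field_simps le_max_iff_disj)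
 qed (auto simp: B_def)
 \<comment> \<open>Such a ball exists at every bad centre: take a bad radius exceeding half the
   supremum of the bad radii there.\<close>
 define K where "K = {(x, R). bad x R & (\<forall>R'\<ge>2 * R. \<not> bad x R')}"
 have ex: "\<exists>R. (x, R) \<in> K" if "bad x R0" for x R0
 proof -
  define s where "s = Sup {R. bad x R}"
  have bdd: "bdd_above {R. bad x R}" using B by (intro bdd_aboveI[of _ B]) auto
  have s: "R <= s" if "bad x R" for R using bdd that by (auto simp: s_def intro: cSup_upper)
  have "s / 2 < s" using s[OF that] that by (simp add: bad_def)
  then have "\<exists>R\<in>{R. bad x R}. s / 2 < R"
   using that bdd unfolding s_def by (subst less_cSup_iff[symmetric]) auto
  then obtain R where "bad x R" "s / 2 < R" by auto
  then show ?thesis using s by (force simp: K_def)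
 qed
 have sub: "{x. \<exists>R. bad x R} \<subseteq> (\<Union>i\<in>K. ball (fst i) (snd i))"
  using ex by (fastforce simp: K_def bad_def)
 have pre: "0 < snd i & snd i <= B" if "i \<in> K" for i
  using that B unfolding K_def by (auto simp: bad_def)
 obtain C where
  C: "countable C" "C \<subseteq> K" "pairwise (%i j. disjnt (ball (fst i) (snd i)) (ball (fst j) (snd j))) C"
    "{x. \<exists>R. bad x R} \<subseteq> (\<Union>i\<in>C. ball (fst i) (5 * snd i))"
  using Vitali_covering_lemma_balls[OF sub pre] by blast
 define I where "I = to_nat_on C ` C"
 define c where "c k = fst (from_nat_into C k)" for k
 \<comment> \<open>Indices that carry no ball get radius 0, hence an empty ball; this turns a
   countable family into a sequence.\<close>
 define r where "r k = (if k \<in> I then snd (from_nat_into C k) else 0)" for k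
 have I: "from_nat_into C k \<in> C" if "k \<in> I" for k
  using that C(1) by (auto simp: I_def)
 have K: "bad (c k) (r k)" "(\<forall>R'\<ge>2 * r k. \<not> bad (c k) R')" if "k \<in> I" for k
  using I[OF that] C(2) that by (auto simp: K_def c_def r_def)
 have r0: "k \<notin> I ==> r k = 0" for k by (simp add: r_def)
 show ?thesis
 proof (rule that[of r c])
  show "r k >= 0" for k using K[of k] r0[of k] by (cases "k \<in> I") (auto simp: bad_def)
  show "disjoint_family (%k. ball (c k) (r k))"
  proof (unfold disjoint_family_on_def, intro ballI impI)
   fix k l :: nat assume kl: "k ~= l"
   show "ball (c k) (r k) \<inter> ball (c l) (r l) = {}"
   proof (cases "k \<in> I & l \<in> I")
    case True
    then have "from_nat_into C k ~= from_nat_into C l" using kl C(1) by (auto simp: I_def)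
    then show ?thesis using C(3) I[of k] I[of l] True unfolding pairwise_def disjnt_def c_def r_def by auto
   qed (use r0 in auto)
  qed
  show "ennreal lam * em (ball (c k) (r k)) <= emeasure (mu f) (ball (c k) (r k))" for k
   using K[of k] r0[of k] by (cases "k \<in> I") (auto simp: bad_def)
  show "emeasure (mu f) (ball (c k) R) <= ennreal lam * em (ball (c k) R)" if "r k > 0" "R >= 2 * r k" for k R
   using K[of k] r0[of k] that by (cases "k \<in> I") (auto simp: bad_def)
  show "emeasure (mu f) (ball x R) <= ennreal lam * em (ball x R)" if "x \<notin> (\<Union>k. ball (c k) (5 * r k))" for x R
  proof (rule ccontr)
   assume n: "\<not> ?thesis"
   then have "bad x R" by (cases "R > 0") (auto simp: bad_def ball_empty)
   then obtain i where i: "i \<in> C" "x \<in> ball (fst i) (5 * snd i)" using C(4) by auto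
   then have "to_nat_on C i \<in> I" "from_nat_into C (to_nat_on C i) = i" using C(1) by (auto simp: I_def)
   then have "x \<in> ball (c (to_nat_on C i)) (5 * r (to_nat_on C i))" using i by (simp add: c_def r_def)
   then show False using that by blast
  qed
 qed
qed

lemma vitali_measure:
 fixes c :: "nat => real^'n"
 assumes "!!k. r k >= 0" "disjoint_family (%k. ball (c k) (r k))" "t >= 0"
  "!!k. ennreal lam * em (ball (c k) (r k)) <= emeasure (mu f) (ball (c k) (r k))"
 shows "ennreal lam * em (\<Union>k. ball (c k) (t * r k)) <= ennreal (t ^ CARD('n)) * emeasure (mu f) (\<Union>k. ball (c k) (r k))"
proof -
 have "ennreal lam * em (\<Union>k. ball (c k) (t * r k)) <= ennreal lam * (\<Sum>k. em (ball (c k) (t * r k)))"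
  by (intro mult_left_mono emeasure_subadditive_countably) auto
 also have "... = (\<Sum>k. ennreal (t ^ CARD('n)) * (ennreal lam * em (ball (c k) (r k))))"
 proof -
  have "em (ball (c k) (t * r k)) = ennreal (t ^ CARD('n)) * em (ball (c k) (r k))" for k
   using assms(1)[of k] assms(3) by (simp add: emeasure_ball power_mult_distrib ennreal_mult[symmetric] mult_ac)
  then show ?thesis by (simp only: ennreal_suminf_cmult[symmetric] mult.left_commute[of "ennreal lam"])
 qed
 also have "... <= (\<Sum>k. ennreal (t ^ CARD('n)) * emeasure (mu f) (ball (c k) (r k)))"
  by (intro suminf_le mult_left_mono assms) auto
 also have "... = ennreal (t ^ CARD('n)) * emeasure (mu f) (\<Union>k. ball (c k) (r k))"
  using assms(2) by (subst suminf_emeasure[symmetric]) (auto simp: ennreal_suminf_cmult)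
 finally show ?thesis .
qed

text \<open>If q is least with |y| < 2^q e, the denominator of \<open>P e y\<close> is at least a
  power of 2^q e / 2. So the q-th term alone dominates the kernel at y, and the weights keep a
  factor 2^(-q) beyond the inverse volume of the ball.\<close>

lemma P_layer:
 fixes g :: "real^'n => ennreal"
 assumes [measurable]: "g \<in> bm" and e: "e > 0"
 shows "(NI y. g y * P e y) <=
  (\<Sum>k. ennreal (Pc TYPE('n) * 2 ^ (CARD('n) + 1) * (1/2)^k / (2^k * e) ^ CARD('n)) * (NI y. g y * indicator (ball 0 (2^k * e)) y))"
proof -
 define a where "a k = Pc TYPE('n) * 2 ^ (CARD('n) + 1) * (1/2)^k / (2^k * e) ^ CARD('n)" for k :: nat
 have [measurable]: "ball (0::real^'n) R \<in> sets borel" for R by simp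
 have "g y * ennreal (P e y) <= (\<Sum>k. ennreal (a k) * (g y * indicator (ball 0 (2^k * e)) y))" for y
 proof -
  define q where "q = (LEAST k. norm y < 2^k * e)"
  have "\<exists>k. norm y < 2^k * e"
   using real_arch_pow[of 2 "norm y / e"] e by (auto simp: field_simps)
  then have q: "norm y < 2^q * e" unfolding q_def by (rule LeastI_ex)
  have q': "2^q * e / 2 <= sqrt (e\<^sup>2 + (norm y)\<^sup>2)"
  proof (cases q)
   case 0
   have "2^q * e / 2 <= e" using 0 e by simp
   also have "e <= sqrt (e\<^sup>2 + (norm y)\<^sup>2)" by (rule real_le_rsqrt) simp
   finally show ?thesis .
  next
   case (Suc k)
   then have "\<not> norm y < 2^k * e" using not_less_Least[of k "%k. norm y < 2^k * e"] by (simp add: q_def)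
   then show ?thesis using Suc e by (auto intro!: order_trans[OF _ real_sqrt_ge_abs2])
  qed
  have "P e y <= Pc TYPE('n) * e / (2^q * e / 2) ^ (CARD('n) + 1)"
   unfolding P_def using e Pc_pos[where 'n='n] q'
   by (intro divide_left_mono power_mono mult_pos_pos zero_less_power) (auto simp: add_pos_nonneg)
  also have "... = a q"
   using e by (simp add: a_def power_divide power_mult_distrib field_simps power_one_over)
  finally have "g y * ennreal (P e y) <= ennreal (a q) * (g y * indicator (ball 0 (2^q * e)) y)"
   using q by (simp add: mult.commute[of _ "g y"] mult_left_mono ennreal_leI)
  also have "... <= (\<Sum>k. ennreal (a k) * (g y * indicator (ball 0 (2^k * e)) y))"
   using sum_le_suminf[of "%k. ennreal (a k) * (g y * indicator (ball 0 (2^k * e)) y)" "{q}"] by auto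
  finally show ?thesis .
 qed
 then have "(NI y. g y * P e y) <= (NI y. (\<Sum>k. ennreal (a k) * (g y * indicator (ball 0 (2^k * e)) y)))"
  by (intro nn_integral_mono) auto
 also have "... = (\<Sum>k. ennreal (a k) * (NI y. g y * indicator (ball 0 (2^k * e)) y))"
  by (subst nn_integral_suminf) (auto simp: nn_integral_cmult)
 finally show ?thesis by (simp add: a_def)
qed

text \<open>The leading 2 is the sum of the geometric series from \<open>P_layer\<close>; the rest
  is its constant times the unit ball volume.\<close>

definition KM :: "'n::finite itself => real" where
 "KM _ = 2 * (Pc TYPE('n) * 2 ^ (CARD('n) + 1) * unit_ball_vol (real CARD('n)))"

lemma max_P:
 fixes f :: "real^'n => complex"
 assumes [measurable]: "f \<in> bm" and e: "e > 0" and lam: "lam >= 0"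
  and x: "!!R. emeasure (mu f) (ball x R) <= ennreal lam * em (ball x R)"
 shows "(NI y. norm (f (x - y)) * P e y) <= ennreal (KM TYPE('n) * lam)"
proof -
 define K V where "K = Pc TYPE('n) * 2 ^ (CARD('n) + 1)" and "V = unit_ball_vol (real CARD('n))"
 have KV: "K >= 0" "V >= 0" using Pc_pos[where 'n='n] by (auto simp: K_def V_def)
 have b: "(NI y. ennreal (norm (f (x - y))) * indicator (ball 0 R) y) <= ennreal lam * em (ball x R)" for R
 proof -
  have [measurable]: "ball x R \<in> sets borel" by simp
  have "(NI y. ennreal (norm (f (x - y))) * indicator (ball 0 R) y) = (NI y. (%y. ennreal (norm (f y)) * indicator (ball x R) y) (x - y))"
   by (intro nn_integral_cong) (auto simp: dist_norm split: split_indicator)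
  also have "... = emeasure (mu f) (ball x R)"
   by (subst lborel_reflect(2)) (auto simp: emeasure_density)
  finally show ?thesis using x by simp
 qed
 have "(NI y. norm (f (x - y)) * P e y) = (NI y. ennreal (norm (f (x - y))) * ennreal (P e y))"
  using e by (simp add: ennreal_mult)
 also have "... <= (\<Sum>k. ennreal (K * (1/2)^k / (2^k * e) ^ CARD('n)) * (NI y. ennreal (norm (f (x - y))) * indicator (ball 0 (2^k * e)) y))"
  unfolding K_def by (rule P_layer) (use e in auto)
 also have "... <= (\<Sum>k. ennreal (K * V * lam * (1/2)^k))"
 proof (intro suminf_le)
  fix k :: nat
  have "ennreal (K * (1/2)^k / (2^k * e) ^ CARD('n)) * (NI y. ennreal (norm (f (x - y))) * indicator (ball 0 (2^k * e)) y)
    <= ennreal (K * (1/2)^k / (2^k * e) ^ CARD('n)) * (ennreal lam * em (ball x (2^k * e)))"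
   by (intro mult_left_mono b) auto
  also have "... = ennreal (K * (1/2)^k / (2^k * e) ^ CARD('n) * (lam * (V * (2^k * e) ^ CARD('n))))"
   using e lam KV by (simp add: emeasure_ball V_def ennreal_mult[symmetric])
  also have "K * (1/2)^k / (2^k * e) ^ CARD('n) * (lam * (V * (2^k * e) ^ CARD('n))) = K * V * lam * (1/2)^k"
   using e by simp
  finally show "ennreal (K * (1/2)^k / (2^k * e) ^ CARD('n)) * (NI y. ennreal (norm (f (x - y))) * indicator (ball 0 (2^k * e)) y) <= ennreal (K * V * lam * (1/2)^k)" .
 qed auto
 also have "... = ennreal (K * V * lam * 2)"
  using KV lam sums_mult[OF geometric_sums[of "1/2::real"], of "K * V * lam"] by (intro suminf_ennreal_eq) auto
 finally show ?thesis by (simp add: KM_def K_def V_def mult_ac)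
qed

text \<open>The fivefold balls cover all bad centres, and their total volume is paid for by the
  disjoint selected balls, each of which carries mass at least \<open>lam\<close> times its volume.
  Elsewhere all ball averages, hence all Poisson averages, are controlled.\<close>

lemma weak_type:
 fixes f :: "real^'n => complex"
 assumes f: "L1 f" and lam: "lam > 0"
 obtains U where "U \<in> sets borel" "ennreal lam * em U <= ennreal (5 ^ CARD('n)) * N f"
  "!!x e. x \<notin> U ==> e > 0 ==> (NI y. norm (f (x - y)) * P e y) <= ennreal (KM TYPE('n) * lam)"
proof -
 show ?thesis
 proof (rule vitali[OF f lam])
  fix c :: "nat => real^'n" and r :: "nat => real"
  assume v: "!!k. r k >= 0" "disjoint_family (%k. ball (c k) (r k))"
   "!!k. ennreal lam * em (ball (c k) (r k)) <= emeasure (mu f) (ball (c k) (r k))"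
   "!!x R. x \<notin> (\<Union>k. ball (c k) (5 * r k)) ==> emeasure (mu f) (ball x R) <= ennreal lam * em (ball x R)"
 show thesis
 proof (rule that[of "\<Union>k. ball (c k) (5 * r k)"])
  have "emeasure (mu f) (\<Union>k. ball (c k) (r k)) <= N f"
   unfolding mu_UNIV[OF f, symmetric] by (intro emeasure_mono) auto
  then show "ennreal lam * em (\<Union>k. ball (c k) (5 * r k)) <= ennreal (5 ^ CARD('n)) * N f"
   by (intro order_trans[OF vitali_measure[OF v(1,2) _ v(3)]] mult_left_mono) auto
  show "(NI y. norm (f (x - y)) * P e y) <= ennreal (KM TYPE('n) * lam)"
   if "x \<notin> (\<Union>k. ball (c k) (5 * r k))" "e > 0" for x e
   using f lam v(4)[OF that(1)] that(2) by (intro max_P) auto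
 qed auto
 qed
qed

lemma osc_triangle:
 fixes f g :: "real^'n => complex"
 assumes [measurable]: "f \<in> bm" "g \<in> bm" and e: "e > 0"
 shows "osc f e x <= osc g e x + ((NI y. norm (f (x - y) - g (x - y)) * P e y) + ennreal (norm (f x - g x)))"
proof -
 have "osc f e x <= (NI y. ennreal (norm (g (x - y) - g x) * P e y) + (ennreal (norm (f (x - y) - g (x - y)) * P e y) + ennreal (norm (f x - g x)) * ennreal (P e y)))"
  unfolding osc_def
 proof (intro nn_integral_mono)
  fix y
  have "norm (f (x - y) - f x) <= norm (g (x - y) - g x) + norm (f (x - y) - g (x - y)) + norm (f x - g x)"
   using norm_triangle_ineq[of "g (x - y) - g x" "f (x - y) - g (x - y) - (f x - g x)"]
    norm_triangle_ineq4[of "f (x - y) - g (x - y)" "f x - g x"] by (simp add: algebra_simps)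
  then have "norm (f (x - y) - f x) * P e y <= (norm (g (x - y) - g x) + norm (f (x - y) - g (x - y)) + norm (f x - g x)) * P e y"
   using e by (intro mult_right_mono) auto
  then show "ennreal (norm (f (x - y) - f x) * P e y) <= ennreal (norm (g (x - y) - g x) * P e y) + (ennreal (norm (f (x - y) - g (x - y)) * P e y) + ennreal (norm (f x - g x)) * ennreal (P e y))"
   using e by (auto simp: ennreal_mult[symmetric] ennreal_plus[symmetric] distrib_right add.assoc simp del: ennreal_plus intro!: ennreal_leI)
 qed
 also have "... = osc g e x + ((NI y. norm (f (x - y) - g (x - y)) * P e y) + ennreal (norm (f x - g x)))"
  using P_one[OF e, where 'n='n] by (simp add: nn_integral_add nn_integral_cmult osc_def)
 finally show ?thesis .
qed

text \<open>Bounded continuous approximants have vanishing oscillation, and the maximal bound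
  controls the error off a small set. Borel-Cantelli along geometric errors gives almost every
  point.\<close>

lemma lebesgue_points:
 fixes f :: "real^'n => complex"
 assumes f: "L1 f"
 shows "AEL x. ((%e. osc f e x) \<longlongrightarrow> 0) (at_right 0)"
proof -
 have [measurable]: "f \<in> bm" using f by auto
 define PP where "PP k g U \<longleftrightarrow> continuous_on UNIV g & (\<exists>B. \<forall>x. norm (g x) <= B) & U \<in> sets borel & em U <= ennreal ((5 ^ CARD('n) + 1) * (1/2)^k) &
   (\<forall>x e. x \<notin> U --> e > 0 --> osc f e x <= osc g e x + ennreal ((KM TYPE('n) + 1) * (1/2)^k))" for k :: nat and g :: "real^'n => complex" and U
 have "\<exists>g U. PP k g U" for k :: nat
 proof -
  define d :: real where "d = (1/2)^k"
  have d: "d > 0" by (simp add: d_def)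
  \<comment> \<open>Error \<open>d * d\<close> against height \<open>d\<close>: weak type for U and
    Chebyshev for W leave an exceptional set of measure O(d), summable over k.\<close>
  obtain g where g: "continuous_on UNIV g" "L1 g" "\<exists>B. \<forall>x. norm (g x) <= B" "N (%x. f x - g x) < ennreal (d * d)"
   using L1_dense[OF f, of "d * d"] d by auto
  have [measurable]: "g \<in> bm" using g by auto
  have fg: "L1 (%x. f x - g x)" using f g by auto
  show ?thesis
  proof (rule weak_type[OF fg d])
  fix U assume U: "U \<in> sets borel" "ennreal d * em U <= ennreal (5 ^ CARD('n)) * N (%x. f x - g x)"
   "!!x e. x \<notin> U ==> e > 0 ==> (NI y. norm (f (x - y) - g (x - y)) * P e y) <= ennreal (KM TYPE('n) * d)"
  define W where "W = {x \<in> space lborel. d <= norm (f x - g x)}"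
  have W: "W \<in> sets borel" unfolding W_def by measurable
  have canc: "em A <= ennreal (K * d)" if "ennreal d * em A <= ennreal K * ennreal (d * d)" "K >= 0" for A :: "(real^'n) set" and K
  proof -
   have "ennreal (1/d) * (ennreal d * em A) <= ennreal (1/d) * (ennreal K * ennreal (d * d))"
    using that by (intro mult_left_mono) auto
   then show ?thesis using d that(2) by (simp add: mult.assoc[symmetric] ennreal_mult[symmetric])
  qed
  have "ennreal d * em W <= N (%x. f x - g x)"
  proof -
   have "ennreal d * em W = (NI x. ennreal d * indicator W x)"
    using W by (simp add: nn_integral_cmult_indicator)
   also have "... <= N (%x. f x - g x)"
    unfolding N_def by (intro nn_integral_mono) (auto simp: W_def split: split_indicator intro!: ennreal_leI)
   finally show ?thesis .
  qed
  then have "ennreal d * em W <= ennreal 1 * ennreal (d * d)" using g(4) by (auto intro: order_trans less_imp_le)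
  from canc[OF this] have W1: "em W <= ennreal d" by simp
  have "ennreal d * em U <= ennreal (5 ^ CARD('n)) * ennreal (d * d)"
   using U(2) g(4) by (auto intro!: order_trans[OF U(2)] mult_left_mono)
  from canc[OF this] have U1: "em U <= ennreal (5 ^ CARD('n) * d)" by simp
  have "em (U \<union> W) <= ennreal (5 ^ CARD('n) * d) + ennreal d"
   using U(1) W by (intro order_trans[OF emeasure_subadditive] add_mono U1 W1) auto
  also have "... = ennreal ((5 ^ CARD('n) + 1) * d)" using d by (subst ennreal_plus[symmetric]) (auto simp: algebra_simps)
  finally have m: "em (U \<union> W) <= ennreal ((5 ^ CARD('n) + 1) * d)" .
  have "osc f e x <= osc g e x + ennreal ((KM TYPE('n) + 1) * d)" if "x \<notin> U \<union> W" "e > 0" for x e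
  proof -
   have "KM TYPE('n) >= 0" using Pc_pos[where 'n='n] by (simp add: KM_def)
   moreover have "(NI y. norm (f (x - y) - g (x - y)) * P e y) + ennreal (norm (f x - g x)) <= ennreal (KM TYPE('n) * d) + ennreal d"
    using U(3)[of x e] that by (intro add_mono ennreal_leI) (auto simp: W_def)
   ultimately show ?thesis using osc_triangle[of f g e x] that d
    by (subst distrib_right, subst ennreal_plus) (auto intro: order_trans add_left_mono)
  qed
  then show "\<exists>g U. PP k g U" using g U(1) W m unfolding d_def PP_def by (intro exI[of _ g] exI[of _ "U \<union> W"]) auto
  qed
 qed
 then obtain g U where PP: "PP k (g k) (U k)" for k by metis
 have g: "continuous_on UNIV (g k)" "\<exists>B. \<forall>x. norm (g k x) <= B" and U: "U k \<in> sets borel"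
   "em (U k) <= ennreal ((5 ^ CARD('n) + 1) * (1/2)^k)"
  and o: "!!x e. x \<notin> U k ==> e > 0 ==> osc f e x <= osc (g k) e x + ennreal ((KM TYPE('n) + 1) * (1/2)^k)" for k :: nat
  using PP[of k] by (auto simp: PP_def)
 have "AEL x. eventually (%k. x \<in> space lborel - U k) sequentially"
 proof (rule borel_cantelli_AE1)
  show "em (U k) < \<infinity>" for k using U(2)[of k] by (auto intro: le_less_trans)
  have "measure lborel (U k) <= (5 ^ CARD('n) + 1) * (1/2)^k" for k
   using enn2real_mono[OF U(2)[of k]] by (simp add: measure_def)
  moreover have sm: "summable (%k. (5 ^ CARD('n) + 1) * (1/2::real)^k)"
   by (rule summable_mult, rule summable_geometric) simp
  ultimately show "summable (%k. measure lborel (U k))"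
   using summable_comparison_test'[OF sm, of 0 "%k. measure lborel (U k)"] by auto
 qed (use U in auto)
 then show ?thesis
 proof (rule AE_mp, intro AE_I2 impI)
  fix x assume ev: "\<forall>\<^sub>F k in sequentially. x \<in> space lborel - U k"
  show "((%e. osc f e x) \<longlongrightarrow> 0) (at_right 0)"
  proof (rule order_tendstoI)
   fix a :: ennreal assume a: "0 < a"
   obtain b where b: "0 < b" "b < a" using dense[OF a] by blast
   then obtain a' where "b = ennreal a'" by (cases b) auto
   with b have a': "0 < a'" "ennreal a' < a" by auto
   have "(%k. (KM TYPE('n) + 1) * (1/2)^k) ---> (KM TYPE('n) + 1) * 0"
    by (intro tendsto_intros LIMSEQ_realpow_zero) auto
   then have "\<forall>\<^sub>F k in sequentially. (KM TYPE('n) + 1) * (1/2)^k < a' / 2"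
    using a' by (intro order_tendstoD) auto
   with ev obtain k where k: "x \<notin> U k" "(KM TYPE('n) + 1) * (1/2)^k < a' / 2"
    using eventually_happens'[OF sequentially_bot eventually_conj] by blast
   obtain B where B: "!!x. norm (g k x) <= B" using g(2) by blast
   have "((%e. osc (g k) e x) \<longlongrightarrow> 0) (at_right 0)"
    using g(1)[of k] by (intro osc_tendsto_bounded[of _ B] B) (auto simp: borel_measurable_continuous_onI continuous_on_eq_continuous_at)
   then have "\<forall>\<^sub>F e in at_right 0. osc (g k) e x < ennreal (a' / 2)" using a' by (intro order_tendstoD) auto
   moreover have "\<forall>\<^sub>F e in at_right (0::real). e > 0" by (rule eventually_at_right_less)
   ultimately show "\<forall>\<^sub>F e in at_right 0. osc f e x < a"
   proof eventually_elim
    case (elim e)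
    have "osc f e x <= osc (g k) e x + ennreal ((KM TYPE('n) + 1) * (1/2)^k)" using o k elim by auto
    also have "... <= ennreal (a' / 2) + ennreal (a' / 2)" using elim k(2) by (intro add_mono ennreal_leI) auto
    also have "... = ennreal a'" using a' by (subst ennreal_plus[symmetric]) auto
    finally show ?case using a'(2) by (rule le_less_trans)
   qed
  qed auto
 qed
qed

section \<open>Truncated Riesz integrals compared with conjugate Poisson integrals\<close>

lemma power_diff_le:
 fixes s a :: real assumes "0 <= a" "a <= s"
 shows "s ^ Suc k - a ^ Suc k <= real (Suc k) * s ^ k * (s - a)"
proof (induction k)
 case (Suc k)
 have "s ^ Suc (Suc k) - a ^ Suc (Suc k) = s * (s ^ Suc k - a ^ Suc k) + a ^ Suc k * (s - a)"
  by (simp add: algebra_simps)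
 also have "... <= s * (real (Suc k) * s ^ k * (s - a)) + s ^ Suc k * (s - a)"
  using assms by (intro add_mono mult_left_mono mult_right_mono Suc power_mono) auto
 also have "... = real (Suc (Suc k)) * s ^ Suc k * (s - a)" by (simp add: algebra_simps)
 finally show ?case .
qed simp

definition Zt :: "real => 'n => real^'n => real" where
 "Zt e i y = (if e < norm y then riesz_kernel y $ i else 0)"

lemma Zt_eq: "e >= 0 ==> Zt e i y = (if e < norm y then Pc TYPE('n) * y $ i / norm y ^ (CARD('n) + 1) else 0)" for y :: "real^'n"
 by (auto simp: Zt_def riesz_kernel_def Pc_def)

lemma Zt_measurable[measurable]: "Zt e i \<in> bm"
 unfolding Zt_def[abs_def] riesz_kernel_def by measurable

lemma Zt_odd: "Zt e i (- y) = - Zt e i y"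
 by (simp add: Zt_def riesz_kernel_def)

definition KZ :: "'n::finite itself => real" where "KZ _ = real (CARD('n) + 1) * 2 ^ (CARD('n) + 1)"

lemma KZ_ge: "KZ TYPE('n::finite) >= 1"
proof -
 have "1 * 1 <= real (CARD('n) + 1) * 2 ^ (CARD('n) + 1)" by (intro mult_mono one_le_power) auto
 then show ?thesis by (simp add: KZ_def)
qed

text \<open>Truncation at radius e and conjugate smoothing at height e differ only by something of
  Poisson size. Inside the ball the truncated kernel is 0 and \<open>Q\<close> is below
  \<open>P\<close>; outside, both are y_i times a power of nearly equal lengths a = |y| and s =
  sqrt(e^2 + |y|^2).\<close>

lemma Q_Zt:
 fixes y :: "real^'n"
 assumes e: "e > 0"
 shows "\<bar>Q e i y - Zt e i y\<bar> <= KZ TYPE('n) * P e y"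
proof (cases "e < norm y")
 case False
 then have "\<bar>y $ i\<bar> / e <= 1" using component_le_norm_cart[of y i] e by simp
 then have "\<bar>Q e i y\<bar> <= 1 * P e y" unfolding Q_eq[OF e] abs_mult
  using e by (intro mult_mono) auto
 also have "... <= KZ TYPE('n) * P e y" using KZ_ge e by (intro mult_right_mono) auto
 finally show ?thesis using False by (simp add: Zt_def)
next
 case True
 define a s N where "a = norm y" and "s = sqrt (e\<^sup>2 + a\<^sup>2)" and "N = CARD('n) + 1"
 have a: "0 < a" "e < a" using True e by (auto simp: a_def)
 have s2: "s\<^sup>2 = e\<^sup>2 + a\<^sup>2" by (simp add: s_def)
 have sa: "a <= s" unfolding s_def by (rule real_le_rsqrt) simp
 have se: "e <= s" unfolding s_def by (rule real_le_rsqrt) simp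
 have s0: "s > 0" using sa a by linarith
 have s2a: "s <= 2 * a" unfolding s_def using a e
  by (intro real_le_lsqrt) (auto simp: power2_eq_square algebra_simps intro!: order_trans[OF mult_mono[of e a e a]])
 \<comment> \<open>From (s - a)(s + a) = e^2: the gap between the two lengths is quadratic in e,
   which supplies the factor e of the Poisson kernel after one power of s absorbs the other.\<close>
 have "(s - a) * a <= (s - a) * (s + a)" using sa a by (intro mult_left_mono) auto
 also have "... = e\<^sup>2" using s2 by (simp add: power2_eq_square algebra_simps)
 finally have d: "(s - a) * a <= e\<^sup>2" .
 have "\<bar>Q e i y - Zt e i y\<bar> = Pc TYPE('n) * (\<bar>y $ i\<bar> * (1 / a ^ N - 1 / s ^ N))"
 proof -
  have "1 / s ^ N <= 1 / a ^ N" using sa a by (intro divide_left_mono power_mono mult_pos_pos) auto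
  moreover have "Q e i y - Zt e i y = - (Pc TYPE('n) * (y $ i * (1 / a ^ N - 1 / s ^ N)))"
   using True e unfolding Zt_eq[OF less_imp_le[OF e]] Q_def a_def s_def N_def by (simp add: algebra_simps)
  ultimately show ?thesis using Pc_pos[where 'n='n] by (simp add: abs_mult)
 qed
 also have "... <= Pc TYPE('n) * (real N * 2 ^ N * e / s ^ N)"
 proof (intro mult_left_mono)
  have "\<bar>y $ i\<bar> * (1 / a ^ N - 1 / s ^ N) <= a * (1 / a ^ N - 1 / s ^ N)"
   using component_le_norm_cart[of y i] sa a s0 by (intro mult_right_mono) (auto simp: a_def intro!: divide_left_mono power_mono mult_pos_pos)
  also have "... = (s ^ N - a ^ N) * a / (a ^ N * s ^ N)" using a sa by (simp add: field_simps)
  also have "... <= (real N * s ^ (N - 1) * (s - a)) * a / (a ^ N * s ^ N)"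
   using power_diff_le[of a s "N - 1"] a sa by (intro divide_right_mono mult_right_mono) (auto simp: N_def)
  also have "... = real N * s ^ (N - 1) * ((s - a) * a) / (a ^ N * s ^ N)" by simp
  also have "... <= real N * s ^ (N - 1) * (e * s) / (a ^ N * s ^ N)"
   using d se e a sa by (intro divide_right_mono mult_left_mono) (auto simp: power2_eq_square intro!: order_trans[OF d])
  also have "... = real N * e / a ^ N" using a sa by (simp add: N_def)
  also have "... <= real N * e / (s / 2) ^ N" using a sa s2a e by (intro divide_left_mono power_mono mult_pos_pos) auto
  also have "... = real N * 2 ^ N * e / s ^ N" by (simp add: power_divide)
  finally show "\<bar>y $ i\<bar> * (1 / a ^ N - 1 / s ^ N) <= real N * 2 ^ N * e / s ^ N" .
 qed (use Pc_pos[where 'n='n] in auto)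
 also have "... = KZ TYPE('n) * P e y" by (simp add: KZ_def P_def N_def s_def a_def mult_ac)
 finally show ?thesis .
qed

lemma P_le: "e > 0 ==> P e (y::real^'n) <= Pc TYPE('n) / e ^ CARD('n)"
proof -
 assume e: "e > 0"
 have "e ^ (CARD('n) + 1) <= sqrt (e\<^sup>2 + (norm y)\<^sup>2) ^ (CARD('n) + 1)"
  using e by (intro power_mono real_le_rsqrt) auto
 then have "P e y <= Pc TYPE('n) * e / e ^ (CARD('n) + 1)"
  unfolding P_def using e Pc_pos[where 'n='n] by (intro divide_left_mono mult_pos_pos zero_less_power) (auto simp: add_pos_nonneg)
 then show ?thesis using e by simp
qed

lemma Q_le: "e > 0 ==> \<bar>Q e i y\<bar> <= Pc TYPE('n) / e ^ CARD('n)" for y :: "real^'n"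
proof -
 assume e: "e > 0"
 define s where "s = sqrt (e\<^sup>2 + (norm y)\<^sup>2)"
 have s: "norm y <= s" "e <= s" unfolding s_def by (auto intro!: real_le_rsqrt)
 have "\<bar>Q e i y\<bar> <= Pc TYPE('n) * s / s ^ (CARD('n) + 1)"
  unfolding Q_def s_def[symmetric] abs_mult abs_divide using Pc_pos[where 'n='n] s e component_le_norm_cart[of y i]
  by (intro divide_mono mult_left_mono) (auto simp: power_mono)
 also have "... = Pc TYPE('n) / s ^ CARD('n)" using s e by simp
 also have "... <= Pc TYPE('n) / e ^ CARD('n)"
  using s e Pc_pos[where 'n='n] by (intro divide_left_mono power_mono mult_pos_pos) auto
 finally show ?thesis .
qed

lemma L1_reflect: "L1 f ==> L1 (%y. f (x - y))" for f :: "'a::euclidean_space => complex"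
proof -
 assume f: "L1 f"
 then have [measurable]: "f \<in> bm" by auto
 show ?thesis using f lborel_reflect(2)[of "%y. ennreal (norm (f y))" x] by (simp add: L1_iff N_def)
qed

definition tr :: "real => 'n => (real^'n => complex) => real^'n => complex" where
 "tr e i f x = (LI y. f (x - y) * cr (Zt e i y))"

text \<open>The difference kernel D is odd, so it has integral 0 and f(x) may be subtracted inside
  the integral; \<open>Q_Zt\<close> then leaves exactly the oscillation. Hence at Lebesgue points
  both families have the same limit behaviour.\<close>

lemma conv_Q_tr:
 fixes f :: "real^'n => complex"
 assumes f: "L1 f" and e: "e > 0"
 shows "ennreal (norm (tr e i f x - conv f (CQ e i) x)) <= ennreal (KZ TYPE('n)) * osc f e x"
  "L1 (%y. f (x - y) * cr (Zt e i y))"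
proof -
 have [measurable]: "f \<in> bm" using f by auto
 define D where "D y = Zt e i y - Q e i y" for y :: "real^'n"
 have Dm[measurable]: "D \<in> bm" unfolding D_def[abs_def] by measurable
 have D: "\<bar>D y\<bar> <= KZ TYPE('n) * P e y" for y using Q_Zt[OF e, of i y] by (simp add: D_def abs_minus_commute)
 have KZ0: "KZ TYPE('n) >= 0" using KZ_ge[where 'n='n] by simp
 have DL: "L1 (%y. cr (D y))"
  by (rule Bochner_Integration.integrable_bound[OF integrable_mult_right[OF P_L1(2)[OF e], of "KZ TYPE('n)"]])
    (use D e KZ0 in \<open>auto simp: abs_mult\<close>)
 have fL: "L1 (%y. f (x - y))" by (rule L1_reflect[OF f])
 have i1: "L1 (%y. f (x - y) * cr (Q e i y))"
  using Q_le[OF e] by (intro L1_mult_bounded(1)[OF fL]) auto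
 have i2: "L1 (%y. f (x - y) * cr (D y))"
 proof (intro L1_mult_bounded(1)[OF fL])
  show "norm (cr (D y)) <= KZ TYPE('n) * (Pc TYPE('n) / e ^ CARD('n))" for y
   using D[of y] mult_left_mono[OF P_le[OF e, of y] KZ0] by simp
 qed auto
 have "L1 (%y. f (x - y) * cr (Q e i y) + f (x - y) * cr (D y))" using i1 i2 by simp
 then show i3: "L1 (%y. f (x - y) * cr (Zt e i y))" by (simp add: D_def algebra_simps)
 have D0: "(LI y. cr (D y)) = 0"
 proof -
  have "(LI y. cr (D y)) = (LI y. cr (D (0 - y)))"
   by (rule lborel_reflect(1)[symmetric]) auto
  also have "... = - (LI y. cr (D y))" by (simp add: D_def Zt_odd flip: Bochner_Integration.integral_minus)
  finally show ?thesis by simp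
 qed
 have "tr e i f x - conv f (CQ e i) x = (LI y. f (x - y) * cr (D y))"
  using i1 i3 by (simp add: tr_def conv_commute[of f "CQ e i"]) (simp add: conv_eq D_def right_diff_distrib mult.commute)
 also have "... = (LI y. f (x - y) * cr (D y)) - (LI y. f x * cr (D y))"
  using D0 by simp
 also have "... = (LI y. (f (x - y) - f x) * cr (D y))"
  using i2 DL by (simp add: left_diff_distrib)
 also have "ennreal (norm ...) <= (NI y. norm ((f (x - y) - f x) * cr (D y)))"
 proof (rule integral_norm_bound_ennreal)
  show "L1 (%y. (f (x - y) - f x) * cr (D y))" using i2 DL by (simp add: left_diff_distrib)
 qed
 also have "... <= (NI y. ennreal (KZ TYPE('n)) * ennreal (norm (f (x - y) - f x) * P e y))"
 proof (intro nn_integral_mono)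
  fix y
  have "norm (f (x - y) - f x) * \<bar>D y\<bar> <= norm (f (x - y) - f x) * (KZ TYPE('n) * P e y)"
   by (intro mult_left_mono D) auto
  then show "ennreal (norm ((f (x - y) - f x) * cr (D y))) <= ennreal (KZ TYPE('n)) * ennreal (norm (f (x - y) - f x) * P e y)"
   using KZ0 e by (subst ennreal_mult[symmetric]) (auto simp: norm_mult mult_ac intro!: ennreal_leI)
 qed
 also have "... = ennreal (KZ TYPE('n)) * osc f e x" by (simp add: nn_integral_cmult osc_def)
 finally show "ennreal (norm (tr e i f x - conv f (CQ e i) x)) <= ennreal (KZ TYPE('n)) * osc f e x" .
qed

lemma tr_diff_tendsto:
 fixes f :: "real^'n => complex"
 assumes f: "L1 f" and o: "((%e. osc f e x) \<longlongrightarrow> 0) (at_right 0)"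
 shows "((%e. tr e i f x - conv f (CQ e i) x) \<longlongrightarrow> 0) (at_right 0)"
proof (rule tendsto_of_ennreal_bound)
 show "\<forall>\<^sub>F e in at_right 0. ennreal (norm (tr e i f x - conv f (CQ e i) x - 0)) <= ennreal (KZ TYPE('n)) * osc f e x"
  using conv_Q_tr(1)[OF f] by (auto intro!: eventually_at_right_less[THEN eventually_mono])
 have "((%e. ennreal (KZ TYPE('n)) * osc f e x) \<longlongrightarrow> ennreal (KZ TYPE('n)) * 0) (at_right 0)"
  by (intro tendsto_intros o) auto
 then show "((%e. ennreal (KZ TYPE('n)) * osc f e x) \<longlongrightarrow> 0) (at_right 0)" by simp
qed

lemma RR_conv_Q_eq:
 assumes "RR i f g" "e > 0"
 shows "conv f (CQ e i) x = conv g (CP e) x"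
 using assms by (subst conv_Q conv_P; simp add: RR_def)+ (simp add: mult_ac)

text \<open>If g is the multiplier transform of f, the conjugate Poisson integral of f is the
  ordinary Poisson integral of g, which converges to g at Lebesgue points.\<close>

lemma RR_imp_tr:
 fixes f :: "real^'n => complex"
 assumes R: "RR i f g"
 shows "AEL x. ((%e. tr e i f x) \<longlongrightarrow> g x) (at_right 0)"
proof -
 have f: "L1 f" and g: "L1 g" using R by (auto simp: RR_def)
 from lebesgue_points[OF f] lebesgue_points[OF g] show ?thesis
 proof eventually_elim
  case (elim x)
  have "((%e. tr e i f x - conv f (CQ e i) x + conv g (CP e) x) \<longlongrightarrow> 0 + g x) (at_right 0)"
   by (intro tendsto_add tr_diff_tendsto conv_P_tendsto f g elim)
  moreover have "\<forall>\<^sub>F e in at_right 0. tr e i f x - conv f (CQ e i) x + conv g (CP e) x = tr e i f x"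
   by (rule eventually_mono[OF eventually_at_right_less]) (simp add: RR_conv_Q_eq[OF R])
  ultimately show ?case using Lim_transform_eventually by fastforce
 qed
qed

section \<open>The Calderon-Zygmund decomposition\<close>

definition KD :: "'n::finite itself => real" where
 "KD _ = (1 + real (CARD('n) + 1) * 2 ^ CARD('n)) * 2 ^ (CARD('n) + 1)"

lemma KD_pos: "KD TYPE('n::finite) > 0"
 by (simp add: KD_def add_pos_nonneg)

text \<open>Smoothness of the conjugate kernel away from its centre, uniform in the height
  \<open>e\<close>. The bound is written with the Poisson kernel at height R because that kernel has
  integral 1.\<close>

lemma Q_diff:
 fixes x y c :: "real^'n"
 assumes e: "e > 0" and R: "R > 0" and y: "norm (y - c) <= R" and x: "2 * R <= norm (x - c)"
 shows "\<bar>Q e i (x - y) - Q e i (x - c)\<bar> <= KD TYPE('n) * P R (x - c)"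
proof -
 define z w where "z = x - c" and "w = x - y"
 define s where "s u = sqrt (e\<^sup>2 + (norm u)\<^sup>2)" for u :: "real^'n"
 define k where "k = CARD('n)"
 have wz: "norm (w - z) <= R" using y by (simp add: w_def z_def norm_minus_commute)
 have z2: "2 * R <= norm z" using x by (simp add: z_def)
 have s0: "s u > 0" "norm u <= s u" "(s u)\<^sup>2 = e\<^sup>2 + (norm u)\<^sup>2" for u
  using e by (auto simp: s_def add_pos_nonneg intro!: real_le_rsqrt)
 have nw: "norm z - R <= norm w" "norm w <= norm z + R" using wz norm_triangle_ineq2[of z w] norm_triangle_ineq2[of w z] by (auto simp: norm_minus_commute)
 have lip: "\<bar>s u - s v\<bar> <= norm (u - v)" for u v
 proof -
  have "(s u - s v) * (s u + s v) = (norm u - norm v) * (norm u + norm v)"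
   using s0(3)[of u] s0(3)[of v] by (simp add: power2_eq_square algebra_simps)
  then have "\<bar>s u - s v\<bar> * \<bar>s u + s v\<bar> = \<bar>norm u - norm v\<bar> * \<bar>norm u + norm v\<bar>" by (metis abs_mult)
  then have "\<bar>s u - s v\<bar> * (s u + s v) = \<bar>norm u - norm v\<bar> * (norm u + norm v)" using s0(1)[of u] s0(1)[of v] by simp
  also have "... <= norm (u - v) * (s u + s v)"
   using s0 by (intro mult_mono norm_triangle_ineq3 add_mono) (auto simp: add_nonneg_nonneg)
  finally show ?thesis using s0(1)[of u] s0(1)[of v] by (simp add: add_pos_pos)
 qed
 have szw: "s z <= 2 * s w"
 proof -
  have "s z <= s w + R" using lip[of z w] wz by (simp add: norm_minus_commute)
  moreover have "R <= s w" using nw z2 s0(2)[of w] by linarith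
  ultimately show ?thesis by simp
 qed
 have pw: "\<bar>s w ^ Suc k - s z ^ Suc k\<bar> <= real (Suc k) * (2 * s w) ^ k * R"
 proof (cases "s z <= s w")
  case True
  have "s w ^ Suc k - s z ^ Suc k <= real (Suc k) * s w ^ k * (s w - s z)"
   using True s0(1)[of z] by (intro power_diff_le) auto
  also have "... <= real (Suc k) * (2 * s w) ^ k * R"
   using lip[of w z] wz s0(1)[of w] True by (intro mult_mono power_mono) auto
  finally show ?thesis using power_mono[OF True, of "Suc k"] s0(1)[of z] by simp
 next
  case False
  have "s z ^ Suc k - s w ^ Suc k <= real (Suc k) * s z ^ k * (s z - s w)"
   using False s0(1)[of w] by (intro power_diff_le) auto
  also have "... <= real (Suc k) * (2 * s w) ^ k * R"
   using lip[of w z] wz s0(1)[of w] s0(1)[of z] False szw by (intro mult_mono power_mono) auto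
  finally show ?thesis using power_mono[of "s w" "s z" "Suc k"] False s0(1)[of w] by simp
 qed
 have "\<bar>w $ i / s w ^ Suc k - z $ i / s z ^ Suc k\<bar> <= (1 + real (Suc k) * 2 ^ k) * R / s z ^ Suc k"
 proof -
  have "w $ i / s w ^ Suc k - z $ i / s z ^ Suc k = ((w - z) $ i + (w $ i / s w ^ Suc k) * (s z ^ Suc k - s w ^ Suc k)) / s z ^ Suc k"
   using s0(1)[of w] s0(1)[of z] by (simp add: field_simps del: power_Suc)
  moreover have "\<bar>(w - z) $ i + (w $ i / s w ^ Suc k) * (s z ^ Suc k - s w ^ Suc k)\<bar> <= R + (1 / s w ^ k) * (real (Suc k) * (2 * s w) ^ k * R)"
  proof (rule order_trans[OF abs_triangle_ineq], rule add_mono)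
   show "\<bar>(w - z) $ i\<bar> <= R" using component_le_norm_cart[of "w - z" i] wz by simp
   have "\<bar>w $ i\<bar> / s w ^ Suc k <= s w / s w ^ Suc k"
    using component_le_norm_cart[of w i] s0(1,2)[of w] by (intro divide_right_mono) auto
   then show "\<bar>w $ i / s w ^ Suc k * (s z ^ Suc k - s w ^ Suc k)\<bar> <= (1 / s w ^ k) * (real (Suc k) * (2 * s w) ^ k * R)"
    unfolding abs_mult using pw s0(1)[of w] by (intro mult_mono) (auto simp: abs_minus_commute)
  qed
  moreover have "R + (1 / s w ^ k) * (real (Suc k) * (2 * s w) ^ k * R) = (1 + real (Suc k) * 2 ^ k) * R"
   using s0(1)[of w] by (simp add: power_mult_distrib field_simps)
  ultimately show ?thesis using s0(1)[of z] by (simp add: divide_right_mono del: power_Suc)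
 qed
 also have "... <= (1 + real (Suc k) * 2 ^ k) * (2 ^ Suc k * (R / sqrt (R\<^sup>2 + (norm z)\<^sup>2) ^ Suc k))"
 proof -
  have nz: "norm z > 0" using z2 R by linarith
  have "R <= norm z" using z2 R by linarith
  then have "R\<^sup>2 <= (norm z)\<^sup>2" using R by (intro power_mono) auto
  then have "R\<^sup>2 + (norm z)\<^sup>2 <= 4 * (norm z)\<^sup>2" using zero_le_power2[of "norm z"] by linarith
  then have "sqrt (R\<^sup>2 + (norm z)\<^sup>2) <= 2 * norm z" by (intro real_le_lsqrt) (auto simp: power_mult_distrib)
  also have "... <= 2 * s z" using s0(2) by simp
  finally have "sqrt (R\<^sup>2 + (norm z)\<^sup>2) ^ Suc k <= (2 * s z) ^ Suc k" by (intro power_mono) auto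
  moreover have "sqrt (R\<^sup>2 + (norm z)\<^sup>2) > 0" using R by (simp add: add_pos_nonneg)
  ultimately have *: "R / (2 * s z) ^ Suc k <= R / sqrt (R\<^sup>2 + (norm z)\<^sup>2) ^ Suc k"
   using R s0(1)[of z] by (intro divide_left_mono mult_pos_pos zero_less_power) auto
  have "R / s z ^ Suc k = 2 ^ Suc k * (R / (2 * s z) ^ Suc k)" by (simp add: power_mult_distrib del: power_Suc)
  also have "... <= 2 ^ Suc k * (R / sqrt (R\<^sup>2 + (norm z)\<^sup>2) ^ Suc k)" by (intro mult_left_mono *) auto
  finally have "R / s z ^ Suc k <= 2 ^ Suc k * (R / sqrt (R\<^sup>2 + (norm z)\<^sup>2) ^ Suc k)" .
  then have "(1 + real (Suc k) * 2 ^ k) * (R / s z ^ Suc k) <= (1 + real (Suc k) * 2 ^ k) * (2 ^ Suc k * (R / sqrt (R\<^sup>2 + (norm z)\<^sup>2) ^ Suc k))"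
   by (intro mult_left_mono) auto
  then show ?thesis by simp
 qed
 finally have "Pc TYPE('n) * \<bar>w $ i / s w ^ Suc k - z $ i / s z ^ Suc k\<bar> <= Pc TYPE('n) * ((1 + real (Suc k) * 2 ^ k) * (2 ^ Suc k * (R / sqrt (R\<^sup>2 + (norm z)\<^sup>2) ^ Suc k)))"
  using Pc_pos[where 'n='n] by (intro mult_left_mono) auto
 moreover have "Q e i w - Q e i z = Pc TYPE('n) * (w $ i / s w ^ Suc k - z $ i / s z ^ Suc k)"
  by (simp add: Q_def s_def k_def right_diff_distrib)
 ultimately show ?thesis using Pc_pos[where 'n='n]
  by (simp add: KD_def P_def w_def[symmetric] z_def[symmetric] k_def abs_mult mult_ac del: power_Suc)
qed

lemma conv_measurable[measurable]:
 assumes [measurable]: "f \<in> bm" "g \<in> bm"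
 shows "conv f g \<in> bm"
 unfolding conv_eq[abs_def] by measurable

text \<open>The mean of b is 0, so the kernel value at the centre can be subtracted;
  \<open>Q_diff\<close> then bounds the integrand by |b| times a Poisson kernel in x.\<close>

lemma atom_Q:
 fixes b :: "real^'n => complex"
 assumes b: "L1 b" "(LI y. b y) = 0" "!!y. b y ~= 0 ==> y \<in> ball c R" and e: "e > 0"
 shows "(NI x. norm (conv b (CQ e i) x) * indicator {x. 2 * R <= norm (x - c)} x) <= ennreal (KD TYPE('n)) * N b"
proof (cases "R > 0")
 case False
 then have "b y = 0" for y using b(3)[of y] by (cases "b y = 0") (auto simp: ball_empty)
 then show ?thesis by (simp add: conv_eq)
next
 case True
 have [measurable]: "b \<in> bm" using b by auto
 have KD0: "KD TYPE('n) >= 0" using KD_pos[where 'n='n] by simp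
 have "ennreal (norm (conv b (CQ e i) x) * indicator {x. 2 * R <= norm (x - c)} x) <= N b * (ennreal (KD TYPE('n)) * ennreal (P R (x - c)))" for x
 proof (cases "2 * R <= norm (x - c)")
  case x: True
  have i1: "L1 (%y. b y * CQ e i (x - y))" using Q_le[OF e] by (intro L1_mult_bounded(1)[OF b(1)]) auto
  have i2: "L1 (%y. b y * CQ e i (x - c))" using b(1) by auto
  have "conv b (CQ e i) x = (LI y. b y * CQ e i (x - y)) - (LI y. b y * CQ e i (x - c))"
   using b(2) by (simp add: conv_eq)
  also have "... = (LI y. b y * (CQ e i (x - y) - CQ e i (x - c)))"
   using i1 i2 by (simp add: right_diff_distrib)
  also have "ennreal (norm ...) <= (NI y. norm (b y * (CQ e i (x - y) - CQ e i (x - c))))"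
   using Bochner_Integration.integrable_diff[OF i1 i2] by (intro integral_norm_bound_ennreal) (simp add: right_diff_distrib)
  also have "... <= (NI y. ennreal (norm (b y)) * (ennreal (KD TYPE('n)) * ennreal (P R (x - c))))"
  proof (intro nn_integral_mono)
   fix y
   have "norm (b y) * \<bar>Q e i (x - y) - Q e i (x - c)\<bar> <= norm (b y) * (KD TYPE('n) * P R (x - c))"
    using Q_diff[OF e True _ x, of y i] b(3)[of y] by (cases "b y = 0") (auto simp: dist_norm norm_minus_commute intro!: mult_left_mono)
   then show "ennreal (norm (b y * (CQ e i (x - y) - CQ e i (x - c)))) <= ennreal (norm (b y)) * (ennreal (KD TYPE('n)) * ennreal (P R (x - c)))"
    using KD0 True by (simp add: norm_mult ennreal_mult[symmetric] flip: of_real_diff)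
  qed
  also have "... = N b * (ennreal (KD TYPE('n)) * ennreal (P R (x - c)))"
   by (subst nn_integral_multc) (auto simp: N_def)
  finally show ?thesis using x by simp
 qed simp
 then have "(NI x. norm (conv b (CQ e i) x) * indicator {x. 2 * R <= norm (x - c)} x) <= (NI x. N b * (ennreal (KD TYPE('n)) * ennreal (P R (x - c))))"
  by (intro nn_integral_mono)
 also have "... = N b * (ennreal (KD TYPE('n)) * (NI x. ennreal (P R (x - c))))"
  by (simp add: nn_integral_cmult)
 also have "(NI x. ennreal (P R (x - c))) = 1"
  using lborel_translate(2)[of "%x. ennreal (P R x)" c] P_one[OF True, where 'n='n] by simp
 finally show ?thesis by (simp add: mult.commute)
qed

lemma joint_count: "(!!k. h k \<in> borel_measurable lborel) ==> (%(k::'k::countable, x). h k x) \<in> borel_measurable (count_space UNIV \<Otimes>\<^sub>M lborel)"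
 by (rule measurable_pair_measure_countable1) auto

lemma pointwise_bound:
 fixes f :: "real^'n => complex"
 assumes f: "L1 f" and x: "((%e. osc f e x) \<longlongrightarrow> 0) (at_right 0)" and K: "K >= 0"
  and b: "!!e. e > 0 ==> (NI y. norm (f (x - y)) * P e y) <= ennreal K"
 shows "norm (f x) <= K"
proof -
 have [measurable]: "f \<in> bm" using f by auto
 have "ennreal (norm (f x)) <= ennreal K + osc f e x" if e: "e > 0" for e
 proof -
  have "ennreal (norm (f x)) = (\<integral>\<^sup>+y. ennreal (norm (f x)) * ennreal (P e y) \<partial>(lborel::(real^'n) measure))"
   using P_one[OF e, where 'n='n] by (simp add: nn_integral_cmult)
  also have "... <= (NI y. ennreal (norm (f (x - y)) * P e y) + ennreal (norm (f (x - y) - f x) * P e y))"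
  proof (intro nn_integral_mono)
   fix y
   have "norm (f x) * P e y <= (norm (f (x - y)) + norm (f (x - y) - f x)) * P e y"
    using e norm_triangle_ineq4[of "f (x - y)" "f (x - y) - f x"] by (intro mult_right_mono) auto
   then show "ennreal (norm (f x)) * ennreal (P e y) <= ennreal (norm (f (x - y)) * P e y) + ennreal (norm (f (x - y) - f x) * P e y)"
    using e by (simp add: ennreal_mult[symmetric] ennreal_plus[symmetric] distrib_right del: ennreal_plus)
  qed
  also have "... = (NI y. norm (f (x - y)) * P e y) + osc f e x"
   by (simp add: nn_integral_add osc_def)
  also have "... <= ennreal K + osc f e x" by (intro add_right_mono b e)
  finally show ?thesis .
 qed
 then have ev: "\<forall>\<^sub>F e in at_right 0. ennreal (norm (f x)) <= ennreal K + osc f e x"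
  by (auto intro: eventually_mono[OF eventually_at_right_less])
 have "((%e. ennreal K + osc f e x) \<longlongrightarrow> ennreal K + 0) (at_right 0)" by (intro tendsto_intros x)
 from tendsto_lowerbound[OF this ev] K show ?thesis by simp
qed

text \<open>The estimates for the bad part and for W use the mass of f on U instead of the full
  norm. This is the point: since U shrinks as the height grows, the right-hand sides tend to 0
  (\<open>mu_tendsto_0\<close>), whereas the classical bound by the norm would not.\<close>

lemma calderon_zygmund:
 fixes f :: "real^'n => complex"
 assumes f: "L1 f" and lam: "lam > 0"
 shows "\<exists>f1 b U W. L1 f1 & L1 b & (\<forall>x. f x = f1 x + b x) & (AEL x. norm (f1 x) <= (5 ^ CARD('n) + KM TYPE('n)) * lam) &
   U \<in> sets borel & W \<in> sets borel & N b <= 2 * emeasure (mu f) U &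
   ennreal lam * em W <= ennreal (10 ^ CARD('n)) * emeasure (mu f) U &
   ennreal lam * em U <= ennreal (5 ^ CARD('n)) * N f &
   (\<forall>e i. e > 0 --> (NI x. norm (conv b (CQ e i) x) * indicator (- W) x) <= ennreal (KD TYPE('n)) * (2 * emeasure (mu f) U))"
proof (rule vitali[OF f lam])
 fix c :: "nat => real^'n" and r :: "nat => real"
 assume r0: "!!k. r k >= 0" and disj: "disjoint_family (%k. ball (c k) (r k))"
  and v3: "!!k. ennreal lam * em (ball (c k) (r k)) <= emeasure (mu f) (ball (c k) (r k))"
  and v4: "!!k R. r k > 0 ==> R >= 2 * r k ==> emeasure (mu f) (ball (c k) R) <= ennreal lam * em (ball (c k) R)"
  and v5: "!!x R. x \<notin> (\<Union>k. ball (c k) (5 * r k)) ==> emeasure (mu f) (ball x R) <= ennreal lam * em (ball x R)"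
 have [measurable]: "f \<in> bm" using f by auto
 define B D where "B k = ball (c k) (r k)" and "D k = ball (c k) (5 * r k)" for k
 \<comment> \<open>A partition of U with the selected ball inside and the fivefold ball outside each
   piece: every piece claims its own ball and whatever of its fivefold ball no other ball and no
   earlier fivefold ball has taken.\<close>
 define G where "G k = B k \<union> (D k - (\<Union>j. B j) - (\<Union>j<k. D j))" for k
 \<comment> \<open>Pieces lie in balls of radius 5r, so outside W one is at distance at least 2 * 5r
   from each centre, as \<open>atom_Q\<close> requires.\<close>
 define U W where "U = (\<Union>k. D k)" and "W = (\<Union>k. ball (c k) (10 * r k))"
 have [measurable]: "B k \<in> sets borel" "D k \<in> sets borel" "U \<in> sets borel" "W \<in> sets borel" for k by (auto simp: B_def D_def U_def W_def)
 then have [measurable]: "G k \<in> sets borel" for k unfolding G_def by auto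
 have BD: "B k \<subseteq> D k" for k using r0[of k] by (auto simp: B_def D_def intro: order_less_le_trans)
 have GD: "B k \<subseteq> G k" "G k \<subseteq> D k" for k using BD[of k] by (auto simp: G_def)
 have Gdisj: "disjoint_family G"
 proof -
  have "G k \<inter> G l = {}" if "k < l" for k l
  proof -
   have "B k \<inter> B l = {}" using disj that by (auto simp: disjoint_family_on_def B_def)
   then show ?thesis using that BD by (auto simp: G_def)
  qed
  then show ?thesis unfolding disjoint_family_on_def by (metis inf_commute linorder_neqE_nat)
 qed
 have GU: "(\<Union>k. G k) = U"
 proof
  show "(\<Union>k. G k) \<subseteq> U" using GD(2) by (auto simp: U_def)
  show "U \<subseteq> (\<Union>k. G k)"
  proof
   fix x assume "x \<in> U"
   then have ex: "\<exists>k. x \<in> D k" by (simp add: U_def)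
   define k where "k = (LEAST k. x \<in> D k)"
   have "x \<in> D k" "!!j. j < k ==> x \<notin> D j" using LeastI_ex[OF ex] not_less_Least by (auto simp: k_def)
   then show "x \<in> (\<Union>k. G k)" by (cases "x \<in> (\<Union>j. B j)") (auto simp: G_def)
  qed
 qed
 have fin: "em (G k) < \<infinity>" for k
  by (rule le_less_trans[OF emeasure_mono[OF GD(2)] emeasure_lborel_ball_finite[of "c k" "5 * r k", folded D_def]]) simp
 define a where "a k = (LI x. indicator (G k) x *\<^sub>R f x) / cr (measure lborel (G k))" for k
 define bk where "bk k x = indicator (G k) x *\<^sub>R (f x - a k)" for k x
 have [measurable]: "bk k \<in> bm" for k unfolding bk_def[abs_def] by measurable
 have iG: "L1 (%x. indicator (G k) x *\<^sub>R f x)" for k using f by (intro integrable_mult_indicator) auto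
 have iG1: "L1 (%x. indicator (G k) x *\<^sub>R z)" for k and z :: complex using fin[of k] by (simp add: integrable_mult_left)
 have muG: "emeasure (mu f) (G k) = ennreal (LI x. norm (indicator (G k) x *\<^sub>R f x))" for k
 proof -
  have "emeasure (mu f) (G k) = N (%x. indicator (G k) x *\<^sub>R f x)"
   by (subst emeasure_density) (auto simp: N_def intro!: nn_integral_cong split: split_indicator)
  then show ?thesis using N_eq[OF iG[of k]] by simp
 qed
 have bkL: "L1 (bk k)" for k
  using iG[of k] iG1[of k "a k"] by (simp add: bk_def[abs_def] scaleR_right_diff_distrib)
 have ak: "norm (a k) * measure lborel (G k) <= (LI x. norm (indicator (G k) x *\<^sub>R f x))" for k
  using integral_norm_bound[of lborel "%x. indicator (G k) x *\<^sub>R f x"] by (simp add: a_def norm_divide)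
 have G0: "measure lborel (G k) > 0" if "r k > 0" for k
 proof -
  have "0 < ennreal (unit_ball_vol (real CARD('n)) * r k ^ CARD('n))" using that by simp
  also have "ennreal (unit_ball_vol (real CARD('n)) * r k ^ CARD('n)) = em (B k)" using r0 by (simp add: B_def emeasure_ball)
  also have "... <= em (G k)" using GD by (intro emeasure_mono) auto
  finally have "em (G k) ~= 0" by auto
  then show ?thesis using fin[of k] by (simp add: measure_def enn2real_positive_iff zero_less_iff_neq_zero)
 qed
 have Ge: "G k = {}" if "\<not> r k > 0" for k using that r0[of k] GD(2)[of k] by (auto simp: D_def)
 have bk0: "(LI x. bk k x) = 0" for k
 proof (cases "r k > 0")
  case True
  have "(LI x. bk k x) = (LI x. indicator (G k) x *\<^sub>R f x) - (LI x. indicator (G k) x *\<^sub>R a k)"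
   using iG[of k] iG1[of k "a k"] by (simp add: bk_def scaleR_right_diff_distrib)
  also have "... = 0" using G0[OF True] fin[of k] by (simp add: a_def scaleR_conv_of_real)
  finally show ?thesis .
 qed (simp add: bk_def Ge)
 have Nbk: "N (bk k) <= 2 * emeasure (mu f) (G k)" for k
 proof -
  have "N (bk k) <= N (%x. indicator (G k) x *\<^sub>R f x) + N (%x. indicator (G k) x *\<^sub>R a k)"
   unfolding bk_def[abs_def] scaleR_right_diff_distrib by (intro N_triangle_diff) auto
  also have "N (%x. indicator (G k) x *\<^sub>R a k) = ennreal (norm (a k) * measure lborel (G k))"
   using fin[of k] unfolding N_eq[OF iG1] by (simp add: mult.commute)
  also have "N (%x. indicator (G k) x *\<^sub>R f x) = emeasure (mu f) (G k)" using muG N_eq[OF iG] by simp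
  also have "emeasure (mu f) (G k) + ennreal (norm (a k) * measure lborel (G k)) <= emeasure (mu f) (G k) + emeasure (mu f) (G k)"
   using ak[of k] by (intro add_left_mono) (simp add: muG ennreal_leI)
  finally show ?thesis by (simp add: mult_2)
 qed
 have muU: "(\<Sum>k. emeasure (mu f) (G k)) = emeasure (mu f) U"
  unfolding GU[symmetric] using Gdisj by (intro suminf_emeasure) auto
 have SN: "(\<Sum>k. N (bk k)) <= 2 * emeasure (mu f) U"
  unfolding muU[symmetric] ennreal_suminf_cmult[symmetric] by (intro suminf_le Nbk) auto
 have muU_fin: "emeasure (mu f) U < \<infinity>"
  using emeasure_mono[of U UNIV "mu f"] N_less_top[OF f] by (auto simp: mu_UNIV[OF f] intro: le_less_trans)
 have sig: "sigma_finite_measure (count_space (UNIV::nat set))" by (rule sigma_finite_count)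
 have jm: "(%(k, x). bk k x) \<in> borel_measurable (count_space UNIV \<Otimes>\<^sub>M lborel)" by (rule joint_count) auto
 have fin1: "(\<integral>\<^sup>+k. N (bk k) \<partial>count_space UNIV) < \<infinity>"
  using SN muU_fin by (auto simp: nn_integral_count_space_nat ennreal_mult_less_top intro: le_less_trans)
 define b where "b x = (\<integral>k. bk k x \<partial>count_space UNIV)" for x
 note mb = mix[OF sig jm fin1, folded b_def]
 have bG: "b x = f x - a k" if "x \<in> G k" for x k
 proof -
  have z: "bk j x = 0" if "j ~= k" for j
   using Gdisj \<open>x \<in> G k\<close> that by (auto simp: bk_def disjoint_family_on_def split: split_indicator)
  then have sub: "{j. bk j x ~= 0} \<subseteq> {k}" by auto
  have "b x = (\<Sum>j | bk j x ~= 0. bk j x)" unfolding b_def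
   using finite_subset[OF sub] by (subst lebesgue_integral_count_space_finite_support) auto
  also have "... = (\<Sum>j\<in>{k}. bk j x)" by (rule sum.mono_neutral_left) (use sub in auto)
  finally have "b x = (\<Sum>j\<in>{k}. bk j x)" .
  then show ?thesis using that by (simp add: bk_def)
 qed
 have bU: "b x = 0" if "x \<notin> U" for x
 proof -
  have "bk k x = 0" for k using that GU by (auto simp: bk_def split: split_indicator)
  then show ?thesis by (simp add: b_def)
 qed
 have "L1 (%x. f x - b x)" using f mb(1) by auto
 moreover have "AEL x. norm (f x - b x) <= (5 ^ CARD('n) + KM TYPE('n)) * lam"
  using lebesgue_points[OF f]
 proof eventually_elim
  case (elim x)
  have KM0: "KM TYPE('n) >= 0" using Pc_pos[where 'n='n] by (simp add: KM_def)
  show ?case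
  proof (cases "x \<in> U")
   case True
   then obtain k where k: "x \<in> G k" using GU by auto
   then have rk: "r k > 0" using Ge[of k] by auto
   define V where "V = unit_ball_vol (real CARD('n)) * r k ^ CARD('n)"
   have V: "V > 0" using rk by (simp add: V_def)
   have BV: "em (B k) = ennreal V" using rk by (simp add: V_def B_def emeasure_ball)
   have "ennreal (norm (a k)) * ennreal V <= ennreal (norm (a k)) * em (G k)"
    unfolding BV[symmetric] using GD by (intro mult_left_mono emeasure_mono) auto
   also have "... = ennreal (norm (a k) * measure lborel (G k))"
    using fin[of k] by (simp add: emeasure_eq_ennreal_measure less_top ennreal_mult)
   also have "... <= emeasure (mu f) (G k)" using ak[of k] by (simp add: muG ennreal_leI)
   also have "... <= emeasure (mu f) (D k)" using GD by (intro emeasure_mono) auto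
   \<comment> \<open>Near-maximality of the selected ball is used here: 5r >= 2r, so the fivefold
     ball is not bad.\<close>
   also have "... <= ennreal lam * em (D k)" unfolding D_def using rk by (intro v4) auto
   also have "em (D k) = ennreal (5 ^ CARD('n) * V)" using rk by (simp add: D_def V_def emeasure_ball power_mult_distrib mult_ac)
   finally have "norm (a k) * V <= lam * (5 ^ CARD('n) * V)"
    using V lam by (simp add: ennreal_mult[symmetric])
   then have "norm (a k) <= 5 ^ CARD('n) * lam" using V by (simp add: mult.assoc[symmetric] mult.commute)
   moreover have "KM TYPE('n) * lam >= 0" using KM0 lam by simp
   ultimately show ?thesis using bG[OF k] by (simp add: distrib_right)
  next
   case False
   have "norm (f x) <= KM TYPE('n) * lam"
   proof (rule pointwise_bound[OF f elim])
    show "(NI y. norm (f (x - y)) * P e y) <= ennreal (KM TYPE('n) * lam)" if "e > 0" for e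
     using v5[of x] False lam that by (intro max_P) (auto simp: U_def D_def)
   qed (use KM0 lam in auto)
   moreover have "0 <= 5 ^ CARD('n) * lam" using lam by simp
   ultimately show ?thesis using bU[OF False] by (simp add: distrib_right)
  qed
 qed
 moreover have "N b <= 2 * emeasure (mu f) U" using mb(2) SN by (simp add: nn_integral_count_space_nat)
 moreover have "ennreal lam * em W <= ennreal (10 ^ CARD('n)) * emeasure (mu f) U"
  unfolding W_def
 proof (rule order_trans[OF vitali_measure[OF r0 disj _ v3]])
  have "(\<Union>k. ball (c k) (r k)) \<subseteq> U" using BD by (auto simp: U_def B_def)
  then show "ennreal (10 ^ CARD('n)) * emeasure (mu f) (\<Union>k. ball (c k) (r k)) <= ennreal (10 ^ CARD('n)) * emeasure (mu f) U"
   by (intro mult_left_mono emeasure_mono) auto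
 qed simp
 moreover have "ennreal lam * em U <= ennreal (5 ^ CARD('n)) * N f"
  unfolding U_def D_def
 proof (rule order_trans[OF vitali_measure[OF r0 disj _ v3]])
  show "ennreal (5 ^ CARD('n)) * emeasure (mu f) (\<Union>k. ball (c k) (r k)) <= ennreal (5 ^ CARD('n)) * N f"
   unfolding mu_UNIV[OF f, symmetric] by (intro mult_left_mono emeasure_mono) auto
 qed simp
 moreover have "(NI x. norm (conv b (CQ e i) x) * indicator (- W) x) <= ennreal (KD TYPE('n)) * (2 * emeasure (mu f) U)" if e: "e > 0" for e i
 proof -
  have pt: "ennreal (norm (conv b (CQ e i) x)) <= (\<Sum>k. ennreal (norm (conv (bk k) (CQ e i) x)))" for x
  proof -
   define h where "h k y = bk k y * CQ e i (x - y)" for k y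
   define M where "M = Pc TYPE('n) / e ^ CARD('n)"
   have M: "M >= 0" "\<bar>Q e i z\<bar> <= M" for z using Q_le[OF e, of i z] abs_ge_zero order_trans by (auto simp: M_def)
   have "N (h k) <= ennreal M * N (bk k)" for k
   proof -
    have "N (h k) <= (NI y. ennreal M * ennreal (norm (bk k y)))"
     unfolding N_def h_def using M by (intro nn_integral_mono) (auto simp: norm_mult ennreal_mult[symmetric] mult.commute[of M] intro!: ennreal_leI mult_left_mono)
    then show ?thesis by (simp add: nn_integral_cmult N_def)
   qed
   then have "(\<integral>\<^sup>+k. N (h k) \<partial>count_space UNIV) <= (\<integral>\<^sup>+k. ennreal M * N (bk k) \<partial>count_space UNIV)"
    by (intro nn_integral_mono) auto
   also have "... = ennreal M * (\<integral>\<^sup>+k. N (bk k) \<partial>count_space UNIV)" by (subst nn_integral_cmult) auto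
   also have "... < \<infinity>" using fin1 by (simp add: ennreal_mult_less_top)
   finally have fh: "(\<integral>\<^sup>+k. N (h k) \<partial>count_space UNIV) < \<infinity>" .
   have jh: "(%(k, y). h k y) \<in> borel_measurable (count_space UNIV \<Otimes>\<^sub>M lborel)" by (rule joint_count) (auto simp: h_def[abs_def])
   note mh = mix[OF sig jh fh]
   have "conv b (CQ e i) x = F (%y. \<integral>k. h k y \<partial>count_space UNIV) 0"
    by (simp add: conv_eq F_def b_def h_def)
   also have "... = (\<integral>k. conv (bk k) (CQ e i) x \<partial>count_space UNIV)"
    unfolding mh(3) by (simp add: F_def h_def conv_eq)
   finally have c: "conv b (CQ e i) x = (\<integral>k. conv (bk k) (CQ e i) x \<partial>count_space UNIV)" .
   have "integrable (count_space UNIV) (%k. conv (bk k) (CQ e i) x)" using mh(6)[of 0] by (simp add: F_def h_def conv_eq)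
   from integral_norm_bound_ennreal[OF this] show ?thesis unfolding c by (simp add: nn_integral_count_space_nat)
  qed
  have "(NI x. norm (conv b (CQ e i) x) * indicator (- W) x) <= (NI x. (\<Sum>k. ennreal (norm (conv (bk k) (CQ e i) x) * indicator {x. 2 * (5 * r k) <= norm (x - c k)} x)))"
  proof (intro nn_integral_mono)
   fix x
   show "ennreal (norm (conv b (CQ e i) x) * indicator (- W) x) <= (\<Sum>k. ennreal (norm (conv (bk k) (CQ e i) x) * indicator {x. 2 * (5 * r k) <= norm (x - c k)} x))"
   proof (cases "x \<in> W")
    case False
    then have "2 * (5 * r k) <= norm (x - c k)" for k by (auto simp: W_def dist_norm norm_minus_commute not_less)
    then show ?thesis using pt[of x] False by simp
   qed simp
  qed
  also have "... = (\<Sum>k. (NI x. ennreal (norm (conv (bk k) (CQ e i) x) * indicator {x. 2 * (5 * r k) <= norm (x - c k)} x)))"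
   by (rule nn_integral_suminf) measurable
  also have "... <= (\<Sum>k. ennreal (KD TYPE('n)) * N (bk k))"
  proof (intro suminf_le atom_Q bkL bk0 e)
   fix k y assume "bk k y ~= 0"
   then show "y \<in> ball (c k) (5 * r k)" using GD(2)[of k] by (auto simp: bk_def D_def split: split_indicator_asm)
  qed auto
  also have "... <= ennreal (KD TYPE('n)) * (2 * emeasure (mu f) U)"
   unfolding ennreal_suminf_cmult by (intro mult_left_mono SN) auto
  finally show ?thesis .
 qed
 ultimately show ?thesis using mb(1)
  by (intro exI[of _ "%x. f x - b x"] exI[of _ b] exI[of _ U] exI[of _ W]) auto
qed

section \<open>From pointwise principal values to the Fourier multiplier\<close>

declare P_even(2)[simp del]

lemma ennreal_two: "2 * ennreal x = ennreal (2 * x)"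
 using ennreal_mult'[of 2 x] by simp

text \<open>The sets need not decrease; summable measures put almost every point in finitely many of
  them, and dominated convergence does the rest.\<close>

lemma mu_tendsto_0:
 fixes f :: "real^'n => complex"
 assumes f: "L1 f" and U: "!!k. U k \<in> sets borel" "!!k. em (U k) <= ennreal (C * (1/2)^k)"
 shows "(%k. emeasure (mu f) (U k)) ---> 0"
proof -
 have [measurable]: "f \<in> bm" "U k \<in> sets borel" for k using f U by auto
 have "AEL x. eventually (%k. x \<in> space lborel - U k) sequentially"
 proof (rule borel_cantelli_AE1)
  show "em (U k) < \<infinity>" for k using U(2)[of k] by (auto intro: le_less_trans)
  have "measure lborel (U k) <= \<bar>C\<bar> * (1/2)^k" for k
  proof -
   have "ennreal (C * (1/2)^k) <= ennreal (\<bar>C\<bar> * (1/2)^k)" by (intro ennreal_leI mult_right_mono) auto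
   from enn2real_mono[OF order_trans[OF U(2)[of k] this]] show ?thesis by (simp add: measure_def)
  qed
  moreover have sm: "summable (%k. \<bar>C\<bar> * (1/2::real)^k)"
   by (rule summable_mult, rule summable_geometric) simp
  ultimately show "summable (%k. measure lborel (U k))"
   using summable_comparison_test'[OF sm, of 0 "%k. measure lborel (U k)"] by auto
 qed (use U in auto)
 then have "(%k. (NI x. ennreal (norm (f x)) * indicator (U k) x)) ---> (\<integral>\<^sup>+x. 0 \<partial>(lborel::(real^'n) measure))"
 proof (intro nn_integral_dominated_convergence[where w="%x. ennreal (norm (f x))"])
  assume a: "AEL x. eventually (%k. x \<in> space lborel - U k) sequentially"
  show "AEL x. (%k. ennreal (norm (f x)) * indicator (U k) x) ---> 0"
   using a by eventually_elim (auto intro!: tendsto_eventually elim!: eventually_mono)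
  show "(NI x. ennreal (norm (f x))) < \<infinity>" using N_less_top[OF f] by (simp add: N_def)
 qed (auto intro!: AE_I2 split: split_indicator)
 then show ?thesis by (simp add: emeasure_density)
qed

lemma F_CP:
 fixes z :: "real^'n"
 shows "e > 0 ==> F (CP e) z = cr (p (e * norm z))"
proof -
 assume e: "e > 0"
 define k where "k y = cr (p (e * norm y))" for y :: "real^'n"
 have Fk: "F k = CP e" using F_p[OF e] by (auto simp: k_def[abs_def] fun_eq_iff)
 have "continuous_on UNIV k"
  unfolding k_def by (intro continuous_intros continuous_on_compose2[OF p(4)]) auto
 then have "isCont k (-z)" by (simp add: continuous_on_eq_continuous_at)
 moreover have "norm (k x) <= 1" for x using p(1,2) by (simp add: k_def)
 moreover have "L1 k" using p_L1[OF e] by (simp add: k_def[abs_def])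
 moreover have "L1 (F k)" using P_L1(1)[OF e] by (simp only: Fk)
 ultimately have "(LI x. F k x * E x (-z)) = k (-z)" by (intro inversion)
 then show ?thesis by (simp add: Fk) (simp add: F_def k_def)
qed

lemma conv_Q_bounded:
 fixes f :: "real^'n => complex"
 assumes f: "L1 f" and e: "e > 0"
 shows "norm (conv f (CQ e i) x) <= (Pc TYPE('n) / e ^ CARD('n)) * (LI y. norm (f y))"
proof -
 have "norm (conv f (CQ e i) x) <= (LI y. norm (f y * CQ e i (x - y)))"
  unfolding conv_eq by (rule integral_norm_bound)
 also have "... <= (LI y. norm (f y) * (Pc TYPE('n) / e ^ CARD('n)))"
 proof (intro integral_mono integrable_norm L1_mult_bounded(1)[OF f])
  show "norm (f y * CQ e i (x - y)) <= norm (f y) * (Pc TYPE('n) / e ^ CARD('n))" for y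
   using mult_left_mono[OF Q_le[OF e, of i "x - y"], of "norm (f y)"] by (simp add: norm_mult)
  show "norm (CQ e i (x - y)) <= Pc TYPE('n) / e ^ CARD('n)" for y using Q_le[OF e, of i "x - y"] by simp
 qed (use f in auto)
 finally show ?thesis by (simp add: mult.commute)
qed

lemma conv_Q_pairing:
 fixes f :: "real^'n => complex"
 assumes f: "L1 f" and e: "e > 0" and d: "d > 0"
 shows "(LI x. conv f (CQ e i) x * CP d (x0 - x)) =
   (LI z. F f z * (m i z * cr (p (e * norm z))) * (cr (p (d * norm z)) * E z x0))"
  "L1 (%x. conv f (CQ e i) x * CP d (x0 - x))"
proof -
 have [measurable]: "f \<in> bm" using f by auto
 have [measurable]: "F f \<in> bm" using continuous_F[OF f] by (rule borel_measurable_continuous_onI)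
 define k where "k z = F f z * (m i z * cr (p (e * norm z)))" for z
 have k: "L1 k" unfolding k_def using norm_F_le[OF f] by (intro L1_mult_bounded(2)[OF mp_L1[OF e]]) auto
 have [measurable]: "F k \<in> bm" using continuous_F[OF k] by (rule borel_measurable_continuous_onI)
 have cf: "conv f (CQ e i) x = F k (- x)" for x by (simp add: conv_Q[OF f e] k_def F_def[of k])
 have h: "L1 (%y. CP d (y - (- x0)))" by (rule L1_translate) (rule P_L1(1)[OF d])
 have "(LI x. conv f (CQ e i) x * CP d (x0 - x)) = (LI x. (%y. CP d (y - (- x0)) * F k (y - 0)) (0 - x))"
  unfolding cf by (intro Bochner_Integration.integral_cong) (auto simp: add.commute mult.commute simp del: P_even(2))
 also have "... = (LI y. CP d (y - (- x0)) * F k (y - 0))" by (rule lborel_reflect(1)) measurable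
 also have "... = (LI z. F (%y. CP d (y - (- x0))) z * k z * E z 0)" by (rule F_mult[OF h k])
 also have "... = (LI z. k z * (cr (p (d * norm z)) * E z x0))"
  using P_L1(1)[OF d] by (subst F_translate) (auto simp: F_CP[OF d] E_minus E_commute[of x0] mult_ac intro!: Bochner_Integration.integral_cong)
 finally show "(LI x. conv f (CQ e i) x * CP d (x0 - x)) =
   (LI z. F f z * (m i z * cr (p (e * norm z))) * (cr (p (d * norm z)) * E z x0))" by (simp add: k_def)
 show "L1 (%x. conv f (CQ e i) x * CP d (x0 - x))"
  using conv_Q_bounded[OF f e] by (intro L1_mult_bounded(2)[OF L1_reflect[OF P_L1(1)[OF d]]]) auto
qed

lemma am_gm: "0 < t ==> a * b <= (t * a\<^sup>2 + b\<^sup>2 / t) / 2" for a b t :: real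
proof -
 assume t: "0 < t"
 have "0 <= (t * a - b)\<^sup>2 / t" using t by simp
 also have "... = t * a\<^sup>2 + b\<^sup>2 / t - 2 * (a * b)" using t by (simp add: power2_eq_square field_simps)
 finally show ?thesis by simp
qed

text \<open>A replacement for Cauchy-Schwarz in which the parameter t is tuned at each use and no
  square roots of extended reals appear.\<close>

lemma nn_am_gm:
 fixes G h :: "real^'n => real"
 assumes [measurable]: "G \<in> bm" "h \<in> bm" and "t > 0" "!!x. 0 <= h x" "!!x. 0 <= G x"
 shows "(NI x. ennreal (G x * h x)) <= ennreal t * (NI x. ennreal ((G x)\<^sup>2)) + ennreal (1 / t) * (NI x. ennreal ((h x)\<^sup>2))"
proof -
 have "(NI x. ennreal (G x * h x)) <= (NI x. ennreal t * ennreal ((G x)\<^sup>2) + ennreal (1 / t) * ennreal ((h x)\<^sup>2))"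
 proof (intro nn_integral_mono)
  fix x
  have "G x * h x <= (t * (G x)\<^sup>2 + (h x)\<^sup>2 / t) / 2" by (rule am_gm[OF assms(3)])
  also have "... <= t * (G x)\<^sup>2 + (1 / t) * (h x)\<^sup>2"
   using assms(3) zero_le_power2[of "G x"] zero_le_power2[of "h x"] by (simp add: field_simps)
  finally show "ennreal (G x * h x) <= ennreal t * ennreal ((G x)\<^sup>2) + ennreal (1 / t) * ennreal ((h x)\<^sup>2)"
   using assms(3) by (simp add: ennreal_mult[symmetric] ennreal_plus[symmetric] del: ennreal_plus)
 qed
 then show ?thesis by (simp add: nn_integral_add nn_integral_cmult)
qed

text \<open>Almost everywhere convergence is upgraded to convergence of pairings although no
  integrable majorant exists. For a fixed height write u = v + w from f = f1 + b: v is bounded in L2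
  uniformly in j, so it is small where little measure is left; w is small in L1 off W, and its
  pairing is small on all of space by the Fourier bound on b.\<close>

lemma tr_limit_pairing:
 fixes f g :: "real^'n => complex"
 assumes f: "L1 f" and g: "L1 g" and lim: "AEL x. (%k. conv f (CQ (X k) i) x) ---> g x"
  and X: "!!k. X k > (0::real)" and d: "d > 0"
 shows "(%k. (LI x. conv f (CQ (X k) i) x * CP d (x0 - x))) ---> (LI x. g x * CP d (x0 - x))"
proof -
 have [measurable]: "f \<in> bm" "g \<in> bm" using f g by auto
 define phi where "phi x = P d (x0 - x)" for x
 define B where "B = Pc TYPE('n) / d ^ CARD('n)"
 have phi: "0 <= phi x" "phi x <= B" for x using d P_le[OF d, of "x0 - x"] by (auto simp: phi_def B_def)
 have B0: "B >= 0" using phi[of 0] by simp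
 have [measurable]: "phi \<in> bm" unfolding phi_def[abs_def] by measurable
 have phi1: "(NI x. phi x) = 1"
  using lborel_reflect(2)[of "%x. ennreal (P d x)" x0] P_one[OF d, where 'n='n] by (simp add: phi_def del: P_even)
 define c1 where "c1 = (LI z. norm (cr (p (d * norm (z::real^'n)))))"
 have c1: "c1 >= 0" by (simp add: c1_def)
 define Tf where "Tf = (LI x. norm (f x))"
 have Tf: "Tf >= 0" "N f = ennreal Tf" using N_eq[OF f] by (auto simp: Tf_def)
 define K1 where "K1 = 5 ^ CARD('n) + KM TYPE('n)"
 have K1: "K1 >= 0" using Pc_pos[where 'n='n] by (simp add: K1_def KM_def)
 \<comment> \<open>Geometric heights make the measures of U and W geometrically small, as
   \<open>mu_tendsto_0\<close> needs.\<close>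
 define l where "l k = (2::real) ^ k" for k :: nat
 have l: "l k > 0" for k by (simp add: l_def)
 define cz where "cz k f1 b U W \<longleftrightarrow> L1 f1 & L1 b & (\<forall>x. f x = f1 x + b x) & (AEL x. norm (f1 x) <= K1 * l k) &
   U \<in> sets borel & W \<in> sets borel & N b <= 2 * emeasure (mu f) U &
   ennreal (l k) * em W <= ennreal (10 ^ CARD('n)) * emeasure (mu f) U &
   ennreal (l k) * em U <= ennreal (5 ^ CARD('n)) * N f &
   (\<forall>e i. e > 0 --> (NI x. norm (conv b (CQ e i) x) * indicator (- W) x) <= ennreal (KD TYPE('n)) * (2 * emeasure (mu f) U))" for k f1 b U W
 have "\<exists>f1 b U W. cz k f1 b U W" for k
  using calderon_zygmund[OF f l] unfolding cz_def K1_def by blast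
 then obtain f1 b U W where cz: "cz k (f1 k) (b k) (U k) (W k)" for k by metis
 have f1: "L1 (f1 k)" and b: "L1 (b k)" and fb: "f x = f1 k x + b k x" and f1b: "AEL x. norm (f1 k x) <= K1 * l k"
  and U[measurable]: "U k \<in> sets borel" and W[measurable]: "W k \<in> sets borel" and Nb: "N (b k) <= 2 * emeasure (mu f) (U k)"
  and lW: "ennreal (l k) * em (W k) <= ennreal (10 ^ CARD('n)) * emeasure (mu f) (U k)"
  and lU: "ennreal (l k) * em (U k) <= ennreal (5 ^ CARD('n)) * N f"
  and bW: "e > 0 ==> (NI x. norm (conv (b k) (CQ e i) x) * indicator (- W k) x) <= ennreal (KD TYPE('n)) * (2 * emeasure (mu f) (U k))" for k x e i
  using cz[of k] unfolding cz_def by auto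
 define h where "h k = enn2real (emeasure (mu f) (U k))" for k
 have muU: "emeasure (mu f) (U k) = ennreal (h k)" "h k >= 0" "h k <= Tf" for k
 proof -
  have le: "emeasure (mu f) (U k) <= ennreal Tf" using emeasure_mono[of "U k" UNIV "mu f"] by (simp add: mu_UNIV[OF f] Tf)
  from le_less_trans[OF this ennreal_less_top] show e: "emeasure (mu f) (U k) = ennreal (h k)"
   unfolding h_def by (rule ennreal_enn2real[symmetric])
  show "h k >= 0" by (simp add: h_def)
  show "h k <= Tf" using le Tf(1) unfolding e by simp
 qed
 have canc: "em A <= ennreal (c * (1/2)^k)" if "ennreal (l k) * em A <= ennreal c" for A :: "(real^'n) set" and c k
 proof -
  have "ennreal (1 / l k) * (ennreal (l k) * em A) <= ennreal (1 / l k) * ennreal c"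
   using that by (intro mult_left_mono) auto
  then show ?thesis using l[of k] by (simp add: mult.assoc[symmetric] ennreal_mult'[symmetric] l_def power_one_over)
 qed
 have Ub: "em (U k) <= ennreal (5 ^ CARD('n) * Tf * (1/2)^k)" for k
  using canc[of k "U k" "5 ^ CARD('n) * Tf"] lU[of k] Tf by (simp add: ennreal_mult)
 have lW': "ennreal (l k) * em (W k) <= ennreal (10 ^ CARD('n) * h k)" for k
  using lW[of k] by (simp add: muU ennreal_mult)
 have Wb: "em (W k) <= ennreal (10 ^ CARD('n) * Tf * (1/2)^k)" for k
  using muU(3)[of k] by (intro canc order_trans[OF lW'] ennreal_leI mult_left_mono) auto
 have h0: "h ---> 0"
  using mu_tendsto_0[OF f U Ub] by (subst tendsto_ennreal_iff[symmetric]) (auto simp: muU)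
 have gW: "(%k. emeasure (mu g) (W k)) ---> 0" by (rule mu_tendsto_0[OF g W Wb])
 define u where "u j x = conv f (CQ (X j) i) x" for j x
 define v where "v k j x = conv (f1 k) (CQ (X j) i) x" for k j x
 define w where "w k j x = conv (b k) (CQ (X j) i) x" for k j x
 have [measurable]: "u j \<in> bm" "v k j \<in> bm" "w k j \<in> bm" for j k
  using f1[of k] b[of k] by (auto simp: u_def[abs_def] v_def[abs_def] w_def[abs_def])
 have uvw: "u j x = v k j x + w k j x" for j k x
 proof -
  have "L1 (%y. f1 k y * CQ (X j) i (x - y))" "L1 (%y. b k y * CQ (X j) i (x - y))"
   using Q_le[OF X[of j]] f1[of k] b[of k] by (auto intro!: L1_mult_bounded(1))
  then show ?thesis by (simp add: u_def v_def w_def conv_eq fb[of _ k] distrib_right)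
 qed
 \<comment> \<open>Sup norm at most \<open>K1 * l k\<close> times L1 norm at most 3 Tf. The bound
   grows with the height but is uniform in j, and its growth is exactly compensated by |W| = O(h/l)
   in \<open>I1\<close> below.\<close>
 have v2: "(NI x. ennreal ((norm (v k j x))\<^sup>2)) <= ennreal (3 * K1 * Tf * l k)" for k j
 proof -
  have "N (f1 k) <= N f + N (b k)"
   using N_triangle_diff[of f "b k"] b[of k] by (simp add: fb[of _ k] cong: arg_cong[of _ _ N])
  also have "... <= ennreal Tf + 2 * ennreal Tf"
   using muU[of k] by (intro add_mono order_trans[OF Nb[of k]] mult_left_mono) (auto simp: Tf ennreal_leI)
  also have "... = ennreal (3 * Tf)" using Tf(1) by (simp add: ennreal_two ennreal_plus[symmetric] del: ennreal_plus)
  finally have Nf1: "N (f1 k) <= ennreal (3 * Tf)" .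
  have "(NI x. ennreal ((norm (v k j x))\<^sup>2)) <= N2 (f1 k)"
   using N2_conv_Q[OF f1[of k] X[of j], of i] by (simp add: N2_def v_def)
  also have "... <= (NI x. ennreal (K1 * l k) * ennreal (norm (f1 k x)))"
   unfolding N2_def using f1b[of k] K1 l[of k]
   by (intro nn_integral_mono_AE) (auto elim!: eventually_mono intro!: ennreal_leI mult_right_mono simp: power2_eq_square ennreal_mult'[symmetric])
  also have "... = ennreal (K1 * l k) * N (f1 k)" using f1[of k] by (simp add: nn_integral_cmult N_def)
  also have "... <= ennreal (K1 * l k) * ennreal (3 * Tf)" by (intro mult_left_mono Nf1) auto
  also have "... = ennreal (3 * K1 * Tf * l k)" using K1 l[of k] Tf by (simp add: ennreal_mult[symmetric] mult_ac)
  finally show ?thesis .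
 qed
 \<comment> \<open>On W nothing is known about w pointwise. The pairing is therefore estimated on
   the Fourier side, where the multiplier has modulus at most 1 and the transform of b is at most
   its norm 2h.\<close>
 have wpair: "norm (LI x. w k j x * CP d (x0 - x)) <= 2 * h k * c1" for k j
 proof -
  have "(LI x. norm (b k x)) <= 2 * h k"
   using Nb[of k] muU(2)[of k] by (simp add: N_eq[OF b] muU ennreal_two ennreal_mult'[symmetric])
  then have Fb: "norm (F (b k) z) <= 2 * h k" for z using norm_F_le[OF b] order_trans by blast
  have "norm (LI x. w k j x * CP d (x0 - x)) <= (LI z. (2 * h k) * norm (cr (p (d * norm (z::real^'n)))))"
   unfolding w_def conv_Q_pairing(1)[OF b X d]
  proof (rule Bochner_Integration.integral_norm_bound_integral)
   have [measurable]: "F (b k) \<in> bm" using continuous_F[OF b] by (rule borel_measurable_continuous_onI)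
   have mb: "norm (F (b k) z * (m i z * cr (p (X j * norm z)))) <= 2 * h k" for z
    using Fb[of z] norm_m_le[of i z] p(1,2)[of "X j * norm z"] unfolding norm_mult
    by (intro order_trans[OF mult_left_le[of "norm (m i z) * norm (cr (p (X j * norm z)))" "norm (F (b k) z)"]] mult_le_one) auto
   have pm[measurable]: "p \<in> bm" using p(4) by (rule borel_measurable_continuous_onI)
   have mm: "m i \<in> bm" unfolding m_def[abs_def] by measurable
   have i1: "L1 (%z. cr (p (d * norm z)) * E z x0)" by (rule L1_E[OF p_L1[OF d]])
   show "L1 (%z. F (b k) z * (m i z * cr (p (X j * norm z))) * (cr (p (d * norm z)) * E z x0))"
    using mb mm by (intro L1_mult_bounded(2)[OF i1, where B="2 * h k"]) auto
   show "L1 (%z. 2 * h k * norm (cr (p (d * norm (z::real^'n)))))"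
    by (intro integrable_mult_right integrable_norm p_L1[OF d])
   show "norm (F (b k) z * (m i z * cr (p (X j * norm z))) * (cr (p (d * norm z)) * E z x0)) <= 2 * h k * norm (cr (p (d * norm z)))" for z
    using mb[of z] by (subst norm_mult) (auto simp: norm_mult intro!: mult_right_mono)
  qed
  then show ?thesis by (simp add: c1_def)
 qed
 have main: "\<forall>\<^sub>F j in sequentially. norm ((LI x. u j x * CP d (x0 - x)) - (LI x. g x * CP d (x0 - x))) <= 9 * z" if z: "z > 0" for z
 proof -
  \<comment> \<open>The order of choices matters: s depends on z, the height index k on s, the
    parameter t on z and k, and only then is j taken large.\<close>
  define s where "s = z / (1 + B * (3 * K1 * Tf))"
  have den: "1 + B * (3 * K1 * Tf) > 0" using B0 K1 Tf by (intro add_pos_nonneg mult_nonneg_nonneg) auto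
  have s: "s > 0" "B * (s * (3 * K1 * Tf)) <= z"
   using z den B0 K1 Tf by (auto simp: s_def field_simps intro!: add_nonneg_nonneg mult_nonneg_nonneg)
  have "(%k. 2 * h k * c1) ---> 2 * 0 * c1" "(%k. B * (10 ^ CARD('n) * h k / s)) ---> B * (10 ^ CARD('n) * 0 / s)"
   "(%k. B * (KD TYPE('n) * (2 * h k))) ---> B * (KD TYPE('n) * (2 * 0))"
   using s by (intro tendsto_intros h0; simp)+
  moreover have "(%k. ennreal B * emeasure (mu g) (W k)) ---> ennreal B * 0" by (intro tendsto_intros gW) auto
  ultimately have "\<forall>\<^sub>F k in sequentially. 2 * h k * c1 < z & B * (10 ^ CARD('n) * h k / s) < z & B * (KD TYPE('n) * (2 * h k)) < z & ennreal B * emeasure (mu g) (W k) < ennreal z"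
   using z by (intro eventually_conj order_tendstoD) auto
  then obtain k where k: "2 * h k * c1 < z" "B * (10 ^ CARD('n) * h k / s) < z" "B * (KD TYPE('n) * (2 * h k)) < z" "ennreal B * emeasure (mu g) (W k) < ennreal z"
   by (auto simp: eventually_sequentially)
  \<comment> \<open>The set where u has already converged to within z. For fixed k, integrals of
    fixed integrable functions over its complement tend to 0 in j.\<close>
  define A where "A j = {x. norm (u j x - g x) <= z}" for j
  have [measurable]: "A j \<in> sets borel" for j unfolding A_def by measurable
  define K3 where "K3 = 3 * K1 * Tf * l k"
  define t where "t = z / (1 + K3)"
  have K3: "K3 >= 0" using K1 Tf l[of k] by (simp add: K3_def)
  have t: "t > 0" "t * K3 <= z" using z K3 by (auto simp: t_def field_simps)
  have A0: "AEL x. \<forall>\<^sub>F j in sequentially. x \<in> A j"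
   using lim
  proof eventually_elim
   case (elim x)
   then have "\<forall>\<^sub>F j in sequentially. dist (u j x) (g x) < z" using z by (auto simp: u_def intro: tendstoD)
   then show ?case by eventually_elim (simp add: A_def dist_norm)
  qed
  have lim0: "(%j. (NI x. ennreal (q x) * indicator (- A j) x)) ---> 0" if q: "q \<in> bm" "(NI x. ennreal (q x)) < \<infinity>" for q
  proof -
   have "(%j. (NI x. ennreal (q x) * indicator (- A j) x)) ---> (\<integral>\<^sup>+x. 0 \<partial>(lborel::(real^'n) measure))"
   proof (intro nn_integral_dominated_convergence[where w="%x. ennreal (q x)"])
    show "AEL x. (%j. ennreal (q x) * indicator (- A j) x) ---> 0"
     using A0 by eventually_elim (auto intro!: tendsto_eventually elim!: eventually_mono)
   qed (use q in \<open>auto intro!: AE_I2 split: split_indicator\<close>)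
   then show ?thesis by simp
  qed
  have l1: "(%j. ennreal (B / t) * (NI x. ennreal (phi x) * indicator (- A j) x)) ---> ennreal (B / t) * 0"
   by (intro tendsto_intros lim0) (auto simp: phi1)
  have l2: "(%j. ennreal B * (NI x. ennreal (norm (g x)) * indicator (- A j) x)) ---> ennreal B * 0"
   using N_less_top[OF g] by (intro tendsto_intros lim0) (auto simp: N_def)
  from l1 l2 have "\<forall>\<^sub>F j in sequentially. ennreal (B / t) * (NI x. ennreal (phi x) * indicator (- A j) x) < ennreal z &
    ennreal B * (NI x. ennreal (norm (g x)) * indicator (- A j) x) < ennreal z"
   using z by (intro eventually_conj order_tendstoD) auto
  then show ?thesis
  proof eventually_elim
   case (elim j)
   have I1: "(NI x. ennreal (norm (v k j x) * indicator (W k) x)) <= ennreal (s * (3 * K1 * Tf)) + ennreal (10 ^ CARD('n) * h k / s)"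
   proof -
    have "(NI x. ennreal (norm (v k j x) * indicator (W k) x)) <= ennreal (s / l k) * (NI x. ennreal ((norm (v k j x))\<^sup>2)) + ennreal (1 / (s / l k)) * (NI x. ennreal ((indicat_real (W k) x)\<^sup>2))"
     using s l[of k] by (intro nn_am_gm) auto
    also have "... <= ennreal (s / l k) * ennreal (3 * K1 * Tf * l k) + ennreal (1 / s) * (ennreal (l k) * em (W k))"
    proof (intro add_mono mult_left_mono v2)
     have "(NI x. ennreal ((indicat_real (W k) x)\<^sup>2)) = em (W k)"
     proof -
      have "(NI x. ennreal ((indicat_real (W k) x)\<^sup>2)) = (NI x. indicator (W k) x)"
       by (intro nn_integral_cong) (auto split: split_indicator)
      then show ?thesis by simp
     qed
     then show "ennreal (1 / (s / l k)) * (NI x. ennreal ((indicat_real (W k) x)\<^sup>2)) <= ennreal (1 / s) * (ennreal (l k) * em (W k))"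
      using s l[of k] by (simp add: mult.assoc[symmetric] ennreal_mult'[symmetric])
    qed auto
    also have "... <= ennreal (s * (3 * K1 * Tf)) + ennreal (1 / s) * ennreal (10 ^ CARD('n) * h k)"
     using s l[of k] by (intro add_mono mult_left_mono lW') (auto simp: ennreal_mult'[symmetric] mult.assoc)
    also have "... = ennreal (s * (3 * K1 * Tf)) + ennreal (10 ^ CARD('n) * h k / s)"
     using s by (simp add: ennreal_mult'[symmetric])
    finally show ?thesis .
   qed
   have I5: "(NI x. ennreal (norm (v k j x) * (phi x * indicator (- A j) x))) <= ennreal z + ennreal z"
   proof -
    have "(NI x. ennreal (norm (v k j x) * (phi x * indicator (- A j) x))) <= ennreal t * (NI x. ennreal ((norm (v k j x))\<^sup>2)) + ennreal (1 / t) * (NI x. ennreal ((phi x * indicator (- A j) x)\<^sup>2))"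
     using t phi by (intro nn_am_gm) auto
    also have "... <= ennreal t * ennreal K3 + ennreal (1 / t) * (ennreal B * (NI x. ennreal (phi x) * indicator (- A j) x))"
    proof (intro add_mono mult_left_mono)
     show "(NI x. ennreal ((norm (v k j x))\<^sup>2)) <= ennreal K3" using v2[of k j] by (simp add: K3_def)
     have "(NI x. ennreal ((phi x * indicator (- A j) x)\<^sup>2)) <= (NI x. ennreal B * (ennreal (phi x) * indicator (- A j) x))"
      using phi B0 by (intro nn_integral_mono) (auto simp: power2_eq_square ennreal_mult'[symmetric] split: split_indicator intro!: ennreal_leI mult_right_mono)
     then show "(NI x. ennreal ((phi x * indicator (- A j) x)\<^sup>2)) <= ennreal B * (NI x. ennreal (phi x) * indicator (- A j) x)"
      by (simp add: nn_integral_cmult)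
    qed auto
    also have "... <= ennreal z + ennreal z"
     using t elim(1) B0 by (intro add_mono) (auto simp: mult.assoc[symmetric] ennreal_mult'[symmetric] ennreal_leI)
    finally show ?thesis .
   qed
   \<comment> \<open>Three regions: on W estimate v and g separately; off W but in
     \<open>A j\<close> use v - g = (u - g) - w; off both estimate v and g separately again. The six
     terms on the right collect these cases.\<close>
   have pt: "ennreal (norm (v k j x - g x) * phi x) <= ennreal B * ennreal (norm (v k j x) * indicator (W k) x) + (ennreal B * (ennreal (norm (g x)) * indicator (W k) x)
     + (ennreal B * ennreal (norm (w k j x) * indicator (- W k) x) + (ennreal z * ennreal (phi x)
     + (ennreal (norm (v k j x) * (phi x * indicator (- A j) x)) + ennreal B * (ennreal (norm (g x)) * indicator (- A j) x)))))" for x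
   proof -
    have "norm (v k j x - g x) * phi x <= B * (norm (v k j x) * indicator (W k) x) + (B * (norm (g x) * indicator (W k) x)
     + (B * (norm (w k j x) * indicator (- W k) x) + (z * phi x
     + (norm (v k j x) * (phi x * indicator (- A j) x) + B * (norm (g x) * indicator (- A j) x)))))" (is "_ <= ?R")
    proof -
     have tri: "norm (v k j x - g x) <= norm (v k j x) + norm (g x)" by (rule norm_triangle_ineq4)
     have b1: "norm q * phi x <= B * norm q" for q :: complex
      using mult_right_mono[OF phi(2)[of x], of "norm q"] by (simp add: mult.commute)
     have nn: "0 <= B * norm q" "0 <= z * phi x" "0 <= norm q * phi x" for q :: complex using B0 phi z by auto
     consider "x \<in> W k" | "x \<notin> W k" "x \<in> A j" | "x \<notin> W k" "x \<notin> A j" by blast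
     then show ?thesis
     proof cases
      case 1
      have "norm (v k j x - g x) * phi x <= (norm (v k j x) + norm (g x)) * phi x" using tri phi by (intro mult_right_mono)
      also have "... <= B * norm (v k j x) + B * norm (g x)" using b1 by (simp add: distrib_right add_mono)
      finally show ?thesis using 1 nn(1)[of "g x"] nn(2) nn(3)[of "v k j x"]
       by (cases "x \<in> A j") (simp_all, linarith?)
     next
      case 2
      have "norm (v k j x - g x) <= norm (u j x - g x) + norm (w k j x)"
       using norm_triangle_ineq4[of "u j x - g x" "w k j x"] by (simp add: uvw[of j x k] algebra_simps)
      then have "norm (v k j x - g x) * phi x <= (z + norm (w k j x)) * phi x" using 2 phi by (intro mult_right_mono) (auto simp: A_def)
      also have "... <= z * phi x + B * norm (w k j x)" using b1 by (simp add: distrib_right)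
      finally show ?thesis using 2 by simp
     next
      case 3
      have "norm (v k j x - g x) * phi x <= (norm (v k j x) + norm (g x)) * phi x" using tri phi by (intro mult_right_mono)
      also have "... <= norm (v k j x) * phi x + B * norm (g x)" using b1 by (simp add: distrib_right)
      finally show ?thesis using 3 nn(1)[of "w k j x"] nn(2) by simp
     qed
    qed
    then have "ennreal (norm (v k j x - g x) * phi x) <= ennreal ?R" by (rule ennreal_leI)
    also have "... = ennreal B * ennreal (norm (v k j x) * indicator (W k) x) + (ennreal B * (ennreal (norm (g x)) * indicator (W k) x)
     + (ennreal B * ennreal (norm (w k j x) * indicator (- W k) x) + (ennreal z * ennreal (phi x)
     + (ennreal (norm (v k j x) * (phi x * indicator (- A j) x)) + ennreal B * (ennreal (norm (g x)) * indicator (- A j) x)))))"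
     using B0 z phi by (simp add: ennreal_mult ennreal_indicator)
    finally show ?thesis .
   qed
   have I: "(NI x. ennreal (norm (v k j x - g x) * phi x)) <= ennreal (8 * z)"
   proof -
    have "(NI x. ennreal (norm (v k j x - g x) * phi x)) <= ennreal B * (NI x. ennreal (norm (v k j x) * indicator (W k) x)) + (ennreal B * emeasure (mu g) (W k)
     + (ennreal B * (NI x. ennreal (norm (w k j x) * indicator (- W k) x)) + (ennreal z * (NI x. ennreal (phi x))
     + ((NI x. ennreal (norm (v k j x) * (phi x * indicator (- A j) x))) + ennreal B * (NI x. ennreal (norm (g x)) * indicator (- A j) x)))))"
     by (rule order_trans[OF nn_integral_mono[OF pt]]) (simp add: nn_integral_add nn_integral_cmult emeasure_density)
    \<comment> \<open>The terms contribute 2, 1, 1, 1, 2 and 1 times z; the pairing of w adds the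
      ninth.\<close>
    also have "... <= ennreal (2 * z) + (ennreal z + (ennreal z + (ennreal z + (ennreal (2 * z) + ennreal z))))"
    proof (intro add_mono)
     have "ennreal B * (NI x. ennreal (norm (v k j x) * indicator (W k) x)) <= ennreal B * (ennreal (s * (3 * K1 * Tf)) + ennreal (10 ^ CARD('n) * h k / s))"
      by (intro mult_left_mono I1) auto
     also have "... = ennreal (B * (s * (3 * K1 * Tf)) + B * (10 ^ CARD('n) * h k / s))"
      using B0 s K1 Tf muU(2)[of k] by (simp add: ennreal_mult'[symmetric] ennreal_plus[symmetric] distrib_left del: ennreal_plus)
     also have "... <= ennreal (2 * z)" using s(2) k(2) by (intro ennreal_leI) simp
     finally show "ennreal B * (NI x. ennreal (norm (v k j x) * indicator (W k) x)) <= ennreal (2 * z)" .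
     have "ennreal B * (NI x. ennreal (norm (w k j x) * indicator (- W k) x)) <= ennreal B * (ennreal (KD TYPE('n)) * (2 * emeasure (mu f) (U k)))"
      unfolding w_def by (intro mult_left_mono bW X) auto
     also have "... = ennreal (B * (KD TYPE('n) * (2 * h k)))"
      using B0 KD_pos[where 'n='n] muU(2)[of k] by (simp add: muU ennreal_two ennreal_mult'[symmetric])
     also have "... <= ennreal z" using k(3) by (intro ennreal_leI) simp
     finally show "ennreal B * (NI x. ennreal (norm (w k j x) * indicator (- W k) x)) <= ennreal z" .
     show "ennreal z * (NI x. ennreal (phi x)) <= ennreal z" by (simp add: phi1)
     show "(NI x. ennreal (norm (v k j x) * (phi x * indicator (- A j) x))) <= ennreal (2 * z)"
      using I5 z by (simp add: ennreal_plus[symmetric] del: ennreal_plus)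
    qed (use k elim in auto)
    also have "... = ennreal (8 * z)" using z by (simp add: ennreal_plus[symmetric] del: ennreal_plus)
    finally show ?thesis .
   qed
   have iu: "L1 (%x. u j x * CP d (x0 - x))" "L1 (%x. v k j x * CP d (x0 - x))" "L1 (%x. w k j x * CP d (x0 - x))"
    unfolding u_def v_def w_def by (rule conv_Q_pairing(2)[OF f X d] conv_Q_pairing(2)[OF f1 X d] conv_Q_pairing(2)[OF b X d])+
   have ig: "L1 (%x. g x * CP d (x0 - x))" using phi by (intro L1_mult_bounded(1)[OF g, where B=B]) (auto simp: phi_def)
   have "(LI x. u j x * CP d (x0 - x)) = (LI x. v k j x * CP d (x0 - x)) + (LI x. w k j x * CP d (x0 - x))"
    using iu by (simp add: uvw[of j _ k] distrib_right)
   then have "(LI x. u j x * CP d (x0 - x)) - (LI x. g x * CP d (x0 - x)) = (LI x. (v k j x - g x) * CP d (x0 - x)) + (LI x. w k j x * CP d (x0 - x))"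
    using iu ig by (simp add: left_diff_distrib)
   moreover have "norm (LI x. (v k j x - g x) * CP d (x0 - x)) <= 8 * z"
   proof -
    have "L1 (%x. (v k j x - g x) * CP d (x0 - x))" using iu ig by (simp add: left_diff_distrib)
    from integral_norm_bound_ennreal[OF this]
    have "ennreal (norm (LI x. (v k j x - g x) * CP d (x0 - x))) <= (NI x. ennreal (norm (v k j x - g x) * phi x))"
     using d by (simp add: norm_mult phi_def)
    also note I
    finally show ?thesis using z by simp
   qed
   moreover have "norm (LI x. w k j x * CP d (x0 - x)) <= z" using wpair[of k j] k(1) by simp
   ultimately show ?case using norm_triangle_ineq[of "(LI x. (v k j x - g x) * CP d (x0 - x))" "(LI x. w k j x * CP d (x0 - x))"] by simp
  qed
 qed
 show ?thesis
 proof (rule tendstoI)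
  fix r :: real assume "r > 0"
  then have "\<forall>\<^sub>F j in sequentially. norm ((LI x. u j x * CP d (x0 - x)) - (LI x. g x * CP d (x0 - x))) <= 9 * (r / 10)" by (intro main) simp
  then show "\<forall>\<^sub>F j in sequentially. dist (LI x. conv f (CQ (X j) i) x * CP d (x0 - x)) (LI x. g x * CP d (x0 - x)) < r"
   by eventually_elim (use \<open>r > 0\<close> in \<open>simp add: u_def dist_norm\<close>)
 qed
qed

lemma m_zero[simp]: "m i 0 = 0" by (simp add: m_def)

lemma p_measurable[measurable]: "p \<in> bm"
 using p(4) by (rule borel_measurable_continuous_onI)

lemma F_measurable[measurable]: "L1 f ==> F f \<in> bm"
 using continuous_F by (rule borel_measurable_continuous_onI)

lemma m_measurable[measurable]: "m i \<in> bm"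
 unfolding m_def[abs_def] by measurable

text \<open>Approaching the origin along the positive and the negative i-th axis, the multiplier is
  constantly -i and i. Continuity of both transforms gives two opposite values for the transform of
  g at 0, which is therefore 0.\<close>

lemma RR_nonzero:
 fixes f g :: "real^'n => complex"
 assumes f: "L1 f" and g: "L1 g" and main: "!!z. z ~= 0 ==> F g z = m i z * F f z"
 shows "RR i f g"
proof -
 define X where "X k = 1 / real (Suc k)" for k
 have X: "X k > 0" "X ---> 0" for k using LIMSEQ_Suc[OF lim_1_over_n] by (auto simp: X_def[abs_def])
 have "F g 0 = 0"
 proof -
  have lm: "(%k. F h (s *\<^sub>R X k *\<^sub>R axis i 1)) ---> F h 0" if "L1 h" for h :: "real^'n => complex" and s :: real
  proof -
   have "(%k. s *\<^sub>R X k *\<^sub>R axis i 1 :: real^'n) ---> s *\<^sub>R 0 *\<^sub>R axis i 1" by (intro tendsto_intros X)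
   then show ?thesis using continuous_on_tendsto_compose[OF continuous_F[OF that]] by simp
  qed
  have m1: "m i (s *\<^sub>R X k *\<^sub>R axis i 1) = - \<i> * of_real (sgn s)" if "s ~= 0" for s k
  proof -
   have "(s *\<^sub>R X k *\<^sub>R axis i 1 :: real^'n) $ i / norm (s *\<^sub>R X k *\<^sub>R axis i 1 :: real^'n) = sgn s"
    using X(1)[of k] that by (auto simp: sgn_real_def abs_if mult_less_0_iff not_less zero_le_mult_iff)
   then show ?thesis unfolding m_def by (simp only:)
  qed
  have "F g 0 = - \<i> * of_real (sgn s) * F f 0" if "s ~= 0" for s
  proof -
   have "(%k. - \<i> * of_real (sgn s) * F f (s *\<^sub>R X k *\<^sub>R axis i 1)) ---> - \<i> * of_real (sgn s) * F f 0"
    by (intro tendsto_intros lm f)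
   moreover have "F g (s *\<^sub>R X k *\<^sub>R axis i 1) = - \<i> * of_real (sgn s) * F f (s *\<^sub>R X k *\<^sub>R axis i 1)" for k
   proof -
    have "s *\<^sub>R X k *\<^sub>R axis i 1 ~= (0 :: real^'n)" using X(1)[of k] that by (simp add: axis_eq_0_iff)
    then show ?thesis by (simp only: main m1[OF that] not_False_eq_True)
   qed
   ultimately have "(%k. F g (s *\<^sub>R X k *\<^sub>R axis i 1)) ---> - \<i> * of_real (sgn s) * F f 0" by simp
   with lm[OF g, of s] show ?thesis by (rule LIMSEQ_unique)
  qed
  from this[of 1] this[of "-1"] show ?thesis by simp
 qed
 then have "F g z = m i z * F f z" for z using main[of z] by (cases "z = 0") auto
 then show ?thesis using f g by (simp add: RR_def)
qed

text \<open>Passing to the limit in \<open>conv_Q_pairing\<close> in two ways shows that the damped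
  difference of the two transforms itself has vanishing Fourier transform. It is continuous away
  from the origin, so it vanishes there, and the damping factor is positive for small d.\<close>

lemma tr_imp_RR:
 fixes f g :: "real^'n => complex"
 assumes f: "L1 f" and g: "L1 g" and lim: "AEL x. ((%e. tr e i f x) \<longlongrightarrow> g x) (at_right 0)"
 shows "RR i f g"
proof -
 define X where "X k = 1 / real (Suc k)" for k
 have X: "X k > 0" "X ---> 0" for k using LIMSEQ_Suc[OF lim_1_over_n] by (auto simp: X_def[abs_def])
 have XF: "filterlim X (at_right 0) sequentially"
 proof -
  have "X k ~= 0" for k using X(1)[of k] by simp
  then show ?thesis using X by (auto simp: filterlim_at intro!: always_eventually)
 qed
 have u: "AEL x. (%k. conv f (CQ (X k) i) x) ---> g x"
  using lim lebesgue_points[OF f]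
 proof eventually_elim
  case (elim x)
  have "((%e. tr e i f x - (tr e i f x - conv f (CQ e i) x)) \<longlongrightarrow> g x - 0) (at_right 0)"
   by (intro tendsto_diff elim(1) tr_diff_tendsto f elim(2))
  from filterlim_compose[OF this XF] show ?case by simp
 qed
 have [measurable]: "F f \<in> bm" "F g \<in> bm" using f g by measurable
 have eq: "(F g z - m i z * F f z) * cr (p (d * norm z)) = 0" if z: "z ~= 0" and d: "d > 0" for z d
 proof (rule F_eq_0_imp[of "%z. (F g z - m i z * F f z) * cr (p (d * norm z))"])
  define k where "k z = (F g z - m i z * F f z) * cr (p (d * norm z))" for z
  define C where "C = (LI x. norm (g x)) + (LI x. norm (f x))"
  have b: "norm (F g z - m i z * F f z) <= C" for z
  proof -
   have "norm (m i z * F f z) <= norm (F f z)" using norm_m_le[of i z] by (simp add: norm_mult mult_left_le_one_le)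
   then show ?thesis using norm_triangle_ineq4[of "F g z" "m i z * F f z"] norm_F_le[OF f, of z] norm_F_le[OF g, of z] by (simp add: C_def)
  qed
  have kL: "L1 k" unfolding k_def by (rule L1_mult_bounded(2)[OF p_L1[OF d] _ b]) measurable
  then show "L1 (%z. (F g z - m i z * F f z) * cr (p (d * norm z)))" by (simp add: k_def[abs_def])
  show "norm ((F g z - m i z * F f z) * cr (p (d * norm z))) <= C" for z
   using order_trans[OF mult_left_le[of "p (d * norm z)" "norm (F g z - m i z * F f z)"] b[of z]] p(1,2)[of "d * norm z"] by (simp add: norm_mult)
  have "isCont (F g) z" "isCont (F f) z" using continuous_F[OF g] continuous_F[OF f] by (auto simp: continuous_on_eq_continuous_at)
  moreover have "isCont (%z. p (d * norm z)) z" for z :: "real^'n"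
  proof -
   have "continuous_on UNIV (%z::real^'n. p (d * norm z))"
    by (rule continuous_on_compose2[OF p(4)]) (auto intro!: continuous_intros)
   then show ?thesis by (simp add: continuous_on_eq_continuous_at)
  qed
  ultimately show "isCont (%z. (F g z - m i z * F f z) * cr (p (d * norm z))) z"
   unfolding m_def using z by (intro continuous_intros) auto
  fix y
  define G where "G z = cr (p (d * norm z)) * E z (-y)" for z :: "real^'n"
  have G: "L1 G" unfolding G_def by (rule L1_E[OF p_L1[OF d]])
  have mfb: "norm (F f z * m i z) <= (LI x. norm (f x))" for z
   using norm_m_le[of i z] norm_F_le[OF f, of z] order_trans[OF mult_left_le[of "norm (m i z)" "norm (F f z)"]] by (simp add: norm_mult)
  have i1: "L1 (%z. F g z * G z)" by (rule L1_mult_bounded(2)[OF G _ norm_F_le[OF g]]) measurable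
  have i2: "L1 (%z. (F f z * m i z) * G z)" by (rule L1_mult_bounded(2)[OF G _ mfb]) measurable
  have "(%k. (LI x. conv f (CQ (X k) i) x * CP d (-y - x))) ---> (LI x. g x * CP d (-y - x))"
   by (rule tr_limit_pairing[OF f g u X(1) d])
  moreover have "(%k. (LI x. conv f (CQ (X k) i) x * CP d (-y - x))) ---> (LI z. (F f z * m i z) * G z)"
   unfolding conv_Q_pairing(1)[OF f X(1) d] G_def[symmetric]
  proof (rule integral_dominated_convergence[where w="%z. norm ((F f z * m i z) * G z)"])
   show "AE z in lborel. (%k. F f z * (m i z * cr (p (X k * norm z))) * G z) ---> F f z * m i z * G z"
   proof (rule AE_I2)
    fix z :: "real^'n"
    have "(%k. p (X k * norm z)) ---> 1" using filterlim_compose[OF p_tendsto XF] .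
    then have "(%k. F f z * (m i z * cr (p (X k * norm z))) * G z) ---> F f z * (m i z * cr 1) * G z"
     by (intro tendsto_intros)
    then show "(%k. F f z * (m i z * cr (p (X k * norm z))) * G z) ---> F f z * m i z * G z" by simp
   qed
   show "AE z in lborel. norm (F f z * (m i z * cr (p (X k * norm z))) * G z) <= norm (F f z * m i z * G z)" for k
    using p(1,2) by (intro AE_I2) (auto simp: norm_mult mult.assoc intro!: mult_left_mono mult_left_le_one_le)
   show "L1 (%z. norm (F f z * m i z * G z))" using i2 by (rule integrable_norm)
  qed (use G in measurable)
  ultimately have "conv g (CP d) (-y) = (LI z. (F f z * m i z) * G z)"
   unfolding conv_eq by (rule LIMSEQ_unique)
  then have "(LI z. F g z * G z) = (LI z. (F f z * m i z) * G z)"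
   by (simp add: conv_P[OF g d] G_def mult.assoc)
  then have "(LI z. F g z * G z - (F f z * m i z) * G z) = 0" using i1 i2 by simp
  then show "F (%z. (F g z - m i z * F f z) * cr (p (d * norm z))) y = 0"
   unfolding F_def[of "%z. (F g z - m i z * F f z) * cr (p (d * norm z))"] G_def
   by (simp add: algebra_simps)
 qed
 have main: "F g z = m i z * F f z" if z: "z ~= 0" for z
 proof -
  have "\<forall>\<^sub>F d in at_right 0. p (d * norm z) > 0 & d > 0"
   by (intro eventually_conj order_tendstoD(1)[OF p_tendsto] eventually_at_right_less) auto
  then obtain d where "p (d * norm z) > 0" "d > 0" using eventually_happens by fastforce
  then show ?thesis using eq[OF z, of d] by simp
 qed
 then show ?thesis by (rule RR_nonzero[OF f g])
qed

section \<open>The space \<open>H1\<close> in terms of the multiplier relation\<close>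

lemma ex_borel_version:
 fixes f :: "real^'n => complex"
 assumes "integrable lebesgue f"
 shows "\<exists>f'. L1 f' & (AEL x. f x = f' x)"
proof -
 have "f \<in> borel_measurable lebesgue" using assms by auto
 then have "(%x. Re (f x)) \<in> borel_measurable lebesgue" "(%x. Im (f x)) \<in> borel_measurable lebesgue" by measurable
 from this[THEN completion_ex_borel_measurable_real] obtain a b where
  ab: "a \<in> borel_measurable lborel" "AEL x. Re (f x) = a x" "b \<in> borel_measurable lborel" "AEL x. Im (f x) = b x" by blast
 define f' where "f' x = Complex (a x) (b x)" for x
 have m: "f' \<in> borel_measurable lborel"
  using ab unfolding f'_def[abs_def] by (subst borel_measurable_complex_iff) auto
 have ae: "AEL x. f x = f' x" using ab(2,4) by eventually_elim (simp add: f'_def complex_eq_iff)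
 have "integrable lebesgue f'"
  using assms ae m by (subst integrable_cong_AE[of _ _ f]) (auto simp: AE_completion_iff measurable_completion intro: AE_completion)
 then show ?thesis using ae m by (auto simp: integrable_completion)
qed

lemma axis_sum: "(\<chi> i. h i) = (\<Sum>i\<in>UNIV. axis i (h i :: complex))"
 by (simp add: vec_eq_iff axis_def if_distrib sum.delta cong: if_cong)

lemma norm_axis_complex: "norm (axis i (z::complex) :: complex^'n) = norm z"
 unfolding norm_vec_def L2_set_def by (subst sum.remove[of _ i]) (auto simp: axis_def)

lemma bounded_linear_axis: "bounded_linear (axis i :: complex => complex^'n)"
proof (rule bounded_linear_intro[where K=1])
 show "norm (axis i x :: complex^'n) <= norm x * 1" for x :: complex by (simp add: norm_axis_complex)
qed (auto simp: vec_eq_iff axis_def)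

lemma integral_vec:
 fixes h :: "'n::finite => 'x => complex"
 assumes "!!i. integrable M (h i)"
 shows "integrable M (%x. \<chi> i. h i x)" "(\<integral>x. (\<chi> i. h i x) \<partial>M) = (\<chi> i. \<integral>x. h i x \<partial>M)"
proof -
 have i: "integrable M (%x. axis i (h i x) :: complex^'n)" for i
  by (rule integrable_bounded_linear[OF bounded_linear_axis assms])
 then show "integrable M (%x. \<chi> i. h i x)" unfolding axis_sum by auto
 have "(\<integral>x. axis i (h i x) \<partial>M) = (axis i (\<integral>x. h i x \<partial>M) :: complex^'n)" for i
  by (rule integral_bounded_linear[OF bounded_linear_axis assms])
 then show "(\<integral>x. (\<chi> i. h i x) \<partial>M) = (\<chi> i. \<integral>x. h i x \<partial>M)"
  unfolding axis_sum using i by (simp add: Bochner_Integration.integral_sum)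
qed

lemma truncated_riesz_eq:
 fixes f f' :: "real^'n => complex"
 assumes f': "L1 f'" and ae: "AEL x. f x = f' x" and f: "integrable lebesgue f" and e: "e > 0"
 shows "truncated_riesz f e x = (\<chi> i. tr e i f' x)"
proof -
 have [measurable]: "f' \<in> bm" using f' by auto
 define h where "h i y = f' (x - y) * cr (Zt e i y)" for i y
 have hL: "L1 (h i)" for i unfolding h_def by (rule conv_Q_tr(2)[OF f' e])
 have aex: "AE y in lborel. f (x - y) = f' (x - y)"
 proof -
  have d: "distr lborel borel (%y. x - y) = (lborel :: (real^'n) measure)"
   using lborel_affine[of "-1" x] by (simp add: density_1)
  then have "AE y in distr lborel borel (%y. x - y). f y = f' y" using ae by (subst d)
  from AE_distrD[OF _ this] show ?thesis by simp
 qed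
 have eq: "AE y in lborel. indicator {y. e < norm y} y *\<^sub>R (\<chi> i. f (x - y) * cr (riesz_kernel y $ i)) = (\<chi> i. h i y)"
  using aex by eventually_elim (auto simp: h_def Zt_def vec_eq_iff split: split_indicator)
 have hv: "(%y. \<chi> i. h i y) \<in> borel_measurable lborel" using integral_vec(1)[of lborel h] hL by auto
 have "truncated_riesz f e x = (\<integral>y. indicator {y. e < norm y} y *\<^sub>R (\<chi> i. f (x - y) * cr (riesz_kernel y $ i)) \<partial>lebesgue)"
  by (simp add: truncated_riesz_def set_lebesgue_integral_def)
 also have "... = (\<integral>y. (\<chi> i. h i y) \<partial>lebesgue)"
 proof (rule integral_cong_AE)
  show hm: "(%y. \<chi> i. h i y) \<in> borel_measurable lebesgue" using hv by (rule measurable_completion)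
  show "AE y in lebesgue. indicator {y. e < norm y} y *\<^sub>R (\<chi> i. f (x - y) * cr (riesz_kernel y $ i)) = (\<chi> i. h i y)"
   using eq by (rule AE_completion)
  have "AE y in lebesgue. (\<chi> i. h i y) = indicator {y. e < norm y} y *\<^sub>R (\<chi> i. f (x - y) * cr (riesz_kernel y $ i))"
   using AE_completion[OF eq] by eventually_elim simp
  from borel_measurable_AE[OF hm this]
  show "(%y. indicat_real {y. e < norm y} y *\<^sub>R (\<chi> i. f (x - y) * cr (riesz_kernel y $ i))) \<in> borel_measurable lebesgue" .
 qed
 also have "... = (LI y. (\<chi> i. h i y))" using hv by (rule integral_completion)
 also have "... = (\<chi> i. tr e i f' x)" using integral_vec(2)[of lborel h, OF hL] by (simp add: h_def tr_def)
 finally show ?thesis .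
qed

lemma L1_norm_eq: "L1_norm f = N f"
 by (simp add: L1_norm_def N_def nn_integral_completion)

lemma N_cong_AE: "AEL x. f x = g x ==> N f = N g"
 unfolding N_def by (intro nn_integral_cong_AE) (auto elim!: eventually_mono)

text \<open>With \<open>H1_D\<close>, the only passage between the principal value definition and
  the relation \<open>RR\<close>; the argument continues with Borel representatives and Fourier
  transforms. The norm formula is exact because the principal value equals the g_i almost
  everywhere.\<close>

lemma H1_I:
 fixes f f' :: "real^'n => complex"
 assumes R: "!!i. RR i f' (g i)" and ae: "AEL x. f x = f' x"
 shows "f \<in> H1" "H1_norm f = N f' + N (%x. \<chi> i. g i x)" "AEL x. riesz f x = (\<chi> i. g i x)"
proof -
 have f': "L1 f'" and g: "L1 (g i)" for i using R[of i] by (auto simp: RR_def)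
 have fint: "integrable lebesgue f"
 proof (rule integrable_cong_AE_imp)
  show "integrable lebesgue f'" using f' by (subst integrable_completion) auto
  show ae': "AE x in lebesgue. f' x = f x" using AE_completion[OF ae] by eventually_elim simp
  show "f \<in> borel_measurable lebesgue" using f' by (intro borel_measurable_AE[OF _ ae'] measurable_completion) auto
 qed
 have "AEL x. \<forall>i. ((%e. tr e i f' x) \<longlongrightarrow> g i x) (at_right 0)"
  using RR_imp_tr[OF R] by (simp add: AE_all_countable)
 then have lim: "AEL x. ((%e. truncated_riesz f e x) \<longlongrightarrow> (\<chi> i. g i x)) (at_right 0)"
 proof eventually_elim
  case (elim x)
  have "((%e. \<chi> i. tr e i f' x) \<longlongrightarrow> (\<chi> i. g i x)) (at_right 0)"
   using elim by (intro vec_tendstoI) auto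
  moreover have "\<forall>\<^sub>F e in at_right 0. (\<chi> i. tr e i f' x) = truncated_riesz f e x"
   by (rule eventually_mono[OF eventually_at_right_less]) (simp add: truncated_riesz_eq[OF f' ae fint])
  ultimately show ?case by (rule Lim_transform_eventually)
 qed
 show rz: "AEL x. riesz f x = (\<chi> i. g i x)"
  using lim by eventually_elim (auto simp: riesz_def intro!: tendsto_Lim)
 have gL: "L1 (%x. \<chi> i. g i x)" using g by (rule integral_vec(1))
 have "integrable lebesgue (riesz f)"
 proof (rule integrable_cong_AE_imp)
  show "integrable lebesgue (%x. \<chi> i. g i x)" using gL by (subst integrable_completion) auto
  show ae': "AE x in lebesgue. (\<chi> i. g i x) = riesz f x" using AE_completion[OF rz] by eventually_elim simp
  show "riesz f \<in> borel_measurable lebesgue" using gL by (intro borel_measurable_AE[OF _ ae'] measurable_completion) auto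
 qed
 moreover have "AE x in lebesgue. \<exists>l. ((%e. truncated_riesz f e x) \<longlongrightarrow> l) (at_right 0)"
  using AE_completion[OF lim] by eventually_elim auto
 ultimately show "f \<in> H1" using fint by (simp add: H1_def)
 then show "H1_norm f = N f' + N (%x. \<chi> i. g i x)"
  unfolding H1_norm_def L1_norm_eq using N_cong_AE[OF ae] N_cong_AE[OF rz] by simp
qed

lemma H1_D:
 fixes f :: "real^'n => complex"
 assumes f: "f \<in> H1"
 shows "\<exists>f' g. (\<forall>i. RR i f' (g i)) & (AEL x. f x = f' x)"
proof -
 have fint: "integrable lebesgue f" and lim: "AEL x. \<exists>l. ((%e. truncated_riesz f e x) \<longlongrightarrow> l) (at_right 0)"
  and rint: "integrable lebesgue (riesz f)" using f by (auto simp: H1_def AE_completion_iff)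
 obtain f' where f': "L1 f'" "AEL x. f x = f' x" using ex_borel_version[OF fint] by blast
 have "\<exists>g. L1 g & (AEL x. riesz f x $ i = g x)" for i
 proof (rule ex_borel_version)
  have "bounded_linear (%v::complex^'n. v $ i)" by (rule bounded_linear_vec_nth)
  from integrable_bounded_linear[OF this rint] show "integrable lebesgue (%x. riesz f x $ i)" .
 qed
 then obtain g where g: "!!i. L1 (g i)" "!!i. AEL x. riesz f x $ i = g i x" by metis
 have "RR i f' (g i)" for i
 proof (rule tr_imp_RR[OF f'(1) g(1)])
  show "AEL x. ((%e. tr e i f' x) \<longlongrightarrow> g i x) (at_right 0)"
   using lim g(2)[of i]
  proof eventually_elim
   case (elim x)
   then obtain l where l: "((%e. truncated_riesz f e x) \<longlongrightarrow> l) (at_right 0)" by blast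
   then have "riesz f x = l" by (auto simp: riesz_def intro!: tendsto_Lim)
   then have "((%e. truncated_riesz f e x $ i) \<longlongrightarrow> g i x) (at_right 0)" using tendsto_vec_nth[OF l, of i] elim by simp
   moreover have "\<forall>\<^sub>F e in at_right 0. truncated_riesz f e x $ i = tr e i f' x"
    by (rule eventually_mono[OF eventually_at_right_less]) (simp add: truncated_riesz_eq[OF f' fint])
   ultimately show ?case by (rule Lim_transform_eventually)
  qed
 qed
 then show ?thesis using f'(2) by (intro exI[of _ f'] exI[of _ g]) auto
qed

section \<open>Linear substitutions, boxes and Fourier series on the cube\<close>

lemma linear_jacobian:
 fixes T S :: "'a::euclidean_space => 'a"
 assumes T: "linear T" and S: "linear S" and TS: "!!x. T (S x) = x" "!!x. S (T x) = x"
 obtains K where "K > 0" "!!f. f \<in> bm ==> (NI x. f (T x)) = ennreal K * (NI x. f x)"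
  "!!f::'a => complex. f \<in> bm ==> (LI x. f (T x)) = K *\<^sub>R (LI x. f x)"
proof -
 have cT: "continuous_on UNIV T" and cS: "continuous_on UNIV S" using T S by (auto intro: linear_continuous_on simp: linear_conv_bounded_linear)
 have [measurable]: "T \<in> bm" using cT by (rule borel_measurable_continuous_onI)
 have Tadd: "T (x + y) = T x + T y" and Sadd: "S (x + y) = S x + S y" and Tneg: "T (- x) = - T x" for x y
  using T S by (simp_all add: linear_add linear_neg)
 \<comment> \<open>Uniqueness of translation-invariant integration in the form of an identity:
   integrate f(Tx) g(y - Tx) over both variables, reflect x about S y to exchange the arguments, and
   integrate in the other order. Testing with the unit ball then fixes the constant.\<close>
 have ex: "(NI x. f (T x)) * (NI y. g y) = (NI x. f x) * (NI x. g (T x))"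
  if [measurable]: "f \<in> bm" "g \<in> bm" for f g :: "'a => ennreal"
 proof -
  have "(NI x. f (T x)) * (NI y. g y) = (NI x. f (T x) * (NI y. g (y - T x)))"
   using lborel_translate(2)[of g] by (simp add: nn_integral_multc)
  also have "... = (NI x. (NI y. f (T x) * g (y - T x)))"
   by (intro nn_integral_cong) (simp add: nn_integral_cmult)
  also have "... = (NI y. (NI x. f (T x) * g (y - T x)))" by (rule lborel_pair.Fubini'[symmetric]) measurable
  also have "... = (NI y. (NI x. f (y - T x) * g (T x)))"
  proof (rule nn_integral_cong)
   fix y
   have "(NI x. f (T x) * g (y - T x)) = (NI x. (%x. f (y - T x) * g (T x)) (S y - x))"
    using Tneg by (intro nn_integral_cong) (simp add: linear_diff[OF T] TS)
   then show "(NI x. f (T x) * g (y - T x)) = (NI x. f (y - T x) * g (T x))"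
    using lborel_reflect(2)[of "%x. f (y - T x) * g (T x)" "S y"] by simp
  qed
  also have "... = (NI x. (NI y. f (y - T x) * g (T x)))" by (rule lborel_pair.Fubini') measurable
  also have "... = (NI x. f x) * (NI x. g (T x))"
   using lborel_translate(2)[of f] by (simp add: nn_integral_multc nn_integral_cmult)
  finally show ?thesis .
 qed
 define B where "B = ball (0::'a) 1"
 have [measurable]: "B \<in> sets borel" by (simp add: B_def)
 have SB: "T -` B = S ` B"
 proof safe
  fix x assume "T x \<in> B"
  then have "S (T x) \<in> S ` B" by (rule imageI)
  then show "x \<in> S ` B" by (simp add: TS)
 qed (simp add: TS)
 have bB: "bounded (S ` B)" using S by (intro bounded_linear_image) (auto simp: B_def linear_conv_bounded_linear)
 have oB: "open (T -` B)" using cT by (intro open_vimage) (auto simp: B_def)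
 have gT: "(NI x. indicator B (T x)) = em (T -` B)"
 proof -
  have "(NI x. indicator B (T x)) = (NI x. indicator (T -` B) x)"
   by (intro nn_integral_cong) (auto split: split_indicator)
  then show ?thesis using oB by simp
 qed
 have fin: "em (T -` B) < \<infinity>" unfolding SB using bB by (rule emeasure_bounded_finite)
 have pos: "em (T -` B) ~= 0"
 proof -
  have "0 \<in> T -` B" using T by (simp add: B_def linear_0)
  then obtain r where r: "r > 0" "ball 0 r \<subseteq> T -` B" using oB by (meson open_contains_ball)
  have "0 < em (ball (0::'a) r)" using r by (simp add: emeasure_ball)
  also have "... <= em (T -` B)" using r oB by (intro emeasure_mono) auto
  finally show ?thesis by simp
 qed
 define V where "V = unit_ball_vol (real DIM('a))"
 have V: "V > 0" "em B = ennreal V" by (auto simp: V_def B_def emeasure_ball)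
 define M where "M = measure lborel (T -` B)"
 have M: "em (T -` B) = ennreal M" using fin by (simp add: M_def emeasure_eq_ennreal_measure less_top)
 have M0: "M > 0" using pos M by (auto simp: M_def less_le)
 define K where "K = M / V"
 have K: "K > 0" using V M0 by (simp add: K_def)
 have nn: "(NI x. f (T x)) = ennreal K * (NI x. f x)" if [measurable]: "f \<in> bm" for f :: "'a => ennreal"
 proof -
  let ?A = "(NI x. f (T x))" and ?I = "(NI x. f x)"
  have eq: "?A * ennreal V = ?I * ennreal M" using ex[of f "indicator B"] by (simp add: gT M V)
  have "?A = ?A * (ennreal V * ennreal (1 / V))" using V by (simp add: ennreal_mult[symmetric])
  also have "... = ?I * (ennreal M * ennreal (1 / V))" using eq by (simp only: mult.assoc[symmetric])
  also have "ennreal M * ennreal (1 / V) = ennreal K" using V M0 by (simp add: ennreal_mult[symmetric] K_def)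
  finally show ?thesis by (simp only: mult.commute)
 qed
 have distr: "distr lborel borel T = density lborel (%_. ennreal K)"
 proof (rule measure_eqI)
  fix A assume "A \<in> sets (distr lborel borel T)"
  then have [measurable]: "A \<in> sets borel" by simp
  have "emeasure (distr lborel borel T) A = (NI x. indicator A (T x))"
   by (subst nn_integral_distr[of T lborel borel "indicator A", symmetric]) auto
  also have "... = ennreal K * em A" by (subst nn) auto
  finally show "emeasure (distr lborel borel T) A = emeasure (density lborel (%_. ennreal K)) A"
   by (simp add: emeasure_density nn_integral_cmult_indicator)
 qed simp
 have "(LI x. f (T x)) = K *\<^sub>R (LI x. f x)" if [measurable]: "f \<in> bm" for f :: "'a => complex"
 proof -
  have "(LI x. f (T x)) = (\<integral>x. f x \<partial>distr lborel borel T)" by (simp add: integral_distr)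
  also have "... = K *\<^sub>R (LI x. f x)" unfolding distr using K by (subst integral_density) auto
  finally show ?thesis .
 qed
 with K nn show ?thesis by (rule that)
qed

lemma cis_integral:
 assumes a: "a >= 0"
 shows "integrable lborel (%t. indicator {-a..a} t *\<^sub>R cis (c * t))"
  "(LI t. indicator {-a..a} t *\<^sub>R cis (c * t)) = cr (if c = 0 then 2 * a else 2 * sin (a * c) / c)"
proof -
 have cont: "continuous_on S (%t. cis (c * t))" for S unfolding cis_conv_exp by (intro continuous_intros)
 then show "integrable lborel (%t. indicator {-a..a} t *\<^sub>R cis (c * t))" by (intro borel_integrable_compact) auto
 show "(LI t. indicator {-a..a} t *\<^sub>R cis (c * t)) = cr (if c = 0 then 2 * a else 2 * sin (a * c) / c)"
 proof (cases "c = 0")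
  case True
  then show ?thesis using a by (simp add: scaleR_conv_of_real)
 next
  case False
  define G where "G z = exp (\<i> * c * z) / (\<i> * c)" for z
  have "(G has_field_derivative exp (\<i> * c * z)) (at z)" for z
   unfolding G_def using False by (auto intro!: derivative_eq_intros)
  from has_vector_derivative_real_field[OF this]
  have "((%t. G (of_real t)) has_vector_derivative exp (\<i> * c * of_real t)) (at t within {-a..a})" for t .
  moreover have "exp (\<i> * c * of_real t) = cis (c * t)" for t by (simp add: cis_conv_exp mult.assoc)
  ultimately have "((%t. G (of_real t)) has_vector_derivative cis (c * t)) (at t within {-a..a})" for t by simp
  then have "(LI t. indicator {-a..a} t *\<^sub>R cis (c * t)) = G (of_real a) - G (of_real (-a))"
   using a cont by (intro integral_FTC_atLeastAtMost) auto
  also have "... = (cis (a * c) - cis (- (a * c))) / (\<i> * c)" by (simp add: G_def cis_conv_exp diff_divide_distrib mult_ac)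
  also have "... = cr (2 * sin (a * c) / c)" using False by (simp add: complex_eq_iff Re_divide Im_divide power2_eq_square)
  finally show ?thesis using False by simp
 qed
qed

text \<open>The closed box factors over coordinates, which gives its transform explicitly; by
  \<open>cube_AE\<close> the box of half-width 1/2 and the open \<open>frequency_cube\<close> differ
  by a null set.\<close>

definition Bx :: "real => (real^'n) set" where "Bx a = {x. \<forall>i. \<bar>x $ i\<bar> <= a}"

lemma Bx_measurable[measurable]: "Bx a \<in> sets borel"
 unfolding Bx_def by measurable

lemma Basis_vec: "(Basis :: (real^'n) set) = range (%i. axis i 1)"
 by (auto simp: Basis_vec_def)

lemma prod_Basis: "(\<Prod>b\<in>(Basis::(real^'n) set). f b) = (\<Prod>i\<in>UNIV. f (axis i 1))"
 unfolding Basis_vec by (subst prod.reindex) (auto simp: inj_on_def axis_eq_axis)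

lemma F_box:
 fixes y :: "real^'n"
 assumes a: "a >= 0"
 shows "L1 (%x::real^'n. indicator (Bx a) x *\<^sub>R (1::complex))"
  "F (%x. indicator (Bx a) x *\<^sub>R (1::complex)) y = (\<Prod>i\<in>UNIV. cr (if y $ i = 0 then 2 * a else sin (2 * pi * a * y $ i) / (pi * y $ i)))"
proof -
 define h where "h b t = indicator {-a..a} t *\<^sub>R cis ((- (2 * pi * (y \<bullet> b))) * t)" for b :: "real^'n" and t :: real
 have h: "integrable lborel (h b)" for b unfolding h_def using cis_integral(1)[OF a] by blast
 have eq: "(\<Prod>b\<in>Basis. h b (x \<bullet> b)) = indicator (Bx a) x *\<^sub>R E x (-y)" for x
 proof -
  have "(\<Prod>b\<in>Basis. h b (x \<bullet> b)) = (\<Prod>i\<in>UNIV. of_real (indicator {-a..a} (x $ i))) * (\<Prod>i\<in>UNIV. cis (- (2 * pi * (y $ i)) * x $ i))"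
   by (simp add: prod_Basis h_def inner_axis scaleR_conv_of_real prod.distrib)
  also have "(\<Prod>i\<in>UNIV. cr (indicator {-a..a} (x $ i))) = of_real (indicator (Bx a) x)"
  proof (cases "x \<in> Bx a")
   case False
   then obtain i where "\<not> \<bar>x $ i\<bar> <= a" by (auto simp: Bx_def)
   then have "x $ i \<notin> {-a..a}" by auto
   then have "\<exists>j\<in>UNIV. cr (indicator {-a..a} (x $ j)) = 0" by (intro bexI[of _ i]) auto
   then show ?thesis using False by (subst prod_zero) auto
  next
   case True
   then have "x $ i \<in> {-a..a}" for i by (auto simp: Bx_def abs_le_iff minus_le_iff)
   then show ?thesis using True by simp
  qed
  also have "(\<Prod>i\<in>UNIV. cis (- (2 * pi * (y $ i)) * x $ i)) = E x (-y)"
   by (simp add: E_def inner_vec_def cis_conv_exp exp_sum[symmetric] sum_distrib_left sum_negf mult_ac)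
  finally show ?thesis by (simp add: scaleR_conv_of_real)
 qed
 have "L1 (%x. indicator (Bx a) x *\<^sub>R E x (-y))" using lborel_prod_integral(2)[of h] h by (simp add: eq)
 then have "L1 (%x. indicator (Bx a) x *\<^sub>R E x (-y) * E x y)" by (rule L1_E)
 then show "L1 (%x::real^'n. indicator (Bx a) x *\<^sub>R (1::complex))" by (simp add: E_minus)
 have "F (%x. indicator (Bx a) x *\<^sub>R (1::complex)) y = (LI x. (\<Prod>b\<in>Basis. h b (x \<bullet> b)))" by (simp add: F_def eq)
 also have "... = (\<Prod>b\<in>Basis. (LI t. h b t))" using h by (intro lborel_prod_integral)
 also have "... = (\<Prod>i\<in>UNIV. cr (if y $ i = 0 then 2 * a else sin (2 * pi * a * y $ i) / (pi * y $ i)))"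
  unfolding prod_Basis
 proof (intro prod.cong refl)
  fix i
  show "(LI t. h (axis i 1) t) = cr (if y $ i = 0 then 2 * a else sin (2 * pi * a * y $ i) / (pi * y $ i))"
   unfolding h_def cis_integral(2)[OF a] by (auto simp: inner_axis mult_ac)
 qed
 finally show "F (%x. indicator (Bx a) x *\<^sub>R (1::complex)) y = (\<Prod>i\<in>UNIV. cr (if y $ i = 0 then 2 * a else sin (2 * pi * a * y $ i) / (pi * y $ i)))" .
qed

abbreviation lp :: "int^'n => real^'n" where "lp \<equiv> lattice_point"

lemma lp_simps[simp]: "lp 0 = 0" "lp (k + l) = lp k + lp l" "lp (k - l) = lp k - lp l" "lp (- k) = - lp k" "lp (axis i 1) = axis i 1"
 by (auto simp: lattice_point_def vec_eq_iff axis_def)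

lemma box_orthogonal: "(LI x. indicator (Bx (1/2)) x *\<^sub>R E x (lp k)) = (if k = 0 then 1 else 0)"
proof -
 have *: "(LI x. indicator (Bx (1/2)) x *\<^sub>R E x (lp k)) = F (%x. indicator (Bx (1/2)) x *\<^sub>R 1) (lp (-k))"
  by (simp add: F_def)
 show ?thesis
 proof (cases "k = 0")
  case True
  then show ?thesis unfolding * F_box(2)[of "1/2", simplified] by (simp add: lattice_point_def)
 next
  case False
  then obtain i where i: "k $ i ~= 0" by (auto simp: vec_eq_iff)
  have "sin (pi * real_of_int (k $ i)) = 0" using sin_zero_iff_int2 by (auto simp: mult.commute)
  then have "cr (if lp (-k) $ i = 0 then 2 * (1/2) else sin (2 * pi * (1/2) * lp (-k) $ i) / (pi * lp (-k) $ i)) = 0"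
   using i by (simp add: lattice_point_def del: lp_simps)
  then have "(\<Prod>i\<in>UNIV. cr (if lp (-k) $ i = 0 then 2 * (1/2) else sin (2 * pi * (1/2) * lp (-k) $ i) / (pi * lp (-k) $ i))) = 0"
   by (intro prod_zero) (simp, blast)
  then show ?thesis unfolding * using False by (subst F_box(2)) (auto simp del: lp_simps)
 qed
qed

lemma cube_measurable[measurable]: "(frequency_cube :: (real^'n) set) \<in> sets borel"
 unfolding frequency_cube_def by measurable

lemma cube_AE: "AE x in (lborel :: (real^'n) measure). (x \<in> frequency_cube) = (x \<in> Bx (1/2))"
proof -
 have ne: "AEL x. (x::real^'n) $ i ~= c" for i c
 proof (rule AE_I')
  have "{x. axis i (1::real) \<bullet> x = c} \<in> null_sets lebesgue"
   using negligible_hyperplane[of "axis i (1::real)" c] by (simp add: negligible_iff_null_sets axis_eq_0_iff)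
  then have "emeasure lebesgue {x. axis i (1::real) \<bullet> x = c} = 0" by auto
  moreover have "{x. axis i (1::real) \<bullet> x = c} \<in> sets borel" by measurable
  ultimately show "{x. axis i (1::real) \<bullet> x = c} \<in> null_sets lborel" by (auto simp: null_sets_def)
 qed (auto simp: inner_axis inner_commute)
 have "AEL x. \<forall>i. (x::real^'n) $ i ~= c" for c
  unfolding AE_all_countable using ne by blast
 from this[of "1/2"] this[of "-1/2"] show ?thesis
 proof eventually_elim
  case (elim x)
  have "(- 1/2 < x $ i & x $ i < 1/2) = (\<bar>x $ i\<bar> <= 1/2)" for i using elim(1)[rule_format, of i] elim(2)[rule_format, of i] by auto
  then show ?case by (simp add: frequency_cube_def Bx_def)
 qed
qed

text \<open>All Fourier coefficients on the torus vanish, for an integrable function on the whole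
  space.\<close>

definition vanish :: "(real^'n => complex) => bool" where
 "vanish g \<longleftrightarrow> L1 g & (\<forall>k. (LI x. g x * E x (lp k)) = 0)"

lemma half_bounds: "-1 <= c ==> c <= 1 ==> \<bar>(1 + c) / 2\<bar> <= 1 & 0 <= (1 + c) / 2 & (1 + c) / 2 <= (1::real)"
 by (auto simp: abs_le_iff field_simps)

text \<open>The factor is a trigonometric polynomial with frequencies 0 and plus or minus the i-th
  unit vector, so each new coefficient combines three old ones.\<close>

lemma vanish_factor:
 assumes g: "vanish g"
 shows "vanish (%x. g x * of_real ((1 + cos (2 * pi * (x $ i - a))) / 2))"
proof -
 have gL: "L1 g" and g0: "(LI x. g x * E x (lp k)) = 0" for k using g by (auto simp: vanish_def)
 have L: "L1 (%x. g x * of_real ((1 + cos (2 * pi * (x $ i - a))) / 2))"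
 proof (rule L1_mult_bounded(1)[OF gL, where B=1])
  show "norm (cr ((1 + cos (2 * pi * (x $ i - a))) / 2)) <= 1" for x
   using half_bounds[OF cos_ge_minus_one cos_le_one, of "2 * pi * (x $ i - a)"] by (simp only: norm_of_real)
 qed measurable
 have eq: "cr ((1 + cos (2 * pi * (x $ i - a))) / 2) = 1/2 + cis (- 2 * pi * a) / 4 * E x (lp (axis i 1)) + cis (2 * pi * a) / 4 * E x (lp (- axis i 1))" for x
 proof -
  have "E x (lp (axis i 1)) = cis (2 * pi * x $ i)" "E x (lp (- axis i 1)) = cis (- (2 * pi * x $ i))" by (simp_all add: E_def inner_axis)
  then show ?thesis by (simp add: complex_eq_iff cos_diff right_diff_distrib cis.ctr algebra_simps) (simp add: add_divide_distrib[symmetric])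
 qed
 have i: "L1 (%x. g x * E x (lp k))" for k by (rule L1_E[OF gL])
 have "(LI x. g x * of_real ((1 + cos (2 * pi * (x $ i - a))) / 2) * E x (lp k)) = 0" for k
 proof -
  have "(LI x. g x * of_real ((1 + cos (2 * pi * (x $ i - a))) / 2) * E x (lp k)) =
   (LI x. 1/2 * (g x * E x (lp k)) + cis (- 2 * pi * a) / 4 * (g x * E x (lp (k + axis i 1))) + cis (2 * pi * a) / 4 * (g x * E x (lp (k + (- axis i 1)))))"
   unfolding eq by (intro Bochner_Integration.integral_cong) (auto simp: E_add E_diff E_minus algebra_simps)
  also have "... = 1/2 * (LI x. g x * E x (lp k)) + cis (- 2 * pi * a) / 4 * (LI x. g x * E x (lp (k + axis i 1))) + cis (2 * pi * a) / 4 * (LI x. g x * E x (lp (k + (- axis i 1))))"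
   using i[of k] i[of "k + axis i 1"] i[of "k + (- axis i 1)"]
   by (simp del: lp_simps)
  also have "... = 0" unfolding g0 by simp
  finally show ?thesis .
 qed
 then show ?thesis using L by (simp add: vanish_def)
qed

text \<open>The classical concentration argument: powers of a nonnegative trigonometric polynomial
  \<open>tau\<close> with maximum 1 at x0 preserve vanishing coefficients, yet concentrate at x0,
  where h = Re (g / g(x0)) is positive. If g(x0) were nonzero, the mass near x0 would eventually
  exceed the rest.\<close>

lemma torus_unique:
 fixes g :: "real^'n => complex"
 assumes g: "vanish g" and supp: "!!x. x \<notin> frequency_cube ==> g x = 0" and x0: "x0 \<in> frequency_cube" and c: "isCont g x0"
 shows "g x0 = 0"
proof (rule ccontr)
 assume g0: "g x0 ~= 0"
 have gL: "L1 g" using g by (simp add: vanish_def)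
 define q where "q i x = (1 + cos (2 * pi * (x $ i - x0 $ i))) / 2" for i and x :: "real^'n"
 define tau where "tau x = (\<Prod>i\<in>UNIV. q i x)" for x
 have q: "0 <= q i x" "q i x <= 1" for i x unfolding q_def
  using half_bounds[OF cos_ge_minus_one cos_le_one, of "2 * pi * (x $ i - x0 $ i)"] by auto
 have tau: "0 <= tau x" "tau x <= 1" "tau x0 = 1" for x
  unfolding tau_def using q by (auto intro!: prod_nonneg prod_le_1 simp: q_def)
 have qm[measurable]: "q i \<in> bm" for i unfolding q_def[abs_def] by measurable
 have [measurable]: "tau \<in> bm" unfolding tau_def[abs_def] by measurable
 have step: "vanish (%x. h x * of_real (tau x))" if "vanish h" for h
 proof -
  have "vanish (%x. h x * of_real (\<Prod>i\<in>I. q i x))" if "finite I" for I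
   using that
  proof (induction I)
   case (insert i I)
   from vanish_factor[OF insert.IH, of i "x0 $ i"] insert show ?case by (simp add: q_def mult_ac)
  qed (use \<open>vanish h\<close> in simp)
  then show ?thesis by (simp add: tau_def)
 qed
 have van: "vanish (%x. g x * of_real (tau x ^ M))" for M
 proof (induction M)
  case (Suc M)
  from step[OF Suc] show ?case by (simp add: mult_ac)
 qed (use g in simp)
 define h where "h x = Re (g x / g x0)" for x
 have hL: "L1 h" unfolding h_def using gL by (intro integrable_Re) auto
 have h0: "(LI x. h x * tau x ^ M) = 0" for M
 proof -
  have "(LI x. g x * of_real (tau x ^ M)) = 0"
   using van[of M, unfolded vanish_def, THEN conjunct2, rule_format, of 0] by simp
  then have "Re ((LI x. g x * of_real (tau x ^ M)) / g x0) = 0" by simp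
  moreover have "L1 (%x. g x * of_real (tau x ^ M))" using van[of M] by (simp add: vanish_def)
  ultimately have "(LI x. Re (g x * of_real (tau x ^ M) / g x0)) = 0" by (subst integral_Re) auto
  moreover have "Re (g x * of_real (tau x ^ M) / g x0) = h x * tau x ^ M" for x
  proof -
   have "g x * of_real (tau x ^ M) / g x0 = g x / g x0 * cr (tau x ^ M)" by simp
   moreover have "Re (z * cr T) = Re z * T" for z T by simp
   ultimately show ?thesis unfolding h_def by (simp only:)
  qed
  ultimately show ?thesis by simp
 qed
 have xb: "\<bar>x0 $ i\<bar> < 1/2" for i
  using x0[unfolded frequency_cube_def, simplified, rule_format, of i] by (auto simp: abs_if)
 define d0 where "d0 = Min (range (%i. 1/2 - \<bar>x0 $ i\<bar>))"
 have d0: "d0 > 0" "d0 <= 1/2 - \<bar>x0 $ i\<bar>" for i using xb by (auto simp: d0_def)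
 have "((%x. Re (g x / g x0)) \<longlongrightarrow> Re (g x0 / g x0)) (at x0)"
  using c g0 by (intro tendsto_intros) (auto simp: isCont_def)
 then have "isCont h x0" by (simp add: isCont_def h_def[abs_def])
 then have "(h \<longlongrightarrow> h x0) (nhds x0)" unfolding isCont_def tendsto_at_iff_tendsto_nhds .
 moreover have "h x0 = 1" using g0 by (simp add: h_def)
 ultimately have "\<forall>\<^sub>F x in nhds x0. h x > 1/2" by (intro order_tendstoD(1)[of h "h x0"]) auto
 then obtain d1 where d1: "d1 > 0" "!!x. dist x x0 < d1 ==> h x > 1/2" by (auto simp: eventually_nhds_metric)
 \<comment> \<open>\<open>d <= d0\<close> keeps the distance to x0 modulo 1 at least d as well, so
   \<open>far\<close> holds on the whole cube; \<open>d <= 1/4\<close> makes the cosine nonnegative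
   and r0 positive; the last bound puts the coordinate box of size d inside the ball where h >
   1/2.\<close>
 define d where "d = min d0 (min (1/4) (d1 / (2 * real CARD('n))))"
 have d: "d > 0" "d <= d0" "d <= 1/4" "d * real CARD('n) < d1"
 proof -
  show "d > 0" using d0 d1 by (simp add: d_def)
  show "d <= d0" "d <= 1/4" by (auto simp: d_def)
  have "d * real CARD('n) <= d1 / (2 * real CARD('n)) * real CARD('n)" by (intro mult_right_mono) (auto simp: d_def)
  then show "d * real CARD('n) < d1" using d1 by simp
 qed
 define r0 where "r0 = (1 + cos (2 * pi * d)) / 2"
 have "cos (2 * pi * d) < cos 0" using d by (intro cos_monotone_0_pi) auto
 moreover have "cos (2 * pi * d) >= 0"
 proof -
  have "0 <= 2 * pi * d" "2 * pi * d <= pi / 2" using d mult_left_mono[of d "1/4" "2 * pi"] by auto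
  then show ?thesis using cos_ge_zero[of "2 * pi * d"] pi_gt_zero by linarith
 qed
 ultimately have r0: "0 < r0" "r0 < 1" by (auto simp: r0_def)
 have far: "tau x <= r0" if "x \<in> frequency_cube" "\<bar>x $ i - x0 $ i\<bar> >= d" for x i
 proof -
  define t where "t = \<bar>x $ i - x0 $ i\<bar>"
  have "\<bar>x $ i\<bar> < 1/2"
   using that(1)[unfolded frequency_cube_def, simplified, rule_format, of i] by (auto simp: abs_if)
  then have t: "d <= t" "t <= 1 - d" using that d0(2)[of i] d(2) by (auto simp: t_def)
  have "cos (2 * pi * t) <= cos (2 * pi * d)"
  proof (cases "t <= 1/2")
   case True
   then show ?thesis using t d by (intro cos_monotone_0_pi_le) auto
  next
   case False
   have "cos (2 * pi * t) = cos (2 * pi * (1 - t))" by (simp add: right_diff_distrib cos_diff)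
   also have "... <= cos (2 * pi * d)" using t d False by (intro cos_monotone_0_pi_le) auto
   finally show ?thesis .
  qed
  moreover have "cos (2 * pi * (x $ i - x0 $ i)) = cos (2 * pi * t)"
   unfolding t_def using cos_minus[of "2 * pi * (x $ i - x0 $ i)"] by (cases "x $ i - x0 $ i >= 0") (auto simp: algebra_simps abs_if)
  ultimately have "q i x <= r0" by (simp add: q_def r0_def)
  moreover have "tau x <= q i x"
  proof -
   have "tau x = q i x * (\<Prod>j\<in>UNIV - {i}. q j x)" unfolding tau_def by (subst prod.remove[of _ i]) auto
   also have "... <= q i x" using q by (intro mult_left_le prod_le_1) auto
   finally show ?thesis .
  qed
  ultimately show ?thesis by simp
 qed
 have near: "h x > 1/2" if "!!i. \<bar>x $ i - x0 $ i\<bar> < d" for x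
 proof (rule d1(2))
  have "norm (x - x0) <= (\<Sum>i\<in>UNIV. \<bar>(x - x0) $ i\<bar>)" by (rule norm_le_l1_cart)
  also have "... <= (\<Sum>i\<in>(UNIV::'n set). d)" using that by (intro sum_mono less_imp_le) auto
  also have "... < d1" using d(4) by (simp add: mult.commute)
  finally show "dist x x0 < d1" by (simp add: dist_norm)
 qed
 \<comment> \<open>Strictly between r0 and 1: \<open>tau\<close> exceeds r1 near x0 and is at most
   r0 far away, so the ratio (r0/r1)^M decides.\<close>
 define r1 where "r1 = (1 + r0) / 2"
 have r1: "r0 < r1" "r1 < 1" using r0 by (auto simp: r1_def)
 have "isCont tau x0" unfolding tau_def q_def by (intro continuous_intros) auto
 then have "(tau \<longlongrightarrow> tau x0) (nhds x0)" unfolding isCont_def tendsto_at_iff_tendsto_nhds .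
 then have "\<forall>\<^sub>F x in nhds x0. tau x > r1" using r1 tau(3)
  by (intro order_tendstoD(1)[of tau "tau x0"]) auto
 then obtain d2 where d2: "d2 > 0" "!!x. dist x x0 < d2 ==> tau x > r1" by (auto simp: eventually_nhds_metric)
 define r where "r = min d2 d"
 have r: "r > 0" using d2 d by (simp add: r_def)
 define C where "C = (LI x. \<bar>h x\<bar>)"
 define V where "V = measure lborel (ball x0 r)"
 have V: "V > 0" using r content_ball_pos[of r x0] by (simp add: V_def)
 have key: "V * r1 ^ M / 2 <= r0 ^ M * C" for M
 proof -
  have ib: "L1 (%x. r1 ^ M / 2 * indicat_real (ball x0 r) x)"
   using emeasure_lborel_ball_finite[of x0 r] by (intro integrable_mult_right) (simp add: integrable_indicator_iff)
  have ia: "L1 (%x. r0 ^ M * \<bar>h x\<bar>)" using hL by auto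
  have it: "L1 (%x. h x * tau x ^ M)"
   by (rule Bochner_Integration.integrable_bound[OF hL]) (use hL tau in \<open>auto simp: abs_mult power_abs intro!: mult_left_le power_le_one AE_I2\<close>)
  have "(LI x. r1 ^ M / 2 * indicat_real (ball x0 r) x - r0 ^ M * \<bar>h x\<bar>) <= (LI x. h x * tau x ^ M)"
  proof (intro integral_mono)
   show "L1 (%x. r1 ^ M / 2 * indicat_real (ball x0 r) x - r0 ^ M * \<bar>h x\<bar>)" using ib ia by auto
   fix x
   show "r1 ^ M / 2 * indicat_real (ball x0 r) x - r0 ^ M * \<bar>h x\<bar> <= h x * tau x ^ M"
   proof (cases "\<forall>i. \<bar>x $ i - x0 $ i\<bar> < d")
    case True
    then have hx: "h x > 1/2" by (intro near) auto
    show ?thesis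
    proof (cases "x \<in> ball x0 r")
     case x: True
     then have "tau x > r1" using d2(2)[of x] by (simp add: r_def dist_commute)
     then have "r1 ^ M <= tau x ^ M" using r1 r0 by (intro power_mono) auto
     then have "1/2 * r1 ^ M <= h x * tau x ^ M" using hx r1 r0 by (intro mult_mono) auto
     moreover have "0 <= r0 ^ M * \<bar>h x\<bar>" using r0 by simp
     ultimately show ?thesis using x by simp
    next
     case False
     have "0 <= r0 ^ M * \<bar>h x\<bar>" "0 <= h x * tau x ^ M" using r0 hx tau by auto
     then show ?thesis using False by simp
    qed
   next
    case False
    then obtain i where i: "\<bar>x $ i - x0 $ i\<bar> >= d" by (auto simp: not_less)
    have nb: "x \<notin> ball x0 r"
    proof
     assume "x \<in> ball x0 r"
     then have "norm (x - x0) < d" by (simp add: r_def dist_norm norm_minus_commute)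
     then show False using component_le_norm_cart[of "x - x0" i] i by simp
    qed
    show ?thesis
    proof (cases "x \<in> frequency_cube")
     case True
     have "tau x ^ M <= r0 ^ M" using far[OF True i] tau by (intro power_mono) auto
     then have "\<bar>h x\<bar> * tau x ^ M <= \<bar>h x\<bar> * r0 ^ M" by (intro mult_left_mono) auto
     moreover have "- (\<bar>h x\<bar> * tau x ^ M) <= h x * tau x ^ M"
     proof -
      have "\<bar>h x * tau x ^ M\<bar> = \<bar>h x\<bar> * tau x ^ M" using tau(1)[of x] by (simp add: abs_mult)
      then show ?thesis using abs_ge_minus_self[of "h x * tau x ^ M"] by linarith
     qed
     ultimately have "- (\<bar>h x\<bar> * r0 ^ M) <= h x * tau x ^ M" by linarith
     then show ?thesis using nb by (simp add: mult.commute)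
    next
     case out: False
     then have "h x = 0" using supp by (simp add: h_def)
     then show ?thesis using nb by simp
    qed
   qed
  qed (rule it)
  moreover have "(LI x. r1 ^ M / 2 * indicat_real (ball x0 r) x - r0 ^ M * \<bar>h x\<bar>) = r1 ^ M / 2 * V - r0 ^ M * C"
   using ib ia by (simp add: V_def C_def)
  ultimately show ?thesis using h0[of M] by (simp add: mult.commute)
 qed
 have "V / 2 <= C * (r0 / r1) ^ M" for M
 proof -
  have "V / 2 * r1 ^ M <= C * r0 ^ M" using key[of M] by (simp add: mult_ac)
  then show ?thesis using r0 r1 by (simp add: power_divide pos_le_divide_eq)
 qed
 moreover have "(%M. C * (r0 / r1) ^ M) ---> C * 0"
  using r0 r1 by (intro tendsto_intros LIMSEQ_power_zero) auto
 ultimately have "V / 2 <= C * 0" by (intro tendsto_lowerbound[of "%M. C * (r0 / r1) ^ M" _ sequentially]) auto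
 then show False using V by simp
qed

section \<open>Sums over the lattice and a band-limited kernel\<close>

lemma infsum_nn_integral:
 fixes f :: "'c => ennreal"
 assumes A: "countable A"
 shows "infsum f A = (\<integral>\<^sup>+k. f k \<partial>count_space A)"
proof (rule antisym)
 have sup: "infsum f A = (SUP S\<in>{S. finite S & S \<subseteq> A}. sum f S)" by (rule nonneg_infsum_complete) auto
 show "infsum f A <= (\<integral>\<^sup>+k. f k \<partial>count_space A)" unfolding sup
 proof (rule SUP_least)
  fix S assume "S \<in> {S. finite S & S \<subseteq> A}"
  then have "sum f S = (\<integral>\<^sup>+k. f k * indicator S k \<partial>count_space A)"
   by (subst nn_integral_count_space'[of S]) (auto intro!: sum.cong)
  also have "... <= (\<integral>\<^sup>+k. f k \<partial>count_space A)" by (intro nn_integral_mono) (auto split: split_indicator)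
  finally show "sum f S <= (\<integral>\<^sup>+k. f k \<partial>count_space A)" .
 qed
 define S where "S m = {x \<in> A. to_nat_on A x <= m}" for m :: nat
 have fin: "finite (S m)" for m
 proof (rule inj_on_finite[of "to_nat_on A" _ "{..m}"])
  show "inj_on (to_nat_on A) (S m)" using inj_on_to_nat_on[OF A] by (rule inj_on_subset) (auto simp: S_def)
 qed (auto simp: S_def)
 have "(SUP m. f k * indicator (S m) k) = f k" if "k \<in> A" for k
 proof (rule antisym)
  have "f k = f k * indicator (S (to_nat_on A k)) k" using that by (simp add: S_def)
  also have "... <= (SUP m. f k * indicator (S m) k)" by (rule SUP_upper) simp
  finally show "f k <= (SUP m. f k * indicator (S m) k)" .
 qed (auto intro!: SUP_least split: split_indicator)
 then have "(\<integral>\<^sup>+k. f k \<partial>count_space A) = (\<integral>\<^sup>+k. (SUP m. f k * indicator (S m) k) \<partial>count_space A)"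
  by (intro nn_integral_cong) auto
 also have "... = (SUP m. \<integral>\<^sup>+k. f k * indicator (S m) k \<partial>count_space A)"
  by (rule nn_integral_monotone_convergence_SUP) (auto simp: incseq_def le_fun_def S_def split: split_indicator)
 also have "... <= infsum f A"
 proof (rule SUP_least)
  fix m
  have "(\<integral>\<^sup>+k. f k * indicator (S m) k \<partial>count_space A) = sum f (S m)"
   using fin[of m] by (subst nn_integral_count_space'[of "S m"]) (auto intro!: sum.cong simp: S_def)
  also have "... <= infsum f A" unfolding sup using fin by (intro SUP_upper) (auto simp: S_def)
  finally show "(\<integral>\<^sup>+k. f k * indicator (S m) k \<partial>count_space A) <= infsum f A" .
 qed
 finally show "(\<integral>\<^sup>+k. f k \<partial>count_space A) <= infsum f A" .
qed

lemma countable_lattice: "countable (UNIV :: (int^'n) set)"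
proof -
 have "(UNIV :: (int^'n) set) = range vec_lambda" by (metis surjI vec_lambda_eta)
 then show ?thesis by (metis countable_image countableI_type)
qed

abbreviation lat :: "(int^'n) measure" where "lat \<equiv> count_space UNIV"

abbreviation (input) lsum :: "(int^'n => 'b::{banach,second_countable_topology}) => 'b" (binder "LK " 10)
 where "lsum f == lebesgue_integral lat f"

abbreviation (input) nsum :: "(int^'n => ennreal) => ennreal" (binder "NK " 10)
 where "nsum f == nn_integral lat f"

lemma sigma_lat: "sigma_finite_measure lat"
 by (rule sigma_finite_measure_count_space_countable[OF countable_lattice])

lemma joint_lat: "(!!k. h k \<in> borel_measurable Na) ==> (%(k::int^'n, x). h k x) \<in> borel_measurable (lat \<Otimes>\<^sub>M Na)"
 by (rule measurable_pair_measure_countable1[OF countable_lattice]) auto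

lemma l1_norm_eq: "l1_norm s = (NK k. norm (s k))"
 by (simp add: l1_norm_def infsum_nn_integral[OF countable_lattice])

text \<open>Each one-dimensional factor is bounded and decays like 1/|t|. Spending the decay of a
  single coordinate at a time and summing over the coordinates yields one full power of |y|; further
  powers come from convolving the box with itself.\<close>

lemma Fbox_bound:
 assumes a: "a > 0"
 obtains r K where "!!y::real^'n. F (%x. indicator (Bx a) x *\<^sub>R (1::complex)) y = cr (r y)"
  "!!y. \<bar>r y\<bar> * (1 + norm y) <= K" "r 0 ~= 0"
proof -
 define f where "f t = (if t = 0 then 2 * a else sin (2 * pi * a * t) / (pi * t))" for t
 define r where "r y = (\<Prod>i\<in>UNIV. f (y $ i))" for y :: "real^'n"
 define c where "c = max 1 (2 * a)"
 have f1: "\<bar>f t\<bar> <= c" for t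
 proof -
  have "\<bar>f t\<bar> <= 2 * a"
  proof (cases "t = 0")
   case False
   have "\<bar>sin (2 * pi * a * t)\<bar> <= 2 * a * \<bar>pi * t\<bar>" using abs_sin_x_le_abs_x[of "2 * pi * a * t"] a by (simp add: abs_mult mult_ac)
   then show ?thesis using False by (simp add: f_def abs_mult abs_divide divide_le_eq)
  qed (use a in \<open>simp add: f_def\<close>)
  then show ?thesis by (simp add: c_def)
 qed
 have f2: "\<bar>f t\<bar> * (1 + \<bar>t\<bar>) <= 2 * c" for t
 proof -
  have "\<bar>f t\<bar> * \<bar>t\<bar> <= 1"
  proof (cases "t = 0")
   case False
   have "\<bar>sin (2 * pi * a * t)\<bar> <= 1" by simp
   also have "1 <= pi" using pi_gt3 by simp
   finally show ?thesis using False by (simp add: f_def abs_mult abs_divide divide_le_eq)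
  qed simp
  also have "1 <= c" by (simp add: c_def)
  finally show ?thesis using f1[of t] by (simp add: distrib_left)
 qed
 have c: "c >= 1" by (simp add: c_def)
 have ri: "\<bar>r y\<bar> * (1 + \<bar>y $ i\<bar>) <= 2 * c ^ CARD('n)" for y i
 proof -
  have "\<bar>r y\<bar> * (1 + \<bar>y $ i\<bar>) = (\<bar>f (y $ i)\<bar> * (1 + \<bar>y $ i\<bar>)) * (\<Prod>j\<in>UNIV - {i}. \<bar>f (y $ j)\<bar>)"
   unfolding r_def abs_prod by (subst prod.remove[of _ i]) auto
  also have "... <= (2 * c) * (\<Prod>j\<in>UNIV - {i}. c)"
  proof (rule mult_mono)
   show "(\<Prod>j\<in>UNIV - {i}. \<bar>f (y $ j)\<bar>) <= (\<Prod>j\<in>UNIV - {i}. c)" using f1 by (intro prod_mono) auto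
  qed (use f2 c in \<open>auto intro: prod_nonneg\<close>)
  also have "... = 2 * c ^ CARD('n)" using c by (simp add: card_Diff_singleton power_eq_if)
  finally show ?thesis .
 qed
 show ?thesis
 proof (rule that[of r "real CARD('n) * (2 * c ^ CARD('n))"])
  show "F (%x. indicator (Bx a) x *\<^sub>R (1::complex)) y = cr (r y)" for y
   unfolding F_box(2)[OF less_imp_le[OF a]] r_def f_def of_real_prod ..
  show "\<bar>r y\<bar> * (1 + norm y) <= real CARD('n) * (2 * c ^ CARD('n))" for y
  proof -
   have "1 + norm y <= (\<Sum>i\<in>UNIV. 1 + \<bar>y $ i\<bar>)"
    using norm_le_l1_cart[of y] by (simp add: sum.distrib) (smt (verit) One_nat_def of_nat_1 of_nat_mono Suc_le_eq zero_less_card_finite)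
   then have "\<bar>r y\<bar> * (1 + norm y) <= (\<Sum>i\<in>UNIV. \<bar>r y\<bar> * (1 + \<bar>y $ i\<bar>))"
    unfolding sum_distrib_left[symmetric] by (intro mult_left_mono) auto
   also have "... <= (\<Sum>i\<in>(UNIV::'n set). 2 * c ^ CARD('n))" by (intro sum_mono ri)
   finally show ?thesis by simp
  qed
  show "r 0 ~= 0" using a by (simp add: r_def f_def)
 qed
qed

lemma conv_power:
 fixes h :: "real^'n => complex"
 assumes h: "L1 h" "!!x. norm (h x) <= 1" "!!x. h x ~= 0 ==> x \<in> Bx a"
 shows "\<exists>k B. L1 k & (\<forall>x. norm (k x) <= B) & (\<forall>x. k x ~= 0 --> x \<in> Bx (real (Suc j) * a)) & (\<forall>y. F k y = F h y ^ Suc j)"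
proof (induction j)
 case 0
 show ?case using h by (intro exI[of _ h] exI[of _ 1]) auto
next
 case (Suc j)
 then obtain k B where k: "L1 k" "!!x. norm (k x) <= B" "!!x. k x ~= 0 ==> x \<in> Bx (real (Suc j) * a)" "!!y. F k y = F h y ^ Suc j" by blast
 have [measurable]: "k \<in> bm" using k by auto
 have "norm (conv h k x) <= B * (LI y. norm (h y))" for x
 proof -
  have "norm (conv h k x) <= (LI y. norm (h y * k (x - y)))" unfolding conv_eq by (rule integral_norm_bound)
  also have "... <= (LI y. B * norm (h y))"
   using h(1) k(2) by (intro integral_mono integrable_norm L1_mult_bounded(1)[where B=B]) (auto simp: norm_mult mult.commute[of B] intro!: mult_left_mono)
  finally show ?thesis by simp
 qed
 moreover have "x \<in> Bx (real (Suc (Suc j)) * a)" if "conv h k x ~= 0" for x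
 proof (rule ccontr)
  assume x: "x \<notin> Bx (real (Suc (Suc j)) * a)"
  have "h y * k (x - y) = 0" for y
  proof (rule ccontr)
   assume "h y * k (x - y) ~= 0"
   then have "y \<in> Bx a" "x - y \<in> Bx (real (Suc j) * a)" using h(3) k(3) by auto
   then have "\<bar>y $ i\<bar> <= a" "\<bar>x $ i - y $ i\<bar> <= real (Suc j) * a" for i by (auto simp: Bx_def)
   then have "\<bar>x $ i\<bar> <= a + real (Suc j) * a" for i
    using add_mono[of "\<bar>y $ i\<bar>" a "\<bar>x $ i - y $ i\<bar>" "real (Suc j) * a"] abs_triangle_ineq[of "y $ i" "x $ i - y $ i"] by simp
   then have "x \<in> Bx (real (Suc (Suc j)) * a)" by (simp add: Bx_def algebra_simps)
   then show False using x by simp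
  qed
  then have "(%y. h y * k (x - y)) = (%_. 0)" by (rule ext)
  then show False using that by (simp add: conv_eq del: mult_eq_0_iff)
 qed
 ultimately show ?case using conv[OF h(1) k(1)] k(4)
  by (intro exI[of _ "conv h k"] exI[of _ "B * (LI y. norm (h y))"]) auto
qed

text \<open>The kernel is the normalised transform of an iterated convolution of boxes, so inversion
  confines its spectrum to a box. The decay exceeds that of \<open>P 1\<close> by one power, which
  makes the first moment finite, as \<open>riesz_of_average\<close> requires.\<close>

lemma band_limited_exists:
 assumes c: "c > 0"
 obtains th :: "real^'n => complex" and C0 where "continuous_on UNIV th" "!!x. norm (th x) * (1 + norm x) <= C0 * P 1 x"
  "!!y i. F th y ~= 0 ==> \<bar>y $ i\<bar> <= c" "F th 0 = 1"
proof -
 define N where "N = CARD('n) + 1"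
 \<comment> \<open>The 2N-fold convolution of a box of half-width a lives in
   \<open>Bx (2 * N * a)\<close>, that is in \<open>Bx c\<close>.\<close>
 define a where "a = c / real (2 * N)"
 have a: "a > 0" using c by (simp add: a_def N_def)
 define h where "h x = indicator (Bx a) x *\<^sub>R (1::complex)" for x :: "real^'n"
 have hL: "L1 h" unfolding h_def using F_box(1)[of a] a by simp
 obtain r K where r: "!!y. F h y = cr (r y)" "!!y. \<bar>r y\<bar> * (1 + norm y) <= K" "r 0 ~= 0"
  using Fbox_bound[OF a] unfolding h_def by blast
 have "\<exists>k B. L1 k & (\<forall>x. norm (k x) <= B) & (\<forall>x. k x ~= 0 --> x \<in> Bx (real (Suc (2 * N - 1)) * a)) & (\<forall>y. F k y = F h y ^ Suc (2 * N - 1))"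
  by (rule conv_power[OF hL]) (auto simp: h_def indicator_def split: if_splits)
 moreover have "Suc (2 * N - 1) = 2 * N" by (simp add: N_def)
 moreover have "real (2 * N) * a = c" by (simp add: a_def N_def)
 ultimately obtain k B where k: "L1 k" "!!x. norm (k x) <= B" "!!x. k x ~= 0 ==> x \<in> Bx c" "!!y. F k y = F h y ^ (2 * N)" by metis
 \<comment> \<open>The even power makes R nonnegative with positive integral, so it can be
   normalised; 2N >= N + 1 powers of decay give \<open>P 1\<close> and the extra factor 1 +
   |y|.\<close>
 define R where "R y = r y ^ (2 * N)" for y
 have Fk: "F k = (%y. cr (R y))" using k(4) r(1) by (auto simp: R_def)
 have R0: "R y >= 0" "R 0 > 0" for y using r(3) by (auto simp: R_def power_mult)
 have Rb: "R y * (1 + norm y) <= K ^ (2 * N) / Pc TYPE('n) * P 1 y" for y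
 proof -
  have "(\<bar>r y\<bar> * (1 + norm y)) ^ (2 * N) <= K ^ (2 * N)" using r(2)[of y] by (intro power_mono) auto
  then have "R y * (1 + norm y) ^ (2 * N) <= K ^ (2 * N)" by (simp add: R_def power_mult_distrib power_mult)
  moreover have "(1 + norm y) * (1 + norm y) ^ N <= (1 + norm y) ^ (2 * N)"
   by (subst power_Suc[symmetric], rule power_increasing) (auto simp: N_def)
  ultimately have 1: "R y * ((1 + norm y) * (1 + norm y) ^ N) <= K ^ (2 * N)" using R0(1)[of y] by (meson mult_left_mono order_trans)
  have "sqrt (1 + (norm y)\<^sup>2) <= 1 + norm y" by (rule real_le_lsqrt) (auto simp: power2_eq_square algebra_simps)
  then have "sqrt (1 + (norm y)\<^sup>2) ^ N <= (1 + norm y) ^ N" by (intro power_mono) auto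
  then have "R y * (1 + norm y) * sqrt (1 + (norm y)\<^sup>2) ^ N <= R y * (1 + norm y) * (1 + norm y) ^ N"
   using R0(1)[of y] by (intro mult_left_mono) auto
  with 1 have "R y * (1 + norm y) * sqrt (1 + (norm y)\<^sup>2) ^ N <= K ^ (2 * N)" by (simp add: mult.assoc)
  moreover have "sqrt (1 + (norm y)\<^sup>2) ^ N > 0" by (simp add: add_pos_nonneg)
  ultimately have "R y * (1 + norm y) <= K ^ (2 * N) / sqrt (1 + (norm y)\<^sup>2) ^ N" by (simp add: pos_le_divide_eq)
  then show ?thesis using Pc_pos[where 'n='n] by (simp add: P_def N_def)
 qed
 have Rc: "continuous_on UNIV (%y. cr (R y))" using continuous_F[OF k(1)] by (simp add: Fk)
 then have Rc': "continuous_on UNIV R" using continuous_on_Re[OF Rc] by simp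
 have [measurable]: "R \<in> bm" using Rc' by (rule borel_measurable_continuous_onI)
 define C where "C = K ^ (2 * N) / Pc TYPE('n)"
 have Rb': "R y <= C * P 1 y" for y
 proof -
  have "R y * 1 <= R y * (1 + norm y)" using R0 by (intro mult_left_mono) auto
  then show ?thesis using Rb[of y] by (simp add: C_def)
 qed
 have RL: "L1 R"
 proof (rule Bochner_Integration.integrable_bound)
  show "L1 (%y. C * P 1 (y::real^'n))" by (intro integrable_mult_right P_L1) simp
 qed (use Rb' R0 in \<open>auto intro: order_trans[OF _ abs_ge_self]\<close>)
 define I where "I = (LI y. R y)"
 have I: "I > 0"
 proof -
  have "\<forall>\<^sub>F y in nhds 0. R y > R 0 / 2"
   using Rc' R0(2) by (intro order_tendstoD(1)[of R "R 0"]) (auto simp: continuous_on_eq_continuous_at isCont_def tendsto_at_iff_tendsto_nhds)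
  then obtain d where d: "d > 0" "!!y. dist y 0 < d ==> R y > R 0 / 2" by (auto simp: eventually_nhds_metric)
  have "(LI y. R 0 / 2 * indicator (ball (0::real^'n) d) y) <= I" unfolding I_def
  proof (rule integral_mono[OF _ RL])
   show "L1 (%y. R 0 / 2 * indicator (ball (0::real^'n) d) y)"
    using emeasure_lborel_ball_finite[of "0::real^'n" d] by (intro integrable_mult_right) (simp add: integrable_indicator_iff)
   show "R 0 / 2 * indicator (ball 0 d) y <= R y" for y
    using d(2)[of y] R0(1)[of y] by (auto simp: less_imp_le split: split_indicator)
  qed
  moreover have "(LI y. R 0 / 2 * indicator (ball (0::real^'n) d) y) = R 0 / 2 * measure lborel (ball (0::real^'n) d)" by simp
  moreover have "R 0 / 2 * measure lborel (ball (0::real^'n) d) > 0" using R0(2) d(1) content_ball_pos[of d "0::real^'n"] by simp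
  ultimately show ?thesis by linarith
 qed
 define th where "th y = cr (R y / I)" for y
 have FL: "L1 (F k)" unfolding Fk using RL by auto
 have thF: "th = (%y. cr (1 / I) * F k y)" by (auto simp: th_def Fk)
 show ?thesis
 proof (rule that[of th "C / I"])
  show "continuous_on UNIV th" unfolding th_def using Rc' I by (intro continuous_intros) auto
  show "norm (th x) * (1 + norm x) <= C / I * P 1 x" for x
  proof -
   have "norm (th x) = R x / I" using I R0(1)[of x] by (simp add: th_def norm_divide)
   then show ?thesis using divide_right_mono[OF Rb[of x] less_imp_le[OF I]] by (simp add: C_def)
  qed
  show "F th 0 = 1" using I by (simp add: F_def th_def I_def)
  show "\<bar>y $ i\<bar> <= c" if "F th y ~= 0" for y i
  proof (rule ccontr)
   assume n: "\<not> \<bar>y $ i\<bar> <= c"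
   define S where "S = {x :: real^'n. \<bar>x $ i\<bar> > c}"
   have S: "open S" "-y \<in> S" unfolding S_def using n by (auto intro!: open_Collect_less continuous_intros)
   have k0: "k x = 0" if "x \<in> S" for x using k(3)[of x] that by (auto simp: S_def Bx_def not_le[symmetric])
   have "(k \<longlongrightarrow> 0) (at (-y))"
    by (rule tendsto_eventually) (use eventually_at_topological S k0 in blast)
   then have "isCont k (-y)" using k0[OF S(2)] by (simp add: isCont_def)
   from inversion[OF k(1,2) this FL] have "(LI x. F k x * E x (-y)) = 0" using k0[OF S(2)] by simp
   then have "F (F k) y = 0" by (simp add: F_def[of "F k"])
   then show False using that unfolding thF F_cmult by simp
  qed
 qed
qed

lemma matrix_inv_both:
 fixes b :: "real^'n^'n"
 assumes "invertible b"
 shows "b ** matrix_inv b = mat 1" "matrix_inv b ** b = mat 1"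
 using someI_ex[OF assms[unfolded invertible_def]] by (simp_all add: matrix_inv_def)

text \<open>\<open>P 1\<close> varies by at most a fixed factor over balls of radius p, and these
  balls around the points of the lattice are disjoint, so the sum is bounded by a multiple of the
  integral, uniformly in x.\<close>

lemma lattice_sum_bound:
 fixes b :: "real^'n^'n"
 assumes b: "invertible b"
 obtains CL where "CL >= 0" "!!x. (NK k. ennreal (P 1 (x - b *v lp k))) <= ennreal CL"
proof -
 define A where "A = onorm ((*v) (matrix_inv b)) + 1"
 have bl: "bounded_linear ((*v) (matrix_inv b))" by simp
 have A: "A > 0" using onorm_pos_le[OF bl] by (simp add: A_def)
 note inv = matrix_inv_both[OF b]
 have low: "norm v <= A * norm (b *v v)" for v
 proof -
  have "v = matrix_inv b *v (b *v v)" by (simp add: matrix_vector_mul_assoc inv)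
  also have "norm ... <= onorm ((*v) (matrix_inv b)) * norm (b *v v)" by (rule onorm[OF bl])
  also have "... <= A * norm (b *v v)" by (intro mult_right_mono) (auto simp: A_def)
  finally show ?thesis .
 qed
 \<comment> \<open>Distinct lattice points have images under b at distance at least 1/A; half of
   this makes the balls disjoint.\<close>
 define p where "p = 1 / (2 * A)"
 have p: "p > 0" using A by (simp add: p_def)
 have sep: "k = l" if "v \<in> ball (b *v lp k) p" "v \<in> ball (b *v lp l) p" for k l :: "int^'n" and v
 proof (rule ccontr)
  assume "k ~= l"
  then obtain i where "k $ i ~= l $ i" by (auto simp: vec_eq_iff)
  then have "1 <= \<bar>(lp k - lp l) $ i\<bar>" by (simp add: lattice_point_def)
  also have "... <= norm (lp k - lp l)" by (rule component_le_norm_cart)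
  also have "... <= A * norm (b *v lp k - b *v lp l)" using low[of "lp k - lp l"] by (simp add: matrix_vector_mult_diff_distrib)
  also have "... < A * (2 * p)"
  proof (intro mult_strict_left_mono A)
   have "dist (b *v lp k) (b *v lp l) <= dist (b *v lp k) v + dist v (b *v lp l)" by (rule dist_triangle)
   also have "... < p + p" using that by (intro add_strict_mono) (auto simp: dist_commute)
   finally show "norm (b *v lp k - b *v lp l) < 2 * p" by (simp add: dist_norm)
  qed
  also have "... = 1" using A by (simp add: p_def)
  finally show False by simp
 qed
 define V where "V = unit_ball_vol (real CARD('n)) * p ^ CARD('n)"
 have V: "V > 0" using p by (simp add: V_def)
 have ball: "em (ball (x::real^'n) p) = ennreal V" for x using p by (simp add: V_def emeasure_ball)
 define M where "M = (1 + p) ^ (CARD('n) + 1)"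
 have M: "M > 0" using p by (simp add: M_def)
 have comp: "P 1 x <= M * P 1 y" if "norm (x - y) < p" for x y :: "real^'n"
 proof -
  define s where "s u = sqrt (1\<^sup>2 + (norm u)\<^sup>2)" for u :: "real^'n"
  have s: "s u >= 1" "norm u <= s u" "s u > 0" for u by (auto simp: s_def add_pos_nonneg intro!: real_le_rsqrt)
  have "s y <= (1 + p) * s x"
  proof -
   have ny: "norm y <= norm x + p" using that norm_triangle_ineq2[of y x] by (simp add: norm_minus_commute)
   have "(norm y)\<^sup>2 <= (norm x + p)\<^sup>2" using ny by (intro power_mono) auto
   also have "... <= (s x + p)\<^sup>2 - 1"
    using s(2)[of x] p by (simp add: s_def power2_eq_square algebra_simps)
   finally have "s y <= s x + p" unfolding s_def[of y] using s(3)[of x] p by (intro real_le_lsqrt) auto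
   also have "... <= (1 + p) * s x" using s(1)[of x] p by (simp add: algebra_simps)
   finally show ?thesis .
  qed
  then have "s y ^ (CARD('n) + 1) <= M * s x ^ (CARD('n) + 1)"
   unfolding M_def power_mult_distrib[symmetric] using s(3)[of y] by (intro power_mono) auto
  then have "1 / s x ^ (CARD('n) + 1) <= M * (1 / s y ^ (CARD('n) + 1))"
   using s(3)[of x] s(3)[of y] by (simp add: field_simps)
  then have "Pc TYPE('n) * (1 / s x ^ (CARD('n) + 1)) <= Pc TYPE('n) * (M * (1 / s y ^ (CARD('n) + 1)))"
   using Pc_pos[where 'n='n] by (intro mult_left_mono) auto
  then show ?thesis by (simp add: P_def s_def mult_ac)
 qed
 have main: "(NK k. ennreal (P 1 (x - b *v lp k))) <= ennreal (M / V)" for x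
 proof -
  have "ennreal (P 1 (x - b *v lp k)) * ennreal V <= ennreal M * (NI v. ennreal (P 1 (x - v)) * indicator (ball (b *v lp k) p) v)" for k
  proof -
   have "ennreal (P 1 (x - b *v lp k)) * ennreal V = (NI v. ennreal (P 1 (x - b *v lp k)) * indicator (ball (b *v lp k) p) v)"
    by (subst nn_integral_cmult_indicator) (auto simp: ball)
   also have "... <= (NI v. ennreal M * (ennreal (P 1 (x - v)) * indicator (ball (b *v lp k) p) v))"
   proof (intro nn_integral_mono)
    fix v
    have "P 1 (x - b *v lp k) <= M * P 1 (x - v)" if "v \<in> ball (b *v lp k) p"
     by (rule comp) (use that in \<open>simp add: dist_norm norm_minus_commute\<close>)
    then show "ennreal (P 1 (x - b *v lp k)) * indicator (ball (b *v lp k) p) v <= ennreal M * (ennreal (P 1 (x - v)) * indicator (ball (b *v lp k) p) v)"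
     using M by (auto simp: ennreal_mult[symmetric] intro!: ennreal_leI split: split_indicator)
   qed
   finally show ?thesis by (subst (asm) nn_integral_cmult) (auto simp del: mem_ball)
  qed
  then have "(NK k. ennreal (P 1 (x - b *v lp k)) * ennreal V) <= (NK k. ennreal M * (NI v. ennreal (P 1 (x - v)) * indicator (ball (b *v lp k) p) v))"
   by (intro nn_integral_mono)
  also have "... = ennreal M * (NI v. (NK k. ennreal (P 1 (x - v)) * indicator (ball (b *v lp k) p) v))"
  proof -
   interpret L: sigma_finite_measure "lat :: (int^'n) measure" by (rule sigma_lat)
   interpret pair_sigma_finite "lat :: (int^'n) measure" "lborel :: (real^'n) measure" ..
   have "(%(k, v). ennreal (P 1 (x - v)) * indicator (ball (b *v lp k) p) v) \<in> borel_measurable (lat \<Otimes>\<^sub>M lborel)"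
    by (rule joint_lat) (auto simp del: mem_ball)
   from Fubini[OF this] show ?thesis by (simp add: nn_integral_cmult)
  qed
  also have "... <= ennreal M * (NI v. ennreal (P 1 (x - v)))"
  proof (intro mult_left_mono nn_integral_mono)
   fix v
   have "(NK k. indicator (ball (b *v lp k) p) v) <= 1"
   proof -
    have "(NK k. indicator (ball (b *v lp k) p) v) = (NK k. indicator {k. v \<in> ball (b *v lp k) p} k)"
     by (intro nn_integral_cong) (auto split: split_indicator)
    also have "... = emeasure lat {k. v \<in> ball (b *v lp k) p}" by simp
    also have "... <= 1"
    proof (cases "\<exists>k. v \<in> ball (b *v lp k) p")
     case True
     then obtain k0 where "v \<in> ball (b *v lp k0) p" by blast
     then have "{k. v \<in> ball (b *v lp k) p} = {k0}" using sep by auto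
     then show ?thesis by simp
    next
     case False
     then have "{k. v \<in> ball (b *v lp k) p} = {}" by blast
     then show ?thesis by (simp only: emeasure_empty) simp
    qed
    finally show ?thesis .
   qed
   then have "ennreal (P 1 (x - v)) * (NK k. indicator (ball (b *v lp k) p) v) <= ennreal (P 1 (x - v)) * 1" by (intro mult_left_mono) auto
   then show "(NK k. ennreal (P 1 (x - v)) * indicator (ball (b *v lp k) p) v) <= ennreal (P 1 (x - v))"
    by (simp add: nn_integral_cmult)
  qed auto
  also have "... = ennreal M"
   using lborel_reflect(2)[of "%v. ennreal (P 1 v)" x] P_one[of 1, where 'n='n] by simp
  finally have "(NK k. ennreal (P 1 (x - b *v lp k))) * ennreal V <= ennreal M" by (simp add: nn_integral_multc)
  then have "(NK k. ennreal (P 1 (x - b *v lp k))) * ennreal V * ennreal (1 / V) <= ennreal M * ennreal (1 / V)" by (rule mult_right_mono) simp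
  then show ?thesis using V M by (simp add: mult.assoc ennreal_mult[symmetric])
 qed
 show ?thesis using M V by (intro that[OF _ main]) simp
qed

section \<open>Fourier series, sampling and the discrete Riesz transform\<close>

definition Shat :: "(int^'n => complex) => real^'n => complex" where
 "Shat s v = (LK k. s k * E (lp k) (-v))"

lemma continuous_Shat:
 fixes s :: "int^'n => complex"
 shows "integrable lat s ==> continuous_on UNIV (Shat s)"
proof (unfold continuous_on_sequentially, intro allI impI ballI)
 fix X and y :: "real^'n" assume s: "integrable lat s" and "(\<forall>n. X n \<in> UNIV) & X ---> y"
 then have "(%n. s k * E (lp k) (- X n)) ---> s k * E (lp k) (-y)" for k
  by (intro tendsto_intros continuous_on_tendsto_compose[of UNIV "E (lp k)"] continuous_intros) auto
 then show "(Shat s \<circ> X) ---> Shat s y"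
  unfolding Shat_def o_def using s
  by (intro integral_dominated_convergence[where w="%x. norm (s x)"]) (auto simp: norm_mult)
qed

lemma Shat_measurable[measurable]: "integrable lat s ==> Shat s \<in> bm"
 by (rule borel_measurable_continuous_onI[OF continuous_Shat])

lemma norm_Shat_le: "integrable lat s ==> norm (Shat s v) <= (LK k. norm (s k))"
 unfolding Shat_def using integral_norm_bound[of lat "%k. s k * E (lp k) (-v)"] by (simp add: norm_mult)

lemma Shat_pair:
 assumes s: "integrable lat s" and f: "L1 f"
 shows "L1 (%x. f x * Shat s x)"
  "(LI x. (f x * Shat s x) * E x (lp j)) = (LK k. s k * (LI x. f x * E x (lp (j - k))))"
proof -
 show "L1 (%x. f x * Shat s x)" by (rule L1_mult_bounded(1)[OF f]) (use s norm_Shat_le in auto)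
 define h where "h k x = s k * (f x * E x (lp (j - k)))" for k x
 have h: "L1 (h k)" for k unfolding h_def using L1_E[OF f] by auto
 have [measurable]: "f \<in> bm" using f by auto
 have "N (h k) = norm (s k) * N f" for k
  unfolding h_def by (subst N_cmult) (auto simp: N_def norm_mult)
 then have "(NK k. N (h k)) = (NK k. norm (s k)) * N f" by (simp add: nn_integral_multc)
 then have fin: "(NK k. N (h k)) < \<infinity>"
  using s N_less_top[OF f] by (auto simp: integrable_iff_bounded ennreal_mult_less_top)
 have jm: "(%(k, x). h k x) \<in> borel_measurable (lat \<Otimes>\<^sub>M lborel)" by (rule joint_lat) (use h in auto)
 have "(%x. (LK k. h k x)) = (%x. (f x * Shat s x) * E x (lp j))"
 proof
  fix x
  have "h k x = (f x * E x (lp j)) * (s k * E (lp k) (-x))" for k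
   by (simp add: h_def E_diff E_minus E_commute[of "lp k"])
  then show "(LK k. h k x) = (f x * Shat s x) * E x (lp j)"
   by (simp add: Shat_def)
 qed
 then show "(LI x. (f x * Shat s x) * E x (lp j)) = (LK k. s k * (LI x. f x * E x (lp (j - k))))"
  using mix(3)[OF sigma_lat jm fin, of 0] by (simp add: F_def) (simp add: h_def)
qed

lemma open_cube: "open (frequency_cube :: (real^'n) set)"
proof -
 have "frequency_cube = (\<Inter>i\<in>UNIV. {x::real^'n. - 1/2 < x $ i} \<inter> {x. x $ i < 1/2})" by (auto simp: frequency_cube_def)
 moreover have "open ..." by (intro open_INT open_Int ballI open_Collect_less continuous_intros) auto
 ultimately show ?thesis by simp
qed

lemma isCont_indicator_cube: "x \<in> frequency_cube ==> isCont (%x::real^'n. indicat_real frequency_cube x) x"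
proof -
 assume "x \<in> frequency_cube"
 then have "\<forall>\<^sub>F y in nhds x. y \<in> frequency_cube" using open_cube by (auto simp: eventually_nhds)
 then have "\<forall>\<^sub>F y in nhds x. indicat_real frequency_cube y = 1" by eventually_elim simp
 then show ?thesis by (subst isCont_cong[where g="%_. 1"]) auto
qed

text \<open>By orthogonality on the cube, the series cut off to the cube and g have the same
  coefficients; \<open>torus_unique\<close> applies to their difference at points of
  continuity.\<close>

lemma fourier_unique:
 fixes g :: "real^'n => complex"
 assumes s: "integrable lat s" and g: "L1 g" "!!x. x \<notin> frequency_cube ==> g x = 0"
  and co: "!!j. (LI x. g x * E x (lp j)) = s j" and x: "x \<in> frequency_cube" "isCont g x"
 shows "Shat s x = g x"
proof -
 define b where "b x = indicator (Bx (1/2)) x *\<^sub>R (1::complex)" for x :: "real^'n"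
 have b: "L1 b" using F_box(1)[of "1/2"] unfolding b_def[abs_def] by simp
 define h where "h x = indicat_real frequency_cube x *\<^sub>R Shat s x - g x" for x
 have ae: "AEL x. indicat_real frequency_cube x *\<^sub>R Shat s x = b x * Shat s x"
  using cube_AE by eventually_elim (auto simp: b_def split: split_indicator)
 have L: "L1 (%x. indicat_real frequency_cube x *\<^sub>R Shat s x)"
  by (rule integrable_cong_AE_imp[OF Shat_pair(1)[OF s b]]) (use ae s in \<open>auto elim!: eventually_mono\<close>)
 have "(LI x. h x * E x (lp j)) = 0" for j
 proof -
  have "(LI x. (indicat_real frequency_cube x *\<^sub>R Shat s x) * E x (lp j)) = (LI x. (b x * Shat s x) * E x (lp j))"
  proof (rule integral_cong_AE)
   show "AEL x. (indicat_real frequency_cube x *\<^sub>R Shat s x) * E x (lp j) = (b x * Shat s x) * E x (lp j)"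
    using ae by eventually_elim (simp only:)
  qed (use s b in auto)
  also have "... = (LK k. s k * (if j - k = 0 then 1 else 0))"
   unfolding Shat_pair(2)[OF s b] box_orthogonal[symmetric] by (simp add: b_def)
  also have "... = (LK k. indicator {j} k *\<^sub>R s j)" by (intro Bochner_Integration.integral_cong) (auto split: split_indicator)
  also have "... = s j" by (subst integral_scaleR_left) (auto simp: integrable_indicator_iff)
  finally show ?thesis
   unfolding h_def left_diff_distrib by (subst Bochner_Integration.integral_diff) (use L1_E[OF L] L1_E[OF g(1)] in \<open>simp_all add: co\<close>)
 qed
 then have vh: "vanish h" unfolding vanish_def h_def using L g(1) by auto
 have "isCont (Shat s) x" using continuous_Shat[OF s] by (simp add: continuous_on_eq_continuous_at)
 then have ch: "isCont h x" unfolding h_def[abs_def]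
  by (rule continuous_diff[OF continuous_scaleR[OF isCont_indicator_cube[OF x(1)]] x(2)])
 have "h x = 0" by (rule torus_unique[OF vh _ x(1) ch]) (simp add: h_def g(2))
 then show ?thesis using x(1) by (simp add: h_def)
qed

lemma norm_vec_le_sum: "norm v <= (\<Sum>i\<in>UNIV. norm (v $ i))" for v :: "complex^'n"
 unfolding norm_vec_def by (rule L2_set_le_sum) auto

lemma infsum_lat:
 fixes f :: "int^'n => 'b::{banach,second_countable_topology}"
 assumes "integrable lat f" shows "infsum f UNIV = (LK k. f k)"
 using infsetsum_infsum[of f UNIV] assms
 by (simp add: infsetsum_def Infinite_Set_Sum.abs_summable_on_def abs_summable_equivalent)

lemma vm_linear: "bounded_linear (%x. x v* A)" for A :: "real^'n^'m"
 unfolding transpose_matrix_vector[symmetric] by (rule matrix_vector_mul_bounded_linear)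

lemma vm_continuous: "continuous_on S (%x. x v* A)" for A :: "real^'n^'m"
 by (rule linear_continuous_on[OF vm_linear])

lemma vm_measurable[measurable]: "(%x. x v* A) \<in> bm" for A :: "real^'n^'m"
 by (rule borel_measurable_continuous_onI[OF vm_continuous])

text \<open>\<open>th\<close> is the band-limited kernel \<open>\<theta>\<close>; \<open>Kb\<close> is the Jacobian \<open>|det b|\<close> of the change of frequency variables.\<close>

locale band =
 fixes b :: "real^'n^'n" and nu th :: "real^'n => complex" and C0 CL Kb NB :: real
 assumes b: "invertible b"
  and nu: "continuous_on UNIV nu" "!!y. nu y ~= 0 ==> y \<in> frequency_cube" "!!y. norm (nu y) <= NB"
  and th: "continuous_on UNIV th" "!!x. norm (th x) * (1 + norm x) <= C0 * P 1 x" "F th 0 = 1"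
  and thF: "!!y. F th y ~= 0 ==> y v* b \<in> frequency_cube & nu (y v* b) = 1" "L1 (F th)"
  and CL: "CL >= 0" "!!x. (NK k. ennreal (P 1 (x - b *v lp k))) <= ennreal CL"
  and Kb: "Kb > 0" "!!f::real^'n => complex. f \<in> bm ==> (LI x. f (x v* matrix_inv b)) = Kb *\<^sub>R (LI x. f x)"
begin

abbreviation hn :: "(int^'n => complex) => ennreal" where "hn == h1_norm b nu"

lemma T_inv[simp]: "(x v* matrix_inv b) v* b = x" "(x v* b) v* matrix_inv b = x"
 using matrix_inv_both[OF b] by (simp_all add: vector_matrix_mul_assoc)

lemma nu_measurable[measurable]: "nu \<in> bm"
 and th_measurable[measurable]: "th \<in> bm"
 using nu(1) th(1) by (auto intro: borel_measurable_continuous_onI)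

lemma th_le: "norm (th x) <= C0 * P 1 x"
 using th(2)[of x] mult_left_mono[of 1 "1 + norm x" "norm (th x)"] by simp

lemma C0: "C0 >= 0"
proof -
 have "0 <= C0 * P 1 (0::real^'n)" using th_le[of 0] norm_ge_zero order_trans by blast
 then show ?thesis using P_pos[of 1 "0::real^'n"] by (simp add: zero_le_mult_iff)
qed

lemma th_bounded: "norm (th x) <= C0 * Pc TYPE('n)"
proof -
 have "1 <= sqrt (1\<^sup>2 + (norm x)\<^sup>2) ^ (CARD('n) + 1)" by (intro one_le_power) simp
 then have "P 1 x <= Pc TYPE('n)" using Pc_pos[where 'n='n] by (simp add: P_def divide_le_eq mult_le_cancel_left1)
 then show ?thesis using th_le[of x] C0 mult_left_mono order_trans by blast
qed

lemma th_L1: "L1 th"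
proof (rule Bochner_Integration.integrable_bound)
 show "L1 (%y. C0 * P 1 (y::real^'n))" by (intro integrable_mult_right P_L1) simp
qed (use th_le in \<open>auto intro: order_trans[OF _ abs_ge_self]\<close>)

text \<open>The i-th component of \<open>riesz_symbol\<close> extended by 0 from the cube, so that
  its integrals against exponentials are the components of \<open>discrete_riesz\<close>.\<close>

definition phi :: "'n => real^'n => complex" where
 "phi i x = indicat_real frequency_cube x *\<^sub>R (m i (x v* matrix_inv b) * nu x)"

lemma phi_L1: "L1 (phi i)"
proof (rule Bochner_Integration.integrable_bound)
 show "L1 (%x::real^'n. NB * norm (indicator (Bx (1/2)) x *\<^sub>R (1::complex)))"
  by (intro integrable_mult_right integrable_norm F_box) simp
 show "phi i \<in> borel_measurable lborel" unfolding phi_def[abs_def] by measurable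
 show "AEL x. norm (phi i x) <= norm (NB * norm (indicator (Bx (1/2)) x *\<^sub>R (1::complex)))"
  using cube_AE
 proof eventually_elim
  case (elim x)
  have "norm (m i (x v* matrix_inv b)) * norm (nu x) <= 1 * NB" using norm_m_le nu(3) by (intro mult_mono) auto
  then show ?case using elim by (auto simp: phi_def norm_mult split: split_indicator)
 qed
qed

definition W :: "(int^'n => complex) => 'n => int^'n => complex" where
 "W s i k = seq_conv s (discrete_riesz b nu) k $ i"

lemma discrete_riesz_eq: "discrete_riesz b nu k = (\<chi> i. (LI x. phi i x * E x (lp k)))"
proof -
 have L: "L1 (%x. phi i x * E x (lp k))" for i by (rule L1_E[OF phi_L1])
 have "indicat_real frequency_cube x *\<^sub>R (cis (2 * pi * (x \<bullet> lp k)) *s riesz_symbol b nu x) = (\<chi> i. phi i x * E x (lp k))" for x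
  by (auto simp: vec_eq_iff phi_def riesz_symbol_def E_def m_def split: split_indicator)
 then have "discrete_riesz b nu k = (\<integral>x. (\<chi> i. phi i x * E x (lp k)) \<partial>lebesgue)"
  by (simp add: discrete_riesz_def set_lebesgue_integral_def)
 also have "... = (LI x. (\<chi> i. phi i x * E x (lp k)))"
  using integral_vec(1)[of lborel "%i x. phi i x * E x (lp k)"] L by (intro integral_completion) auto
 also have "... = (\<chi> i. (LI x. phi i x * E x (lp k)))" by (rule integral_vec(2)[OF L])
 finally show ?thesis .
qed

text \<open>The convolution theorem read from product to coefficients: s is summable and the kernel
  z bounded, which suffices for Fubini, while the convolution itself may fail to be
  summable.\<close>

lemma W_eq:
 assumes s: "integrable lat s"
 shows "W s i j = (LI x. (phi i x * Shat s x) * E x (lp j))"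
proof -
 define h where "h i l = s l * (LI x. phi i x * E x (lp (j - l)))" for i l
 have "norm (LI x. phi i x * E x y) <= (LI x. norm (phi i x))" for i y
  using integral_norm_bound[of lborel "%x. phi i x * E x y"] by (simp add: norm_mult)
 note B = mult_left_mono[OF this norm_ge_zero]
 have h: "integrable lat (h i)" for i
 proof (rule Bochner_Integration.integrable_bound)
  show "integrable lat (%l. norm (s l) * (LI x. norm (phi i x)))" using s by auto
  show "AE l in lat. norm (h i l) <= norm (norm (s l) * (LI x. norm (phi i x)))"
   unfolding h_def using B by (auto simp: norm_mult intro!: order_trans[OF _ abs_ge_self])
 qed auto
 have "seq_conv s (discrete_riesz b nu) j = infsum (%l. \<chi> i. h i l) UNIV"
  unfolding seq_conv_def by (intro infsum_cong) (simp add: discrete_riesz_eq vec_eq_iff h_def)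
 also have "... = (LK l. (\<chi> i. h i l))" by (rule infsum_lat) (rule integral_vec(1)[OF h])
 also have "... = (\<chi> i. (LK l. h i l))" by (rule integral_vec(2)[OF h])
 finally show ?thesis using Shat_pair(2)[OF s phi_L1[of i], of j] by (simp add: W_def h_def)
qed

text \<open>Wherever the transform of \<open>th\<close> is nonzero the cut-off equals 1, so the
  discrete symbol coincides there with the continuous multiplier. The origin is left out because the
  symbol jumps there.\<close>

lemma W_hat:
 assumes s: "integrable lat s" and Ws: "integrable lat (W s i)" and y: "y ~= 0"
 shows "Shat (W s i) (y v* b) * F th y = m i y * (Shat s (y v* b) * F th y)"
proof (cases "F th y = 0")
 case False
 define x where "x = y v* b"
 have x: "x \<in> frequency_cube" "nu x = 1" "x v* matrix_inv b = y" using thF(1)[OF False] by (auto simp: x_def)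
 have "isCont (%x. m i (x v* matrix_inv b)) x"
 proof -
  have "isCont (%x. x v* matrix_inv b) x" using vm_continuous[of UNIV "matrix_inv b"] by (simp add: continuous_on_eq_continuous_at)
  then show ?thesis unfolding m_def using x(3) y by (intro continuous_intros) auto
 qed
 moreover have "isCont nu x" "isCont (Shat s) x" using nu(1) continuous_Shat[OF s] by (auto simp: continuous_on_eq_continuous_at)
 ultimately have ic: "isCont (%x. phi i x * Shat s x) x"
  unfolding phi_def by (intro continuous_intros isCont_indicator_cube x)
 have "Shat (W s i) x = phi i x * Shat s x"
 proof (rule fourier_unique[where g="%x. phi i x * Shat s x", OF Ws Shat_pair(1)[OF s phi_L1] _ _ x(1) ic])
  show "!!x. x \<notin> frequency_cube ==> phi i x * Shat s x = 0" by (simp add: phi_def)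
  show "!!j. (LI x. (phi i x * Shat s x) * E x (lp j)) = W s i j" by (simp only: W_eq[OF s])
 qed
 moreover have "phi i x = m i y" unfolding phi_def x(2,3) using x(1) by simp
 ultimately show ?thesis unfolding x_def[symmetric] by (simp only: mult.assoc)
qed simp

text \<open>Samples of the smoothed function on the lattice; the factor \<open>Kb\<close> makes
  their Fourier series equal to \<open>G f\<close> on the cube.\<close>

definition coef :: "(real^'n => complex) => int^'n => complex" where
 "coef f k = of_real Kb * conv f th (b *v lp k)"

definition G :: "(real^'n => complex) => real^'n => complex" where
 "G f x = F f (x v* matrix_inv b) * F th (x v* matrix_inv b)"

text \<open>\<open>th\<close> is dominated by \<open>P 1\<close>, whose lattice sums are bounded
  uniformly in the position; summing over k inside the convolution integral gives the
  constant.\<close>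

lemma coef_bound:
 assumes f: "L1 f"
 shows "(NK k. norm (coef f k)) <= ennreal (Kb * C0 * CL) * N f"
proof -
 have [measurable]: "f \<in> bm" using f by auto
 have "ennreal (norm (coef f k)) <= ennreal (Kb * C0) * (NI u. norm (f u) * ennreal (P 1 (u - b *v lp k)))" for k
 proof -
  have "ennreal (norm (coef f k)) <= ennreal Kb * (NI u. norm (f u * th (b *v lp k - u)))"
   using Kb(1) integral_norm_bound_ennreal[of lborel "%u. f u * th (b *v lp k - u)"]
    L1_mult_bounded(1)[OF f _ th_bounded, of "%u. b *v lp k - u"]
   by (auto simp: coef_def conv_eq norm_mult ennreal_mult intro!: mult_left_mono)
  also have "... <= ennreal Kb * (NI u. ennreal C0 * (norm (f u) * ennreal (P 1 (u - b *v lp k))))"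
  proof (intro mult_left_mono nn_integral_mono)
   fix u
   have "norm (f u * th (b *v lp k - u)) <= norm (f u) * (C0 * P 1 (u - b *v lp k))"
    using th_le[of "b *v lp k - u"] P_even(2)[of 1 "b *v lp k" u] by (auto simp: norm_mult intro: mult_left_mono)
   then show "ennreal (norm (f u * th (b *v lp k - u))) <= ennreal C0 * (norm (f u) * ennreal (P 1 (u - b *v lp k)))"
    using C0 by (subst (asm) ennreal_le_iff[symmetric]) (auto simp: ennreal_mult' mult_ac)
  qed auto
  also have "... = ennreal (Kb * C0) * (NI u. norm (f u) * ennreal (P 1 (u - b *v lp k)))"
   using Kb(1) C0 by (subst nn_integral_cmult) (auto simp: ennreal_mult' mult.assoc)
  finally show ?thesis .
 qed
 then have "(NK k. norm (coef f k)) <= (NK k. ennreal (Kb * C0) * (NI u. norm (f u) * ennreal (P 1 (u - b *v lp k))))"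
  by (intro nn_integral_mono)
 also have "... = ennreal (Kb * C0) * (NI u. (NK k. norm (f u) * ennreal (P 1 (u - b *v lp k))))"
 proof -
  interpret L: sigma_finite_measure "lat :: (int^'n) measure" by (rule sigma_lat)
  interpret pair_sigma_finite "lat :: (int^'n) measure" "lborel :: (real^'n) measure" ..
  have "(%(k, u). ennreal (norm (f u)) * ennreal (P 1 (u - b *v lp k))) \<in> borel_measurable (lat \<Otimes>\<^sub>M lborel)"
   by (rule joint_lat) auto
  from Fubini[OF this] show ?thesis by (simp add: nn_integral_cmult)
 qed
 also have "... = ennreal (Kb * C0) * (NI u. norm (f u) * (NK k. ennreal (P 1 (u - b *v lp k))))"
  by (simp add: nn_integral_cmult)
 also have "... <= ennreal (Kb * C0) * (NI u. norm (f u) * ennreal CL)"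
  by (intro mult_left_mono nn_integral_mono CL) auto
 also have "... = ennreal (Kb * C0 * CL) * N f"
  using Kb(1) C0 CL(1) by (subst nn_integral_multc) (auto simp: N_def ennreal_mult' mult_ac)
 finally show ?thesis .
qed

lemma coef_l1: "L1 f ==> integrable lat (coef f)"
 using coef_bound[of f] N_less_top[of f] by (auto simp: integrable_iff_bounded ennreal_mult_less_top intro: le_less_trans)

text \<open>Write \<open>th\<close> as the inverse transform of its spectrum, move the transform
  onto f by \<open>F_mult\<close>, and substitute z = x \<open>matrix_inv b\<close>, with Jacobian
  \<open>Kb\<close>.\<close>

lemma coef_fourier:
 assumes f: "L1 f" shows "coef f k = (LI x. G f x * E x (lp k))"
proof -
 have thi: "th v = F (F th) (- v)" for v
 proof -
  have "(LI x. F th x * E x v) = th v"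
   by (rule inversion[OF th_L1 th_bounded _ thF(2)]) (use th(1) in \<open>simp add: continuous_on_eq_continuous_at\<close>)
  then show ?thesis by (simp add: F_def[of "F th"])
 qed
 define h where "h z = F f z * F th z * E z (b *v lp k)" for z
 have "conv f th (b *v lp k) = (LI u. f u * F (F th) (u - b *v lp k))" by (simp add: conv_eq thi[of "b *v lp k - _"])
 also have "... = (LI z. h z)" unfolding h_def by (rule F_mult[OF f thF(2)])
 finally have "coef f k = Kb *\<^sub>R (LI z. h z)" by (simp add: coef_def scaleR_conv_of_real)
 also have "... = (LI x. h (x v* matrix_inv b))"
  using f th_L1 unfolding h_def by (subst Kb(2)) auto
 also have "... = (LI x. G f x * E x (lp k))"
  by (simp add: h_def G_def E_def dot_lmul_matrix[symmetric])
 finally show ?thesis .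
qed

lemma G_props:
 assumes f: "L1 f"
 shows "continuous_on UNIV (G f)" "x \<notin> frequency_cube ==> G f x = 0" "L1 (G f)"
proof -
 show c: "continuous_on UNIV (G f)" unfolding G_def[abs_def]
  by (intro continuous_intros continuous_on_compose2[OF continuous_F[OF f]] continuous_on_compose2[OF continuous_F[OF th_L1]] vm_continuous) auto
 show z: "x \<notin> frequency_cube ==> G f x = 0" for x using thF(1)[of "x v* matrix_inv b"] by (auto simp: G_def)
 have "L1 (%x. (indicator (Bx (1/2)) x *\<^sub>R (1::complex)) * G f x)"
 proof (rule L1_mult_bounded(1)[OF F_box(1)])
  show "norm (G f x) <= (LI x. norm (f x)) * (LI x. norm (th x))" for x
   unfolding G_def norm_mult using norm_F_le[OF f] norm_F_le[OF th_L1] by (intro mult_mono) auto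
 qed (use c in \<open>auto intro: borel_measurable_continuous_onI\<close>)
 moreover have "(indicator (Bx (1/2)) x *\<^sub>R (1::complex)) * G f x = G f x" for x
 proof (cases "x \<in> frequency_cube")
  case True
  then have "-(1/2) < x $ i & x $ i < 1/2" for i by (simp add: frequency_cube_def)
  then have "x \<in> Bx (1/2)" unfolding Bx_def mem_Collect_eq abs_le_iff by (intro allI) (smt (verit))
  then show ?thesis by simp
 qed (simp add: z)
 ultimately show "L1 (G f)" by (simp only:)
qed

lemma coef_hat:
 assumes f: "L1 f" and x: "x \<in> frequency_cube" shows "Shat (coef f) x = G f x"
proof (rule fourier_unique[OF coef_l1[OF f] G_props(3)[OF f] _ _ x])
 show "isCont (G f) x" using G_props(1)[OF f] by (simp add: continuous_on_eq_continuous_at)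
 show "!!x. x \<notin> frequency_cube ==> G f x = 0" by (rule G_props(2)[OF f])
 show "!!j. (LI x. G f x * E x (lp j)) = coef f j" by (simp only: coef_fourier[OF f])
qed

text \<open>Sampling turns the Riesz transform into the discrete one: multiplying \<open>G f\<close>
  by the discrete symbol gives \<open>G g\<close>, because the symbol is the exact multiplier on the
  spectrum of \<open>th\<close>. This is what puts the coefficients of an \<open>H1\<close> function
  in the discrete Hardy space.\<close>

lemma coef_W:
 assumes R: "RR i f g" shows "W (coef f) i = coef g"
proof
 fix j
 have fg: "L1 f" "L1 g" "!!y. F g y = m i y * F f y" using R by (auto simp: RR_def)
 have "phi i x * Shat (coef f) x = G g x" for x
 proof (cases "x \<in> frequency_cube")
  case True
  then show ?thesis using coef_hat[OF fg(1) True] thF(1)[of "x v* matrix_inv b"]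
   by (cases "F th (x v* matrix_inv b) = 0") (auto simp: phi_def G_def fg(3))
 qed (use G_props(2)[OF fg(2)] in \<open>simp add: phi_def\<close>)
 then show "W (coef f) i j = coef g j" using W_eq[OF coef_l1[OF fg(1)]] coef_fourier[OF fg(2)] by simp
qed

lemma h1_norm_ge:
 shows "(NK k. norm (s k)) <= hn s" "(NK k. norm (W s i k)) <= hn s"
proof -
 show "(NK k. norm (s k)) <= hn s" by (simp add: h1_norm_def l1_norm_eq)
 have "(NK k. norm (W s i k)) <= l1_norm (seq_conv s (discrete_riesz b nu))"
  unfolding l1_norm_eq W_def by (intro nn_integral_mono ennreal_leI Finite_Cartesian_Product.norm_nth_le)
 then show "(NK k. norm (W s i k)) <= hn s" by (simp add: h1_norm_def add_increasing)
qed

lemma h1_integrable: "hn s < \<infinity> ==> integrable lat s" "hn s < \<infinity> ==> integrable lat (W s i)"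
 using h1_norm_ge[of s] by (auto simp: integrable_iff_bounded intro: le_less_trans)

lemma h1_norm_le: "hn s <= (NK k. norm (s k)) + (\<Sum>i\<in>UNIV. (NK k. norm (W s i k)))"
proof -
 have "ennreal (norm (seq_conv s (discrete_riesz b nu) k)) <= (\<Sum>i\<in>UNIV. ennreal (norm (W s i k)))" for k
  unfolding W_def by (subst sum_ennreal) (auto intro!: ennreal_leI norm_vec_le_sum)
 then have "l1_norm (seq_conv s (discrete_riesz b nu)) <= (NK k. (\<Sum>i\<in>UNIV. ennreal (norm (W s i k))))"
  unfolding l1_norm_eq by (intro nn_integral_mono)
 also have "... = (\<Sum>i\<in>UNIV. (NK k. norm (W s i k)))" by (subst nn_integral_sum) auto
 finally show ?thesis by (simp add: h1_norm_def l1_norm_eq)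
qed

end

lemma band_exists:
 fixes b :: "real^'n^'n"
 assumes b: "invertible b" and nu: "cutoff nu"
 shows "\<exists>th C0 CL Kb NB. band b nu th C0 CL Kb NB"
proof -
 have c0: "continuous_on UNIV nu" using nu unfolding cutoff_def by (metis times_cont_diff.simps(1))
 have supp: "nu y ~= 0 ==> y \<in> frequency_cube" for y
  using nu closure_subset[of "{y. nu y ~= 0}"] unfolding cutoff_def by blast
 have "bounded (nu ` closure {y. nu y ~= 0})"
  using nu c0 unfolding cutoff_def by (intro compact_imp_bounded compact_continuous_image) (auto intro: continuous_on_subset)
 then obtain NB where "!!y. y \<in> closure {y. nu y ~= 0} ==> norm (nu y) <= NB" unfolding bounded_iff by blast
 then have NB: "norm (nu y) <= max NB 0" for y
  using closure_subset[of "{y. nu y ~= 0}"] by (cases "nu y = 0") force+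
 obtain d where d: "d > 0" "!!y. norm y < d ==> nu y = 1"
  using nu unfolding cutoff_def eventually_nhds_metric by (auto simp: dist_norm)
 define A where "A = onorm (%x. x v* b) + 1"
 have bl: "bounded_linear (%x. x v* b)" by (rule vm_linear)
 have A: "A > 0" using onorm_pos_le[OF bl] by (simp add: A_def)
 \<comment> \<open>Spectrum |y_i| <= c then gives |y b| <= d/2 < d, inside the ball on which the
   cut-off is 1.\<close>
 define c where "c = d / (2 * A * real CARD('n))"
 have c: "c > 0" using A d by (simp add: c_def)
 obtain th :: "real^'n => complex" and C0 where th: "continuous_on UNIV th" "!!x. norm (th x) * (1 + norm x) <= C0 * P 1 x"
  "!!y i. F th y ~= 0 ==> \<bar>y $ i\<bar> <= c" "F th 0 = 1" using band_limited_exists[OF c] by blast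
 obtain CL where CL: "CL >= 0" "!!x. (NK k. ennreal (P 1 (x - b *v lp k))) <= ennreal CL" using lattice_sum_bound[OF b] by blast
 have inv: "(x v* matrix_inv b) v* b = x" "(x v* b) v* matrix_inv b = x" for x
  using matrix_inv_both[OF b] by (simp_all add: vector_matrix_mul_assoc)
 have lin: "linear (%x. x v* M)" for M :: "real^'n^'n" using vm_linear[of M] by (rule bounded_linear.linear)
 have "\<exists>K>0. \<forall>f::real^'n => complex. f \<in> bm --> (LI x. f (x v* matrix_inv b)) = K *\<^sub>R (LI x. f x)"
  by (rule linear_jacobian[OF lin[of "matrix_inv b"] lin[of b] inv(2,1)]) blast
 then obtain K where K: "K > 0" "!!f::real^'n => complex. f \<in> bm ==> (LI x. f (x v* matrix_inv b)) = K *\<^sub>R (LI x. f x)"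
  by blast
 have "y v* b \<in> frequency_cube & nu (y v* b) = 1" if "F th y ~= 0" for y
 proof -
  have "norm y <= (\<Sum>i\<in>UNIV. \<bar>y $ i\<bar>)" by (rule norm_le_l1_cart)
  also have "... <= real CARD('n) * c" using th(3)[OF that] by (intro sum_bounded_above) auto
  finally have n: "norm y <= real CARD('n) * c" .
  have "norm (y v* b) <= onorm (%x. x v* b) * norm y" by (rule onorm[OF bl])
  also have "... <= A * (real CARD('n) * c)" using n onorm_pos_le[OF bl] by (intro mult_mono) (auto simp: A_def)
  also have "... < d" using A d by (simp add: c_def)
  finally have "nu (y v* b) = 1" by (rule d(2))
  then show ?thesis using supp by auto
 qed
 moreover have "L1 (F th)"
 proof -
  obtain B where B: "!!x. norm (F th x) <= B"
  proof -
   have "norm (th x) <= C0 * P 1 x" for x using th(2)[of x] mult_left_mono[of 1 "1 + norm x" "norm (th x)"] by simp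
   moreover have "L1 (%y. C0 * P 1 (y::real^'n))" by (intro integrable_mult_right P_L1) simp
   ultimately have "L1 th"
    by (intro Bochner_Integration.integrable_bound[of _ "%y. C0 * P 1 y" th])
      (use th(1) in \<open>auto intro: order_trans[OF _ abs_ge_self] borel_measurable_continuous_onI\<close>)
   then show ?thesis using norm_F_le that by blast
  qed
  have "th \<in> bm" using th(1) by (rule borel_measurable_continuous_onI)
  then have "F th \<in> bm" unfolding F_def[abs_def] by measurable
  then have "L1 (%x. (indicator (Bx c) x *\<^sub>R (1::complex)) * F th x)"
   by (rule L1_mult_bounded(1)[OF F_box(1)[OF less_imp_le[OF c]] _ B])
  moreover have "(indicator (Bx c) x *\<^sub>R (1::complex)) * F th x = F th x" for x
   using th(3)[of x] by (cases "F th x = 0") (auto simp: Bx_def split: split_indicator)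
  ultimately show ?thesis by simp
 qed
 ultimately have "band b nu th C0 CL K (max NB 0)"
  by unfold_locales (use b c0 supp NB th CL K in auto)
 then show ?thesis by (intro exI)
qed

section \<open>Approximate identities, Riemann-Lebesgue and averages of modulations\<close>

lemma ennreal_tendsto_zeroI:
 assumes "!!e::real. e > 0 ==> \<forall>\<^sub>F x in Fl. f x <= ennreal e"
 shows "(f \<longlongrightarrow> 0) Fl"
proof (rule order_tendstoI)
 fix a :: ennreal assume a: "0 < a"
 obtain e where "e > 0" "ennreal e < a"
 proof (cases a)
  case (real r)
  then show ?thesis using a that[of "r / 2"] by (simp add: ennreal_less_iff)
 qed (use that[of 1] in simp)
 then show "\<forall>\<^sub>F x in Fl. f x < a" using assms[of e] by (auto elim!: eventually_mono)
qed simp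

lemma L1_shift_measurable[measurable]:
 fixes f :: "'a::euclidean_space => complex"
 assumes [measurable]: "f \<in> bm"
 shows "(%u. N (%x. f x - f (x - u))) \<in> bm"
 unfolding N_def by measurable

text \<open>For a continuous integrable function translates converge pointwise and have equal norms,
  so Scheffe's lemma gives L1 convergence; density extends this to f.\<close>

lemma L1_translation:
 fixes f :: "'a::euclidean_space => complex"
 assumes f: "L1 f"
 shows "((%u. N (%x. f x - f (x - u))) \<longlongrightarrow> 0) (nhds 0)"
proof -
 have [measurable]: "f \<in> bm" using f by auto
 have "\<forall>\<^sub>F u in nhds 0. N (%x. f x - f (x - u)) < ennreal e" if e: "e > 0" for e
 proof -
  obtain g where g: "continuous_on UNIV g" "L1 g" "N (%x. f x - g x) < ennreal (e / 3)"
   using L1_dense[OF f, of "e/3"] e by auto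
  have [measurable]: "g \<in> bm" using g by auto
  have z: "N (%x. g x - g (x - 0)) = 0" by (simp add: N_def)
  have "isCont (%u. N (%x. g x - g (x - u))) 0"
  proof (unfold continuous_at_sequentially o_def z, intro allI impI)
   fix X :: "nat => 'a" assume X: "X ---> 0"
   have "(%n. (NI x. norm (g (x - X n) - g x))) ---> 0"
   proof (rule Scheffe_lemma1)
    have "(%n. g (x - X n)) ---> g x" for x
    proof (rule continuous_on_tendsto_compose[OF g(1)])
     show "(%n. x - X n) ---> x" using tendsto_diff[OF tendsto_const X, of x] by simp
    qed auto
    then show "AEL x. (%n. g (x - X n)) ---> g x" by simp
    show "limsup (%n. (NI x. ennreal (norm (g (x - X n))))) <= (NI x. ennreal (norm (g x)))"
     using lborel_translate(2)[of "%x. ennreal (norm (g x))"] by (simp add: Limsup_const)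
   qed (use g L1_translate[OF g(2)] in auto)
   then show "(%n. N (%x. g x - g (x - X n))) ---> 0" by (simp add: N_def norm_minus_commute)
  qed
  then have "((%u. N (%x. g x - g (x - u))) \<longlongrightarrow> N (%x. g x - g (x - 0))) (nhds 0)"
   using tendsto_at_iff_tendsto_nhds[of "%u. N (%x. g x - g (x - u))" 0] by (simp only: isCont_def)
  then have "((%u. N (%x. g x - g (x - u))) \<longlongrightarrow> 0) (nhds 0)" by (simp only: z)
  then have "\<forall>\<^sub>F u in nhds 0. N (%x. g x - g (x - u)) < ennreal (e / 3)" using e by (intro order_tendstoD) auto
  then show ?thesis
  proof eventually_elim
   case (elim u)
   have "N (%x. f x - f (x - u)) <= N (%x. f x - g x) + N (%x. g x - f (x - u))" by (rule N_triangle3) auto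
   also have "N (%x. g x - f (x - u)) <= N (%x. g x - g (x - u)) + N (%x. g (x - u) - f (x - u))" by (rule N_triangle3) auto
   also have "N (%x. g (x - u) - f (x - u)) = N (%x. f x - g x)"
    using N_translate[of "%x. g x - f x" u] by (simp add: N_diff_commute[of f])
   also have "N (%x. f x - g x) + (N (%x. g x - g (x - u)) + N (%x. f x - g x)) < ennreal (e/3) + (ennreal (e/3) + ennreal (e/3))"
    using g(3) elim by (intro add_strict_mono)
   finally show ?case using e by (simp add: ennreal_plus[symmetric] del: ennreal_plus)
  qed
 qed
 then show ?thesis by (intro ennreal_tendsto_zeroI) (blast intro: eventually_mono less_imp_le)
qed

lemma shift_bound:
 fixes f :: "'a::euclidean_space => complex"
 assumes [measurable]: "f \<in> bm"
 shows "N (%x. f x - f (x - u)) <= 2 * N f"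
 using N_triangle_diff[of f "%x. f (x - u)"] N_translate[of f u] by (simp add: mult_2)

text \<open>The error is at most the integral of |k(v)| times the L1 modulus of continuity of f at v
  / a_j, which tends to 0 and stays below 2 \<open>N f\<close>. The kernel is not normalised: its
  integral \<open>F k 0\<close> multiplies the limit.\<close>

lemma approx_identity:
 fixes f k :: "real^'n => complex"
 assumes f: "L1 f" and k: "L1 k" and a: "filterlim (%j. \<bar>a j\<bar>) at_top sequentially" "!!j. a j ~= 0"
 shows "(%j. N (%x. conv f (dil (a j) k) x - F k 0 * f x)) ---> 0"
proof (rule tendsto_sandwich[OF _ _ tendsto_const])
 have [measurable]: "f \<in> bm" "k \<in> bm" using f k by auto
 define D where "D u = N (%x. f x - f (x - u))" for u
 have [measurable]: "D \<in> bm" unfolding D_def[abs_def] by measurable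
 have "N (%x. conv f (dil (a j) k) x - F k 0 * f x) <= (NI v. norm (k v) * D (v /\<^sub>R a j))" for j
 proof -
  define K where "K = dil (a j) k"
  have K: "L1 K" using k a(2) by (simp add: K_def L1_dil)
  have [measurable]: "K \<in> bm" using K by auto
  have F0: "F K 0 = F k 0" using F_dil[OF k a(2), of j 0] by (simp add: K_def)
  have ae: "AEL x. L1 (%u. K u * f (x - u))"
   using sm(4)[of lborel "%u. u" K f] K f by (simp add: lborel.sigma_finite_measure_axioms)
  have "N (%x. conv f K x - F k 0 * f x) <= (NI x. (NI u. norm (K u) * ennreal (norm (f x - f (x - u)))))"
   unfolding N_def
  proof (rule nn_integral_mono_AE)
   show "AEL x. ennreal (norm (conv f K x - F k 0 * f x)) <= (NI u. norm (K u) * ennreal (norm (f x - f (x - u))))"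
    using ae
   proof eventually_elim
    case (elim x)
    have 1: "L1 (%u. K u * f x)" using K by auto
    have "conv f K x - F k 0 * f x = conv K f x - F K 0 * f x" by (simp add: conv_commute[of f K] F0)
    also have "... = (LI u. K u * f (x - u) - K u * f x)"
     by (subst Bochner_Integration.integral_diff[OF elim 1]) (simp add: conv_eq F_def)
    finally have "conv f K x - F k 0 * f x = (LI u. K u * f (x - u) - K u * f x)" .
    then have "ennreal (norm (conv f K x - F k 0 * f x)) <= (NI u. norm (K u * f (x - u) - K u * f x))"
     using integral_norm_bound_ennreal[OF Bochner_Integration.integrable_diff[OF elim 1]] by simp
    also have "... = (NI u. norm (K u) * ennreal (norm (f x - f (x - u))))"
     by (rule nn_integral_cong) (simp add: right_diff_distrib[symmetric] norm_mult ennreal_mult' norm_minus_commute)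
    finally show ?case .
   qed
  qed
  also have "... = (NI u. (NI x. norm (K u) * ennreal (norm (f x - f (x - u)))))"
   by (rule lborel_pair.Fubini') measurable
  also have "... = (NI u. norm (K u) * D u)"
   by (simp add: nn_integral_cmult D_def N_def)
  also have "... = (NI u. ennreal (\<bar>a j\<bar> ^ DIM(real^'n)) * (%v. norm (k v) * D (v /\<^sub>R a j)) (a j *\<^sub>R u))"
   by (rule nn_integral_cong) (use a(2)[of j] in \<open>simp add: K_def dil_def ennreal_mult' mult.assoc\<close>)
  also have "... = (NI v. norm (k v) * D (v /\<^sub>R a j))"
   by (rule nn_dilate) (use a(2) in measurable)
  finally show ?thesis unfolding K_def .
 qed
 then show "\<forall>\<^sub>F j in sequentially. N (%x. conv f (dil (a j) k) x - F k 0 * f x) <= (NI v. norm (k v) * D (v /\<^sub>R a j))"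
  by (intro always_eventually allI)
 have a0: "(%j. inverse (a j)) ---> 0"
  using tendsto_inverse_0_at_top[OF a(1)] by (rule_tac tendsto_rabs_zero_cancel) simp
 have D0: "(%j. D (v /\<^sub>R a j)) ---> 0" for v
  by (rule filterlim_compose[OF L1_translation[OF f, folded D_def]]) (use tendsto_scaleR[OF a0 tendsto_const, of v] in simp)
 have Nf: "N f < \<infinity>" using N_less_top[OF f] .
 have "(%j. (NI v. norm (k v) * D (v /\<^sub>R a j))) ---> (NI (v::real^'n). 0)"
 proof (rule nn_integral_dominated_convergence[where w="%v. norm (k v) * (2 * N f)"])
  show "AE v in lborel. norm (k v) * D (v /\<^sub>R a j) <= norm (k v) * (2 * N f)" for j
   by (intro AE_I2 mult_left_mono) (auto simp: D_def shift_bound)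
  show "(NI v. norm (k v) * (2 * N f)) < \<infinity>"
   using N_less_top[OF k] Nf by (simp add: nn_integral_multc N_def[symmetric] ennreal_mult_less_top)
  show "AE v in lborel. (%j. norm (k v) * D (v /\<^sub>R a j)) ---> 0"
  proof (rule AE_I2)
   fix v show "(%j. norm (k v) * D (v /\<^sub>R a j)) ---> 0"
    using ennreal_tendsto_cmult[OF _ D0[of v], of "ennreal (norm (k v))"] by simp
  qed
 qed measurable
 then show "(%j. (NI v. norm (k v) * D (v /\<^sub>R a j))) ---> 0" by simp
qed simp

text \<open>The shift u has u . y = 1/2, so translation by u flips the sign of the transform at y
  and the difference doubles it. The shift tends to 0 as y goes to infinity, and Riemann-Lebesgue
  follows from continuity of translation.\<close>

lemma F_half_shift:
 fixes f :: "'a::euclidean_space => complex"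
 assumes f: "L1 f" and y: "y ~= 0"
 shows "ennreal (2 * norm (F f y)) <= N (%x. f x - f (x - (1 / (2 * (norm y)\<^sup>2)) *\<^sub>R y))"
proof -
 define u where "u = (1 / (2 * (norm y)\<^sup>2)) *\<^sub>R y"
 have uy: "u \<bullet> y = 1 / 2" using y by (simp add: u_def power2_norm_eq_inner)
 then have E: "E u (-y) = -1" unfolding E_def inner_minus_right uy by (simp flip: cis_cnj)
 have L: "L1 (%x. f x - f (x - u))" using f L1_translate[OF f] by auto
 have "F (%x. f x - f (x - u)) y = 2 * F f y" using f L1_translate[OF f, of u] by (simp add: F_diff F_translate E)
 then have "2 * norm (F f y) <= (LI x. norm (f x - f (x - u)))" using norm_F_le[OF L, of y] by (simp add: norm_mult)
 then show ?thesis using N_eq[OF L] by (simp add: u_def ennreal_leI)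
qed

lemma riemann_lebesgue:
 fixes f :: "'a::euclidean_space => complex"
 assumes f: "L1 f"
 shows "(F f \<longlongrightarrow> 0) at_infinity"
proof -
 have "((%y::'a. (1 / (2 * (norm y)\<^sup>2)) *\<^sub>R y) \<longlongrightarrow> 0) at_infinity"
 proof (rule Lim_null_comparison)
  show "\<forall>\<^sub>F y::'a in at_infinity. norm ((1 / (2 * (norm y)\<^sup>2)) *\<^sub>R y) <= inverse (norm y)"
   unfolding eventually_at_infinity by (intro exI[of _ 1]) (auto simp: power2_eq_square field_simps)
  show "((%y::'a. inverse (norm y)) \<longlongrightarrow> 0) at_infinity"
   by (rule tendsto_inverse_0_at_top[OF filterlim_norm_at_top])
 qed
 then have lim: "((%y. N (%x. f x - f (x - (1 / (2 * (norm y)\<^sup>2)) *\<^sub>R y))) \<longlongrightarrow> 0) at_infinity"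
  by (rule filterlim_compose[OF L1_translation[OF f]])
 show ?thesis
 proof (rule tendstoI)
  fix e :: real assume e: "e > 0"
  have "\<forall>\<^sub>F y in at_infinity. N (%x. f x - f (x - (1 / (2 * (norm y)\<^sup>2)) *\<^sub>R y)) < ennreal e"
   using order_tendstoD(2)[OF lim] e by simp
  moreover have "\<forall>\<^sub>F y::'a in at_infinity. y ~= 0" unfolding eventually_at_infinity by (intro exI[of _ 1]) auto
  ultimately show "\<forall>\<^sub>F y in at_infinity. dist (F f y) 0 < e"
  proof eventually_elim
   case (elim y)
   then have "ennreal (2 * norm (F f y)) < ennreal e" using F_half_shift[OF f elim(2)] by (rule_tac le_less_trans)
   then show ?case using e by (simp add: ennreal_less_iff)
  qed
 qed
qed

lemma F_modulate: "F (%x. E x v * f x) y = F f (y - v)"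
 unfolding F_def by (intro Bochner_Integration.integral_cong) (auto simp: E_diff E_minus)

lemma L1_modulate: "L1 f ==> L1 (%x. E x v * f x)"
 by (rule L1_mult_bounded(2)[where B=1]) auto

lemma N_modulate: "N (%x. E x v * f x) = N f"
 by (simp add: N_def norm_mult)

text \<open>The Poisson means depend on the transform alone, hence vanish, and they converge to k at
  Lebesgue points.\<close>

lemma F_inj_AE:
 fixes k :: "real^'n => complex"
 assumes k: "L1 k" and z: "!!y. F k y = 0" shows "AEL x. k x = 0"
 using lebesgue_points[OF k]
proof eventually_elim
 case (elim x)
 have "\<forall>\<^sub>F e in at_right 0. conv k (CP e) x = 0"
  using eventually_at_right_less[of "0::real"] by eventually_elim (simp add: conv_P[OF k] z)
 then have "((%e. conv k (CP e) x) \<longlongrightarrow> 0) (at_right 0)" by (rule tendsto_eventually)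
 then show "k x = 0" using conv_P_tendsto[OF k elim] tendsto_unique trivial_limit_at_right_real by blast
qed

lemma N_sum:
 fixes h :: "'i => 'a::euclidean_space => complex"
 assumes "finite I" "!!i. i \<in> I ==> h i \<in> bm"
 shows "N (%x. \<Sum>i\<in>I. h i x) <= (\<Sum>i\<in>I. N (h i))"
 using assms
proof (induction I rule: finite_induct)
 case (insert i I)
 have "N (%x. h i x + (\<Sum>i\<in>I. h i x)) <= N (h i) + N (%x. \<Sum>i\<in>I. h i x)"
  using insert.prems by (intro N_triangle borel_measurable_sum) auto
 also have "... <= N (h i) + (\<Sum>i\<in>I. N (h i))" using insert by (intro add_left_mono) auto
 finally show ?case using insert by simp
qed (simp add: N_def)

text \<open>Greedy selection: each new index is taken far enough out to be related, in both orders,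
  to all earlier ones.\<close>

lemma ex_spread_set:
 assumes R: "!!j'::nat. \<forall>\<^sub>F j in sequentially. R j j' & R j' j"
 shows "\<exists>A. finite A & card A = M & A \<subseteq> {N0..} & (\<forall>j\<in>A. \<forall>j'\<in>A. j ~= j' --> R j j')"
proof (induction M)
 case 0
 show ?case by (intro exI[of _ "{}"]) auto
next
 case (Suc M)
 then obtain A where A: "finite A" "card A = M" "A \<subseteq> {N0..}" "\<forall>j\<in>A. \<forall>j'\<in>A. j ~= j' --> R j j'" by blast
 have "\<forall>\<^sub>F j in sequentially. \<forall>j'\<in>A. R j j' & R j' j" by (rule eventually_ball_finite[OF A(1)]) (use R in blast)
 moreover have "\<forall>\<^sub>F j in sequentially. \<forall>j'\<in>A. j > j'" by (rule eventually_ball_finite[OF A(1)]) (blast intro: eventually_gt_at_top)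
 ultimately have "\<forall>\<^sub>F j in sequentially. (\<forall>j'\<in>A. R j j' & R j' j) & j >= N0 & (\<forall>j'\<in>A. j > j')"
  using eventually_ge_at_top[of N0] by eventually_elim blast
 then obtain j where "\<forall>j'\<in>A. R j j' & R j' j" "j >= N0" "\<forall>j'\<in>A. j > j'" by (auto simp: eventually_sequentially)
 then show ?case using A by (intro exI[of _ "insert j A"]) auto
qed

text \<open>Expanding |S|^2 against |f|, diagonal terms contribute the norm of f over the number of
  scales, and each off-diagonal term is a value of the transform of |f| at a difference of
  frequencies.\<close>

lemma average_second_moment:
 fixes f :: "'a::euclidean_space => complex"
 assumes f: "L1 f" and A: "finite A" "A ~= {}" and s: "!!j. norm (s j) <= 1"
  and off: "!!j j'. j \<in> A ==> j' \<in> A ==> j ~= j' ==> norm (F (%x. of_real (norm (f x))) (v j - v j')) <= e"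
  and e: "e >= 0"
 defines "S \<equiv> %x. (\<Sum>j\<in>A. s j * E x (v j)) / of_nat (card A)"
 shows "L1 (%x. norm (f x) * (norm (S x))\<^sup>2)" "(LI x. norm (f x) * (norm (S x))\<^sup>2) <= (LI x. norm (f x)) / card A + e"
proof -
 define M where "M = real (card A)"
 have M: "M > 0" using A by (simp add: M_def card_gt_0_iff)
 define h where "h x = cr (norm (f x))" for x
 have h: "L1 h" unfolding h_def using f by auto
 define nf where "nf = (LI x. norm (f x))"
 have nf: "nf >= 0" by (simp add: nf_def)
 define t where "t j j' x = (s j * cnj (s j') / of_real (M\<^sup>2)) * (h x * E x (- (v j' - v j)))" for j j' x
 have t: "L1 (t j j')" for j j' unfolding t_def using L1_E[OF h] by auto
 have eq: "cr (norm (f x) * (norm (S x))\<^sup>2) = (\<Sum>j\<in>A. \<Sum>j'\<in>A. t j j' x)" for x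
 proof -
  have "cr ((norm (S x))\<^sup>2) = S x * cnj (S x)" by (metis complex_norm_square)
  also have "... = (\<Sum>j\<in>A. \<Sum>j'\<in>A. (s j * E x (v j)) * cnj (s j' * E x (v j'))) / of_real (M\<^sup>2)"
   by (simp add: S_def M_def power2_eq_square sum_product)
  finally have "cr ((norm (S x))\<^sup>2) = (\<Sum>j\<in>A. \<Sum>j'\<in>A. (s j * E x (v j)) * cnj (s j' * E x (v j'))) / of_real (M\<^sup>2)" .
  then have "cr (norm (f x) * (norm (S x))\<^sup>2) = h x * ((\<Sum>j\<in>A. \<Sum>j'\<in>A. (s j * E x (v j)) * cnj (s j' * E x (v j'))) / of_real (M\<^sup>2))"
   by (simp only: h_def of_real_mult)
  also have "... = (\<Sum>j\<in>A. \<Sum>j'\<in>A. t j j' x)"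
   unfolding sum_divide_distrib sum_distrib_left t_def by (intro sum.cong refl) (simp add: E_diff)
  finally show ?thesis .
 qed
 have tL: "L1 (%x. cr (norm (f x) * (norm (S x))\<^sup>2))" unfolding eq using t by auto
 then have "L1 (%x. Re (cr (norm (f x) * (norm (S x))\<^sup>2)))" by (rule integrable_Re)
 then show L: "L1 (%x. norm (f x) * (norm (S x))\<^sup>2)" by (simp only: Re_complex_of_real)
 have ti: "norm (LI x. t j j' x) <= (if j = j' then nf / M\<^sup>2 else e / M\<^sup>2)" if "j \<in> A" "j' \<in> A" for j j'
 proof -
  have "norm (LI x. t j j' x) = norm (s j) * norm (s j') / M\<^sup>2 * norm (F h (v j' - v j))"
   using M by (simp add: t_def F_def norm_mult norm_divide norm_power)
  also have "... <= 1 * 1 / M\<^sup>2 * (if j = j' then nf else e)"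
  proof (intro mult_mono divide_right_mono)
   show "norm (F h (v j' - v j)) <= (if j = j' then nf else e)"
    using off[of j' j] that norm_F_le[OF h, of 0] by (auto simp: h_def[abs_def] nf_def)
  qed (use s M in auto)
  finally show ?thesis by (auto split: if_splits)
 qed
 have "(LI x. norm (f x) * (norm (S x))\<^sup>2) = norm (LI x. cr (norm (f x) * (norm (S x))\<^sup>2))"
  unfolding integral_complex_of_real by (simp del: of_real_mult)
 also have "... = norm (\<Sum>j\<in>A. \<Sum>j'\<in>A. (LI x. t j j' x))"
  unfolding eq using t by (simp add: Bochner_Integration.integral_sum)
 also have "... <= (\<Sum>j\<in>A. \<Sum>j'\<in>A. if j = j' then nf / M\<^sup>2 else e / M\<^sup>2)"
  by (intro order_trans[OF norm_sum] sum_mono ti)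
 also have "... <= (\<Sum>j\<in>A. nf / M\<^sup>2 + e / M)"
 proof (rule sum_mono)
  fix j assume j: "j \<in> A"
  have "(\<Sum>j'\<in>A. if j = j' then nf / M\<^sup>2 else e / M\<^sup>2) <= (\<Sum>j'\<in>A. (if j = j' then nf / M\<^sup>2 else 0) + e / M\<^sup>2)"
   using e nf by (intro sum_mono) auto
  also have "... = nf / M\<^sup>2 + M * (e / M\<^sup>2)" using j A(1) by (simp add: sum.distrib M_def)
  also have "... = nf / M\<^sup>2 + e / M" using M by (simp add: power2_eq_square)
  finally show "(\<Sum>j'\<in>A. if j = j' then nf / M\<^sup>2 else e / M\<^sup>2) <= nf / M\<^sup>2 + e / M" .
 qed
 also have "... = nf / M + e" using M by (simp add: M_def[symmetric] power2_eq_square field_simps)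
 finally show "(LI x. norm (f x) * (norm (S x))\<^sup>2) <= (LI x. norm (f x)) / card A + e" by (simp add: nf_def M_def)
qed

text \<open>The set of scales is chosen before the coefficients s, so it works for the constant 1
  and for the signs of the dilations at once, and simultaneously for all the given functions and
  frequencies.\<close>

lemma averaging:
 fixes \<alpha> :: "nat => real" and Fs :: "('a::euclidean_space => complex) set"
 assumes a: "filterlim (%j. \<bar>\<alpha> j\<bar>) at_top sequentially" and Fs: "finite Fs" "!!f. f \<in> Fs ==> L1 f"
  and L: "finite L" "0 \<notin> L" and d: "d > 0"
 shows "\<exists>A. finite A & A ~= {} & A \<subseteq> {N0..} & (\<forall>s f l. (\<forall>j. norm (s j) <= 1) --> f \<in> Fs --> l \<in> L -->
  N (%x. (\<Sum>j\<in>A. s j * E x (\<alpha> j *\<^sub>R l)) / of_nat (card A) * f x) <= ennreal d)"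
proof -
 define nf where "nf = (\<Sum>f\<in>Fs. (LI x. norm (f x)))"
 have nf0: "nf >= 0" unfolding nf_def by (intro sum_nonneg) auto
 have nf: "(LI x. norm (f x)) <= nf" if "f \<in> Fs" for f
  unfolding nf_def using that Fs(1) by (intro member_le_sum) auto
 \<comment> \<open>AM-GM splits the L1 norm into eps |f| and |f||S|^2 / eps, each halved. The first
   integrates to at most d; with \<open>e = d * eps / 2\<close> and nf/M <= e the second is at most
   2e/eps = d.\<close>
 define eps where "eps = d / (nf + 1)"
 have eps: "eps > 0" "eps * nf <= d" using d nf0 by (auto simp: eps_def field_simps)
 define e where "e = d * eps / 2"
 have e: "e > 0" using d eps by (simp add: e_def)
 define M where "M = Suc (nat \<lceil>nf / e\<rceil>)"
 have M: "nf / real M <= e"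
 proof -
  have "nf / e <= real M" unfolding M_def using of_nat_ceiling[of "nf / e"] by linarith
  then show ?thesis using e by (simp add: M_def field_simps)
 qed
 define R where "R j j' \<longleftrightarrow> (\<forall>f\<in>Fs. \<forall>l\<in>L. norm (F (%x. of_real (norm (f x))) (\<alpha> j *\<^sub>R l - \<alpha> j' *\<^sub>R l)) <= e)" for j j'
 have inf: "\<forall>\<^sub>F j in sequentially. norm (F (%x. of_real (norm (f x))) (\<alpha> j *\<^sub>R l - \<alpha> j' *\<^sub>R l)) <= e &
   norm (F (%x. of_real (norm (f x))) (\<alpha> j' *\<^sub>R l - \<alpha> j *\<^sub>R l)) <= e" if "f \<in> Fs" "l \<in> L" for f l j'
 proof -
  have h: "L1 (%x. cr (norm (f x)))" using Fs(2)[OF that(1)] by auto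
  have l: "norm l > 0" using L(2) that(2) by auto
  have "\<forall>\<^sub>F y in at_infinity. dist (F (%x. of_real (norm (f x))) y) 0 < e" by (rule tendstoD[OF riemann_lebesgue[OF h] e])
  then obtain B where B: "!!y. norm y >= B ==> norm (F (%x. of_real (norm (f x))) y) < e" by (auto simp: eventually_at_infinity)
  have "\<forall>\<^sub>F j in sequentially. \<bar>\<alpha> j\<bar> >= \<bar>\<alpha> j'\<bar> + B / norm l" using a by (simp add: filterlim_at_top)
  then show ?thesis
  proof eventually_elim
   case (elim j)
   then have "B / norm l <= \<bar>\<alpha> j - \<alpha> j'\<bar>" by linarith
   then have "B <= \<bar>\<alpha> j - \<alpha> j'\<bar> * norm l" using l by (simp add: field_simps)
   then have "B <= norm (\<alpha> j *\<^sub>R l - \<alpha> j' *\<^sub>R l)" by (simp add: scaleR_left_diff_distrib[symmetric])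
   then show ?case using B[of "\<alpha> j *\<^sub>R l - \<alpha> j' *\<^sub>R l"] B[of "\<alpha> j' *\<^sub>R l - \<alpha> j *\<^sub>R l"] by (simp add: norm_minus_commute less_imp_le)
  qed
 qed
 have "\<forall>\<^sub>F j in sequentially. R j j' & R j' j" for j'
 proof -
  have "\<forall>\<^sub>F j in sequentially. \<forall>f\<in>Fs. \<forall>l\<in>L. norm (F (%x. of_real (norm (f x))) (\<alpha> j *\<^sub>R l - \<alpha> j' *\<^sub>R l)) <= e &
    norm (F (%x. of_real (norm (f x))) (\<alpha> j' *\<^sub>R l - \<alpha> j *\<^sub>R l)) <= e"
   using inf by (intro eventually_ball_finite Fs(1) L(1) ballI)
  then show ?thesis by eventually_elim (auto simp: R_def)
 qed
 from ex_spread_set[of R M N0, OF this] obtain A where A: "finite A" "card A = M" "A \<subseteq> {N0..}"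
  "!!j j'. j \<in> A ==> j' \<in> A ==> j ~= j' ==> R j j'" by blast
 have A0: "A ~= {}" using A(2) by (auto simp: M_def)
 have "N (%x. (\<Sum>j\<in>A. s j * E x (\<alpha> j *\<^sub>R l)) / of_nat (card A) * f x) <= ennreal d"
  if s: "\<forall>j. norm (s j) <= 1" and f: "f \<in> Fs" and l: "l \<in> L" for s f l
 proof -
  define S where "S x = (\<Sum>j\<in>A. s j * E x (\<alpha> j *\<^sub>R l)) / of_nat (card A)" for x
  have off: "norm (F (%x. of_real (norm (f x))) (\<alpha> j *\<^sub>R l - \<alpha> j' *\<^sub>R l)) <= e" if "j \<in> A" "j' \<in> A" "j ~= j'" for j j'
   using A(4)[OF that] f l by (auto simp: R_def)
  note mom = average_second_moment[where s=s and v="%j. \<alpha> j *\<^sub>R l", OF Fs(2)[OF f] A(1) A0 spec[OF s] off less_imp_le[OF e], folded S_def]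
  have fL: "L1 (%x. norm (f x))" using Fs(2)[OF f] by auto
  have pt: "norm (S x * f x) <= (eps * norm (f x) + (1 / eps) * (norm (f x) * (norm (S x))\<^sup>2)) / 2" for x
  proof -
   have "0 <= (eps - norm (S x))\<^sup>2" by simp
   then have "2 * eps * norm (S x) <= eps\<^sup>2 + (norm (S x))\<^sup>2" by (simp add: power2_diff)
   then have "norm (S x) <= (eps + (1 / eps) * (norm (S x))\<^sup>2) / 2" using eps by (simp add: field_simps power2_eq_square)
   then have "norm (f x) * norm (S x) <= norm (f x) * ((eps + (1 / eps) * (norm (S x))\<^sup>2) / 2)" by (intro mult_left_mono) auto
   then show ?thesis by (simp add: norm_mult algebra_simps)
  qed
  have "N (%x. S x * f x) <= (NI x. ennreal ((eps * norm (f x) + (1 / eps) * (norm (f x) * (norm (S x))\<^sup>2)) / 2))"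
   unfolding N_def by (intro nn_integral_mono ennreal_leI pt)
  also have "... = ennreal (LI x. (eps * norm (f x) + (1 / eps) * (norm (f x) * (norm (S x))\<^sup>2)) / 2)"
   using fL mom(1) eps by (intro nn_integral_eq_integral) auto
  also have "(LI x. (eps * norm (f x) + (1 / eps) * (norm (f x) * (norm (S x))\<^sup>2)) / 2)
    = (eps * (LI x. norm (f x)) + (1 / eps) * (LI x. norm (f x) * (norm (S x))\<^sup>2)) / 2"
   using fL mom(1) by simp
  also have "... <= (eps * nf + (1 / eps) * (nf / M + e)) / 2"
  proof -
   have "(LI x. norm (f x)) / real (card A) <= nf / real M" using nf[OF f] by (simp add: A(2) divide_right_mono)
   then have "(LI x. norm (f x) * (norm (S x))\<^sup>2) <= nf / M + e" using mom(2) by linarith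
   then show ?thesis using nf[OF f] eps by (intro divide_right_mono add_mono mult_left_mono) auto
  qed
  also have "... <= (d + (1 / eps) * (e + e)) / 2" using eps M by (intro divide_right_mono add_mono mult_left_mono) auto
  also have "... = d" using eps by (simp add: e_def)
  finally show ?thesis using ennreal_leI unfolding S_def by blast
 qed
 then show ?thesis using A A0 by (intro exI[of _ A]) auto
qed

section \<open>Synthesis of sampled functions and its aliases\<close>

lemma int_inner: "lp k \<bullet> lp l \<in> \<int>"
 by (auto simp: inner_vec_def lattice_point_def intro!: Ints_sum)

lemma E_lattice: "E (lp k) (lp l) = 1"
proof -
 obtain z where "lp k \<bullet> lp l = of_int z" using int_inner[of k l] by (auto elim: Ints_cases)
 then show ?thesis by (simp only: E_def) (rule cis_multiple_2pi, simp)
qed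

lemma Shat_periodic: "Shat s (v - lp l) = Shat s v"
proof -
 have "E (lp k) (- (v - lp l)) = E (lp k) (- v)" for k using E_lattice[of k l] by (simp add: E_diff(2) E_minus(2))
 then show ?thesis by (simp add: Shat_def)
qed

lemma finite_lattice_ball: "finite {l :: int^'n. norm (lp l) <= r}"
proof -
 define S where "S = {- \<lceil>r\<rceil>..\<lceil>r\<rceil>}"
 have "{l :: int^'n. norm (lp l) <= r} \<subseteq> vec_lambda ` (UNIV \<rightarrow>\<^sub>E S)"
 proof
  fix l :: "int^'n" assume "l \<in> {l. norm (lp l) <= r}"
  then have "\<bar>real_of_int (l $ i)\<bar> <= r" for i
   using component_le_norm_cart[of "lp l" i] by (auto simp: lattice_point_def)
  then have "l $ i \<in> S" for i unfolding S_def by (smt (verit) atLeastAtMost_iff le_of_int_ceiling of_int_le_iff of_int_minus)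
  then show "l \<in> vec_lambda ` (UNIV \<rightarrow>\<^sub>E S)" by (intro image_eqI[of _ _ "vec_nth l"]) (auto simp: vec_lambda_eta)
 qed
 moreover have "finite (vec_lambda ` (UNIV \<rightarrow>\<^sub>E S))" by (intro finite_imageI finite_PiE) (auto simp: S_def)
 ultimately show ?thesis by (rule finite_subset)
qed

lemma cube_unique: "v - lp k \<in> frequency_cube ==> v - lp l \<in> frequency_cube ==> k = l"
proof (simp add: vec_eq_iff, intro allI)
 fix i assume "v - lp k \<in> frequency_cube" "v - lp l \<in> frequency_cube"
 then have "- 1/2 < v $ i - of_int (k $ i)" "v $ i - of_int (k $ i) < 1/2" "- 1/2 < v $ i - of_int (l $ i)" "v $ i - of_int (l $ i) < 1/2"
  by (auto simp: frequency_cube_def lattice_point_def)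
 then show "k $ i = l $ i" by linarith
qed

lemma cube_norm: "v \<in> frequency_cube ==> norm v <= CARD('n)" for v :: "real^'n"
proof -
 assume v: "v \<in> frequency_cube"
 have "\<bar>v $ i\<bar> <= 1" for i using v unfolding frequency_cube_def mem_Collect_eq by (smt (verit) field_sum_of_halves)
 then have "(\<Sum>i\<in>UNIV. \<bar>v $ i\<bar>) <= (\<Sum>i\<in>(UNIV::'n set). 1)" by (intro sum_mono)
 then show ?thesis using norm_le_l1_cart[of v] by simp
qed

text \<open>A point may lie on the boundary between translated open cubes; a small step along the
  diagonal moves it into the interior of one of them.\<close>

lemma eventually_in_cell:
 fixes v :: "real^'n"
 shows "\<forall>\<^sub>F t in at_right 0. \<exists>l. v + t *\<^sub>R 1 - lp l \<in> frequency_cube"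
proof -
 have 1: "\<forall>\<^sub>F t in at_right 0. \<exists>z::int. \<bar>c + t - z\<bar> < 1/2" for c :: real
 proof -
  have "\<forall>\<^sub>F t in at_right 0. t < \<lfloor>c + 1/2\<rfloor> + 1 - (c + 1/2)"
   by (rule eventually_at_right_real[THEN eventually_mono, of 0 "\<lfloor>c + 1/2\<rfloor> + 1 - (c + 1/2)"]) (auto, linarith)
  then show ?thesis using eventually_at_right_less[of "0::real"]
  proof eventually_elim
   case (elim t)
   have "\<bar>c + t - \<lfloor>c + 1/2\<rfloor>\<bar> < 1/2" using elim by linarith
   then show ?case by blast
  qed
 qed
 have "\<forall>\<^sub>F t in at_right 0. \<forall>i. \<exists>z::int. \<bar>v $ i + t - z\<bar> < 1/2" by (rule eventually_all_finite) (rule 1)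
 then show ?thesis
 proof eventually_elim
  case (elim t)
  then obtain z where z: "!!i. \<bar>v $ i + t - of_int (z i)\<bar> < 1/2" by metis
  have "- (1/2) < v $ i + t - of_int (z i) & v $ i + t - of_int (z i) < 1/2" for i using z[of i] by (auto simp only: abs_less_iff)
  then have "v + t *\<^sub>R 1 - lp (\<chi> i. z i) \<in> frequency_cube" by (simp add: frequency_cube_def lattice_point_def)
  then show ?case by blast
 qed
qed

context band
begin

lemma vm_bound: obtains B where "B > 0" "!!x. norm (x v* b) <= B * norm x" "!!x. norm (x v* matrix_inv b) <= B * norm x"
proof -
 define B where "B = onorm (%x. x v* b) + onorm (%x. x v* matrix_inv b) + 1"
 note o = onorm_pos_le[OF vm_linear[of b]] onorm_pos_le[OF vm_linear[of "matrix_inv b"]]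
 show ?thesis
 proof (rule that[of B])
  show "B > 0" using o by (simp add: B_def)
  show "norm (x v* b) <= B * norm x" for x
   by (rule order_trans[OF onorm[OF vm_linear]]) (use o in \<open>auto simp: B_def intro!: mult_right_mono\<close>)
  show "norm (x v* matrix_inv b) <= B * norm x" for x
   by (rule order_trans[OF onorm[OF vm_linear]]) (use o in \<open>auto simp: B_def intro!: mult_right_mono\<close>)
 qed
qed

text \<open>The series of the samples is periodic and equals \<open>G f\<close> on the open cube, so
  on each cell it is a translate of \<open>G f\<close>. Boundary points are reached along the
  diagonal by continuity, and a bounded region meets finitely many cells.\<close>

lemma periodization:
 obtains L where "finite L" "0 \<in> L" "!!f v. L1 f ==> norm (v v* matrix_inv b) <= R ==> Shat (coef f) v = (\<Sum>l\<in>L. G f (v - lp l))"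
proof -
 obtain B where B: "B > 0" "!!x. norm (x v* b) <= B * norm x" using vm_bound by metis
 \<comment> \<open>The first summand bounds |v|, the second the diagonal step with t < 1, the third
   a point of the cube; together they bound the lattice point of the cell.\<close>
 define r where "r = B * \<bar>R\<bar> + CARD('n) + CARD('n)"
 define L where "L = {l :: int^'n. norm (lp l) <= r}"
 have L: "finite L" unfolding L_def by (rule finite_lattice_ball)
 show ?thesis
 proof (rule that[OF L])
  show "0 \<in> L" using B by (simp add: L_def r_def)
  fix f :: "real^'n => complex" and v :: "real^'n" assume f: "L1 f" and v: "norm (v v* matrix_inv b) <= R"
  have nv: "norm v <= B * \<bar>R\<bar>"
   using B(2)[of "v v* matrix_inv b"] mult_left_mono[of "norm (v v* matrix_inv b)" "\<bar>R\<bar>" B] v B(1) by (simp only: T_inv) linarith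
  have n1: "norm (t *\<^sub>R (1::real^'n)) <= CARD('n)" if "0 < t" "t < 1" for t
  proof -
   have "norm (t *\<^sub>R (1::real^'n)) <= 1 * norm (1::real^'n)" unfolding norm_scaleR using that by (intro mult_right_mono) auto
   also have "... <= CARD('n)" using norm_le_l1_cart[of "1::real^'n"] by simp
   finally show ?thesis .
  qed
  have c1: "\<forall>\<^sub>F t in at_right 0. Shat (coef f) (v + t *\<^sub>R 1) = (\<Sum>l\<in>L. G f (v + t *\<^sub>R 1 - lp l))"
   using eventually_in_cell[of v] eventually_at_right_real[of 0 "1::real", OF zero_less_one]
  proof eventually_elim
   case (elim t)
   then obtain k where k: "v + t *\<^sub>R 1 - lp k \<in> frequency_cube" by blast
   have "norm (lp k) = norm ((v + t *\<^sub>R 1) - (v + t *\<^sub>R 1 - lp k))" by simp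
   also have "... <= norm (v + t *\<^sub>R 1) + norm (v + t *\<^sub>R 1 - lp k)" by (rule norm_triangle_ineq4)
   also have "... <= norm v + norm (t *\<^sub>R (1::real^'n)) + norm (v + t *\<^sub>R 1 - lp k)" by (intro add_right_mono norm_triangle_ineq)
   finally have "norm (lp k) <= norm v + norm (t *\<^sub>R (1::real^'n)) + norm (v + t *\<^sub>R 1 - lp k)" .
   then have kL: "k \<in> L" unfolding L_def r_def using nv n1[of t] cube_norm[OF k] elim by simp
   have "Shat (coef f) (v + t *\<^sub>R 1) = G f (v + t *\<^sub>R 1 - lp k)"
    using Shat_periodic[of "coef f" "v + t *\<^sub>R 1" k] coef_hat[OF f k] by simp
   also have "... = (\<Sum>l\<in>{k}. G f (v + t *\<^sub>R 1 - lp l))" by simp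
   also have "... = (\<Sum>l\<in>L. G f (v + t *\<^sub>R 1 - lp l))"
   proof (rule sum.mono_neutral_left[OF L])
    show "\<forall>l\<in>L - {k}. G f (v + t *\<^sub>R 1 - lp l) = 0"
    proof
     fix l assume "l \<in> L - {k}"
     then have "v + t *\<^sub>R 1 - lp l \<notin> frequency_cube" using cube_unique[OF k] by auto
     then show "G f (v + t *\<^sub>R 1 - lp l) = 0" by (rule G_props(2)[OF f])
    qed
   qed (use kL in auto)
   finally show ?case .
  qed
  have lim: "((%t. v + t *\<^sub>R 1 - lp l) \<longlongrightarrow> v - lp l) (at_right 0)" for l
  proof -
   have "((%t. v + t *\<^sub>R 1 - lp l) \<longlongrightarrow> v + 0 *\<^sub>R 1 - lp l) (at_right 0)" by (intro tendsto_intros)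
   then show ?thesis by simp
  qed
  have c2: "((%t. Shat (coef f) (v + t *\<^sub>R 1)) \<longlongrightarrow> Shat (coef f) v) (at_right 0)"
   by (rule continuous_on_tendsto_compose[OF continuous_Shat[OF coef_l1[OF f]]]) (use lim[of 0] in auto)
  have c3: "((%t. \<Sum>l\<in>L. G f (v + t *\<^sub>R 1 - lp l)) \<longlongrightarrow> (\<Sum>l\<in>L. G f (v - lp l))) (at_right 0)"
   by (intro tendsto_sum continuous_on_tendsto_compose[OF G_props(1)[OF f] lim]) auto
  show "Shat (coef f) v = (\<Sum>l\<in>L. G f (v - lp l))"
   by (rule tendsto_unique[OF trivial_limit_at_right_real Lim_transform_eventually[OF c2 c1] c3])
 qed
qed

definition Syn :: "(int^'n => complex) => (real^'n => complex) => real^'n => complex" where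
 "Syn s f = sm lat (%k. b *v lp k) s f"

lemma Syn:
 assumes s: "integrable lat s" and f: "L1 f"
 shows "L1 (Syn s f)" "N (Syn s f) <= (NK k. norm (s k)) * N f" "F (Syn s f) y = Shat s (y v* b) * F f y"
proof -
 note sm = sm[OF sigma_lat _ s f, of "%k. b *v lp k", folded Syn_def]
 show "L1 (Syn s f)" "N (Syn s f) <= (NK k. norm (s k)) * N f" using sm(1,2) by auto
 have "E (b *v lp k) (- y) = E (lp k) (- (y v* b))" for k
  by (simp add: E_def dot_lmul_matrix[symmetric] inner_commute[of "b *v lp k"] inner_commute[of "lp k"])
 then show "F (Syn s f) y = Shat s (y v* b) * F f y" using sm(3)[of y] by (simp add: Shat_def)
qed

text \<open>Sample f at scale a and synthesise with h at the same scale. The sampled function is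
  \<open>dil (1 / a) f\<close> so that one lattice and one kernel serve all scales. With h = psi
  this is an admissible level of the series; other h occur in its Riesz transform.\<close>

definition T :: "real => (real^'n => complex) => (real^'n => complex) => real^'n => complex" where
 "T a f h = dil a (Syn (coef (dil (1 / a) f)) h)"

definition CT :: real where "CT = Kb * C0 * CL"

lemma CT: "CT >= 0" using Kb(1) C0 CL(1) by (simp add: CT_def)

lemma T:
 assumes f: "L1 f" and h: "L1 h" and a: "a ~= 0"
 shows "L1 (T a f h)" "N (T a f h) <= ennreal CT * N f * N h"
  "F (T a f h) y = Shat (coef (dil (1 / a) f)) ((y /\<^sub>R a) v* b) * F h (y /\<^sub>R a)"
proof -
 have d: "L1 (dil (1 / a) f)" using f a by (intro L1_dil) auto
 note s = Syn[OF coef_l1[OF d] h]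
 show "L1 (T a f h)" unfolding T_def using s(1) a by (rule L1_dil)
 have "N (T a f h) = N (Syn (coef (dil (1 / a) f)) h)" unfolding T_def using s(1) a by (intro N_dil) auto
 also have "... <= (NK k. norm (coef (dil (1 / a) f) k)) * N h" by (rule s(2))
 also have "... <= (ennreal CT * N (dil (1 / a) f)) * N h" unfolding CT_def by (intro mult_right_mono coef_bound d) auto
 also have "N (dil (1 / a) f) = N f" using f a by (intro N_dil) auto
 finally show "N (T a f h) <= ennreal CT * N f * N h" .
 show "F (T a f h) y = Shat (coef (dil (1 / a) f)) ((y /\<^sub>R a) v* b) * F h (y /\<^sub>R a)"
  unfolding T_def F_dil[OF s(1) a] s(3) ..
qed

text \<open>Synthesis is a pointwise Bochner integral over the lattice and is additive only where it
  converges; comparing transforms avoids tracking the exceptional set.\<close>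

lemma T_diff_N:
 assumes f: "L1 f" and h: "L1 h" "L1 h'" and a: "a ~= 0"
 shows "N (%x. T a f h x - T a f h' x) <= ennreal CT * N f * N (%x. h x - h' x)"
proof -
 have hd: "L1 (%x. h x - h' x)" using h by auto
 note t = T[OF f h(1) a] T[OF f h(2) a] T[OF f hd a]
 have "AEL x. (T a f h x - T a f h' x) - T a f (%x. h x - h' x) x = 0"
 proof (rule F_inj_AE)
  have d1: "L1 (%x. T a f h x - T a f h' x)" using t(1,4) by auto
  show "F (%x. T a f h x - T a f h' x - T a f (%x. h x - h' x) x) y = 0" for y
   unfolding F_diff[OF d1 t(7)] F_diff[OF t(1,4)] t(3,6,9) F_diff[OF h] by (simp add: algebra_simps)
  show "L1 (%x. T a f h x - T a f h' x - T a f (%x. h x - h' x) x)" using d1 t(7) by auto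
 qed
 then have "N (%x. T a f h x - T a f h' x) = N (T a f (%x. h x - h' x))"
  by (intro N_cong_AE) (auto elim!: eventually_mono)
 then show ?thesis using t(8) by simp
qed

text \<open>Each translate of \<open>G\<close> in the periodised series contributes the transform of
  f shifted by a times a dual lattice vector, that is, a modulated copy of f smoothed by a dilated
  fixed kernel. A bounded spectrum of h leaves finitely many such terms for all f and a at
  once.\<close>

lemma T_band_limited:
 assumes h: "L1 h" and R: "!!y. F h y ~= 0 ==> norm y <= R"
 obtains L where "finite L" "0 \<in> L"
  "!!f a. L1 f ==> a ~= 0 ==> AEL x. T a f h x =
    (\<Sum>l\<in>L. E x (a *\<^sub>R (lp l v* matrix_inv b)) * conv f (dil a (conv th (%x. E x (- (lp l v* matrix_inv b)) * h x))) x)"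
proof -
 obtain L where L: "finite L" "0 \<in> L" "!!f v. L1 f ==> norm (v v* matrix_inv b) <= R ==> Shat (coef f) v = (\<Sum>l\<in>L. G f (v - lp l))"
  using periodization[of R] by metis
 define lam where "lam l = lp l v* matrix_inv b" for l
 define K where "K l = conv th (%x. E x (- lam l) * h x)" for l
 have K: "L1 (K l)" "F (K l) y = F th y * F h (y + lam l)" for l y
  unfolding K_def using conv[OF th_L1 L1_modulate[OF h, of "- lam l"]] by (auto simp: F_modulate)
 show ?thesis
 proof (rule that[OF L(1,2)])
  fix f :: "real^'n => complex" and a :: real assume f: "L1 f" and a: "a ~= 0"
  define g where "g = dil (1 / a) f"
  have g: "L1 g" "F g y = F f (a *\<^sub>R y)" for y using L1_dil[OF f, of "1/a"] F_dil[OF f, of "1/a" y] a by (auto simp: g_def)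
  define X where "X l x = E x (a *\<^sub>R lam l) * conv f (dil a (K l)) x" for l x
  have cL: "L1 (conv f (dil a (K l)))" for l using conv(1)[OF f L1_dil[OF K(1) a]] .
  have XL: "L1 (X l)" for l unfolding X_def using cL by (rule L1_modulate)
  have FX: "F (X l) y = F f (y - a *\<^sub>R lam l) * F (K l) ((y - a *\<^sub>R lam l) /\<^sub>R a)" for l y
   unfolding X_def F_modulate conv(3)[OF f L1_dil[OF K(1) a]] F_dil[OF K(1) a] ..
  have XS: "L1 (%x. \<Sum>l\<in>L. X l x)" using XL by auto
  have "F (%x. T a f h x - (\<Sum>l\<in>L. X l x)) y = 0" for y
  proof -
   have "F (T a f h) y = (\<Sum>l\<in>L. F (X l) y)"
   proof (cases "F h (y /\<^sub>R a) = 0")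
    case True
    have "F (X l) y = 0" for l
     using True a by (simp add: FX K(2) scaleR_diff_right)
    then show ?thesis using True by (simp add: T(3)[OF f h a])
   next
    case False
    have n: "norm (((y /\<^sub>R a) v* b) v* matrix_inv b) <= R" using R[OF False] by simp
    have GX: "G g ((y /\<^sub>R a) v* b - lp l) * F h (y /\<^sub>R a) = F (X l) y" for l
    proof -
     have "((y /\<^sub>R a) v* b - lp l) v* matrix_inv b = y /\<^sub>R a - lam l"
      by (simp add: lam_def vector_matrix_mult_diff_distrib)
     then show ?thesis using a by (simp add: G_def g(2) FX K(2) scaleR_diff_right)
    qed
    have "F (T a f h) y = (\<Sum>l\<in>L. G g ((y /\<^sub>R a) v* b - lp l)) * F h (y /\<^sub>R a)"
     unfolding T(3)[OF f h a] g_def[symmetric] L(3)[OF g(1) n] ..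
    then show ?thesis by (simp add: sum_distrib_right GX)
   qed
   then show ?thesis using T(1)[OF f h a] XS XL by (simp add: F_diff F_sum)
  qed
  moreover have "L1 (%x. T a f h x - (\<Sum>l\<in>L. X l x))" using T(1)[OF f h a] XS by auto
  ultimately have "AEL x. T a f h x - (\<Sum>l\<in>L. X l x) = 0" by (rule F_inj_AE[rotated])
  then show "AEL x. T a f h x =
    (\<Sum>l\<in>L. E x (a *\<^sub>R (lp l v* matrix_inv b)) * conv f (dil a (conv th (%x. E x (- (lp l v* matrix_inv b)) * h x))) x)"
   by eventually_elim (simp add: X_def K_def lam_def)
 qed
qed

end

context band
begin

text \<open>The dual lattice of the translations: its exponentials are 1 at all points
  \<open>b *v lp k\<close>.\<close>

definition lam :: "int^'n => real^'n" where "lam l = lp l v* matrix_inv b"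

lemma lam_zero: "lam l = 0 \<longleftrightarrow> l = 0"
proof
 assume "lam l = 0"
 then have "lam l v* b = 0" by simp
 then have "lp l = 0" by (simp add: lam_def)
 then show "l = 0" by (simp add: lattice_point_def vec_eq_iff)
qed (simp add: lam_def)

text \<open>Each alias is an approximate identity applied to f and then modulated; its kernel has
  integral \<open>F h (lam l)\<close> since the transform of \<open>th\<close> is 1 at the origin.
  The term l = 0 gives the main part, the others survive with growing frequencies.\<close>

lemma T_limit_band_limited:
 fixes f h :: "real^'n => complex"
 assumes a: "filterlim (%j. \<bar>\<alpha> j\<bar>) at_top sequentially" "!!j. \<alpha> j ~= 0"
  and f: "L1 f" and h: "L1 h" and R: "!!y. F h y ~= 0 ==> norm y <= R"
 shows "\<exists>L. finite L & 0 \<notin> L &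
  (%j. N (%x. T (\<alpha> j) f h x - F h 0 * f x - (\<Sum>l\<in>L. F h (lam l) * (E x (\<alpha> j *\<^sub>R lam l) * f x)))) ---> 0"
proof -
 obtain L where L0: "finite L" "0 \<in> L"
  "!!f a. L1 f ==> a ~= 0 ==> AEL x. T a f h x =
    (\<Sum>l\<in>L. E x (a *\<^sub>R (lp l v* matrix_inv b)) * conv f (dil a (conv th (%x. E x (- (lp l v* matrix_inv b)) * h x))) x)"
  by (rule T_band_limited[OF h R]) (assumption, rule that)
 note L = L0(1,2) L0(3)[folded lam_def]
 define K where "K l = conv th (%x. E x (- lam l) * h x)" for l
 have K: "L1 (K l)" "F (K l) y = F th y * F h (y + lam l)" for l y
  unfolding K_def using conv[OF th_L1 L1_modulate[OF h, of "- lam l"]] by (auto simp: F_modulate)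
 have [measurable]: "f \<in> bm" "h \<in> bm" using f h by auto
 have [measurable]: "K l \<in> bm" for l using K by auto
 define D where "D l j = N (%x. conv f (dil (\<alpha> j) (K l)) x - F (K l) 0 * f x)" for l j
 have "(%j. \<Sum>l\<in>L. D l j) ---> (\<Sum>l\<in>L. 0)"
  unfolding D_def by (intro tendsto_sum approx_identity f K(1) a)
 then have D: "(%j. \<Sum>l\<in>L. D l j) ---> 0" by simp
 have "N (%x. T (\<alpha> j) f h x - F h 0 * f x - (\<Sum>l\<in>L - {0}. F h (lam l) * (E x (\<alpha> j *\<^sub>R lam l) * f x))) <= (\<Sum>l\<in>L. D l j)" for j
 proof -
  define Y where "Y l x = E x (\<alpha> j *\<^sub>R lam l) * (conv f (dil (\<alpha> j) (K l)) x - F (K l) 0 * f x)" for l x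
  have "AEL x. T (\<alpha> j) f h x - F h 0 * f x - (\<Sum>l\<in>L - {0}. F h (lam l) * (E x (\<alpha> j *\<^sub>R lam l) * f x)) = (\<Sum>l\<in>L. Y l x)"
   using L(3)[OF f a(2)[of j]]
  proof eventually_elim
   case (elim x)
   have "F h 0 * f x + (\<Sum>l\<in>L - {0}. F h (lam l) * (E x (\<alpha> j *\<^sub>R lam l) * f x)) = (\<Sum>l\<in>L. F h (lam l) * (E x (\<alpha> j *\<^sub>R lam l) * f x))"
    using sum.remove[OF L(1,2), of "%l. F h (lam l) * (E x (\<alpha> j *\<^sub>R lam l) * f x)"] by (simp add: lam_def)
   then show ?case
    unfolding elim K_def[symmetric] diff_diff_eq by (simp add: Y_def K(2) th(3) sum_subtractf[symmetric] right_diff_distrib mult_ac)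
  qed
  then have "N (%x. T (\<alpha> j) f h x - F h 0 * f x - (\<Sum>l\<in>L - {0}. F h (lam l) * (E x (\<alpha> j *\<^sub>R lam l) * f x))) = N (%x. \<Sum>l\<in>L. Y l x)"
   by (rule N_cong_AE)
  also have "... <= (\<Sum>l\<in>L. N (Y l))" by (rule N_sum[OF L(1)]) (auto simp: Y_def[abs_def])
  also have "... = (\<Sum>l\<in>L. D l j)" by (intro sum.cong refl) (simp add: Y_def[abs_def] N_modulate D_def)
  finally show ?thesis .
 qed
 then have "(%j. N (%x. T (\<alpha> j) f h x - F h 0 * f x - (\<Sum>l\<in>L - {0}. F h (lam l) * (E x (\<alpha> j *\<^sub>R lam l) * f x)))) ---> 0"
  by (intro tendsto_sandwich[OF _ _ tendsto_const D] always_eventually allI) auto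
 then show ?thesis using L(1) by (intro exI[of _ "L - {0}"]) auto
qed

text \<open>Convolving h with a dilate of \<open>th\<close> makes it band limited, and the resulting
  error in \<open>T\<close> is controlled uniformly over all scales by
  \<open>T_diff_N\<close>.\<close>

lemma T_limit:
 fixes f h :: "real^'n => complex"
 assumes a: "filterlim (%j. \<bar>\<alpha> j\<bar>) at_top sequentially" "!!j. \<alpha> j ~= 0"
  and f: "L1 f" and h: "L1 h" and d: "d > 0"
 shows "\<exists>L c. finite L & 0 \<notin> L &
  (\<forall>\<^sub>F j in sequentially. N (%x. T (\<alpha> j) f h x - F h 0 * f x - (\<Sum>l\<in>L. c l * (E x (\<alpha> j *\<^sub>R lam l) * f x))) <= ennreal d)"
proof -
 obtain B where B: "B > 0" "!!x. norm (x v* matrix_inv b) <= B * norm x" using vm_bound by metis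
 have [measurable]: "f \<in> bm" "h \<in> bm" using f h by auto
 \<comment> \<open>The 1 keeps B1 positive; half of d is spent on replacing h, half on the
   band-limited limit.\<close>
 define B1 where "B1 = CT * (LI x. norm (f x)) + 1"
 define e where "e = d / (2 * B1)"
 have nf: "(LI x. norm (f x)) >= 0" by simp
 have pos: "B1 > 0" unfolding B1_def using CT nf by (intro add_nonneg_pos mult_nonneg_nonneg) auto
 have e: "e > 0" using d pos by (simp add: e_def)
 have "(%j. N (%x. conv h (dil (real (Suc j)) th) x - F th 0 * h x)) ---> 0"
 proof (rule approx_identity[OF h th_L1])
  show "filterlim (%j. \<bar>real (Suc j)\<bar>) at_top sequentially"
   using filterlim_compose[OF filterlim_real_sequentially filterlim_Suc] by simp
 qed simp
 then have "\<forall>\<^sub>F j in sequentially. N (%x. conv h (dil (real (Suc j)) th) x - F th 0 * h x) < ennreal e"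
  using e by (intro order_tendstoD) auto
 then obtain j where j: "N (%x. conv h (dil (real (Suc j)) th) x - h x) < ennreal e"
  using th(3) by (auto simp: eventually_sequentially)
 define r where "r = real (Suc j)"
 have r: "r > 0" by (simp add: r_def)
 define k where "k = conv h (dil r th)"
 have dL: "L1 (dil r th)" using th_L1 r by (intro L1_dil) auto
 have k: "L1 k" "F k y = F h y * F th (y /\<^sub>R r)" for y
  unfolding k_def using conv[OF h dL] F_dil[OF th_L1, of r] r by auto
 have [measurable]: "k \<in> bm" using k by auto
 have k0: "F k 0 = F h 0" using k(2)[of 0] th(3) by simp
 have supp: "norm y <= r * (B * real CARD('n))" if "F k y ~= 0" for y
 proof -
  have "F th (y /\<^sub>R r) ~= 0" using that k(2) by auto
  then have "norm ((y /\<^sub>R r) v* b) <= real CARD('n)" using thF(1) cube_norm by blast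
  then have "norm (((y /\<^sub>R r) v* b) v* matrix_inv b) <= B * real CARD('n)"
   using B order_trans[OF B(2)] by (meson less_imp_le mult_left_mono order_trans)
  then have "norm y / r <= B * real CARD('n)" using r by (simp add: divide_inverse mult.commute)
  then show ?thesis using r by (simp add: field_simps)
 qed
 obtain L where L: "finite L" "0 \<notin> L"
  "(%j. N (%x. T (\<alpha> j) f k x - F k 0 * f x - (\<Sum>l\<in>L. F k (lam l) * (E x (\<alpha> j *\<^sub>R lam l) * f x)))) ---> 0"
  by (rule exE[OF T_limit_band_limited[OF a f k(1) supp]]) (assumption, elim conjE, rule that)
 have "\<forall>\<^sub>F j in sequentially. N (%x. T (\<alpha> j) f k x - F k 0 * f x - (\<Sum>l\<in>L. F k (lam l) * (E x (\<alpha> j *\<^sub>R lam l) * f x))) < ennreal (d / 2)"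
  using L(3) d by (intro order_tendstoD) auto
 then have "\<forall>\<^sub>F j in sequentially. N (%x. T (\<alpha> j) f h x - F h 0 * f x - (\<Sum>l\<in>L. F k (lam l) * (E x (\<alpha> j *\<^sub>R lam l) * f x))) <= ennreal d"
 proof eventually_elim
  case (elim i)
  have [measurable]: "T (\<alpha> i) f h \<in> bm" "T (\<alpha> i) f k \<in> bm"
   using T(1)[OF f h a(2)] T(1)[OF f k(1) a(2)] by auto
  have "N (%x. T (\<alpha> i) f h x - T (\<alpha> i) f k x) <= ennreal CT * N f * N (%x. h x - k x)" by (rule T_diff_N[OF f h k(1) a(2)])
  also have "... <= ennreal CT * N f * ennreal e"
   using j N_diff_commute[of h k] by (intro mult_left_mono) (auto simp: k_def r_def)
  also have "... = ennreal (CT * (LI x. norm (f x)) * e)" using CT nf e by (simp add: N_eq[OF f] ennreal_mult' mult_nonneg_nonneg)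
  also have "CT * (LI x. norm (f x)) * e <= B1 * e" unfolding B1_def using e by (intro mult_right_mono) auto
  also have "... = d / 2" using pos unfolding e_def by simp
  finally have 1: "N (%x. T (\<alpha> i) f h x - T (\<alpha> i) f k x) <= ennreal (d / 2)" using ennreal_leI by blast
  define Z where "Z x = F h 0 * f x + (\<Sum>l\<in>L. F k (lam l) * (E x (\<alpha> i *\<^sub>R lam l) * f x))" for x
  have [measurable]: "Z \<in> bm" unfolding Z_def[abs_def] by measurable
  have "N (%x. T (\<alpha> i) f h x - Z x) <= N (%x. T (\<alpha> i) f h x - T (\<alpha> i) f k x) + N (%x. T (\<alpha> i) f k x - Z x)"
   by (rule N_triangle3) auto
  also have "... <= ennreal (d / 2) + ennreal (d / 2)"
   using 1 elim by (intro add_mono) (auto simp: Z_def k0 diff_diff_eq less_imp_le)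
  also have "... = ennreal d" using d by (simp add: ennreal_plus[symmetric] del: ennreal_plus)
  finally show ?case by (simp add: Z_def diff_diff_eq)
 qed
 then show ?thesis using L by (intro exI[of _ L] exI[of _ "%l. F k (lam l)"]) auto
qed

text \<open>One common set of scales for a finite family of pairs, and for arbitrary weights s of
  modulus at most 1: the function and all components of its Riesz transform must be approximated
  with the same coefficients.\<close>

lemma averages_small:
 fixes f h :: "'i => real^'n => complex"
 assumes a: "filterlim (%j. \<bar>\<alpha> j\<bar>) at_top sequentially" "!!j. \<alpha> j ~= 0"
  and I: "finite I" and f: "!!i. i \<in> I ==> L1 (f i)" and h: "!!i. i \<in> I ==> L1 (h i)" and d: "d > 0"
 shows "\<exists>A. finite A & A ~= {} & A \<subseteq> {N0..} & (\<forall>s i. (\<forall>j. norm (s j) <= 1) --> i \<in> I -->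
  N (%x. (\<Sum>j\<in>A. s j * (T (\<alpha> j) (f i) (h i) x - F (h i) 0 * f i x)) / of_nat (card A)) <= ennreal d)"
proof -
 have ex: "\<forall>i. \<exists>L c. i \<in> I --> finite L & 0 \<notin> L &
  (\<forall>\<^sub>F j in sequentially. N (%x. T (\<alpha> j) (f i) (h i) x - F (h i) 0 * f i x - (\<Sum>l\<in>L. c l * (E x (\<alpha> j *\<^sub>R lam l) * f i x))) <= ennreal (d / 2))"
  (is "\<forall>i. \<exists>L c. i \<in> I --> ?P i L c")
 proof
  fix i
  show "\<exists>L c. i \<in> I --> ?P i L c"
  proof (cases "i \<in> I")
   case True
   from T_limit[OF a f[OF True] h[OF True] half_gt_zero[OF d]] obtain L c where "?P i L c" by (elim exE)
   then show ?thesis by (intro exI impI)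
  qed simp
 qed
 from choice[OF ex] obtain L where ex2: "\<forall>i. \<exists>c. i \<in> I --> ?P i (L i) c" by (elim exE)
 from choice[OF ex2] obtain c where c: "\<forall>i. i \<in> I --> ?P i (L i) (c i)" by (elim exE)
 note Lc = c[rule_format, THEN conjunct1] c[rule_format, THEN conjunct2, THEN conjunct1] c[rule_format, THEN conjunct2, THEN conjunct2]
 have "\<forall>\<^sub>F j in sequentially. \<forall>i\<in>I. N (%x. T (\<alpha> j) (f i) (h i) x - F (h i) 0 * f i x - (\<Sum>l\<in>L i. c i l * (E x (\<alpha> j *\<^sub>R lam l) * f i x))) <= ennreal (d / 2)"
  by (rule eventually_ball_finite[OF I]) (rule ballI, rule Lc(3))
 then obtain N1 where N1: "!!i j. j >= N1 ==> i \<in> I ==> N (%x. T (\<alpha> j) (f i) (h i) x - F (h i) 0 * f i x - (\<Sum>l\<in>L i. c i l * (E x (\<alpha> j *\<^sub>R lam l) * f i x))) <= ennreal (d / 2)"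
  by (auto simp: eventually_sequentially)
 \<comment> \<open>The total size of all alias coefficients, plus 1; each averaged modulation is
   made smaller than d/(2C), so all of them together cost at most d/2.\<close>
 define C where "C = (\<Sum>i\<in>I. \<Sum>l\<in>L i. norm (c i l)) + 1"
 have C0: "C > 0" unfolding C_def by (intro add_nonneg_pos sum_nonneg) auto
 have Ci: "(\<Sum>l\<in>L i. norm (c i l)) <= C" if "i \<in> I" for i
  using member_le_sum[of i I "%i. \<Sum>l\<in>L i. norm (c i l)"] that I by (simp add: C_def sum_nonneg)
 define L' where "L' = lam ` (\<Union>i\<in>I. L i)"
 have L': "finite L'" "0 \<notin> L'" using I Lc(1,2) by (auto simp: L'_def lam_zero eq_commute[of 0])
 obtain A where A: "finite A" "A ~= {}" "A \<subseteq> {max N0 N1..}"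
  "!!s g l. \<forall>j. norm (s j) <= 1 ==> g \<in> f ` I ==> l \<in> L' ==> N (%x. (\<Sum>j\<in>A. s j * E x (\<alpha> j *\<^sub>R l)) / of_nat (card A) * g x) <= ennreal (d / (2 * C))"
 proof -
  have fI: "finite (f ` I)" "!!g. g \<in> f ` I ==> L1 g" "d / (2 * C) > 0" using I f d C0 by auto
  show thesis by (rule exE[OF averaging[OF a(1) fI(1,2) L' fI(3), of "max N0 N1"]]) (assumption, elim conjE, rule that, assumption+, blast)
 qed
 have cA: "card A > 0" using A by (simp add: card_gt_0_iff)
 have "N (%x. (\<Sum>j\<in>A. s j * (T (\<alpha> j) (f i) (h i) x - F (h i) 0 * f i x)) / of_nat (card A)) <= ennreal d"
  if s: "\<forall>j. norm (s j) <= 1" and i: "i \<in> I" for s i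
 proof -
  have [measurable]: "f i \<in> bm" "h i \<in> bm" "T (\<alpha> j) (f i) (h i) \<in> bm" for j
   using f[OF i] h[OF i] T(1)[OF f[OF i] h[OF i] a(2)] by auto
  define X where "X j x = (s j / of_nat (card A)) * (T (\<alpha> j) (f i) (h i) x - F (h i) 0 * f i x - (\<Sum>l\<in>L i. c i l * (E x (\<alpha> j *\<^sub>R lam l) * f i x)))" for j x
  define Y where "Y l x = c i l * ((\<Sum>j\<in>A. s j * E x (\<alpha> j *\<^sub>R lam l)) / of_nat (card A) * f i x)" for l x
  have [measurable]: "X j \<in> bm" "Y l \<in> bm" for j l
   unfolding X_def[abs_def] Y_def[abs_def] by measurable
  have eq: "(\<Sum>j\<in>A. s j * (T (\<alpha> j) (f i) (h i) x - F (h i) 0 * f i x)) / of_nat (card A) = (\<Sum>j\<in>A. X j x) + (\<Sum>l\<in>L i. Y l x)" for x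
  proof -
   have "(\<Sum>l\<in>L i. Y l x) = (\<Sum>j\<in>A. (s j / of_nat (card A)) * (\<Sum>l\<in>L i. c i l * (E x (\<alpha> j *\<^sub>R lam l) * f i x)))"
    unfolding Y_def sum_distrib_left sum_distrib_right sum_divide_distrib
    by (subst sum.swap) (simp add: mult_ac)
   then show ?thesis by (simp add: X_def sum.distrib[symmetric] sum_divide_distrib diff_divide_distrib algebra_simps)
  qed
  have "N (%x. (\<Sum>j\<in>A. X j x) + (\<Sum>l\<in>L i. Y l x)) <= N (%x. \<Sum>j\<in>A. X j x) + N (%x. \<Sum>l\<in>L i. Y l x)"
   by (rule N_triangle) auto
  also have "... <= (\<Sum>j\<in>A. N (X j)) + (\<Sum>l\<in>L i. N (Y l))" by (intro add_mono N_sum A(1) Lc(1) i) auto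
  also have "... <= (\<Sum>j\<in>A. ennreal (d / 2 / card A)) + (\<Sum>l\<in>L i. ennreal (norm (c i l) * (d / (2 * C))))"
  proof (intro add_mono sum_mono)
   fix j assume j: "j \<in> A"
   have "N (X j) = ennreal (norm (s j / of_nat (card A))) * N (%x. T (\<alpha> j) (f i) (h i) x - F (h i) 0 * f i x - (\<Sum>l\<in>L i. c i l * (E x (\<alpha> j *\<^sub>R lam l) * f i x)))"
    unfolding X_def[abs_def] by (rule N_cmult) measurable
   also have "... <= ennreal (1 / card A) * ennreal (d / 2)"
    using s j A(3) i by (intro mult_mono N1 ennreal_leI) (auto simp: norm_divide divide_right_mono)
   also have "... = ennreal (d / 2 / card A)" using d by (subst ennreal_mult[symmetric]) auto
   finally show "N (X j) <= ennreal (d / 2 / card A)" .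
  next
   fix l assume l: "l \<in> L i"
   have "N (Y l) = ennreal (norm (c i l)) * N (%x. (\<Sum>j\<in>A. s j * E x (\<alpha> j *\<^sub>R lam l)) / of_nat (card A) * f i x)"
    unfolding Y_def[abs_def] by (rule N_cmult) measurable
   also have "... <= ennreal (norm (c i l)) * ennreal (d / (2 * C))"
    using s i l by (intro mult_left_mono A(4)) (auto simp: L'_def)
   also have "... = ennreal (norm (c i l) * (d / (2 * C)))" using d C0 by (subst ennreal_mult[symmetric]) auto
   finally show "N (Y l) <= ennreal (norm (c i l) * (d / (2 * C)))" .
  qed
  also have "... = ennreal (d / 2) + ennreal ((\<Sum>l\<in>L i. norm (c i l)) * (d / (2 * C)))"
  proof -
   have "(\<Sum>j\<in>A. ennreal (d / 2 / card A)) = ennreal (\<Sum>j\<in>A. d / 2 / card A)" using d by (intro sum_ennreal) auto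
   moreover have "(\<Sum>j\<in>A. d / 2 / card A) = d / 2" using cA by simp
   moreover have "(\<Sum>l\<in>L i. ennreal (norm (c i l) * (d / (2 * C)))) = ennreal (\<Sum>l\<in>L i. norm (c i l) * (d / (2 * C)))"
    using d C0 by (intro sum_ennreal) auto
   ultimately show ?thesis by (simp only: sum_distrib_right)
  qed
  also have "... <= ennreal (d / 2) + ennreal (C * (d / (2 * C)))"
   using Ci[OF i] d C0 by (intro add_left_mono ennreal_leI mult_right_mono) auto
  also have "... = ennreal d" using d C0 by (simp add: ennreal_plus[symmetric] del: ennreal_plus)
  finally show ?thesis unfolding eq .
 qed
 then show ?thesis using A by (intro exI[of _ A]) auto
qed

end

section \<open>The Riesz transform of psi minus its band-limited part\<close>

lemma AE_translate:
 fixes a :: "'a::euclidean_space"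
 assumes "AEL x. Pr x" shows "AEL x. Pr (x - a)"
proof -
 obtain M where M: "{x. \<not> Pr x} \<subseteq> M" "M \<in> null_sets lborel" using AE_E[OF assms] by (auto simp: null_sets_def)
 then have [measurable]: "M \<in> sets borel" by auto
 have "(NI x. indicator M (x - a)) = (\<integral>\<^sup>+x. indicator M x \<partial>(lborel :: 'a measure))" by (rule lborel_translate(2)) measurable
 also have "... = 0" using M(2) by auto
 finally have "AEL x. indicator M (x - a) = (0::ennreal)" by (subst (asm) nn_integral_0_iff_AE) auto
 then show ?thesis by eventually_elim (use M(1) in \<open>auto split: split_indicator_asm\<close>)
qed

lemma N_vec_ge: "N (g i) <= N (%x. \<chi> i. g i x)" for g :: "'n::finite => 'a::euclidean_space => complex"
 unfolding N_def by (intro nn_integral_mono ennreal_leI) (metis Finite_Cartesian_Product.norm_nth_le vec_lambda_beta)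

lemma N_vec_le:
 fixes g :: "'n::finite => 'a::euclidean_space => complex"
 assumes "!!i. g i \<in> bm"
 shows "N (%x. \<chi> i. g i x) <= (\<Sum>i\<in>UNIV. N (g i))"
proof -
 have "N (%x. \<chi> i. g i x) <= (NI x. (\<Sum>i\<in>UNIV. ennreal (norm (g i x))))"
  unfolding N_def
 proof (rule nn_integral_mono)
  show "ennreal (norm (\<chi> i. g i x)) <= (\<Sum>i\<in>UNIV. ennreal (norm (g i x)))" for x
   using norm_vec_le_sum[of "\<chi> i. g i x"] by (simp add: ennreal_leI sum_ennreal)
 qed
 also have "... = (\<Sum>i\<in>UNIV. N (g i))" unfolding N_def using assms by (intro nn_integral_sum) auto
 finally show ?thesis .
qed

lemma RR_cong_AE: "RR i f g ==> AEL x. f x = f' x ==> L1 f' ==> RR i f' g"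
 using F_cong_AE[of f f'] by (auto simp: RR_def)

lemma H1_cong:
 assumes f: "f \<in> H1" and ae: "AEL x. f x = f' x"
 shows "f' \<in> H1" "H1_norm f' = H1_norm f"
proof -
 obtain f0 g where 0: "!!i. RR i f0 (g i)" "AEL x. f x = f0 x" using H1_D[OF f] by blast
 have ae': "AEL x. f' x = f0 x" using 0(2) ae by eventually_elim simp
 show "f' \<in> H1" by (rule H1_I(1)[OF 0(1) ae'])
 show "H1_norm f' = H1_norm f" using H1_I(2)[OF 0(1) ae'] H1_I(2)[OF 0] by simp
qed

lemma differences_local:
 fixes \<psi> \<psi>' :: "real^'n => complex"
 assumes \<psi>': "L1 \<psi>'" "AEL x. \<psi> x = \<psi>' x"
  and lim: "((%y. H1_norm (%x. \<psi> x - \<psi> (x - y))) \<longlongrightarrow> 0) (at 0)"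
 obtains d where "d > 0" "!!u. norm u < d ==> \<exists>g. \<forall>i. RR i (%x. \<psi>' x - \<psi>' (x - u)) (g i) & N (g i) <= 1"
proof -
 have "\<forall>\<^sub>F y in at 0. H1_norm (%x. \<psi> x - \<psi> (x - y)) < 1" using lim by (rule order_tendstoD) simp
 then obtain d where d: "d > 0" "!!y. y ~= 0 ==> norm y < d ==> H1_norm (%x. \<psi> x - \<psi> (x - y)) < 1"
  by (auto simp: eventually_at dist_norm)
 have "\<exists>g. \<forall>i. RR i (%x. \<psi>' x - \<psi>' (x - u)) (g i) & N (g i) <= 1" if u: "norm u < d" for u
 proof (cases "u = 0")
  case True
  have "RR i (%x. \<psi>' x - \<psi>' (x - u)) (%x. 0)" for i by (simp add: True RR_def F_def)
  then show ?thesis by (intro exI[of _ "%i x. 0"]) (auto simp: N_def)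
 next
  case False
  have lt: "H1_norm (%x. \<psi> x - \<psi> (x - u)) < 1" using d(2)[OF False u] .
  then have H: "(%x. \<psi> x - \<psi> (x - u)) \<in> H1" by (auto simp: H1_norm_def split: if_splits)
  obtain f0 g where 0: "!!i. RR i f0 (g i)" "AEL x. \<psi> x - \<psi> (x - u) = f0 x" using H1_D[OF H] by blast
  have ae: "AEL x. f0 x = \<psi>' x - \<psi>' (x - u)"
   using 0(2) \<psi>'(2) AE_translate[OF \<psi>'(2), of u] by eventually_elim simp
  have L: "L1 (%x. \<psi>' x - \<psi>' (x - u))" using \<psi>'(1) L1_translate[OF \<psi>'(1)] by auto
  have "N (g i) <= 1" for i
  proof -
   have "N (g i) <= N f0 + N (%x. \<chi> i. g i x)" using N_vec_ge[of g i] by (simp add: add_increasing)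
   also have "... = H1_norm (%x. \<psi> x - \<psi> (x - u))" using H1_I(2)[OF 0] by simp
   finally show ?thesis using lt by simp
  qed
  then show ?thesis using RR_cong_AE[OF 0(1) ae L] by blast
 qed
 then show ?thesis using that d(1) by blast
qed

text \<open>Telescope along k shorter steps of length below d, each of which has Riesz transform of
  norm at most 1. The resulting growth is linear in |u|, which is why \<open>th\<close> must have a
  finite first moment.\<close>

lemma differences_global:
 fixes f :: "real^'n => complex"
 assumes f: "L1 f" and d: "d > 0" "!!u. norm u < d ==> \<exists>g. \<forall>i. RR i (%x. f x - f (x - u)) (g i) & N (g i) <= 1"
 shows "\<exists>g. \<forall>i. RR i (%x. f x - f (x - u)) (g i) & N (g i) <= ennreal (2 + norm u / d)"
proof -
 define k where "k = Suc (nat \<lceil>norm u / d\<rceil>)"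
 have k: "norm u / d < real k" "real k <= 2 + norm u / d"
  using d(1) of_nat_ceiling[of "norm u / d"] by (auto simp: k_def) linarith+
 define v where "v = u /\<^sub>R real k"
 have kv: "real k *\<^sub>R v = u" by (simp add: v_def k_def)
 have "norm v < d"
 proof -
  have "norm u < d * real k" using k(1) d(1) by (simp add: field_simps)
  then show ?thesis by (simp add: v_def k_def field_simps)
 qed
 then obtain g where g: "!!i. RR i (%x. f x - f (x - v)) (g i)" "!!i. N (g i) <= 1" using d(2) by blast
 have [measurable]: "g i \<in> bm" for i using g(1)[of i] by (auto simp: RR_def)
 have tel: "(\<Sum>j<n. f (x - real j *\<^sub>R v) - f (x - real j *\<^sub>R v - v)) = f x - f (x - real n *\<^sub>R v)" for x n
  by (induction n) (auto simp: algebra_simps)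
 have "RR i (%x. f x - f (x - u)) (%x. \<Sum>j<k. g i (x - real j *\<^sub>R v)) & N (%x. \<Sum>j<k. g i (x - real j *\<^sub>R v)) <= ennreal (2 + norm u / d)" for i
 proof
  have "RR i (%x. \<Sum>j<k. f (x - real j *\<^sub>R v) - f (x - real j *\<^sub>R v - v)) (%x. \<Sum>j<k. g i (x - real j *\<^sub>R v))"
   by (rule RR_sum) (rule RR_translate[OF g(1)])
  then show "RR i (%x. f x - f (x - u)) (%x. \<Sum>j<k. g i (x - real j *\<^sub>R v))" unfolding tel kv .
  have "N (%x. \<Sum>j<k. g i (x - real j *\<^sub>R v)) <= (\<Sum>j<k. N (%x. g i (x - real j *\<^sub>R v)))" by (rule N_sum) auto
  also have "... <= (\<Sum>j<k. 1)" by (intro sum_mono) (simp add: N_translate g(2))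
  also have "... = ennreal (real k)" by (simp add: ennreal_of_nat_eq_real_of_nat)
  also have "... <= ennreal (2 + norm u / d)" by (rule ennreal_leI[OF k(2)])
  finally show "N (%x. \<Sum>j<k. g i (x - real j *\<^sub>R v)) <= ennreal (2 + norm u / d)" .
 qed
 then show ?thesis by (intro exI[of _ "%i x. \<Sum>j<k. g i (x - real j *\<^sub>R v)"] allI)
qed

lemma conv_Q_RR:
 assumes R: "RR i f g" and e: "e > 0"
 shows "conv f (CQ e i) x = conv g (CP e) x"
 using R e by (auto simp: RR_def conv_Q conv_P mult_ac)

lemma conv_difference:
 fixes f k :: "'a::euclidean_space => complex"
 assumes f: "L1 f" and [measurable]: "k \<in> bm" and k: "!!x. norm (k x) <= B"
 shows "conv (%x. f x - f (x - u)) k x = conv f k x - conv f k (x - u)"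
proof -
 have [measurable]: "f \<in> bm" using f by auto
 have L: "L1 (%y. f y * k (x - y))" "L1 (%y. f (y - u) * k (x - y))"
  using L1_mult_bounded(1)[OF f _ k, of "%y. x - y"] L1_mult_bounded(1)[OF L1_translate[OF f] _ k, of "%y. x - y"] by auto
 have "(LI y. f (y - u) * k (x - y)) = conv f k (x - u)"
  unfolding conv_eq by (subst (2) lborel_translate(1)[symmetric, of _ u]) (auto simp: algebra_simps)
 then show ?thesis using L by (simp add: conv_eq left_diff_distrib)
qed

text \<open>Since \<open>th\<close> has integral 1, f minus its average is the superposition of the
  differences f - f(. - u) with weights \<open>th u\<close>. Each difference has an integrable Riesz
  transform with norm growing linearly in |u|, and the superposition converges in L1.\<close>

lemma riesz_of_average:
 fixes f th :: "real^'n => complex"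
 assumes f: "L1 f" and th: "L1 th" "F th 0 = 1" "L1 (%u. norm (th u) * norm u)" and d: "d > 0"
  and g: "!!u. \<exists>g. \<forall>i. RR i (%x. f x - f (x - u)) (g i) & N (g i) <= ennreal (2 + norm u / d)"
 shows "\<exists>G. RR i (%x. f x - conv f th x) G"
proof -
 have [measurable]: "f \<in> bm" "th \<in> bm" using f th by auto
 \<comment> \<open>The transforms of the differences must be jointly measurable in u and x, which a
   choice for each u would not guarantee. As limits of explicit conjugate Poisson integrals they
   are.\<close>
 define K where "K n = conv f (CQ (1 / real (Suc n)) i)" for n
 have [measurable]: "K n \<in> bm" for n unfolding K_def by (rule conv_measurable) measurable
 define gg where "gg u x = lim (%n. K n x - K n (x - u))" for u x
 have jm: "(%(u, x). gg u x) \<in> borel_measurable (lborel \<Otimes>\<^sub>M lborel)"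
  unfolding gg_def split_beta' by (rule borel_measurable_lim_metric) measurable
 have gm: "gg u \<in> bm" for u unfolding gg_def by (rule borel_measurable_lim_metric) measurable
 have gg: "RR i (%x. f x - f (x - u)) (gg u)" "N (gg u) <= ennreal (2 + norm u / d)" for u
 proof -
  obtain g where g: "RR i (%x. f x - f (x - u)) g" "N g <= ennreal (2 + norm u / d)" using g[of u] by blast
  have gL: "L1 g" using g(1) by (auto simp: RR_def)
  have fl: "filterlim (%n. 1 / real (Suc n)) (at_right 0) sequentially"
   unfolding filterlim_at using lim_inverse_n[THEN LIMSEQ_Suc] by (auto simp: inverse_eq_divide)
  have ae: "AEL x. gg u x = g x"
   using lebesgue_points[OF gL]
  proof eventually_elim
   case (elim x)
   have "(%n. conv g (CP (1 / real (Suc n))) x) ---> g x"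
    by (rule filterlim_compose[OF conv_P_tendsto[OF gL elim] fl])
   moreover have "conv g (CP (1 / real (Suc n))) x = K n x - K n (x - u)" for n
    unfolding K_def using conv_Q_RR[OF g(1), of "1 / real (Suc n)" x]
     conv_difference[OF f, of "CQ (1 / real (Suc n)) i" "Pc TYPE('n) / (1 / real (Suc n)) ^ CARD('n)" u x] Q_le[of "1 / real (Suc n)" i]
    by simp
   ultimately show ?case by (simp add: gg_def limI)
  qed
  have "N (gg u) = N g" by (rule N_cong_AE[OF ae])
  then show "N (gg u) <= ennreal (2 + norm u / d)" using g(2) by simp
  have "L1 (gg u)" unfolding L1_iff using gm \<open>N (gg u) = N g\<close> N_less_top[OF gL] by simp
  moreover have "F (gg u) y = F g y" for y by (rule F_cong_AE[OF ae]) (use gm gL in auto)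
  ultimately show "RR i (%x. f x - f (x - u)) (gg u)" using g(1) by (auto simp: RR_def)
 qed
 define h where "h u x = th u * (f x - f (x - u))" for u x
 define k where "k u x = th u * gg u x" for u x
 have R: "RR i (h u) (k u)" for u unfolding h_def k_def by (rule RR_cmult[OF gg(1)])
 have hm: "(%(u, x). h u x) \<in> borel_measurable (lborel \<Otimes>\<^sub>M lborel)" unfolding h_def by measurable
 have km: "(%(u, x). k u x) \<in> borel_measurable (lborel \<Otimes>\<^sub>M lborel)"
 proof -
  have "(%p. th (fst p) * (case p of (u, x) => gg u x)) \<in> borel_measurable (lborel \<Otimes>\<^sub>M lborel)" using jm by measurable
  then show ?thesis by (simp add: k_def split_beta')
 qed
 have hf: "(NI u. N (h u)) < \<infinity>"
 proof -
  have "N (h u) <= norm (th u) * (2 * N f)" for u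
   unfolding h_def by (subst N_cmult) (auto intro!: mult_left_mono shift_bound)
  then have "(NI u. N (h u)) <= (NI u. norm (th u) * (2 * N f))" by (intro nn_integral_mono)
  also have "... < \<infinity>" using N_less_top[OF th(1)] N_less_top[OF f] by (simp add: nn_integral_multc N_def[symmetric] ennreal_mult_less_top)
  finally show ?thesis .
 qed
 have kf: "(NI u. N (k u)) < \<infinity>"
 proof -
  have "N (k u) <= ennreal (2 * norm (th u) + (1 / d) * (norm (th u) * norm u))" for u
  proof -
   have "N (k u) = norm (th u) * N (gg u)" unfolding k_def using gm by (subst N_cmult) auto
   also have "... <= ennreal (norm (th u)) * ennreal (2 + norm u / d)" by (intro mult_left_mono gg(2)) auto
   also have "... = ennreal (2 * norm (th u) + (1 / d) * (norm (th u) * norm u))"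
    using d by (subst ennreal_mult[symmetric]) (auto simp: algebra_simps)
   finally show ?thesis .
  qed
  then have "(NI u. N (k u)) <= (NI u. ennreal (2 * norm (th u) + (1 / d) * (norm (th u) * norm u)))" by (intro nn_integral_mono)
  also have "... = ennreal (LI u. 2 * norm (th u) + (1 / d) * (norm (th u) * norm u))"
   using th d by (intro nn_integral_eq_integral) auto
  finally show ?thesis by (simp add: le_less_trans)
 qed
 have mix_RR: "RR i (%x. (LI u. h u x)) (%x. (LI u. k u x))"
  by (rule RR_mix[OF lborel.sigma_finite_measure_axioms hm km hf kf]) (use R in auto)
 have "F (%x. (LI u. h u x)) y = F (%x. f x - conv f th x) y" for y
 proof -
  have "F (%x. (LI u. h u x)) y = (LI u. F (h u) y)" by (rule mix(3)[OF lborel.sigma_finite_measure_axioms hm hf])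
  also have "... = (LI u. (th u * E u (- 0) - th u * E u (- y)) * F f y)"
   unfolding h_def F_cmult by (intro Bochner_Integration.integral_cong refl) (simp add: F_diff[OF f L1_translate[OF f]] F_translate[OF f] algebra_simps)
  also have "... = (F th 0 - F th y) * F f y"
   unfolding F_def[of th] using L1_E[OF th(1), of "-0"] L1_E[OF th(1), of "-y"] by simp
  finally show ?thesis using conv[OF f th(1)] f by (simp add: F_diff th(2) algebra_simps)
 qed
 then show ?thesis using mix_RR conv(1)[OF f th(1)] f by (intro exI[of _ "%x. (LI u. k u x)"]) (auto simp: RR_def)
qed

section \<open>Synthesis with the generator and one approximation step\<close>

lemma dil_scale: "dil a (%x. z * f x) x = z * dil a f x"
 by (simp add: dil_def)

text \<open>\<open>psi\<close> is a Borel version of \<open>\<psi>\<close>, and \<open>Gr\<close> the Riesz transform of \<open>\<psi> - \<psi> * \<theta>\<close>.\<close>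

locale generator = band b nu th C0 CL Kb NB
 for b :: "real^'n^'n" and nu th :: "real^'n => complex" and C0 CL Kb NB :: real +
 fixes psi :: "real^'n => complex" and Gr :: "'n => real^'n => complex" and \<alpha> :: "nat => real"
 assumes psi: "L1 psi" "F psi 0 = 1"
  and Gr: "!!i. RR i (%x. psi x - conv psi th x) (Gr i)"
  and \<alpha>: "filterlim (%j. \<bar>\<alpha> j\<bar>) at_top sequentially" "!!j. \<alpha> j ~= 0"
begin

lemma Gr_L1: "L1 (Gr i)" using Gr[of i] by (simp add: RR_def)

definition ps :: "real^'n => complex" where "ps = conv psi th"

lemma ps: "L1 ps" "F ps y = F psi y * F th y"
 using conv[OF psi(1) th_L1] by (simp_all add: ps_def)

text \<open>The Riesz transform of the synthesis, with psi split as (psi - psi * th) + psi * th: on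
  the first part it falls on the function, giving \<open>Gr\<close>; on the band-limited part it
  falls on the sequence, giving the discrete transform \<open>W\<close>.\<close>

definition Sr :: "(int^'n => complex) => 'n => real^'n => complex" where
 "Sr s i x = Syn s (Gr i) x + Syn (W s i) ps x"

text \<open>On the spectrum of psi * th the discrete symbol is the multiplier
  (\<open>W_hat\<close>), so the two parts recombine to the multiplier times the transform of the
  synthesis.\<close>

lemma Syn_RR:
 assumes s: "integrable lat s" "!!i. integrable lat (W s i)"
 shows "RR i (Syn s psi) (Sr s i)"
proof (rule RR_nonzero)
 note a = Syn[OF s(1) Gr_L1[of i]] and c = Syn[OF s(2) ps(1), of i]
 show "L1 (Syn s psi)" by (rule Syn(1)[OF s(1) psi(1)])
 show "L1 (Sr s i)" unfolding Sr_def[abs_def] using a(1) c(1) by auto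
 fix z :: "real^'n" assume z: "z ~= 0"
 have Gz: "F (Gr i) z = m i z * (F psi z - F psi z * F th z)"
  using Gr[of i] ps psi(1) by (simp add: RR_def F_diff flip: ps_def)
 have Sz: "F (Sr s i) z = Shat s (z v* b) * F (Gr i) z + (Shat (W s i) (z v* b) * F th z) * F psi z"
  unfolding Sr_def[abs_def] F_add[OF a(1) c(1)] a(3) c(3) ps(2) by simp
 show "F (Sr s i) z = m i z * F (Syn s psi) z"
  unfolding Sz Gz W_hat[OF s(1,2) z] Syn(3)[OF s(1) psi(1)] by (simp add: algebra_simps)
qed

text \<open>Bounds the synthesis operator. It depends on psi and enters convergence only, never the
  final constant, which comes from \<open>CT\<close>.\<close>

definition Cs :: ennreal where "Cs = N psi + (\<Sum>i\<in>(UNIV::'n set). N (Gr i) + N ps)"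

lemma Cs: "Cs < \<infinity>"
 using N_less_top[OF psi(1)] N_less_top[OF Gr_L1] N_less_top[OF ps(1)] by (simp add: Cs_def)

lemma Syn_bound:
 assumes s: "hn s < \<infinity>"
 shows "N (Syn s psi) + (\<Sum>i\<in>UNIV. N (Sr s i)) <= Cs * hn s"
proof -
 note i = h1_integrable[OF s]
 have "N (Syn s psi) <= N psi * hn s"
  using order_trans[OF Syn(2)[OF i(1) psi(1)] mult_right_mono[OF h1_norm_ge(1)]] by (simp add: mult.commute)
 moreover have "N (Sr s j) <= (N (Gr j) + N ps) * hn s" for j
 proof -
  have "N (Sr s j) <= N (Syn s (Gr j)) + N (Syn (W s j) ps)"
   unfolding Sr_def[abs_def] using Syn(1)[OF i(1) Gr_L1] Syn(1)[OF i(2) ps(1)] by (intro N_triangle) auto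
  also have "... <= (NK k. norm (s k)) * N (Gr j) + (NK k. norm (W s j k)) * N ps"
   by (intro add_mono Syn(2) i Gr_L1 ps)
  also have "... <= hn s * N (Gr j) + hn s * N ps"
   by (intro add_mono mult_right_mono h1_norm_ge) auto
  finally show ?thesis by (simp add: algebra_simps)
 qed
 ultimately have "N (Syn s psi) + (\<Sum>i\<in>UNIV. N (Sr s i)) <= N psi * hn s + (\<Sum>i\<in>UNIV. (N (Gr i) + N ps) * hn s)"
  by (intro add_mono sum_mono)
 then show ?thesis by (simp add: Cs_def distrib_right sum_distrib_right)
qed

lemma h1_coef:
 assumes R: "!!i. RR i f (g i)"
 shows "hn (coef f) <= ennreal CT * (N f + (\<Sum>i\<in>UNIV. N (g i)))"
proof -
 have L: "L1 f" "L1 (g i)" for i using R[of i] by (auto simp: RR_def)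
 have "hn (coef f) <= (NK k. norm (coef f k)) + (\<Sum>i\<in>UNIV. (NK k. norm (coef (g i) k)))"
  using h1_norm_le[of "coef f"] by (simp add: coef_W[OF R])
 also have "... <= ennreal CT * N f + (\<Sum>i\<in>UNIV. ennreal CT * N (g i))"
  unfolding CT_def by (intro add_mono sum_mono coef_bound L)
 finally show ?thesis by (simp add: distrib_left sum_distrib_left)
qed

lemma coef_scale: "coef (%x. z * f x) = (%k. z * coef f k)"
 by (rule ext) (simp add: coef_def conv_eq mult.assoc)

lemma Syn_scale: "Syn (%k. z * s k) f x = z * Syn s f x"
 by (simp add: Syn_def sm_def mult.assoc)

lemma T_scale: "T a (%x. z * f x) h x = z * T a f h x"
proof -
 have e: "dil (1 / a) (%x. z * f x) = (%x. z * dil (1 / a) f x)" by (rule ext) (rule dil_scale)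
 have "Syn (coef (dil (1 / a) (%x. z * f x))) h = (%x. z * Syn (coef (dil (1 / a) f)) h x)"
  unfolding e coef_scale by (rule ext) (rule Syn_scale)
 then show ?thesis by (simp add: T_def dil_scale)
qed

text \<open>The Riesz transform of a sampled synthesis consists of two such syntheses, so the
  averaging result applies to it too: \<open>Gr\<close> has integral 0 and contributes in the limit
  only aliases, while \<open>ps\<close> has integral 1 and reproduces the Riesz transform of
  f.\<close>

lemma T_RR:
 assumes R: "!!i. RR i f (g i)" and a: "a ~= 0"
 shows "RR i (T a f psi) (%x. sgn (of_real a) * T a f (Gr i) x + T a (g i) ps x)"
proof -
 define f1 where "f1 = dil (1 / a) f"
 have R1: "RR i f1 (%x. sgn (of_real (1 / a)) * dil (1 / a) (g i) x)" for i
  unfolding f1_def by (rule RR_dil[OF R]) (use a in simp)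
 have L1: "L1 f1" "L1 (%x. sgn (of_real (1 / a)) * dil (1 / a) (g i) x)" for i using R1[of i] by (auto simp: RR_def)
 have W1: "W (coef f1) i = (%k. sgn (of_real (1 / a)) * coef (dil (1 / a) (g i)) k)" for i
  unfolding coef_W[OF R1] coef_scale ..
 have "RR i (Syn (coef f1) psi) (Sr (coef f1) i)"
  by (rule Syn_RR) (use coef_l1[OF L1(1)] coef_l1[OF L1(2)] in \<open>simp_all add: coef_W[OF R1]\<close>)
 from RR_dil[OF this a]
 have "RR i (T a f psi) (%x. sgn (of_real a) * dil a (Sr (coef f1) i) x)" by (simp add: T_def f1_def)
 moreover have "sgn (of_real a) * dil a (Sr (coef f1) i) x = sgn (of_real a) * T a f (Gr i) x + T a (g i) ps x" for x
 proof -
  have sg: "sgn (cr a) * sgn (cr (1 / a)) = 1" using a by (simp add: sgn_of_real sgn_if)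
  have "sgn (of_real a) * dil a (Sr (coef f1) i) x =
    sgn (of_real a) * T a f (Gr i) x + (sgn (cr a) * sgn (cr (1 / a))) * T a (g i) ps x"
   unfolding T_def f1_def[symmetric] dil_def[of a] Sr_def W1 Syn_scale by (simp add: algebra_simps scaleR_conv_of_real)
  then show ?thesis unfolding sg by simp
 qed
 ultimately show ?thesis by simp
qed

definition level :: "nat => (int^'n => complex) => real^'n => complex" where
 "level j s = dil (\<alpha> j) (Syn s psi)"

lemma level:
 assumes s: "hn s < \<infinity>"
 shows "RR i (level j s) (%x. sgn (of_real (\<alpha> j)) * dil (\<alpha> j) (Sr s i) x)"
  "N (level j s) + (\<Sum>i\<in>UNIV. N (%x. sgn (of_real (\<alpha> j)) * dil (\<alpha> j) (Sr s i) x)) <= Cs * hn s"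
proof -
 note R = Syn_RR[OF h1_integrable[OF s]]
 show "RR i (level j s) (%x. sgn (of_real (\<alpha> j)) * dil (\<alpha> j) (Sr s i) x)"
  unfolding level_def by (rule RR_dil[OF R \<alpha>(2)])
 have L: "L1 (Syn s psi)" "L1 (Sr s i)" for i using R[of i] by (auto simp: RR_def)
 have [measurable]: "Sr s i \<in> bm" for i using L by auto
 have sg: "norm (sgn (cr (\<alpha> j))) = 1" using \<alpha>(2)[of j] by (simp add: norm_sgn)
 have "N (%x. sgn (of_real (\<alpha> j)) * dil (\<alpha> j) (Sr s i) x) = N (Sr s i)" for i
  by (subst N_cmult) (auto simp: sg N_dil \<alpha>(2))
 moreover have "N (level j s) = N (Syn s psi)" unfolding level_def using L by (intro N_dil \<alpha>) auto
 ultimately show "N (level j s) + (\<Sum>i\<in>UNIV. N (%x. sgn (of_real (\<alpha> j)) * dil (\<alpha> j) (Sr s i) x)) <= Cs * hn s"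
  using Syn_bound[OF s] by simp
qed

text \<open>The coefficients of f/M at each of M well separated scales: their total discrete norm is
  at most \<open>CT\<close> times the size of f, whatever M is, while the remainder becomes
  arbitrarily small in \<open>H1\<close>. Scales can be taken beyond any \<open>N0\<close>.\<close>

lemma one_step:
 assumes R: "!!i. RR i f (g i)" and d: "d > 0"
 shows "\<exists>A c r. finite A & A \<subseteq> {N0..} & (\<forall>j. j \<notin> A --> c j = (%k. 0)) &
  (\<Sum>j\<in>A. hn (c j)) <= ennreal CT * (N f + (\<Sum>i\<in>UNIV. N (g i))) &
  (\<forall>i. RR i (%x. f x - (\<Sum>j\<in>A. level j (c j) x)) (r i)) &
  N (%x. f x - (\<Sum>j\<in>A. level j (c j) x)) + (\<Sum>i\<in>UNIV. N (r i)) <= ennreal d"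
proof -
 have fL: "L1 f" "L1 (g i)" for i using R[of i] by (auto simp: RR_def)
 define n where "n = real CARD('n)"
 have n: "n >= 1" by (simp add: n_def Suc_leI)
 \<comment> \<open>One average for the function and two for each of the n components of its Riesz
   transform.\<close>
 define d1 where "d1 = d / (1 + 2 * n)"
 have d1: "d1 > 0" using d n by (simp add: d1_def)
 \<comment> \<open>The type \<open>('n + 'n) option\<close> enumerates these 1 + 2n pairs: None for
   f with psi, Inl for f with \<open>Gr\<close>, Inr for the Riesz components with
   \<open>ps\<close>.\<close>
 define ff where "ff q = (case q of None => f | Some (Inl i) => f | Some (Inr i) => g i)" for q :: "('n + 'n) option"
 define hh where "hh q = (case q of None => psi | Some (Inl i) => Gr i | Some (Inr i) => ps)" for q :: "('n + 'n) option"
 have ffL: "L1 (ff q)" for q using fL by (auto simp: ff_def split: option.split sum.split)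
 have hhL: "L1 (hh q)" for q using psi Gr_L1 ps by (auto simp: hh_def split: option.split sum.split)
 have G0: "F (Gr i) 0 = 0" for i using Gr[of i] by (simp add: RR_def)
 have ps0: "F ps 0 = 1" by (simp add: ps psi th)
 from averages_small[where I=UNIV and ?N0.0=N0 and f=ff and h=hh, OF \<alpha> finite ffL hhL d1]
 obtain A where A0: "finite A & A ~= {} & A \<subseteq> {N0..} & (\<forall>s q. (\<forall>j. norm (s j) <= 1) --> q \<in> UNIV -->
  N (%x. (\<Sum>j\<in>A. s j * (T (\<alpha> j) (ff q) (hh q) x - F (hh q) 0 * ff q x)) / of_nat (card A)) <= ennreal d1)"
  by (rule exE)
 note A = A0[THEN conjunct1] A0[THEN conjunct2, THEN conjunct1] A0[THEN conjunct2, THEN conjunct2, THEN conjunct1]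
  A0[THEN conjunct2, THEN conjunct2, THEN conjunct2, rule_format, OF _ UNIV_I]
 define M where "M = real (card A)"
 have M: "M > 0" using A by (simp add: M_def card_gt_0_iff)
 define z where "z = cr (1 / M)"
 have zn: "norm z = 1 / M" using M by (simp add: z_def norm_divide)
 define c where "c j = (if j \<in> A then coef (dil (1 / \<alpha> j) (%x. z * f x)) else (%k. 0))" for j
 have lev: "level j (c j) x = z * T (\<alpha> j) f psi x" if "j \<in> A" for j x
  using that T_scale[of "\<alpha> j" z f psi x] by (simp add: level_def c_def T_def)
 have sg1: "norm (sgn (cr (\<alpha> j))) = 1" for j using \<alpha>(2)[of j] by (simp add: norm_sgn)
 have h1: "hn (c j) <= ennreal (1 / M) * (ennreal CT * (N f + (\<Sum>i\<in>UNIV. N (g i))))" if "j \<in> A" for j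
 proof -
  have "RR i (dil (1 / \<alpha> j) (%x. z * f x)) (%x. sgn (of_real (1 / \<alpha> j)) * dil (1 / \<alpha> j) (%x. z * g i x) x)" for i
   by (rule RR_dil[OF RR_cmult[OF R]]) (use \<alpha>(2)[of j] in simp)
  from h1_coef[OF this] have hc: "hn (c j) <= ennreal CT * (N (dil (1 / \<alpha> j) (%x. z * f x)) +
    (\<Sum>i\<in>UNIV. N (%x. sgn (of_real (1 / \<alpha> j)) * dil (1 / \<alpha> j) (%x. z * g i x) x)))" using that by (simp add: c_def)
  have eqf: "N (dil (1 / \<alpha> j) (%x. z * f x)) = ennreal (1 / M) * N f"
   using fL \<alpha>(2)[of j] by (subst N_dil) (auto simp: N_cmult zn)
  have eqg: "N (%x. sgn (of_real (1 / \<alpha> j)) * dil (1 / \<alpha> j) (%x. z * g i x) x) = ennreal (1 / M) * N (g i)" for i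
  proof -
   have [measurable]: "g i \<in> bm" using fL by auto
   have "norm (sgn (cr (1 / \<alpha> j))) = 1" using \<alpha>(2)[of j] by (subst norm_sgn) simp
   then have "N (%x. sgn (of_real (1 / \<alpha> j)) * dil (1 / \<alpha> j) (%x. z * g i x) x) = N (dil (1 / \<alpha> j) (%x. z * g i x))"
    by (subst N_cmult) auto
   also have "... = N (%x. z * g i x)" using \<alpha>(2)[of j] by (intro N_dil) auto
   finally show ?thesis by (simp add: N_cmult zn)
  qed
  show ?thesis using hc unfolding eqf eqg by (simp add: sum_distrib_left[symmetric] distrib_left[symmetric] mult.left_commute)
 qed
 define r where "r i x = g i x - (\<Sum>j\<in>A. z * (sgn (of_real (\<alpha> j)) * T (\<alpha> j) f (Gr i) x + T (\<alpha> j) (g i) ps x))" for i x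
 have S: "(\<Sum>j\<in>A. level j (c j) x) = (\<Sum>j\<in>A. z * T (\<alpha> j) f psi x)" for x by (intro sum.cong refl lev)
 have RRr: "RR i (%x. f x - (\<Sum>j\<in>A. level j (c j) x)) (r i)" for i
  unfolding r_def[abs_def] S by (intro RR_diff R RR_sum RR_cmult T_RR \<alpha>)
 have zA: "(\<Sum>j\<in>A. z * w) = w" for w using M by (simp add: z_def M_def)
 have Nf: "N (%x. f x - (\<Sum>j\<in>A. level j (c j) x)) <= ennreal d1"
 proof -
  have "f x - (\<Sum>j\<in>A. level j (c j) x) = - ((\<Sum>j\<in>A. 1 * (T (\<alpha> j) (ff None) (hh None) x - F (hh None) 0 * ff None x)) / of_nat (card A))" for x
  proof -
   have "f x - (\<Sum>j\<in>A. level j (c j) x) = (\<Sum>j\<in>A. z * f x) - (\<Sum>j\<in>A. z * T (\<alpha> j) f psi x)" unfolding S zA ..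
   also have "... = - ((\<Sum>j\<in>A. T (\<alpha> j) f psi x - f x) * z)"
    by (simp add: sum_distrib_right sum_subtractf left_diff_distrib mult.commute[of z])
   finally show ?thesis by (simp add: ff_def hh_def psi z_def M_def divide_inverse)
  qed
  then show ?thesis using A(4)[of "%_. 1" None] by simp
 qed
 have Nr: "N (r i) <= ennreal (2 * d1)" for i
 proof -
  \<comment> \<open>The weights are the signs of the dilations, which reach this part through
    \<open>T_RR\<close>; the subtracted main term is 0 because \<open>Gr\<close> has integral
    0.\<close>
  define X where "X x = (\<Sum>j\<in>A. sgn (of_real (\<alpha> j)) * (T (\<alpha> j) (ff (Some (Inl i))) (hh (Some (Inl i))) x - F (hh (Some (Inl i))) 0 * ff (Some (Inl i)) x)) / of_nat (card A)" for x
  define Y where "Y x = (\<Sum>j\<in>A. 1 * (T (\<alpha> j) (ff (Some (Inr i))) (hh (Some (Inr i))) x - F (hh (Some (Inr i))) 0 * ff (Some (Inr i)) x)) / of_nat (card A)" for x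
  have [measurable]: "T (\<alpha> j) (ff q) (hh q) \<in> bm" "ff q \<in> bm" for j q
   using T(1)[OF ffL hhL \<alpha>(2)] ffL[of q] by auto
  have [measurable]: "X \<in> bm" "Y \<in> bm" unfolding X_def[abs_def] Y_def[abs_def] by measurable
  have "r i x = - (X x + Y x)" for x
  proof -
   have "r i x = (\<Sum>j\<in>A. z * g i x) - (\<Sum>j\<in>A. z * (sgn (of_real (\<alpha> j)) * T (\<alpha> j) f (Gr i) x + T (\<alpha> j) (g i) ps x))" unfolding r_def zA ..
   also have "... = - ((\<Sum>j\<in>A. sgn (of_real (\<alpha> j)) * T (\<alpha> j) f (Gr i) x) * z + (\<Sum>j\<in>A. T (\<alpha> j) (g i) ps x - g i x) * z)"
    unfolding sum_distrib_right sum_negf[symmetric] sum_subtractf[symmetric] sum.distrib[symmetric] by (simp add: algebra_simps)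
   finally show ?thesis by (simp add: X_def Y_def ff_def hh_def G0 ps0 z_def M_def divide_inverse)
  qed
  then have "r i = (%x. - (X x + Y x))" by (rule ext)
  then have "N (r i) = N (%x. X x + Y x)" by (simp only: N_uminus)
  also have "... <= N X + N Y" by (rule N_triangle) auto
  also have "... <= ennreal d1 + ennreal d1"
   unfolding X_def[abs_def] Y_def[abs_def] by (intro add_mono A(4)) (auto simp: sg1)
  finally show ?thesis using d1 by (simp add: ennreal_plus[symmetric] del: ennreal_plus)
 qed
 have "N (%x. f x - (\<Sum>j\<in>A. level j (c j) x)) + (\<Sum>i\<in>UNIV. N (r i)) <= ennreal d1 + (\<Sum>i\<in>(UNIV::'n set). ennreal (2 * d1))"
  by (intro add_mono sum_mono Nf Nr)
 also have "... = ennreal d"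
 proof -
  have "(\<Sum>i\<in>(UNIV::'n set). ennreal (2 * d1)) = ennreal (n * (2 * d1))" using d1 by (subst sum_ennreal) (auto simp: n_def)
  moreover have "d1 + n * (2 * d1) = d"
  proof -
   have "d1 + n * (2 * d1) = d1 * (1 + 2 * n)" by (simp add: algebra_simps)
   then show ?thesis using n by (simp add: d1_def)
  qed
  ultimately show ?thesis using d1 n by (simp add: ennreal_plus[symmetric] del: ennreal_plus)
 qed
 finally have 1: "N (%x. f x - (\<Sum>j\<in>A. level j (c j) x)) + (\<Sum>i\<in>UNIV. N (r i)) <= ennreal d" .
 have "(\<Sum>j\<in>A. hn (c j)) <= (\<Sum>j\<in>A. ennreal (1 / M) * (ennreal CT * (N f + (\<Sum>i\<in>UNIV. N (g i)))))" by (intro sum_mono h1)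
 also have "... = (of_nat (card A) * ennreal (1 / M)) * (ennreal CT * (N f + (\<Sum>i\<in>UNIV. N (g i))))" by (simp add: mult.assoc)
 also have "of_nat (card A) * ennreal (1 / M) = 1"
  using M by (simp add: M_def ennreal_of_nat_eq_real_of_nat ennreal_mult[symmetric])
 finally have 2: "(\<Sum>j\<in>A. hn (c j)) <= ennreal CT * (N f + (\<Sum>i\<in>UNIV. N (g i)))" by simp
 show ?thesis
  by (intro exI[of _ A] exI[of _ c] exI[of _ r] conjI allI impI A(1,3) 1 2 RRr) (simp add: c_def)
qed

end

section \<open>Norm and metric on \<open>H1\<close>\<close>

lemma H1_norm_le:
 assumes R: "!!i. RR i f0 (g i)" and ae: "AEL x. f x = f0 x"
 shows "f \<in> H1" "H1_norm f <= N f0 + (\<Sum>i\<in>UNIV. N (g i))" "N f0 <= H1_norm f" "N (g i) <= H1_norm f"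
proof -
 note H = H1_I[OF R ae]
 show "f \<in> H1" by (rule H(1))
 have "g i \<in> bm" for i using R[of i] by (auto simp: RR_def)
 then show "H1_norm f <= N f0 + (\<Sum>i\<in>UNIV. N (g i))" unfolding H(2) by (intro add_left_mono N_vec_le)
 show "N f0 <= H1_norm f" unfolding H(2) by simp
 show "N (g i) <= H1_norm f" unfolding H(2) using N_vec_ge[of g i] by (simp add: add_increasing)
qed

text \<open>Passing from the Euclidean norm of the vector transform to the sum of its components
  costs the factor n + 1 that appears in \<open>CX\<close>.\<close>

lemma H1_size:
 fixes f0 :: "real^'n => complex"
 assumes R: "!!i. RR i f0 (g i)" and ae: "AEL x. f x = f0 x"
 shows "N f0 + (\<Sum>i\<in>UNIV. N (g i)) <= of_nat (Suc CARD('n)) * H1_norm f"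
proof -
 have "N f0 + (\<Sum>i\<in>UNIV. N (g i)) <= H1_norm f + (\<Sum>i\<in>(UNIV::'n set). H1_norm f)"
  by (intro add_mono sum_mono H1_norm_le[OF R ae])
 then show ?thesis by (simp add: distrib_right)
qed

lemma H1_norm_finite: "f \<in> H1 \<longleftrightarrow> H1_norm f < \<infinity>"
proof
 assume f: "f \<in> H1"
 obtain f0 g where 0: "!!i. RR i f0 (g i)" "AEL x. f x = f0 x" using H1_D[OF f] by blast
 have "L1 f0" "L1 (g i)" for i using 0(1)[of i] by (auto simp: RR_def)
 then have "N f0 + (\<Sum>i\<in>UNIV. N (g i)) < \<infinity>" using N_less_top by (auto simp: less_top[symmetric])
 then show "H1_norm f < \<infinity>" using H1_norm_le(2)[OF 0] le_less_trans by blast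
qed (auto simp: H1_norm_def split: if_splits)

lemma H1_norm_cong: "AEL x. f x = f' x ==> H1_norm f = H1_norm f'"
proof -
 assume ae: "AEL x. f x = f' x"
 then have ae': "AEL x. f' x = f x" by eventually_elim simp
 show ?thesis
 proof (cases "f \<in> H1 \<or> f' \<in> H1")
  case True then show ?thesis using H1_cong(2)[OF _ ae] H1_cong(2)[OF _ ae'] by auto
 qed (simp add: H1_norm_def)
qed

lemma N_vec_triangle:
 fixes g h :: "'n::finite => 'a::euclidean_space => complex"
 assumes g: "!!i. L1 (g i)" and h: "!!i. L1 (h i)"
 shows "N (%x. \<chi> i. g i x + h i x) <= N (%x. \<chi> i. g i x) + N (%x. \<chi> i. h i x)"
proof -
 have [measurable]: "(%x. \<chi> i. g i x) \<in> bm" "(%x. \<chi> i. h i x) \<in> bm"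
  using integral_vec(1)[of lborel g] integral_vec(1)[of lborel h] g h by auto
 have "N (%x. \<chi> i. g i x + h i x) <= (NI x. ennreal (norm (\<chi> i. g i x)) + ennreal (norm (\<chi> i. h i x)))"
  unfolding N_def
 proof (rule nn_integral_mono)
  fix x
  have "(\<chi> i. g i x + h i x) = (\<chi> i. g i x) + (\<chi> i. h i x)" by (simp add: vec_eq_iff)
  then show "ennreal (norm (\<chi> i. g i x + h i x)) <= ennreal (norm (\<chi> i. g i x)) + ennreal (norm (\<chi> i. h i x))"
   using norm_triangle_ineq[of "\<chi> i. g i x" "\<chi> i. h i x"] by (simp add: ennreal_plus[symmetric] ennreal_leI del: ennreal_plus)
 qed
 also have "... = N (%x. \<chi> i. g i x) + N (%x. \<chi> i. h i x)" unfolding N_def by (rule nn_integral_add) auto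
 finally show ?thesis .
qed

lemma H1_add:
 assumes f: "f \<in> H1" and f': "f' \<in> H1"
 shows "(%x. f x + f' x) \<in> H1" "H1_norm (%x. f x + f' x) <= H1_norm f + H1_norm f'"
proof -
 obtain f0 g where 0: "!!i. RR i f0 (g i)" "AEL x. f x = f0 x" using H1_D[OF f] by blast
 obtain f1 h where 1: "!!i. RR i f1 (h i)" "AEL x. f' x = f1 x" using H1_D[OF f'] by blast
 have L: "L1 f0" "L1 (g i)" "L1 f1" "L1 (h i)" for i using 0(1)[of i] 1(1)[of i] by (auto simp: RR_def)
 have R: "RR i (%x. f0 x + f1 x) (%x. g i x + h i x)" for i by (rule RR_add[OF 0(1) 1(1)])
 have ae: "AEL x. f x + f' x = f0 x + f1 x" using 0(2) 1(2) by eventually_elim simp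
 show "(%x. f x + f' x) \<in> H1" by (rule H1_I(1)[OF R ae])
 have "N (%x. f0 x + f1 x) + N (%x. \<chi> i. g i x + h i x) <= (N f0 + N f1) + (N (%x. \<chi> i. g i x) + N (%x. \<chi> i. h i x))"
  using L by (intro add_mono N_triangle N_vec_triangle) auto
 then show "H1_norm (%x. f x + f' x) <= H1_norm f + H1_norm f'"
  unfolding H1_I(2)[OF R ae] H1_I(2)[OF 0] H1_I(2)[OF 1] by (simp add: add_ac)
qed

lemma H1_cmult_minus:
 assumes f: "f \<in> H1" shows "(%x. - f x) \<in> H1" "H1_norm (%x. - f x) = H1_norm f"
proof -
 obtain f0 g where 0: "!!i. RR i f0 (g i)" "AEL x. f x = f0 x" using H1_D[OF f] by blast
 have R: "RR i (%x. - f0 x) (%x. - g i x)" for i using RR_cmult[OF 0(1), of i "-1"] by simp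
 have ae: "AEL x. - f x = - f0 x" using 0(2) by eventually_elim simp
 show "(%x. - f x) \<in> H1" by (rule H1_I(1)[OF R ae])
 have "(\<chi> i. - g i x) = - (\<chi> i. g i x)" for x by (simp add: vec_eq_iff)
 then show "H1_norm (%x. - f x) = H1_norm f"
  unfolding H1_I(2)[OF R ae] H1_I(2)[OF 0] by (simp add: N_def)
qed

lemma H1_diff:
 assumes f: "f \<in> H1" and f': "f' \<in> H1"
 shows "(%x. f x - f' x) \<in> H1" "H1_norm (%x. f x - f' x) <= H1_norm f + H1_norm f'"
 using H1_add[OF f H1_cmult_minus(1)[OF f']] H1_cmult_minus(2)[OF f'] by auto

lemma N_le_H1_norm:
 fixes f :: "real^'n => complex"
 shows "N f <= H1_norm f"
proof (cases "f \<in> H1")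
 case True
 obtain f0 g where 0: "!!i. RR i f0 (g i)" "AEL x. f x = f0 x" using H1_D[OF True] by blast
 show ?thesis using H1_norm_le(3)[OF 0] N_cong_AE[OF 0(2)] by simp
qed (simp add: H1_norm_def)

lemma N_zero_AE: "N f = 0 ==> f \<in> bm ==> AEL x. f x = 0" for f :: "'a::euclidean_space => complex"
 by (simp add: N_def nn_integral_0_iff_AE)

lemma H1_norm_zero:
 assumes "H1_norm f = 0" shows "AEL x. f x = 0"
proof -
 have "f \<in> H1" using assms by (simp add: H1_norm_finite)
 then obtain f0 g where 0: "!!i. RR i f0 (g i)" "AEL x. f x = f0 x" using H1_D by blast
 have "L1 f0" using 0(1) by (auto simp: RR_def)
 moreover have "N f0 = 0" using H1_norm_le(3)[OF 0] assms by simp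
 ultimately have "AEL x. f0 x = 0" by (intro N_zero_AE) auto
 then show ?thesis using 0(2) by eventually_elim simp
qed

lemma ae_class_iff: "g \<in> ae_class f \<longleftrightarrow> (AEL x. g x = f x)"
 by (simp add: ae_class_def AE_completion_iff)

lemma ae_class_eq: "ae_class f = ae_class g \<longleftrightarrow> (AEL x. f x = g x)"
proof
 assume "ae_class f = ae_class g"
 then have "f \<in> ae_class g" unfolding set_eq_iff by (auto simp: ae_class_iff)
 then show "AEL x. f x = g x" by (simp add: ae_class_iff)
next
 assume "AEL x. f x = g x"
 then have "(AEL x. h x = f x) \<longleftrightarrow> (AEL x. h x = g x)" for h
  by (intro eventually_subst) (auto elim!: eventually_mono)
 then show "ae_class f = ae_class g" by (auto simp: ae_class_iff)
qed

text \<open>The distance chooses representatives arbitrarily; this makes it computable from any of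
  them.\<close>

lemma H1_dist_class:
 fixes f g :: "real^'n => complex"
 shows "H1_dist (ae_class f) (ae_class g) = enn2real (H1_norm (%x. f x - g x))"
proof -
 have rep: "AEL x. (SOME f'. f' \<in> ae_class f) x = f x" for f :: "real^'n => complex"
  using someI[of "%f'. f' \<in> ae_class f" f] by (simp add: ae_class_iff)
 have "AEL x. (SOME f'. f' \<in> ae_class f) x - (SOME g'. g' \<in> ae_class g) x = f x - g x"
  using rep[of f] rep[of g] by eventually_elim simp
 from H1_norm_cong[OF this] show ?thesis by (simp add: H1_dist_def)
qed

lemma H1_metric: "Metric_space (H1_space :: (real^'n => complex) set set) H1_dist"
proof
 show "0 <= H1_dist F G" for F G :: "(real^'n => complex) set" by (simp add: H1_dist_def)
 have com: "H1_norm (%x. f x - g x) = H1_norm (%x. g x - f x)" for f g :: "real^'n => complex"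
 proof (cases "(%x. f x - g x) \<in> H1 \<or> (%x. g x - f x) \<in> H1")
  case True then show ?thesis using H1_cmult_minus(2)[of "%x. f x - g x"] H1_cmult_minus(2)[of "%x. g x - f x"] by auto
 qed (simp add: H1_norm_def)
 show "H1_dist F G = H1_dist G F" for F G :: "(real^'n => complex) set"
  unfolding H1_dist_def by (subst com) rule
next
 fix F G :: "(real^'n => complex) set" assume "F \<in> H1_space" "G \<in> H1_space"
 then obtain f g where fg: "f \<in> H1" "F = ae_class f" "g \<in> H1" "G = ae_class g" by (auto simp: H1_space_def)
 have fin: "H1_norm (%x. f x - g x) < \<infinity>" using H1_diff(1)[OF fg(1,3)] by (simp add: H1_norm_finite)
 have "H1_dist F G = 0 \<longleftrightarrow> H1_norm (%x. f x - g x) = 0"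
  using fin by (auto simp: fg H1_dist_class enn2real_eq_0_iff)
 also have "... \<longleftrightarrow> (AEL x. f x - g x = 0)"
 proof
  assume "AEL x. f x - g x = 0"
  then have "H1_norm (%x. f x - g x) = H1_norm (%x::real^'n. 0)" by (rule H1_norm_cong)
  also have "... = 0"
  proof -
   have "RR i (%x::real^'n. 0) (%x. 0)" for i by (simp add: RR_def F_def)
   from H1_I(2)[OF this, of "%x. 0"] show ?thesis by (simp add: N_def zero_vec_def[symmetric])
  qed
  finally show "H1_norm (%x. f x - g x) = 0" .
 qed (rule H1_norm_zero)
 finally show "H1_dist F G = 0 \<longleftrightarrow> F = G" by (simp add: fg ae_class_eq)
next
 fix F G K :: "(real^'n => complex) set" assume "F \<in> H1_space" "G \<in> H1_space" "K \<in> H1_space"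
 then obtain f g k where fg: "f \<in> H1" "F = ae_class f" "g \<in> H1" "G = ae_class g" "k \<in> H1" "K = ae_class k" by (auto simp: H1_space_def)
 have fin: "H1_norm (%x. f x - g x) < \<infinity>" "H1_norm (%x. g x - k x) < \<infinity>"
  using H1_diff(1)[OF fg(1,3)] H1_diff(1)[OF fg(3,5)] by (simp_all add: H1_norm_finite)
 have "H1_norm (%x. f x - k x) <= H1_norm (%x. f x - g x) + H1_norm (%x. g x - k x)"
  using H1_add(2)[OF H1_diff(1)[OF fg(1,3)] H1_diff(1)[OF fg(3,5)]] by simp
 then have "enn2real (H1_norm (%x. f x - k x)) <= enn2real (H1_norm (%x. f x - g x) + H1_norm (%x. g x - k x))"
  using fin by (intro enn2real_mono) auto
 also have "... = enn2real (H1_norm (%x. f x - g x)) + enn2real (H1_norm (%x. g x - k x))"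
  using fin by (intro enn2real_plus) auto
 finally show "H1_dist F K <= H1_dist F G + H1_dist G K" by (simp add: fg H1_dist_class)
qed

section \<open>Series over the scales\<close>

lemma suminf_tail_ennreal:
 fixes f :: "nat => ennreal"
 assumes fin: "(\<Sum>n. f n) < \<infinity>"
 shows "(%J. \<Sum>n. f (n + J)) ---> 0"
proof -
 define r where "r n = enn2real (f n)" for n
 have "f n <= (\<Sum>n. f n)" for n using sum_le_suminf[of f "{n}"] by simp
 then have "f n < \<infinity>" for n using fin le_less_trans by blast
 then have fr: "f n = ennreal (r n)" for n by (simp add: r_def)
 have r0: "0 <= r n" for n by (simp add: r_def)
 have sr: "summable r" using fin unfolding fr by (intro summable_suminf_not_top) (auto simp: r0)
 have "(%J. suminf r - (\<Sum>i<J. r i)) ---> suminf r - suminf r" by (intro tendsto_diff tendsto_const summable_LIMSEQ sr)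
 then have "(%J. ennreal (\<Sum>n. r (n + J))) ---> ennreal 0"
  by (intro tendsto_ennrealI) (simp add: suminf_minus_initial_segment[OF sr])
 moreover have "(\<Sum>n. f (n + J)) = ennreal (\<Sum>n. r (n + J))" for J
  unfolding fr by (rule suminf_ennreal2) (use r0 sr in \<open>auto simp: summable_iff_shift\<close>)
 ultimately show ?thesis by simp
qed

text \<open>The pointwise sum as an integral over counting measure, so that \<open>mix\<close>
  applies; where the series does not converge absolutely the value is 0, a null set under the
  assumptions of \<open>ser\<close>.\<close>

definition ser :: "(nat => 'a::euclidean_space => complex) => 'a => complex" where
 "ser h x = (\<integral>j. h j x \<partial>count_space UNIV)"

lemma joint_nat: "(!!k. h k \<in> borel_measurable Na) ==> (%(k::nat, x). h k x) \<in> borel_measurable (count_space UNIV \<Otimes>\<^sub>M Na)"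
 by (rule measurable_pair_measure_countable1) auto

lemma ser:
 fixes h :: "nat => 'a::euclidean_space => complex"
 assumes h: "!!j. L1 (h j)" and fin: "(\<Sum>j. N (h j)) < \<infinity>"
 shows "L1 (ser h)" "N (%x. ser h x - (\<Sum>j<J. h j x)) <= (\<Sum>n. N (h (n + J)))"
proof -
 have jm: "(%(k::nat, x). h (k + J) x) \<in> borel_measurable (count_space UNIV \<Otimes>\<^sub>M lborel)" for J
  by (rule joint_nat) (use h in auto)
 have le: "(\<Sum>n. N (h (n + J))) <= (\<Sum>j. N (h j))" for J
 proof -
  have "(\<Sum>j. N (h j)) = (\<Sum>n. N (h (n + J))) + (\<Sum>i<J. N (h i))"
   by (rule suminf_offset) simp
  then show ?thesis by simp
 qed
 have fin': "(\<integral>\<^sup>+n. N (h (n + J)) \<partial>count_space UNIV) < \<infinity>" for J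
  unfolding nn_integral_count_space_nat using le[of J] fin by (rule le_less_trans)
 note mix = mix[OF sigma_finite_count jm fin']
 show "L1 (ser h)" using mix(1)[of 0] by (simp add: ser_def[abs_def])
 have "AEL x. integrable (count_space UNIV) (%j. h j x)" using mix(5)[of 0] by simp
 then have "AEL x. ser h x - (\<Sum>j<J. h j x) = (\<integral>n. h (n + J) x \<partial>count_space UNIV)"
 proof eventually_elim
  case (elim x)
  then have s: "summable (%j. norm (h j x))" by (simp add: integrable_count_space_nat_iff)
  then have "summable (%n. norm (h (n + J) x))" by (rule summable_ignore_initial_segment)
  then have "integrable (count_space UNIV) (%n. h (n + J) x)" by (simp add: integrable_count_space_nat_iff)
  then show ?case
   using elim suminf_minus_initial_segment[OF summable_norm_cancel[OF s], of J] by (simp add: ser_def integral_count_space_nat)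
 qed
 then have "N (%x. ser h x - (\<Sum>j<J. h j x)) = N (%x. \<integral>n. h (n + J) x \<partial>count_space UNIV)" by (rule N_cong_AE)
 also have "... <= (\<Sum>n. N (h (n + J)))" using mix(2)[of J] by (simp add: nn_integral_count_space_nat)
 finally show "N (%x. ser h x - (\<Sum>j<J. h j x)) <= (\<Sum>n. N (h (n + J)))" .
qed

lemma ser_F:
 fixes h :: "nat => 'a::euclidean_space => complex"
 assumes h: "!!j. L1 (h j)" and fin: "(\<Sum>j. N (h j)) < \<infinity>"
 shows "F (ser h) y = (\<integral>j. F (h j) y \<partial>count_space UNIV)" "integrable (count_space UNIV) (%j. F (h j) y)"
proof -
 have jm: "(%(k::nat, x). h k x) \<in> borel_measurable (count_space UNIV \<Otimes>\<^sub>M lborel)" by (rule joint_nat) (use h in auto)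
 have fin': "(\<integral>\<^sup>+n. N (h n) \<partial>count_space UNIV) < \<infinity>" using fin by (simp add: nn_integral_count_space_nat)
 note mix = mix[OF sigma_finite_count jm fin']
 show "F (ser h) y = (\<integral>j. F (h j) y \<partial>count_space UNIV)" "integrable (count_space UNIV) (%j. F (h j) y)"
  using mix(3,6)[of y] by (simp_all add: ser_def[abs_def])
qed

lemma ser_RR:
 assumes R: "!!j. RR i (h j) (k j)" and fin: "(\<Sum>j. N (h j)) < \<infinity>" "(\<Sum>j. N (k j)) < \<infinity>"
 shows "RR i (ser h) (ser k)"
proof -
 have L: "L1 (h j)" "L1 (k j)" for j using R[of j] by (auto simp: RR_def)
 have "F (k j) y = m i y * F (h j) y" for j y using R[of j] by (simp add: RR_def)
 then show ?thesis using ser(1)[OF L(1) fin(1)] ser(1)[OF L(2) fin(2)]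
  by (simp add: RR_def ser_F[OF L(1) fin(1)] ser_F[OF L(2) fin(2)])
qed

text \<open>Stated for a general filter because it identifies both limits over finite subsets of the
  lattice and limits over scales.\<close>

lemma unique_limit:
 fixes f g :: "'a::euclidean_space => complex"
 assumes [measurable]: "f \<in> bm" "g \<in> bm" "!!K. h K \<in> bm"
  and lim: "((%K. N (%x. f x - h K x)) \<longlongrightarrow> 0) Fl" "((%K. N (%x. g x - h K x)) \<longlongrightarrow> 0) Fl" and Fl: "Fl ~= bot"
 shows "AEL x. f x = g x"
proof -
 have "((%K. N (%x. f x - h K x) + N (%x. g x - h K x)) \<longlongrightarrow> 0 + 0) Fl" by (intro tendsto_add lim)
 moreover have "N (%x. f x - g x) <= N (%x. f x - h K x) + N (%x. g x - h K x)" for K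
  using N_triangle3[of f "h K" g] by (simp add: N_diff_commute[of "h K" g])
 ultimately have "N (%x. f x - g x) <= 0" using Fl by (intro tendsto_lowerbound[of _ 0 Fl]) auto
 then have "AEL x. f x - g x = 0" by (intro N_zero_AE) auto
 then show ?thesis by eventually_elim simp
qed

lemma AE_affine:
 fixes v :: "'a::euclidean_space"
 assumes P: "AEL x. Pr x" and a: "a ~= 0" shows "AEL x. Pr (a *\<^sub>R x - v)"
proof -
 have P': "AEL x. Pr (x - v)" by (rule AE_translate[OF P])
 obtain M where M: "{x. \<not> Pr (x - v)} \<subseteq> M" "M \<in> null_sets lborel" using AE_E[OF P'] by (auto simp: null_sets_def)
 then have [measurable]: "M \<in> sets borel" by auto
 have "(NI x. ennreal (\<bar>a\<bar> ^ DIM('a)) * indicator M (a *\<^sub>R x)) = (\<integral>\<^sup>+x. indicator M x \<partial>(lborel :: 'a measure))" by (rule nn_dilate) (use a in measurable)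
 also have "... = 0" using M(2) by auto
 finally have "AEL x. ennreal (\<bar>a\<bar> ^ DIM('a)) * indicator M (a *\<^sub>R x) = (0::ennreal)" by (subst (asm) nn_integral_0_iff_AE) auto
 then show ?thesis by eventually_elim (use M(1) a in \<open>auto split: split_indicator_asm\<close>)
qed

lemma mat_vec: "mat k *v x = k *\<^sub>R x" for x :: "real^'n"
 by (simp add: vec_eq_iff matrix_vector_mult_def mat_def if_distrib[of "%t. t * _"] cong: if_cong)

lemma det_mat: "det (mat k :: real^'n^'n) = k ^ CARD('n)"
 by (subst det_diagonal) (auto simp: mat_def)

context generator
begin

lemma Shat_diff: "integrable lat s ==> integrable lat s' ==> Shat (%k. s k - s' k) v = Shat s v - Shat s' v"
 and Shat_add: "integrable lat s ==> integrable lat s' ==> Shat (%k. s k + s' k) v = Shat s v + Shat s' v"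
proof -
 assume s: "integrable lat s" "integrable lat s'"
 have L: "integrable lat (%k. s k * E (lp k) (-v))" if "integrable lat s" for s
  by (rule Bochner_Integration.integrable_bound[OF that]) (auto simp: norm_mult)
 show "Shat (%k. s k - s' k) v = Shat s v - Shat s' v" "Shat (%k. s k + s' k) v = Shat s v + Shat s' v"
  using L[OF s(1)] L[OF s(2)] by (simp_all add: Shat_def left_diff_distrib distrib_right)
qed

lemma Syn_diff_AE:
 assumes s: "integrable lat s" "integrable lat s'"
 shows "AEL x. Syn s psi x - Syn s' psi x = Syn (%k. s k - s' k) psi x"
proof -
 have d: "integrable lat (%k. s k - s' k)" using s by auto
 note t = Syn[OF s(1) psi(1)] Syn[OF s(2) psi(1)] Syn[OF d psi(1)]
 have d1: "L1 (%x. Syn s psi x - Syn s' psi x)" using t(1,4) by auto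
 have "AEL x. Syn s psi x - Syn s' psi x - Syn (%k. s k - s' k) psi x = 0"
 proof (rule F_inj_AE)
  show "L1 (%x. Syn s psi x - Syn s' psi x - Syn (%k. s k - s' k) psi x)" using d1 t(7) by auto
  show "F (%x. Syn s psi x - Syn s' psi x - Syn (%k. s k - s' k) psi x) y = 0" for y
   unfolding F_diff[OF d1 t(7)] F_diff[OF t(1,4)] t(3,6,9) Shat_diff[OF s] by (simp add: algebra_simps)
 qed
 then show ?thesis by eventually_elim simp
qed

definition atm :: "nat => int^'n => real^'n => complex" where
 "atm j k = dil (\<alpha> j) (%x. psi (x - b *v lp k))"

lemma atm: "L1 (atm j k)" "N (atm j k) = N psi"
proof -
 show "L1 (atm j k)" unfolding atm_def by (rule L1_dil[OF L1_translate[OF psi(1)] \<alpha>(2)])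
 have "N (atm j k) = N (%x. psi (x - b *v lp k))"
  unfolding atm_def using L1_translate[OF psi(1)] \<alpha>(2) by (intro N_dil) auto
 then show "N (atm j k) = N psi" using psi(1) by (simp add: N_translate)
qed

text \<open>A finite partial sum is the synthesis of the truncated sequence, so the error is at most
  the l1 norm of the discarded entries times the norm of psi.\<close>

lemma partial_sums_k:
 assumes s: "integrable lat s"
 shows "((%K. N (%x. level j s x - (\<Sum>k\<in>K. s k * atm j k x))) \<longlongrightarrow> 0) (finite_subsets_at_top UNIV)"
proof -
 define I where "I = (LK k. norm (s k))"
 have sn: "integrable lat (%k. norm (s k))" using s by auto
 have hs: "((%k. norm (s k)) has_sum I) UNIV"
 proof -
  have "(%k. norm (s k)) summable_on UNIV"
   using s sn abs_summable_equivalent[of "%k. norm (s k)" UNIV] by (simp add: Infinite_Set_Sum.abs_summable_on_def)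
  then show ?thesis using has_sum_infsum infsum_lat[OF sn] by (force simp: I_def)
 qed
 then have "((%K. I - (\<Sum>k\<in>K. norm (s k))) \<longlongrightarrow> I - I) (finite_subsets_at_top UNIV)"
  unfolding has_sum_def by (intro tendsto_diff tendsto_const)
 then have lim: "((%K. ennreal (I - (\<Sum>k\<in>K. norm (s k))) * N psi) \<longlongrightarrow> 0 * N psi) (finite_subsets_at_top UNIV)"
  using N_less_top[OF psi(1)] by (intro tendsto_mult_ennreal tendsto_const) (auto simp flip: ennreal_0 intro: tendsto_ennrealI)
 have "N (%x. level j s x - (\<Sum>k\<in>K. s k * atm j k x)) <= ennreal (I - (\<Sum>k\<in>K. norm (s k))) * N psi" if K: "finite K" for K
 proof -
  define s' where "s' k = (if k \<in> K then s k else 0)" for k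
  have s': "integrable lat s'" by (rule Bochner_Integration.integrable_bound[OF s]) (auto simp: s'_def)
  have d: "integrable lat (%k. s k - s' k)" using s s' by auto
  have fin: "(LK k. s' k * g k) = (\<Sum>k\<in>K. s k * g k)" for g :: "int^'n => complex"
  proof -
   have "(LK k. s' k * g k) = (\<Sum>k | k \<in> UNIV & s' k * g k ~= 0. s' k * g k)"
    by (rule lebesgue_integral_count_space_finite_support) (rule finite_subset[OF _ K], auto simp: s'_def)
   also have "... = (\<Sum>k\<in>K. s k * g k)" by (rule sum.mono_neutral_cong_left[OF K]) (auto simp: s'_def)
   finally show ?thesis .
  qed
  have "level j s x - (\<Sum>k\<in>K. s k * atm j k x) = dil (\<alpha> j) (%x. Syn s psi x - Syn s' psi x) x" for x
   by (simp add: level_def dil_def atm_def Syn_def[of s'] sm_def fin algebra_simps scaleR_sum_right sum_distrib_left scaleR_conv_of_real)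
  then have "N (%x. level j s x - (\<Sum>k\<in>K. s k * atm j k x)) = N (dil (\<alpha> j) (%x. Syn s psi x - Syn s' psi x))" by simp
  also have "... = N (%x. Syn s psi x - Syn s' psi x)"
   using Syn(1)[OF s psi(1)] Syn(1)[OF s' psi(1)] \<alpha>(2) by (intro N_dil) auto
  also have "... = N (Syn (%k. s k - s' k) psi)" by (rule N_cong_AE[OF Syn_diff_AE[OF s s']])
  also have "... <= (NK k. norm (s k - s' k)) * N psi" by (rule Syn(2)[OF d psi(1)])
  also have "(NK k. norm (s k - s' k)) = ennreal (LK k. norm (s k - s' k))"
   using d by (intro nn_integral_eq_integral) auto
  also have "(LK k. norm (s k - s' k)) = (LK k. norm (s k) - norm (s' k))"
   by (intro Bochner_Integration.integral_cong) (auto simp: s'_def)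
  also have "... = I - (LK k. norm (s' k))" using s s' by (simp add: I_def)
  also have "(LK k. norm (s' k)) = (\<Sum>k\<in>K. norm (s k))"
  proof -
   have "(LK k. norm (s' k)) = (\<Sum>k | k \<in> UNIV & norm (s' k) ~= 0. norm (s' k))"
    by (rule lebesgue_integral_count_space_finite_support) (rule finite_subset[OF _ K], auto simp: s'_def)
   also have "... = (\<Sum>k\<in>K. norm (s k))" by (rule sum.mono_neutral_cong_left[OF K]) (auto simp: s'_def)
   finally show ?thesis .
  qed
  finally show ?thesis .
 qed
 then have ev: "\<forall>\<^sub>F K in finite_subsets_at_top UNIV. N (%x. level j s x - (\<Sum>k\<in>K. s k * atm j k x)) <= ennreal (I - (\<Sum>k\<in>K. norm (s k))) * N psi"
  by (intro eventually_finite_subsets_at_top_weakI) auto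
 show ?thesis
  by (rule tendsto_sandwich[OF _ ev tendsto_const]) (use lim in auto)
qed

definition tot :: "(nat => int^'n => complex) => real^'n => complex" where
 "tot c = ser (%j. level j (c j))"

definition lr :: "nat => (int^'n => complex) => 'n => real^'n => complex" where
 "lr j s i x = sgn (of_real (\<alpha> j)) * dil (\<alpha> j) (Sr s i) x"

text \<open>\<open>level\<close> is bounded in \<open>H1\<close> by \<open>Cs\<close> times the
  discrete norm, uniformly in the scale; so the series over scales and those of its Riesz components
  converge together, and all tails are bounded by a tail of the coefficient norms.\<close>

lemma tot:
 assumes fin: "(\<Sum>j. hn (c j)) < \<infinity>"
 shows "RR i (tot c) (ser (%j. lr j (c j) i))"
  "H1_norm (%x. tot c x - (\<Sum>j<J. level j (c j) x)) <= Cs * (\<Sum>n. hn (c (n + J)))"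
  "(\<Sum>j. N (level j (c j))) < \<infinity>"
proof -
 have "hn (c j) <= (\<Sum>j. hn (c j))" for j using sum_le_suminf[of "%j. hn (c j)" "{j}"] by simp
 then have cj: "hn (c j) < \<infinity>" for j using fin le_less_trans by blast
 have R: "RR i (level j (c j)) (lr j (c j) i)" for i j unfolding lr_def[abs_def] by (rule level(1)[OF cj])
 have L: "L1 (level j (c j))" "L1 (lr j (c j) i)" for i j using R[of i j] by (auto simp: RR_def)
 have bd: "N (level j (c j)) + (\<Sum>i\<in>UNIV. N (lr j (c j) i)) <= Cs * hn (c j)" for j
  unfolding lr_def[abs_def] by (rule level(2)[OF cj])
 have tail: "(\<Sum>n. N (level (n + J) (c (n + J)))) + (\<Sum>i\<in>UNIV. \<Sum>n. N (lr (n + J) (c (n + J)) i)) <= Cs * (\<Sum>n. hn (c (n + J)))" for J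
 proof -
  have "(\<Sum>n. N (level (n + J) (c (n + J)))) + (\<Sum>i\<in>UNIV. \<Sum>n. N (lr (n + J) (c (n + J)) i)) =
    (\<Sum>n. N (level (n + J) (c (n + J))) + (\<Sum>i\<in>UNIV. N (lr (n + J) (c (n + J)) i)))"
   by (simp add: suminf_add[symmetric] suminf_sum)
  also have "... <= (\<Sum>n. Cs * hn (c (n + J)))" by (intro suminf_le bd) auto
  finally show ?thesis by simp
 qed
 have f0: "Cs * (\<Sum>j. hn (c j)) < \<infinity>" using fin Cs by (simp add: ennreal_mult_less_top)
 have t0: "(\<Sum>n. N (level n (c n))) + (\<Sum>i\<in>UNIV. \<Sum>n. N (lr n (c n) i)) < \<infinity>"
  by (rule le_less_trans[OF tail[of 0, unfolded add_0_right] f0])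
 then show f1: "(\<Sum>j. N (level j (c j))) < \<infinity>" by simp
 have f2: "(\<Sum>j. N (lr j (c j) i)) < \<infinity>" for i
 proof -
  have "(\<Sum>n. N (lr n (c n) i)) <= (\<Sum>i\<in>UNIV. \<Sum>n. N (lr n (c n) i))" by (rule member_le_sum) auto
  then show ?thesis using t0 by (auto simp: add_increasing intro: le_less_trans)
 qed
 show R0: "RR i (tot c) (ser (%j. lr j (c j) i))" for i unfolding tot_def by (rule ser_RR[OF R f1 f2])
 have RJ: "RR i (%x. tot c x - (\<Sum>j<J. level j (c j) x)) (%x. ser (%j. lr j (c j) i) x - (\<Sum>j<J. lr j (c j) i x))" for i
  by (intro RR_diff R0 RR_sum R)
 have "H1_norm (%x. tot c x - (\<Sum>j<J. level j (c j) x)) <= N (%x. tot c x - (\<Sum>j<J. level j (c j) x)) +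
   (\<Sum>i\<in>UNIV. N (%x. ser (%j. lr j (c j) i) x - (\<Sum>j<J. lr j (c j) i x)))"
  by (rule H1_norm_le(2)[OF RJ]) simp
 also have "... <= (\<Sum>n. N (level (n + J) (c (n + J)))) + (\<Sum>i\<in>UNIV. \<Sum>n. N (lr (n + J) (c (n + J)) i))"
  unfolding tot_def by (intro add_mono sum_mono ser(2) L f1 f2)
 also note tail[of J]
 finally show "H1_norm (%x. tot c x - (\<Sum>j<J. level j (c j) x)) <= Cs * (\<Sum>n. hn (c (n + J)))" .
qed

end

section \<open>Exact representation by iteration over fresh scales\<close>

context band
begin

lemma h1_zero[simp]: "hn (%k. 0) = 0"
proof -
 have "seq_conv (%k. 0) z = (%k. 0)" for z :: "int^'n => complex^'n" by (rule ext) (simp add: seq_conv_def)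
 then show ?thesis by (simp add: h1_norm_def l1_norm_eq)
qed

lemma l1h1_norm_eq:
 assumes "c 0 = (%k. 0)" shows "l1h1_norm b nu c = (\<Sum>j. hn (c j))"
proof -
 have "l1h1_norm b nu c = infsum (%j. hn (c j)) UNIV"
  unfolding l1h1_norm_def by (rule infsum_cong_neutral) (use assms in \<open>auto simp: not_le\<close>)
 then show ?thesis by (simp add: infsum_nn_integral nn_integral_count_space_nat)
qed

end

context generator
begin

lemma level_zero[simp]: "level j (%k. 0) x = 0"
 by (simp add: level_def dil_def Syn_def sm_def)

text \<open>Filling the chosen set of scales up to an interval with zero sequences lets successive
  steps occupy consecutive intervals, so their coefficients never collide.\<close>

lemma one_step_interval:
 assumes R: "\<forall>i. RR i f (g i)" and d: "d > 0"
 shows "\<exists>M c r. N0 < M & (\<forall>j. j \<notin> {N0..<M} --> c j = (%k. 0)) &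
  (\<Sum>j\<in>{N0..<M}. hn (c j)) <= ennreal CT * (N f + (\<Sum>i\<in>UNIV. N (g i))) &
  (\<forall>i. RR i (%x. f x - (\<Sum>j\<in>{N0..<M}. level j (c j) x)) (r i)) &
  N (%x. f x - (\<Sum>j\<in>{N0..<M}. level j (c j) x)) + (\<Sum>i\<in>UNIV. N (r i)) <= ennreal d"
proof -
 obtain A c r where A: "finite A" "A \<subseteq> {N0..}" "\<forall>j. j \<notin> A --> c j = (%k. 0)"
  "(\<Sum>j\<in>A. hn (c j)) <= ennreal CT * (N f + (\<Sum>i\<in>UNIV. N (g i)))"
  "\<forall>i. RR i (%x. f x - (\<Sum>j\<in>A. level j (c j) x)) (r i)"
  "N (%x. f x - (\<Sum>j\<in>A. level j (c j) x)) + (\<Sum>i\<in>UNIV. N (r i)) <= ennreal d"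
  using one_step[OF spec[OF R] d, of N0] by (elim exE conjE)
 define M where "M = Suc (Max (insert N0 A))"
 have AM: "A \<subseteq> {N0..<M}" using A(1,2) by (auto simp: M_def less_Suc_eq_le)
 have M: "N0 < M" using A(1) by (simp add: M_def less_Suc_eq_le)
 have s1: "(\<Sum>j\<in>{N0..<M}. hn (c j)) = (\<Sum>j\<in>A. hn (c j))"
  by (rule sum.mono_neutral_right) (use AM A(3) in auto)
 have s2: "(\<Sum>j\<in>{N0..<M}. level j (c j) x) = (\<Sum>j\<in>A. level j (c j) x)" for x
  by (rule sum.mono_neutral_right) (use AM A(3) in auto)
 show ?thesis unfolding atLeastLessThan_iff
  by (rule exI[of _ M], rule exI[of _ c], rule exI[of _ r]) (use A M AM in \<open>auto simp: s1 s2\<close>)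
qed

text \<open>Only the first step costs the full size of f. Step n starts from a remainder of size at
  most \<eta> / 2^n, so all later steps together cost at most \<open>CT * \<eta>\<close>.\<close>

lemma solve:
 assumes R: "\<forall>i. RR i f (g i)" and e: "\<eta> > 0"
 shows "\<exists>c. c 0 = (%k. 0) & (\<Sum>j. hn (c j)) <= ennreal CT * (N f + (\<Sum>i\<in>UNIV. N (g i)) + ennreal \<eta>) &
  (AEL x. f x = tot c x)"
proof -
 define sz where "sz f g = N f + (\<Sum>i\<in>UNIV. N (g i))" for f :: "real^'n => complex" and g :: "'n => real^'n => complex"
 \<comment> \<open>The state is the remainder, its Riesz transforms and the first free scale. The
   first remainder is f itself, of arbitrary size; smallness is asserted from n = 1 on. The first
   free scale is 1, so the pinned entry at 0 stays zero.\<close>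
 define P1 where "P1 n q \<longleftrightarrow> (\<forall>i. RR i (fst q) (fst (snd q) i)) & (n = 0 --> q = (f, g, 1)) &
  (n > 0 --> sz (fst q) (fst (snd q)) <= ennreal (\<eta> / 2 ^ n))" for n and q :: "(real^'n => complex) \<times> ('n => real^'n => complex) \<times> nat"
 define Q1 where "Q1 n q q' \<longleftrightarrow> (\<exists>c. snd (snd q) < snd (snd q') & (\<forall>j. j \<notin> {snd (snd q)..<snd (snd q')} --> c j = (%k. 0)) &
  (\<Sum>j\<in>{snd (snd q)..<snd (snd q')}. hn (c j)) <= ennreal CT * sz (fst q) (fst (snd q)) &
  fst q' = (%x. fst q x - (\<Sum>j\<in>{snd (snd q)..<snd (snd q')}. level j (c j) x)))"
  for n :: nat and q q' :: "(real^'n => complex) \<times> ('n => real^'n => complex) \<times> nat"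
 have "\<exists>F. \<forall>n. P1 n (F n) & Q1 n (F n) (F (Suc n))"
 proof (rule dependent_nat_choice)
  show "\<exists>q. P1 0 q" by (rule exI[of _ "(f, g, 1)"]) (use R in \<open>simp add: P1_def\<close>)
  fix q n assume q: "P1 n q"
  have pos: "\<eta> / 2 ^ Suc n > 0" using e by simp
  have Rq: "\<forall>i. RR i (fst q) (fst (snd q) i)" using q by (simp add: P1_def)
  obtain M c r where M: "snd (snd q) < M" "\<forall>j. j \<notin> {snd (snd q)..<M} --> c j = (%k. 0)"
   "(\<Sum>j\<in>{snd (snd q)..<M}. hn (c j)) <= ennreal CT * (N (fst q) + (\<Sum>i\<in>UNIV. N (fst (snd q) i)))"
   "\<forall>i. RR i (%x. fst q x - (\<Sum>j\<in>{snd (snd q)..<M}. level j (c j) x)) (r i)"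
   "N (%x. fst q x - (\<Sum>j\<in>{snd (snd q)..<M}. level j (c j) x)) + (\<Sum>i\<in>UNIV. N (r i)) <= ennreal (\<eta> / 2 ^ Suc n)"
   using one_step_interval[OF Rq pos, of "snd (snd q)"] by (elim exE conjE)
  show "\<exists>q'. P1 (Suc n) q' & Q1 n q q'"
  proof (intro exI conjI)
   show "P1 (Suc n) ((%x. fst q x - (\<Sum>j\<in>{snd (snd q)..<M}. level j (c j) x)), r, M)"
    unfolding P1_def sz_def fst_conv snd_conv using M(4,5) by blast
   show "Q1 n q ((%x. fst q x - (\<Sum>j\<in>{snd (snd q)..<M}. level j (c j) x)), r, M)"
    unfolding Q1_def sz_def fst_conv snd_conv by (rule exI[of _ c]) (intro conjI M(1,2,3) refl)
  qed
 qed
 then obtain q where q: "!!n. P1 n (q n)" "!!n. Q1 n (q n) (q (Suc n))" by blast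
 define fs where "fs n = fst (q n)" for n
 define gs where "gs n = fst (snd (q n))" for n
 define Ms where "Ms n = snd (snd (q n))" for n
 have Rn: "RR i (fs n) (gs n i)" for i n using q(1)[of n] by (simp add: P1_def fs_def gs_def)
 have q0: "fs 0 = f" "gs 0 = g" "Ms 0 = 1" using q(1)[of 0] by (simp_all add: P1_def fs_def gs_def Ms_def)
 have szn: "sz (fs (Suc n)) (gs (Suc n)) <= ennreal (\<eta> / 2 ^ Suc n)" for n using q(1)[of "Suc n"] by (simp add: P1_def fs_def gs_def)
 have "\<forall>n. \<exists>c. Ms n < Ms (Suc n) & (\<forall>j. j \<notin> {Ms n..<Ms (Suc n)} --> c j = (%k. 0)) &
  (\<Sum>j\<in>{Ms n..<Ms (Suc n)}. hn (c j)) <= ennreal CT * sz (fs n) (gs n) &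
  fs (Suc n) = (%x. fs n x - (\<Sum>j\<in>{Ms n..<Ms (Suc n)}. level j (c j) x))"
  using q(2) unfolding Q1_def fs_def gs_def Ms_def by blast
 from choice[OF this] obtain cs where cs: "!!n. Ms n < Ms (Suc n)" "!!n j. j \<notin> {Ms n..<Ms (Suc n)} ==> cs n j = (%k. 0)"
  "!!n. (\<Sum>j\<in>{Ms n..<Ms (Suc n)}. hn (cs n j)) <= ennreal CT * sz (fs n) (gs n)"
  "!!n. fs (Suc n) = (%x. fs n x - (\<Sum>j\<in>{Ms n..<Ms (Suc n)}. level j (cs n j) x))" by blast
 have mono: "strict_mono Ms" using cs(1) by (simp add: strict_mono_Suc_iff)
 have Mge: "n <= Ms n" for n using strict_mono_imp_increasing[OF mono] .
 \<comment> \<open>The least n with j < \<open>Ms (Suc n)\<close> is the step whose interval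
   contains j; below \<open>Ms 0\<close> it is step 0, whose coefficients vanish there.\<close>
 define c where "c j = cs (LEAST n. j < Ms (Suc n)) j" for j
 have cn: "c j = cs n j" if "j \<in> {Ms n..<Ms (Suc n)}" for j n
 proof -
  have "(LEAST n. j < Ms (Suc n)) = n"
  proof (rule Least_equality)
   fix y assume "j < Ms (Suc y)"
   then have "Ms n < Ms (Suc y)" using that by simp
   then show "n <= y" using mono by (simp add: strict_mono_less less_Suc_eq_le)
  qed (use that in simp)
  then show ?thesis by (simp add: c_def)
 qed
 have c0: "c 0 = (%k. 0)"
 proof -
  have "(LEAST n. 0 < Ms (Suc n)) = 0" by (rule Least_equality) (use Mge[of "Suc 0"] in auto)
  then show ?thesis unfolding c_def by (simp add: cs(2) q0)
 qed
 have split: "{..<Ms (Suc n)} = {..<Ms n} \<union> {Ms n..<Ms (Suc n)}" for n using cs(1)[of n] by auto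
 have sum_split: "(\<Sum>j<Ms (Suc n). u j) = (\<Sum>j<Ms n. u j) + (\<Sum>j\<in>{Ms n..<Ms (Suc n)}. u j)" for n and u :: "nat => 'z::comm_monoid_add"
  unfolding split by (rule sum.union_disjoint) auto
 have rem: "f x - (\<Sum>j<Ms n. level j (c j) x) = fs n x" for n x
 proof (induction n)
  case 0
  then show ?case by (simp add: q0 c0)
 next
  case (Suc n)
  have "(\<Sum>j\<in>{Ms n..<Ms (Suc n)}. level j (c j) x) = (\<Sum>j\<in>{Ms n..<Ms (Suc n)}. level j (cs n j) x)"
   by (intro sum.cong refl) (simp only: cn)
  then have "f x - (\<Sum>j<Ms (Suc n). level j (c j) x) = (f x - (\<Sum>j<Ms n. level j (c j) x)) - (\<Sum>j\<in>{Ms n..<Ms (Suc n)}. level j (cs n j) x)"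
   unfolding sum_split by simp
  then show ?case unfolding Suc.IH cs(4)[of n] .
 qed
 \<comment> \<open>The partial geometric sum: at n = 0 it is 0, matching the first step, which is
   charged to f alone.\<close>
 have hsum: "(\<Sum>j<Ms (Suc n). hn (c j)) <= ennreal CT * (sz f g + ennreal (\<eta> * (1 - (1/2) ^ n)))" for n
 proof (induction n)
  case 0
  have "(\<Sum>j<Ms (Suc 0). hn (c j)) = (\<Sum>j\<in>{Ms 0..<Ms (Suc 0)}. hn (c j))"
   unfolding sum_split[of _ 0] by (simp add: q0 c0)
  also have "... = (\<Sum>j\<in>{Ms 0..<Ms (Suc 0)}. hn (cs 0 j))" by (intro sum.cong refl) (simp only: cn)
  also have "... <= ennreal CT * sz f g" using cs(3)[of 0] by (simp add: q0)
  finally show ?case by simp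
 next
  case (Suc n)
  have "(\<Sum>j\<in>{Ms (Suc n)..<Ms (Suc (Suc n))}. hn (c j)) = (\<Sum>j\<in>{Ms (Suc n)..<Ms (Suc (Suc n))}. hn (cs (Suc n) j))"
   by (intro sum.cong refl) (simp only: cn)
  also have "... <= ennreal CT * ennreal (\<eta> / 2 ^ Suc n)"
   by (rule order_trans[OF cs(3)]) (intro mult_left_mono szn, simp)
  finally have "(\<Sum>j<Ms (Suc (Suc n)). hn (c j)) <=
    ennreal CT * (sz f g + ennreal (\<eta> * (1 - (1/2) ^ n))) + ennreal CT * ennreal (\<eta> / 2 ^ Suc n)"
   unfolding sum_split[of _ "Suc n"] by (intro add_mono Suc.IH)
  also have "... = ennreal CT * (sz f g + (ennreal (\<eta> * (1 - (1/2) ^ n)) + ennreal (\<eta> / 2 ^ Suc n)))"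
   by (simp add: distrib_left add.assoc)
  also have "ennreal (\<eta> * (1 - (1/2) ^ n)) + ennreal (\<eta> / 2 ^ Suc n) = ennreal (\<eta> * (1 - (1/2) ^ n) + \<eta> / 2 ^ Suc n)"
   using e by (intro ennreal_plus[symmetric]) (auto simp: power_le_one)
  also have "\<eta> * (1 - (1/2) ^ n) + \<eta> / 2 ^ Suc n = \<eta> * (1 - (1/2) ^ Suc n)"
   by (simp add: field_simps power_divide)
  finally show ?case .
 qed
 have tot_le: "(\<Sum>j. hn (c j)) <= ennreal CT * (sz f g + ennreal \<eta>)"
 proof (rule suminf_le_const[OF summableI])
  fix n
  have "(\<Sum>j<n. hn (c j)) <= (\<Sum>j<Ms (Suc n). hn (c j))"
   using Mge[of "Suc n"] by (intro sum_mono2) auto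
  also have "... <= ennreal CT * (sz f g + ennreal (\<eta> * (1 - (1/2) ^ n)))" by (rule hsum)
  also have "... <= ennreal CT * (sz f g + ennreal \<eta>)"
   using e by (intro mult_left_mono add_left_mono ennreal_leI) (auto simp: mult_le_cancel_left1)
  finally show "(\<Sum>j<n. hn (c j)) <= ennreal CT * (sz f g + ennreal \<eta>)" .
 qed
 have "sz f g < \<infinity>"
 proof -
  have "L1 f" "L1 (g i)" for i using R by (auto simp: RR_def)
  then show ?thesis using N_less_top by (auto simp: sz_def)
 qed
 then have fin: "(\<Sum>j. hn (c j)) < \<infinity>"
  by (intro le_less_trans[OF tot_le]) (auto simp: ennreal_mult_less_top)
 \<comment> \<open>It suffices to compare along the subsequence of scales \<open>Ms n\<close>, where
   the partial sums leave exactly the remainders.\<close>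
 have "AEL x. f x = tot c x"
 proof (rule unique_limit[where h="%n x. \<Sum>j<Ms n. level j (c j) x" and Fl=sequentially])
  show "f \<in> bm" using R by (auto simp: RR_def)
  show "tot c \<in> bm" using tot(1)[OF fin, unfolded RR_def, THEN conjunct1] by auto
  have "hn (c j) < \<infinity>" for j using sum_le_suminf[of "%j. hn (c j)" "{j}"] fin by (auto intro: le_less_trans)
  from level(1)[OF this, unfolded RR_def, THEN conjunct1] have [measurable]: "level j (c j) \<in> bm" for j by auto
  show "(%x. \<Sum>j<Ms n. level j (c j) x) \<in> bm" for n by measurable
  show "(%n. N (%x. f x - (\<Sum>j<Ms n. level j (c j) x))) ---> 0"
  proof (rule LIMSEQ_imp_Suc, rule tendsto_sandwich[OF _ _ tendsto_const])
   show "\<forall>\<^sub>F n in sequentially. N (%x. f x - (\<Sum>j<Ms (Suc n). level j (c j) x)) <= ennreal (\<eta> / 2 ^ Suc n)"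
   proof (intro always_eventually allI)
    fix n
    have "N (fs (Suc n)) <= sz (fs (Suc n)) (gs (Suc n))" by (simp add: sz_def)
    then show "N (%x. f x - (\<Sum>j<Ms (Suc n). level j (c j) x)) <= ennreal (\<eta> / 2 ^ Suc n)"
     unfolding rem using order_trans szn by blast
   qed
   have "(%n. \<eta> * (1/2) ^ Suc n) ---> \<eta> * 0" by (intro tendsto_mult tendsto_const LIMSEQ_Suc LIMSEQ_power_zero) auto
   then have "(%n. \<eta> / 2 ^ Suc n) ---> 0" by (simp add: power_divide)
   from tendsto_ennrealI[OF this] show "(%n. ennreal (\<eta> / 2 ^ Suc n)) ---> 0" by simp
  qed simp
  show "(%n. N (%x. tot c x - (\<Sum>j<Ms n. level j (c j) x))) ---> 0"
  proof (rule tendsto_sandwich[OF _ _ tendsto_const])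
   show "\<forall>\<^sub>F n in sequentially. N (%x. tot c x - (\<Sum>j<Ms n. level j (c j) x)) <= Cs * (\<Sum>k. hn (c (k + Ms n)))"
    by (intro always_eventually allI order_trans[OF N_le_H1_norm tot(2)[OF fin]])
   have "(%n. \<Sum>k. hn (c (k + Ms n))) ---> 0"
    by (rule filterlim_compose[OF suminf_tail_ennreal[OF fin] filterlim_subseq[OF mono]])
   from ennreal_tendsto_cmult[OF _ this, of Cs] Cs
   show "(%n. Cs * (\<Sum>k. hn (c (k + Ms n)))) ---> 0" by simp
  qed simp
 qed simp
 then show ?thesis using c0 tot_le by (intro exI[of _ c]) (simp add: sz_def)
qed

end

section \<open>The sequence space as a metric space, and synthesis as an open map\<close>

context generator
begin

lemma h1_uminus: "hn (%k. - s k) = hn s"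
proof -
 have "seq_conv (%k. - s k) z = (%k. - seq_conv s z k)" for z :: "int^'n => complex^'n"
  by (rule ext) (simp add: seq_conv_def infsum_uminus[symmetric])
 then show ?thesis by (simp add: h1_norm_def l1_norm_eq)
qed

text \<open>For summable sequences additivity of the discrete Riesz transform is read off from its
  Fourier coefficients; if either norm is infinite the bound is trivial.\<close>

lemma h1_add: "hn (%k. s k + s' k) <= hn s + hn s'"
proof (cases "hn s < \<infinity> & hn s' < \<infinity>")
 case True
 note i = h1_integrable(1)[OF conjunct1[OF True]] h1_integrable(1)[OF conjunct2[OF True]]
 have d: "integrable lat (%k. s k + s' k)" using i by auto
 have W: "W (%k. s k + s' k) i j = W s i j + W s' i j" for i j
  unfolding W_eq[OF i(1)] W_eq[OF i(2)] W_eq[OF d]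
  using L1_E[OF Shat_pair(1)[OF i(1) phi_L1[of i]], of "lp j"] L1_E[OF Shat_pair(1)[OF i(2) phi_L1[of i]], of "lp j"]
  by (subst Bochner_Integration.integral_add[symmetric]) (auto simp: Shat_add[OF i] algebra_simps)
 have sc: "seq_conv (%k. s k + s' k) (discrete_riesz b nu) = (%k. seq_conv s (discrete_riesz b nu) k + seq_conv s' (discrete_riesz b nu) k)"
  using W unfolding W_def by (simp add: fun_eq_iff vec_eq_iff)
 have tri: "(NK k. norm (u k + v k)) <= (NK k. norm (u k)) + (NK k. norm (v k))" for u v :: "int^'n => 'b::real_normed_vector"
  by (subst nn_integral_add[symmetric])
    (auto intro!: nn_integral_mono simp: ennreal_plus[symmetric] norm_triangle_ineq simp del: ennreal_plus)
 have "hn (%k. s k + s' k) <= ((NK k. norm (s k)) + (NK k. norm (s' k))) +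
  ((NK k. norm (seq_conv s (discrete_riesz b nu) k)) + (NK k. norm (seq_conv s' (discrete_riesz b nu) k)))"
  unfolding h1_norm_def l1_norm_eq sc by (intro add_mono tri)
 then show ?thesis by (simp add: h1_norm_def l1_norm_eq add_ac)
qed (auto simp: not_less top_unique)

lemma h1_diff: "hn (%k. s k - s' k) <= hn s + hn s'"
 using h1_add[of s "%k. - s' k"] by (simp add: h1_uminus)

lemma h1_zero_imp:
 assumes "hn s = 0" shows "s = (%k. 0)"
proof -
 have "(NK k. norm (s k)) <= 0" using h1_norm_ge(1)[of s] assms by simp
 then have "AE k in lat. ennreal (norm (s k)) = 0" by (subst nn_integral_0_iff_AE[symmetric]) auto
 then show ?thesis by (auto simp: AE_count_space fun_eq_iff)
qed

lemma l1h1_iff: "c \<in> l1h1 b nu \<longleftrightarrow> c 0 = (%k. 0) & (\<Sum>j. hn (c j)) < \<infinity>"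
 using l1h1_norm_eq[of c] by (auto simp: l1h1_def)

lemma l1h1_diff:
 assumes c: "c \<in> l1h1 b nu" "c' \<in> l1h1 b nu"
 shows "(%j k. c j k - c' j k) \<in> l1h1 b nu"
  "l1h1_norm b nu (%j k. c j k - c' j k) = (\<Sum>j. hn (%k. c j k - c' j k))"
proof -
 have z: "(%k. c 0 k - c' 0 k) = (%k. 0)" using c by (simp add: l1h1_iff)
 show "l1h1_norm b nu (%j k. c j k - c' j k) = (\<Sum>j. hn (%k. c j k - c' j k))"
  by (rule l1h1_norm_eq[of "%j k. c j k - c' j k", OF z])
 have "(\<Sum>j. hn (%k. c j k - c' j k)) <= (\<Sum>j. hn (c j) + hn (c' j))"
  by (intro suminf_le h1_diff) auto
 also have "... = (\<Sum>j. hn (c j)) + (\<Sum>j. hn (c' j))" by (intro suminf_add[symmetric]) auto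
 also have "... < \<infinity>" using c by (simp add: l1h1_iff)
 finally show "(%j k. c j k - c' j k) \<in> l1h1 b nu" using z by (simp add: l1h1_iff)
qed

lemma l1h1_metric: "Metric_space (l1h1 b nu) (l1h1_dist b nu)"
proof
 show "0 <= l1h1_dist b nu c c'" for c c' by (simp add: l1h1_dist_def)
 have sw: "hn (%k. s k - s' k) = hn (%k. s' k - s k)" for s s'
  using h1_uminus[of "%k. s k - s' k"] by simp
 show "l1h1_dist b nu c c' = l1h1_dist b nu c' c" for c c'
  by (simp add: l1h1_dist_def l1h1_norm_def sw[of "c _" "c' _"])
next
 fix c c' assume c: "c \<in> l1h1 b nu" "c' \<in> l1h1 b nu"
 have fin: "l1h1_norm b nu (%j k. c j k - c' j k) < \<infinity>" using l1h1_diff(1)[OF c] by (simp add: l1h1_def)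
 show "(l1h1_dist b nu c c' = 0) = (c = c')"
 proof
  assume "l1h1_dist b nu c c' = 0"
  then have "(\<Sum>j. hn (%k. c j k - c' j k)) = 0"
   using fin by (auto simp: l1h1_dist_def enn2real_eq_0_iff l1h1_diff(2)[OF c])
  then have "hn (%k. c j k - c' j k) = 0" for j
   using sum_le_suminf[of "%j. hn (%k. c j k - c' j k)" "{j}"] by simp
  from h1_zero_imp[OF this] show "c = c'" by (simp add: fun_eq_iff)
 qed (simp add: l1h1_dist_def l1h1_norm_def)
next
 fix c c' c'' assume c: "c \<in> l1h1 b nu" "c' \<in> l1h1 b nu" "c'' \<in> l1h1 b nu"
 have fin: "l1h1_norm b nu (%j k. c j k - c' j k) < \<infinity>" "l1h1_norm b nu (%j k. c' j k - c'' j k) < \<infinity>"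
  using l1h1_diff(1)[OF c(1,2)] l1h1_diff(1)[OF c(2,3)] by (simp_all add: l1h1_def)
 have "(\<Sum>j. hn (%k. c j k - c'' j k)) <= (\<Sum>j. hn (%k. c j k - c' j k) + hn (%k. c' j k - c'' j k))"
 proof (intro suminf_le)
  show "hn (%k. c j k - c'' j k) <= hn (%k. c j k - c' j k) + hn (%k. c' j k - c'' j k)" for j
   using h1_add[of "%k. c j k - c' j k" "%k. c' j k - c'' j k"] by simp
 qed auto
 also have "... = (\<Sum>j. hn (%k. c j k - c' j k)) + (\<Sum>j. hn (%k. c' j k - c'' j k))"
  by (intro suminf_add[symmetric]) auto
 finally have "l1h1_norm b nu (%j k. c j k - c'' j k) <= l1h1_norm b nu (%j k. c j k - c' j k) + l1h1_norm b nu (%j k. c' j k - c'' j k)"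
  by (simp add: l1h1_diff(2) c)
 then have "l1h1_dist b nu c c'' <= enn2real (l1h1_norm b nu (%j k. c j k - c' j k) + l1h1_norm b nu (%j k. c' j k - c'' j k))"
  unfolding l1h1_dist_def using fin by (intro enn2real_mono) auto
 also have "... = l1h1_dist b nu c c' + l1h1_dist b nu c' c''"
  unfolding l1h1_dist_def using fin by (intro enn2real_plus) auto
 finally show "l1h1_dist b nu c c'' <= l1h1_dist b nu c c' + l1h1_dist b nu c' c''" .
qed

lemma h1_summand: "(\<Sum>j. hn (c j)) < \<infinity> ==> hn (c j) < \<infinity>"
 using sum_le_suminf[of "%j. hn (c j)" "{j}"] by (auto intro: le_less_trans)

lemma level_L1: "hn s < \<infinity> ==> L1 (level j s)"
 and F_level: "hn s < \<infinity> ==> F (level j s) y = Shat s ((y /\<^sub>R \<alpha> j) v* b) * F psi (y /\<^sub>R \<alpha> j)"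
 using Syn[OF h1_integrable(1) psi(1), of s] by (auto simp: level_def L1_dil F_dil \<alpha>(2))

lemma tot_F:
 assumes fin: "(\<Sum>j. hn (c j)) < \<infinity>"
 shows "L1 (tot c)" "F (tot c) y = (\<integral>j. F (level j (c j)) y \<partial>count_space UNIV)"
  "integrable (count_space UNIV) (%j. F (level j (c j)) y)"
 unfolding tot_def using ser(1)[OF level_L1[OF h1_summand[OF fin]] tot(3)[OF fin]]
  ser_F[OF level_L1[OF h1_summand[OF fin]] tot(3)[OF fin], of y] by auto

text \<open>The sums are pointwise integrals that are additive only where they converge; equality
  almost everywhere follows from equality of the transforms.\<close>

lemma tot_diff:
 assumes c: "c \<in> l1h1 b nu" "c' \<in> l1h1 b nu"
 shows "AEL x. tot (%j k. c j k - c' j k) x = tot c x - tot c' x"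
proof -
 define d where "d j k = c j k - c' j k" for j k
 have d: "d \<in> l1h1 b nu" using l1h1_diff(1)[OF c] by (simp add: d_def[abs_def])
 have fin: "(\<Sum>j. hn (c j)) < \<infinity>" "(\<Sum>j. hn (c' j)) < \<infinity>" "(\<Sum>j. hn (d j)) < \<infinity>"
  using c d by (auto simp: l1h1_iff)
 note t = tot_F[OF fin(1)] tot_F[OF fin(2)] tot_F[OF fin(3)]
 have lev: "F (level j (d j)) y = F (level j (c j)) y - F (level j (c' j)) y" for j y
  unfolding F_level[OF h1_summand[OF fin(1)]] F_level[OF h1_summand[OF fin(2)]] F_level[OF h1_summand[OF fin(3)]]
  unfolding d_def[abs_def] Shat_diff[OF h1_integrable(1)[OF h1_summand[OF fin(1)]] h1_integrable(1)[OF h1_summand[OF fin(2)]]]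
  by (rule left_diff_distrib)
 have L: "L1 (%x. tot c x - tot c' x)" using t(1,4) by auto
 have "AEL x. tot d x - (tot c x - tot c' x) = 0"
 proof (rule F_inj_AE)
  show "L1 (%x. tot d x - (tot c x - tot c' x))" using L t(7) by auto
  show "F (%x. tot d x - (tot c x - tot c' x)) y = 0" for y
   unfolding F_diff[OF t(7) L] F_diff[OF t(1,4)] t(2,5,8) lev using t(3)[of y] t(6)[of y] by simp
 qed
 then show ?thesis unfolding d_def[abs_def] by eventually_elim simp
qed

text \<open>The two-step convergence required of the series determines its sum: the inner L1 limit
  must be \<open>level j (c j)\<close>, the outer \<open>H1\<close> limit must be
  \<open>tot c\<close>. Conversely these satisfy every requirement. Replacing \<psi> by its Borel
  version changes each atom on a null set only, and there are countably many atoms.\<close>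

lemma synthesis_iff:
 assumes ae: "AEL x. \<psi> x = psi x" and a: "\<forall>j\<ge>1. a j = mat (\<alpha> j)" and c: "c \<in> l1h1 b nu"
 shows "synthesis_converges a b \<psi> c f \<longleftrightarrow> (AEL x. f x = tot c x)"
proof -
 have c0: "c 0 = (%k. 0)" and fin: "(\<Sum>j. hn (c j)) < \<infinity>" using c by (auto simp: l1h1_iff)
 note cj = h1_summand[OF fin]
 note i = h1_integrable(1)[OF cj]
 have lm[measurable]: "level j (c j) \<in> bm" for j using level_L1[OF cj] by auto
 have am[measurable]: "atm j k \<in> bm" for j k using atm(1)[of j k] by auto
 have at_ae: "AEL x. affine_atom a b \<psi> j k x = atm j k x" if "j >= 1" for j k
  using AE_affine[OF ae \<alpha>(2)[of j], of "b *v lp k"]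
  by eventually_elim (simp add: affine_atom_def a[rule_format, OF that] det_mat mat_vec atm_def dil_def power_abs scaleR_conv_of_real)
 have cl: "countable (UNIV :: (int^'n) set)" by (rule countable_lattice)
 have sum_ae: "AEL x. (\<Sum>k\<in>K. c j k * affine_atom a b \<psi> j k x) = (\<Sum>k\<in>K. c j k * atm j k x)" if "j >= 1" for j K
 proof -
  have "AEL x. \<forall>k\<in>UNIV. affine_atom a b \<psi> j k x = atm j k x"
   by (subst AE_ball_countable[OF cl]) (intro ballI at_ae[OF that])
  then show ?thesis by eventually_elim simp
 qed
 have RR0: "RR i (level j (c j)) (lr j (c j) i)" for i j unfolding lr_def[abs_def] by (rule level(1)[OF cj])
 have lev_H1: "level j (c j) \<in> H1" "H1_norm (level j (c j)) <= Cs * hn (c j)" for j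
 proof -
  note le = H1_norm_le[OF RR0[of _ j], of "level j (c j)"]
  show "level j (c j) \<in> H1" by (rule le(1)) simp
  have "H1_norm (level j (c j)) <= N (level j (c j)) + (\<Sum>i\<in>UNIV. N (lr j (c j) i))" by (rule le(2)) simp
  also have "... <= Cs * hn (c j)" unfolding lr_def[abs_def] by (rule level(2)[OF cj])
  finally show "H1_norm (level j (c j)) <= Cs * hn (c j)" .
 qed
 \<comment> \<open>Sums over j = 1..J and over j < Suc J agree because the entry at 0 is
   zero.\<close>
 have shift: "(\<Sum>j=1..J. level j (c j) x) = (\<Sum>j<Suc J. level j (c j) x)" for J x
  by (rule sum.mono_neutral_left) (auto simp: c0 not_le less_Suc_eq_le)
 have tail: "(%J. H1_norm (%x. tot c x - (\<Sum>j<Suc J. level j (c j) x))) ---> 0"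
 proof (rule tendsto_sandwich[OF _ _ tendsto_const])
  show "\<forall>\<^sub>F J in sequentially. H1_norm (%x. tot c x - (\<Sum>j<Suc J. level j (c j) x)) <= Cs * (\<Sum>n. hn (c (n + Suc J)))"
   by (intro always_eventually allI tot(2) fin)
  from ennreal_tendsto_cmult[OF _ LIMSEQ_Suc[OF suminf_tail_ennreal[OF fin]], of Cs] Cs
  show "(%J. Cs * (\<Sum>n. hn (c (n + Suc J)))) ---> 0" by simp
 qed simp
 have tot_H1: "tot c \<in> H1" using H1_I(1)[OF tot(1)[OF fin], of "tot c"] by simp
 show ?thesis
 proof
  assume f: "AEL x. f x = tot c x"
  then have f': "AEL x. tot c x = f x" by eventually_elim simp
  show "synthesis_converges a b \<psi> c f" unfolding synthesis_converges_def
  proof (intro conjI exI[of _ "%j. level j (c j)"] allI impI)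
   show "f \<in> H1" by (rule H1_cong(1)[OF tot_H1 f'])
   fix j :: nat assume j: "1 <= j"
   show "level j (c j) \<in> H1" by (rule lev_H1)
   have "L1_norm (%x. c j k * affine_atom a b \<psi> j k x) = ennreal (norm (c j k)) * N psi" for k
   proof -
    have "N (%x. c j k * affine_atom a b \<psi> j k x) = N (%x. c j k * atm j k x)"
     by (rule N_cong_AE) (use at_ae[OF j, of k] in \<open>eventually_elim, simp\<close>)
    then show ?thesis by (simp add: L1_norm_eq N_cmult atm(2))
   qed
   then have "(\<Sum>\<^sub>\<infinity>k. L1_norm (%x. c j k * affine_atom a b \<psi> j k x)) = (NK k. norm (c j k)) * N psi"
    by (simp add: infsum_nn_integral[OF cl] nn_integral_multc)
   also have "... < \<infinity>" using i[of j] N_less_top[OF psi(1)] by (auto simp: integrable_iff_bounded ennreal_mult_less_top)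
   finally show "(\<Sum>\<^sub>\<infinity>k. L1_norm (%x. c j k * affine_atom a b \<psi> j k x)) < \<infinity>" .
   have "L1_norm (%x. level j (c j) x - (\<Sum>k\<in>K. c j k * affine_atom a b \<psi> j k x)) = N (%x. level j (c j) x - (\<Sum>k\<in>K. c j k * atm j k x))" for K
    unfolding L1_norm_eq by (rule N_cong_AE) (use sum_ae[OF j, of K] in \<open>eventually_elim, simp\<close>)
   then show "((%K. L1_norm (%x. level j (c j) x - (\<Sum>k\<in>K. c j k * affine_atom a b \<psi> j k x))) \<longlongrightarrow> 0) (finite_subsets_at_top UNIV)"
    using partial_sums_k[OF i[of j], of j] by simp
  next
   have "(\<Sum>\<^sub>\<infinity>j\<in>{1..}. H1_norm (level j (c j))) = (\<integral>\<^sup>+j. H1_norm (level j (c j)) \<partial>count_space {1::nat..})"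
    by (rule infsum_nn_integral) auto
   also have "... <= (\<integral>\<^sup>+j. Cs * hn (c j) \<partial>count_space {1::nat..})" by (intro nn_integral_mono lev_H1)
   also have "... = Cs * (\<Sum>\<^sub>\<infinity>j\<in>{1..}. hn (c j))" by (simp add: nn_integral_cmult infsum_nn_integral)
   also have "... = Cs * (\<Sum>j. hn (c j))" using l1h1_norm_eq[of c, OF c0] by (simp add: l1h1_norm_def)
   also have "... < \<infinity>" using fin Cs by (simp add: ennreal_mult_less_top)
   finally show "(\<Sum>\<^sub>\<infinity>j\<in>{1..}. H1_norm (level j (c j))) < \<infinity>" .
   have "H1_norm (%x. f x - (\<Sum>j=1..J. level j (c j) x)) = H1_norm (%x. tot c x - (\<Sum>j<Suc J. level j (c j) x))" for J
    unfolding shift by (rule H1_norm_cong) (use f in \<open>eventually_elim, simp\<close>)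
   then show "(%J. H1_norm (%x. f x - (\<Sum>j=1..J. level j (c j) x))) ---> 0" using tail by simp
  qed
 next
  assume "synthesis_converges a b \<psi> c f"
  then obtain Fj where f: "f \<in> H1" and Fj: "!!j. j >= 1 ==> Fj j \<in> H1"
   "!!j. j >= 1 ==> ((%K. L1_norm (%x. Fj j x - (\<Sum>k\<in>K. c j k * affine_atom a b \<psi> j k x))) \<longlongrightarrow> 0) (finite_subsets_at_top UNIV)"
   "(%J. H1_norm (%x. f x - (\<Sum>j=1..J. Fj j x))) ---> 0"
   unfolding synthesis_converges_def by blast
  have FjL: "AEL x. Fj j x = level j (c j) x" if j: "j >= 1" for j
  proof -
   obtain f0 g where 0: "!!i. RR i f0 (g i)" "AEL x. Fj j x = f0 x" using H1_D[OF Fj(1)[OF j]] by blast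
   have f0m: "f0 \<in> bm" using 0(1)[unfolded RR_def, THEN conjunct1] by auto
   have "L1_norm (%x. Fj j x - (\<Sum>k\<in>K. c j k * affine_atom a b \<psi> j k x)) = N (%x. f0 x - (\<Sum>k\<in>K. c j k * atm j k x))" for K
    unfolding L1_norm_eq by (rule N_cong_AE) (use sum_ae[OF j, of K] 0(2) in \<open>eventually_elim, simp\<close>)
   then have lim0: "((%K. N (%x. f0 x - (\<Sum>k\<in>K. c j k * atm j k x))) \<longlongrightarrow> 0) (finite_subsets_at_top UNIV)"
    using Fj(2)[OF j] by simp
   have "AEL x. f0 x = level j (c j) x"
    by (rule unique_limit[OF f0m lm _ lim0 partial_sums_k[OF i]]) (auto intro!: borel_measurable_sum)
   then show ?thesis using 0(2) by eventually_elim simp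
  qed
  obtain f0 g where 0: "!!i. RR i f0 (g i)" "AEL x. f x = f0 x" using H1_D[OF f] by blast
  have f0m: "f0 \<in> bm" using 0(1)[unfolded RR_def, THEN conjunct1] by auto
  have all: "AEL x. \<forall>j\<in>{1..}. Fj j x = level j (c j) x"
   by (subst AE_ball_countable) (use FjL in auto)
  have "N (%x. f0 x - (\<Sum>j<Suc J. level j (c j) x)) <= H1_norm (%x. f x - (\<Sum>j=1..J. Fj j x))" for J
  proof -
   have "N (%x. f0 x - (\<Sum>j<Suc J. level j (c j) x)) = N (%x. f x - (\<Sum>j=1..J. Fj j x))"
    unfolding shift[symmetric] by (rule N_cong_AE) (use all 0(2) in \<open>eventually_elim, simp\<close>)
   then show ?thesis using N_le_H1_norm[of "%x. f x - (\<Sum>j=1..J. Fj j x)"] by simp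
  qed
  then have lim1: "(%J. N (%x. f0 x - (\<Sum>j<Suc J. level j (c j) x))) ---> 0"
   by (intro tendsto_sandwich[OF _ _ tendsto_const Fj(3)] always_eventually allI) auto
  have lim2: "(%J. N (%x. tot c x - (\<Sum>j<Suc J. level j (c j) x))) ---> 0"
   by (intro tendsto_sandwich[OF _ _ tendsto_const tail] always_eventually allI) (auto intro: N_le_H1_norm)
  have "AEL x. f0 x = tot c x"
   by (rule unique_limit[OF f0m _ _ lim1 lim2]) (use tot_F(1)[OF fin] in \<open>auto intro!: borel_measurable_sum\<close>)
  then show "AEL x. f x = tot c x" using 0(2) by eventually_elim simp
 qed
qed

lemma tot_H1: "c \<in> l1h1 b nu ==> tot c \<in> H1"
 using H1_I(1)[OF tot(1), of c "tot c"] by (simp add: l1h1_iff)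

lemma synthesis_eq:
 assumes "AEL x. \<psi> x = psi x" "\<forall>j\<ge>1. a j = mat (\<alpha> j)" "c \<in> l1h1 b nu"
 shows "synthesis a b \<psi> c = ae_class (tot c)"
 unfolding synthesis_def set_eq_iff mem_Collect_eq ae_class_iff synthesis_iff[OF assms] by simp

definition CX :: real where "CX = CT * real (Suc CARD('n))"

lemma CX: "CX >= 0" using CT by (simp add: CX_def)

lemma represent:
 assumes f: "f \<in> H1" and e: "\<epsilon> > 0"
 obtains c where "c \<in> l1h1 b nu" "AEL x. f x = tot c x" "l1h1_norm b nu c <= ennreal CX * H1_norm f + ennreal \<epsilon>"
proof -
 obtain f0 g where 0: "!!i. RR i f0 (g i)" "AEL x. f x = f0 x" using H1_D[OF f] by blast
 \<comment> \<open>The iteration multiplies its error by \<open>CT\<close>, so it is run with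
   \<epsilon> / (CT + 1).\<close>
 define \<eta> where "\<eta> = \<epsilon> / (CT + 1)"
 have \<eta>: "\<eta> > 0" "CT * \<eta> <= \<epsilon>" using e CT by (auto simp: \<eta>_def field_simps)
 obtain c where c: "c 0 = (%k. 0)" "(\<Sum>j. hn (c j)) <= ennreal CT * (N f0 + (\<Sum>i\<in>UNIV. N (g i)) + ennreal \<eta>)"
  "AEL x. f0 x = tot c x" using solve[OF allI[OF 0(1)] \<eta>(1)] by (elim exE conjE)
 have "ennreal CT * (N f0 + (\<Sum>i\<in>UNIV. N (g i)) + ennreal \<eta>) <= ennreal CT * (of_nat (Suc CARD('n)) * H1_norm f + ennreal \<eta>)"
  by (intro mult_left_mono add_right_mono H1_size 0) auto
 also have "... = ennreal CX * H1_norm f + ennreal (CT * \<eta>)"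
  using CT \<eta>(1) by (simp add: CX_def distrib_left ennreal_mult' mult.assoc ennreal_of_nat_eq_real_of_nat del: of_nat_Suc)
 also have "... <= ennreal CX * H1_norm f + ennreal \<epsilon>" by (intro add_left_mono ennreal_leI \<eta>)
 finally have le: "(\<Sum>j. hn (c j)) <= ennreal CX * H1_norm f + ennreal \<epsilon>" using c(2) by (rule_tac order_trans)
 have "ennreal CX * H1_norm f + ennreal \<epsilon> < \<infinity>" using f by (simp add: H1_norm_finite ennreal_mult_less_top)
 then have "(\<Sum>j. hn (c j)) < \<infinity>" using le by (rule_tac le_less_trans)
 then have "c \<in> l1h1 b nu" using c(1) by (simp add: l1h1_iff)
 moreover have "AEL x. f x = tot c x" using 0(2) c(3) by eventually_elim simp
 ultimately show ?thesis using that le l1h1_norm_eq[of c, OF c(1)] by simp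
qed

text \<open>A target near the image of c differs from it by a small element of \<open>H1\<close>,
  which has a small preimage by \<open>represent\<close>; subtracting that from c stays in the given
  open set. No completeness is invoked.\<close>

lemma synthesis_open:
 assumes ae: "AEL x. \<psi> x = psi x" and a: "\<forall>j\<ge>1. a j = mat (\<alpha> j)"
 shows "open_map (l1h1_topology b nu) H1_topology (synthesis a b \<psi>)"
 unfolding open_map_def l1h1_topology_def H1_topology_def
  Metric_space.openin_mtopology[OF l1h1_metric] Metric_space.openin_mtopology[OF H1_metric]
proof (intro allI impI conjI ballI)
 fix U assume U: "U \<subseteq> l1h1 b nu & (\<forall>x. x \<in> U --> (\<exists>r>0. Metric_space.mball (l1h1 b nu) (l1h1_dist b nu) x r \<subseteq> U))"
 show "synthesis a b \<psi> ` U \<subseteq> H1_space"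
  using U synthesis_eq[OF ae a] tot_H1 by (auto simp: H1_space_def)
 fix F0 assume "F0 \<in> synthesis a b \<psi> ` U"
 then obtain c where c: "c \<in> U" "F0 = synthesis a b \<psi> c" by blast
 have cl: "c \<in> l1h1 b nu" using U c by blast
 obtain r where r: "r > 0" "Metric_space.mball (l1h1 b nu) (l1h1_dist b nu) c r \<subseteq> U" using U c by blast
 \<comment> \<open>The correction has norm at most \<open>CX * \<rho>\<close> + r/4 <= 3r/4 < r; the
   r/4 is the slack allowed to \<open>represent\<close>.\<close>
 define \<rho> where "\<rho> = r / (2 * (CX + 1))"
 have \<rho>: "\<rho> > 0" "CX * \<rho> <= r / 2" using r CX by (auto simp: \<rho>_def field_simps)
 have "Metric_space.mball H1_space H1_dist F0 \<rho> \<subseteq> synthesis a b \<psi> ` U"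
 proof
  fix G0 assume "G0 \<in> Metric_space.mball H1_space H1_dist F0 \<rho>"
  then have G0: "G0 \<in> H1_space" "H1_dist F0 G0 < \<rho>" by (simp_all add: Metric_space.mball_def[OF H1_metric])
  then obtain g where g: "g \<in> H1" "G0 = ae_class g" by (auto simp: H1_space_def)
  define h where "h x = tot c x - g x" for x
  have h: "h \<in> H1" unfolding h_def[abs_def] by (rule H1_diff(1)[OF tot_H1[OF cl] g(1)])
  have "enn2real (H1_norm h) < \<rho>"
   using G0(2) by (simp add: c(2) g(2) synthesis_eq[OF ae a cl] H1_dist_class h_def[abs_def])
  moreover have "H1_norm h < \<infinity>" using h by (simp add: H1_norm_finite)
  ultimately have hn: "H1_norm h <= ennreal \<rho>" by (simp add: ennreal_enn2real_if less_imp_le less_top[symmetric] flip: enn2real_le_iff)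
  have r4: "r / 4 > 0" using r by simp
  obtain c2 where c2: "c2 \<in> l1h1 b nu" "AEL x. h x = tot c2 x" "l1h1_norm b nu c2 <= ennreal CX * H1_norm h + ennreal (r / 4)"
   by (rule represent[OF h r4])
  define c1 where "c1 j k = c j k - c2 j k" for j k
  have c1: "c1 \<in> l1h1 b nu" using l1h1_diff(1)[OF cl c2(1)] by (simp add: c1_def[abs_def])
  have "l1h1_norm b nu c2 <= ennreal CX * ennreal \<rho> + ennreal (r / 4)"
   using c2(3) hn by (meson add_right_mono mult_left_mono order_trans zero_le)
  also have "... = ennreal (CX * \<rho> + r / 4)" using CX \<rho>(1) r(1) by (simp add: ennreal_mult' ennreal_plus)
  also have "... <= ennreal (3 * r / 4)" using \<rho>(2) by (intro ennreal_leI) linarith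
  finally have "enn2real (l1h1_norm b nu c2) <= 3 * r / 4" using r(1) by (intro enn2real_leI) auto
  then have "l1h1_dist b nu c c1 < r" using r(1) by (simp add: l1h1_dist_def c1_def)
  then have "c1 \<in> U" using r(2) cl c1 by (auto simp: Metric_space.mball_def[OF l1h1_metric])
  moreover have "G0 = synthesis a b \<psi> c1"
  proof -
   have "AEL x. g x = tot c1 x"
    using tot_diff[OF cl c2(1)] c2(2) unfolding c1_def[abs_def, symmetric] by eventually_elim (auto simp: h_def algebra_simps)
   then show ?thesis by (simp add: g(2) synthesis_eq[OF ae a c1] ae_class_eq)
  qed
  ultimately show "G0 \<in> synthesis a b \<psi> ` U" by blast
 qed
 then show "\<exists>r>0. Metric_space.mball H1_space H1_dist F0 r \<subseteq> synthesis a b \<psi> ` U" using \<rho>(1) by (intro exI[of _ \<rho>] conjI)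
qed

lemma synthesis_theorem:
 assumes ae: "AEL x. \<psi> x = psi x" and a: "\<forall>j\<ge>1. a j = mat (\<alpha> j)"
 shows "synthesis a b \<psi> \<in> l1h1 b nu \<rightarrow> H1_space"
  "synthesis a b \<psi> ` l1h1 b nu = H1_space"
  "\<forall>f\<in>H1. \<forall>\<epsilon>::real. \<epsilon> > 0 --> (\<exists>c\<in>l1h1 b nu. synthesis_converges a b \<psi> c f & l1h1_norm b nu c <= ennreal (CX + 1) * H1_norm f + ennreal \<epsilon>)"
proof -
 show 1: "synthesis a b \<psi> \<in> l1h1 b nu \<rightarrow> H1_space"
  using synthesis_eq[OF ae a] tot_H1 by (auto simp: H1_space_def)
 have rep: "\<exists>c\<in>l1h1 b nu. (AEL x. f x = tot c x) & l1h1_norm b nu c <= ennreal CX * H1_norm f + ennreal \<epsilon>"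
  if "f \<in> H1" "\<epsilon> > 0" for f \<epsilon> by (rule represent[OF that]) (intro bexI conjI)
 show "synthesis a b \<psi> ` l1h1 b nu = H1_space"
 proof
  show "H1_space \<subseteq> synthesis a b \<psi> ` l1h1 b nu"
  proof
   fix G0 :: "(real^'n => complex) set" assume "G0 \<in> H1_space"
   then obtain f where f: "f \<in> H1" "G0 = ae_class f" by (auto simp: H1_space_def)
   obtain c where c: "c \<in> l1h1 b nu" "AEL x. f x = tot c x" using rep[OF f(1) zero_less_one] by (elim bexE conjE)
   then have "G0 = synthesis a b \<psi> c" by (simp add: f(2) synthesis_eq[OF ae a c(1)] ae_class_eq)
   then show "G0 \<in> synthesis a b \<psi> ` l1h1 b nu" using c(1) by blast
  qed
 qed (use 1 in blast)
 show "\<forall>f\<in>H1. \<forall>\<epsilon>::real. \<epsilon> > 0 --> (\<exists>c\<in>l1h1 b nu. synthesis_converges a b \<psi> c f & l1h1_norm b nu c <= ennreal (CX + 1) * H1_norm f + ennreal \<epsilon>)"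
 proof (intro ballI allI impI)
  fix f :: "real^'n => complex" and \<epsilon> :: real assume f: "f \<in> H1" and e: "\<epsilon> > 0"
  obtain c where c: "c \<in> l1h1 b nu" "AEL x. f x = tot c x" "l1h1_norm b nu c <= ennreal CX * H1_norm f + ennreal \<epsilon>"
   using rep[OF f e] by (elim bexE conjE)
  have "ennreal CX * H1_norm f <= ennreal (CX + 1) * H1_norm f" by (intro mult_right_mono ennreal_leI) auto
  then have "l1h1_norm b nu c <= ennreal (CX + 1) * H1_norm f + ennreal \<epsilon>"
   by (intro order_trans[OF c(3)] add_right_mono)
  then show "\<exists>c\<in>l1h1 b nu. synthesis_converges a b \<psi> c f & l1h1_norm b nu c <= ennreal (CX + 1) * H1_norm f + ennreal \<epsilon>"
   by (intro bexI[OF _ c(1)] conjI) (rule synthesis_iff[OF ae a c(1), THEN iffD2, OF c(2)])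
 qed
qed

end

section \<open>Assembling the data of the theorem\<close>

lemma generator_exists:
 fixes \<psi> :: "real^'n => complex"
 assumes B: "band b nu th C0 CL Kb NB" and \<psi>: "integrable lebesgue \<psi>" "(LINT x|lebesgue. \<psi> x) = 1"
  and lim: "((%y. H1_norm (%x. \<psi> x - \<psi> (x - y))) \<longlongrightarrow> 0) (at 0)"
  and \<alpha>: "filterlim (%j. \<bar>\<alpha> j\<bar>) at_top sequentially" "!!j. \<alpha> j ~= 0"
 obtains psi Gr where "AEL x. \<psi> x = psi x" "generator b nu th C0 CL Kb NB psi Gr \<alpha>"
proof -
 interpret band b nu th C0 CL Kb NB by (rule B)
 obtain psi where psi: "L1 psi" "AEL x. \<psi> x = psi x" using ex_borel_version[OF \<psi>(1)] by blast
 have "F psi 0 = (LI x. psi x)" by (simp add: F_def)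
 also have "... = (\<integral>x. psi x \<partial>lebesgue)" using psi(1) by (intro integral_completion[symmetric]) auto
 also have "... = (\<integral>x. \<psi> x \<partial>lebesgue)"
 proof (rule integral_cong_AE)
  show "psi \<in> borel_measurable lebesgue" using psi(1) by (intro measurable_completion) auto
  show "AE x in lebesgue. psi x = \<psi> x" using AE_completion[OF psi(2)] by eventually_elim simp
 qed (use \<psi>(1) in auto)
 finally have psi0: "F psi 0 = 1" using \<psi>(2) by simp
 obtain d where d: "d > 0" "!!u. norm u < d ==> \<exists>g. \<forall>i. RR i (%x. psi x - psi (x - u)) (g i) & N (g i) <= 1"
  by (rule differences_local[OF psi lim]) (rule that)
 \<comment> \<open>The extra power in the decay of \<open>th\<close> pays for the factor
   |u|.\<close>
 have thu: "L1 (%u. norm (th u) * norm u)"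
 proof (rule Bochner_Integration.integrable_bound)
  show "L1 (%y. C0 * P 1 (y::real^'n))" by (intro integrable_mult_right P_L1) simp
  have "norm (th u) * norm u <= C0 * P 1 u" for u
   using th(2)[of u] by (simp add: distrib_left) (smt (verit) norm_ge_zero)
  then show "AE u in lborel. norm (norm (th u) * norm u) <= norm (C0 * P 1 u)" by (auto intro: order_trans[OF _ abs_ge_self])
 qed auto
 have "\<exists>G. RR i (%x. psi x - conv psi th x) G" for i
  by (rule riesz_of_average[OF psi(1) th_L1 th(3) thu d(1) differences_global[OF psi(1) d]])
 then obtain Gr where Gr: "!!i. RR i (%x. psi x - conv psi th x) (Gr i)" by metis
 have "generator b nu th C0 CL Kb NB psi Gr \<alpha>"
  by (intro generator.intro generator_axioms.intro B psi(1) psi0 Gr \<alpha>)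
 with psi(2) show ?thesis by (rule that)
qed

theorem theorem8:
 fixes b :: "real^'n^'n" and \<nu> :: "real^'n \<Rightarrow> complex"
 assumes "invertible b" and "cutoff \<nu>"
 shows "\<exists>C::real. C > 0 \<and>
  (\<forall>(\<alpha> :: nat \<Rightarrow> real) (a :: nat \<Rightarrow> real^'n^'n) (\<psi> :: real^'n \<Rightarrow> complex).
    (\<forall>j\<ge>1. \<alpha> j \<noteq> 0 \<and> a j = mat (\<alpha> j)) \<longrightarrow>
    filterlim (\<lambda>j. \<bar>\<alpha> j\<bar>) at_top sequentially \<longrightarrow>
    integrable lebesgue \<psi> \<longrightarrow>
    (LINT x|lebesgue. \<psi> x) = 1 \<longrightarrow>
    ((\<lambda>y. H1_norm (\<lambda>x. \<psi> x - \<psi> (x - y))) \<longlongrightarrow> 0) (at 0) \<longrightarrow>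
     synthesis a b \<psi> \<in> l1h1 b \<nu> \<rightarrow> H1_space
    \<and> open_map (l1h1_topology b \<nu>) H1_topology (synthesis a b \<psi>)
    \<and> synthesis a b \<psi> ` l1h1 b \<nu> = H1_space
    \<and> (\<forall>f\<in>H1. \<forall>\<epsilon>::real. \<epsilon> > 0 \<longrightarrow>
      (\<exists>c\<in>l1h1 b \<nu>. synthesis_converges a b \<psi> c f
        \<and> l1h1_norm b \<nu> c \<le> ennreal C * H1_norm f + ennreal \<epsilon>)))"
proof -
 obtain th C0 CL Kb NB where B: "band b \<nu> th C0 CL Kb NB" using band_exists[OF assms] by (elim exE)
 interpret band b \<nu> th C0 CL Kb NB by (rule B)
 \<comment> \<open>Fixed before the dilations and \<psi> are introduced: \<open>CT\<close> is built
   from the kernel \<open>th\<close> and the lattice only. It equals \<open>CX + 1\<close>, where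
   the 1 ensures positivity.\<close>
 define C where "C = CT * real (Suc CARD('n)) + 1"
 have C: "C > 0" using CT by (simp add: C_def add_nonneg_pos)
 show ?thesis
 proof (intro exI[of _ C] conjI C allI impI)
  fix \<alpha> :: "nat \<Rightarrow> real" and a :: "nat \<Rightarrow> real^'n^'n" and \<psi> :: "real^'n \<Rightarrow> complex"
  assume a: "\<forall>j\<ge>1. \<alpha> j \<noteq> 0 \<and> a j = mat (\<alpha> j)" and \<alpha>: "filterlim (\<lambda>j. \<bar>\<alpha> j\<bar>) at_top sequentially"
   and \<psi>: "integrable lebesgue \<psi>" "(LINT x|lebesgue. \<psi> x) = 1"
   "((\<lambda>y. H1_norm (\<lambda>x. \<psi> x - \<psi> (x - y))) \<longlongrightarrow> 0) (at 0)"
  \<comment> \<open>The scale \<open>j = 0\<close> does not occur in the series; its value only has to be nonzero.\<close>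
  define \<beta> where "\<beta> = \<alpha>(0 := 1)"
  have ev: "\<forall>\<^sub>F j in sequentially. \<bar>\<alpha> j\<bar> = \<bar>\<beta> j\<bar>"
   using eventually_gt_at_top[of "0::nat"] by eventually_elim (simp add: \<beta>_def)
  have \<beta>: "filterlim (\<lambda>j. \<bar>\<beta> j\<bar>) at_top sequentially" by (rule iffD1[OF filterlim_cong[OF refl refl ev] \<alpha>])
  have \<beta>0: "\<beta> j \<noteq> 0" for j using a by (simp add: \<beta>_def)
  have a\<beta>: "\<forall>j\<ge>1. a j = mat (\<beta> j)" using a by (simp add: \<beta>_def)
  obtain psi Gr where ae: "AE x in lborel. \<psi> x = psi x" and G: "generator b \<nu> th C0 CL Kb NB psi Gr \<beta>"
   by (rule generator_exists[OF B \<psi> \<beta> \<beta>0])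
  interpret G: generator b \<nu> th C0 CL Kb NB psi Gr \<beta> by (rule G)
  note t = G.synthesis_theorem[OF ae a\<beta>]
  show "synthesis a b \<psi> \<in> l1h1 b \<nu> \<rightarrow> H1_space" by (rule t(1))
  show "open_map (l1h1_topology b \<nu>) H1_topology (synthesis a b \<psi>)" by (rule G.synthesis_open[OF ae a\<beta>])
  show "synthesis a b \<psi> ` l1h1 b \<nu> = H1_space" by (rule t(2))
  show "\<forall>f\<in>H1. \<forall>\<epsilon>::real. \<epsilon> > 0 \<longrightarrow> (\<exists>c\<in>l1h1 b \<nu>. synthesis_converges a b \<psi> c f \<and> l1h1_norm b \<nu> c \<le> ennreal C * H1_norm f + ennreal \<epsilon>)"
   using t(3) unfolding G.CX_def C_def .
 qed
qed

end
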